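(* Let $M$ be a compact smooth manifold. Suppose that the $C^2$ diffeomorphism $f:M\to M$ has a dominated decomposition $TM=R\oplus S$, and let $E\subset TM$ be a continuous $Tf$-invariant subbundle. If the pointwise bunching condition $$\sup_{p\in M}\frac{\|T^S_pf\|}{\boldsymbol{m}(T^R_pf)\,\boldsymbol{m}(T^E_pf)}<1$$ holds, then $R$ is continuously differentiable with respect to $E$.
   Context: $M$ carries a fixed Riemannian (or Finsler) metric. For a linear map $T:X\to Y$, $\|T\|$ is the operator norm and $\boldsymbol{m}(T)=\inf_{x\neq 0}|Tx|/|x|$ is the conorm. For a $Tf$-invariant subbundle $X\subset TM$, $T^Xf$ is the restriction of $Tf$ to $X$, and $T^X_pf:X_p\to X_{f(p)}$. A dominated decomposition for $f$ is a $Tf$-invariant splitting $TM=R\oplus S$ with $\inf_p \boldsymbol{m}(T^R_pf)/\|T^S_pf\|>1$. Differentiability of a bundle along a bundle: let $d$ be the fiber dimension of $R$, and regard $R$ as a section $\sigma:p\mapsto R_p$ of the Grassmann bundle $\pi:G=G(d,TM)\to M$ of $d$-planes in $TM$. Then $R$ is continuously differentiable with respect to $E$ if there is a continuous map $H:E\to TG$ such that (a) for each $p\in M$, $H$ maps $E_p$ linearly into $T_{\sigma(p)}G$; (b) $T\pi\circ H=\mathrm{Id}_E$; (c) for every $C^1$ arc $\gamma$ in $M$ that is everywhere tangent to $E$, $\sigma\circ\gamma$ is differentiable and $(\sigma\circ\gamma)'(t)=H(\gamma'(t))$. *)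

theory Defs
  imports "HOL-Analysis.Analysis"
begin

text \<open>
  Manifolds are given by an atlas. The same notions of tangent bundle, tangent map and velocity are
  used for the base manifold \<open>M\<close> and for the Grassmann bundle \<open>G(d, TM)\<close>. To allow for the latter
  (whose dimension depends on the number \<open>d\<close>), charts take their values in a normed space \<open>'v\<close>, and
  their images are relatively open subsets of a linear subspace \<open>W\<close> of \<open>'v\<close>, the model space;
  \<open>W = UNIV\<close> for \<open>M\<close>.
\<close>

type_synonym ('x, 'v) chart = "'x set \<times> ('x \<Rightarrow> 'v)"
type_synonym ('x, 'v) atlas = "('x, 'v) chart set"

definition chart_inv :: "('x, 'v) chart \<Rightarrow> 'v \<Rightarrow> 'x" where
  "chart_inv c = inv_into (fst c) (snd c)"

primrec Ck_on :: "nat \<Rightarrow> ('a::real_normed_vector \<Rightarrow> 'b::real_normed_vector) \<Rightarrow> 'a set \<Rightarrow> bool" where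
  "Ck_on 0 F D \<longleftrightarrow> continuous_on D F"
| "Ck_on (Suc k) F D \<longleftrightarrow>
     (\<forall>x\<in>D. F differentiable (at x)) \<and> (\<forall>v. Ck_on k (\<lambda>x. frechet_derivative F (at x) v) D)"

definition smooth_atlas :: "('m::topological_space, 'e::euclidean_space) atlas \<Rightarrow> bool" where
  "smooth_atlas A \<longleftrightarrow>
     (\<Union>c\<in>A. fst c) = UNIV \<and>
     (\<forall>c\<in>A. open (fst c) \<and> open (snd c ` fst c) \<and>
        homeomorphism (fst c) (snd c ` fst c) (snd c) (chart_inv c)) \<and>
     (\<forall>c\<in>A. \<forall>c'\<in>A. \<forall>k. Ck_on k (snd c' \<circ> chart_inv c) (snd c ` (fst c \<inter> fst c')))"

definition Ck_map :: "('m::topological_space, 'e::euclidean_space) atlas \<Rightarrow> nat \<Rightarrow> ('m \<Rightarrow> 'm) \<Rightarrow> bool" where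
  "Ck_map A k f \<longleftrightarrow> continuous_on UNIV f \<and>
     (\<forall>c\<in>A. \<forall>c'\<in>A. Ck_on k (snd c' \<circ> f \<circ> chart_inv c) (snd c ` (fst c \<inter> f -` fst c')))"

definition Ck_diffeomorphism ::
    "('m::topological_space, 'e::euclidean_space) atlas \<Rightarrow> nat \<Rightarrow> ('m \<Rightarrow> 'm) \<Rightarrow> bool" where
  "Ck_diffeomorphism A k f \<longleftrightarrow> bij f \<and> Ck_map A k f \<and> Ck_map A k (inv f)"


text \<open>
  A tangent vector at \<open>x\<close> is a pair \<open>(x, w)\<close>, where \<open>w \<in> W\<close> is its coordinate vector in a preferred
  chart at \<open>x\<close>. Thus every \<open>T\<^sub>x\<close> is the vector space \<open>W\<close>. The preferred chart may jump with \<open>x\<close>, so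
  that the tangent bundle is the set of pairs \<open>(x, w)\<close> but does not carry the product topology.
\<close>

definition chart_at :: "('x, 'v) atlas \<Rightarrow> 'x \<Rightarrow> ('x, 'v) chart" where
  "chart_at A x = (SOME c. c \<in> A \<and> x \<in> fst c)"

text \<open>
  Derivatives in charts are taken as velocities of images of straight lines. For differentiable maps
  this is the value of the Frechet derivative on the direction of the line; it also makes sense when
  the chart images are open only relative to the model space.
\<close>

definition line_at :: "('x, 'v::real_normed_vector) atlas \<Rightarrow> 'x \<times> 'v \<Rightarrow> real \<Rightarrow> 'x" where
  "line_at A \<xi> t = (let c = chart_at A (fst \<xi>) in chart_inv c (snd c (fst \<xi>) + t *\<^sub>R snd \<xi>))"

definition tangent_coord ::
    "('x, 'v::real_normed_vector) atlas \<Rightarrow> ('x, 'v) chart \<Rightarrow> 'x \<times> 'v \<Rightarrow> 'v" where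
  "tangent_coord A c \<xi> = vector_derivative (\<lambda>t. snd c (line_at A \<xi> t)) (at 0)"

definition tangent_map ::
    "('x, 'v::real_normed_vector) atlas \<Rightarrow> ('y, 'w::real_normed_vector) atlas \<Rightarrow> ('x \<Rightarrow> 'y) \<Rightarrow>
     'x \<times> 'v \<Rightarrow> 'y \<times> 'w" where
  "tangent_map A B h \<xi> =
     (h (fst \<xi>), vector_derivative (\<lambda>t. snd (chart_at B (h (fst \<xi>))) (h (line_at A \<xi> t))) (at 0))"

definition tangent_at ::
    "('m, 'e::real_normed_vector) atlas \<Rightarrow> ('m \<Rightarrow> 'm) \<Rightarrow> 'm \<Rightarrow> 'e \<Rightarrow> 'e" where
  "tangent_at A f p v = snd (tangent_map A A f (p, v))"

text \<open>The topology for which all bundle charts \<open>(x, w) \<mapsto> (\<phi> x, T\<^sub>x\<phi> w)\<close> are homeomorphisms.\<close>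

definition tangent_topology ::
    "('x, 'v::real_normed_vector) atlas \<Rightarrow> 'v set \<Rightarrow> ('x \<times> 'v) topology" where
  "tangent_topology A W = topology_generated_by
     {{\<xi>. fst \<xi> \<in> fst c \<and> snd \<xi> \<in> W \<and> (snd c (fst \<xi>), tangent_coord A c \<xi>) \<in> B} | c B.
        c \<in> A \<and> open B}"

definition has_velocity ::
    "('x, 'v::real_normed_vector) atlas \<Rightarrow> (real \<Rightarrow> 'x) \<Rightarrow> real set \<Rightarrow> real \<Rightarrow> 'x \<times> 'v \<Rightarrow> bool" where
  "has_velocity A \<gamma> I t \<xi> \<longleftrightarrow> fst \<xi> = \<gamma> t \<and>
     (\<forall>\<^sub>F s in at t within I. \<gamma> s \<in> fst (chart_at A (\<gamma> t))) \<and>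
     ((\<lambda>s. snd (chart_at A (\<gamma> t)) (\<gamma> s)) has_vector_derivative snd \<xi>) (at t within I)"

definition C1_arc ::
    "('m, 'e::real_normed_vector) atlas \<Rightarrow> real \<Rightarrow> real \<Rightarrow> (real \<Rightarrow> 'm) \<Rightarrow> (real \<Rightarrow> 'm \<times> 'e) \<Rightarrow> bool" where
  "C1_arc A a b \<gamma> \<gamma>' \<longleftrightarrow> a < b \<and> (\<forall>t\<in>{a..b}. has_velocity A \<gamma> {a..b} t (\<gamma>' t)) \<and>
     continuous_map (top_of_set {a..b}) (tangent_topology A UNIV) \<gamma>'"


text \<open>A bundle of subspaces of \<open>TM\<close> is a family \<open>X\<close> with \<open>X p\<close> a subspace of \<open>T\<^sub>pM\<close>.\<close>

definition total_space :: "('m \<Rightarrow> 'e set) \<Rightarrow> ('m \<times> 'e) set" where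
  "total_space X = {(p, v). v \<in> X p}"

definition invariant_subbundle ::
    "('m, 'e::euclidean_space) atlas \<Rightarrow> ('m \<Rightarrow> 'm) \<Rightarrow> ('m \<Rightarrow> 'e set) \<Rightarrow> bool" where
  "invariant_subbundle A f X \<longleftrightarrow>
     (\<forall>p. subspace (X p)) \<and> (\<forall>p. tangent_at A f p ` X p = X (f p))"

text \<open>Continuity is the existence of local continuous frames.\<close>

definition continuous_subbundle ::
    "('m::topological_space, 'e::euclidean_space) atlas \<Rightarrow> ('m \<Rightarrow> 'e set) \<Rightarrow> bool" where
  "continuous_subbundle A X \<longleftrightarrow> (\<forall>p. \<exists>U k. \<exists>s :: nat \<Rightarrow> 'm \<Rightarrow> 'e. open U \<and> p \<in> U \<and>
     (\<forall>i<k. continuous_map (top_of_set U) (tangent_topology A UNIV) (\<lambda>q. (q, s i q))) \<and>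
     (\<forall>q\<in>U. inj_on (\<lambda>i. s i q) {..<k} \<and> independent ((\<lambda>i. s i q) ` {..<k}) \<and>
        span ((\<lambda>i. s i q) ` {..<k}) = X q))"

text \<open>
  A Finsler metric is a norm on each tangent space, continuous on \<open>TM\<close>. A Riemannian metric is the
  special case in which the norms come from inner products.
\<close>

definition finsler_metric ::
    "('m, 'e::euclidean_space) atlas \<Rightarrow> ('m \<Rightarrow> 'e \<Rightarrow> real) \<Rightarrow> bool" where
  "finsler_metric A N \<longleftrightarrow>
     (\<forall>p v. N p v \<ge> 0) \<and> (\<forall>p v. N p v = 0 \<longleftrightarrow> v = 0) \<and>
     (\<forall>p r v. N p (r *\<^sub>R v) = \<bar>r\<bar> * N p v) \<and> (\<forall>p v w. N p (v + w) \<le> N p v + N p w) \<and>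
     continuous_map (tangent_topology A UNIV) euclidean (\<lambda>(p, v). N p v)"

text \<open>
  For \<open>T : X \<rightarrow> Y\<close> with norms \<open>nX\<close> and \<open>nY\<close>. In \<open>ennreal\<close>, the zero space has operator norm \<open>0\<close> and
  conorm \<open>\<infinity>\<close>.
\<close>

definition operator_norm ::
    "('e::zero \<Rightarrow> real) \<Rightarrow> ('e \<Rightarrow> real) \<Rightarrow> 'e set \<Rightarrow> ('e \<Rightarrow> 'e) \<Rightarrow> ennreal" where
  "operator_norm nX nY X T = (SUP x\<in>X - {0}. ennreal (nY (T x) / nX x))"

definition conorm ::
    "('e::zero \<Rightarrow> real) \<Rightarrow> ('e \<Rightarrow> real) \<Rightarrow> 'e set \<Rightarrow> ('e \<Rightarrow> 'e) \<Rightarrow> ennreal" where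
  "conorm nX nY X T = (INF x\<in>X - {0}. ennreal (nY (T x) / nX x))"

definition bundle_norm ::
    "('m, 'e::euclidean_space) atlas \<Rightarrow> ('m \<Rightarrow> 'e \<Rightarrow> real) \<Rightarrow> ('m \<Rightarrow> 'm) \<Rightarrow> ('m \<Rightarrow> 'e set) \<Rightarrow> 'm \<Rightarrow> ennreal" where
  "bundle_norm A N f X p = operator_norm (N p) (N (f p)) (X p) (tangent_at A f p)"

definition bundle_conorm ::
    "('m, 'e::euclidean_space) atlas \<Rightarrow> ('m \<Rightarrow> 'e \<Rightarrow> real) \<Rightarrow> ('m \<Rightarrow> 'm) \<Rightarrow> ('m \<Rightarrow> 'e set) \<Rightarrow> 'm \<Rightarrow> ennreal" where
  "bundle_conorm A N f X p = conorm (N p) (N (f p)) (X p) (tangent_at A f p)"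

definition dominated_decomposition ::
    "('m, 'e::euclidean_space) atlas \<Rightarrow> ('m \<Rightarrow> 'e \<Rightarrow> real) \<Rightarrow> ('m \<Rightarrow> 'm) \<Rightarrow>
     ('m \<Rightarrow> 'e set) \<Rightarrow> ('m \<Rightarrow> 'e set) \<Rightarrow> bool" where
  "dominated_decomposition A N f R S \<longleftrightarrow>
     invariant_subbundle A f R \<and> invariant_subbundle A f S \<and>
     (\<forall>p. R p \<inter> S p = {0} \<and> (\<forall>v. \<exists>r\<in>R p. \<exists>s\<in>S p. v = r + s)) \<and>
     (INF p. bundle_conorm A N f R p / bundle_norm A N f S p) > 1"


text \<open>
  The Grassmann bundle \<open>G(d, TM)\<close>. The standard charts of the Grassmannian of \<open>'e\<close> are indexed by
  linear automorphisms \<open>g\<close>: fixing a \<open>d\<close>-dimensional subspace \<open>V\<^sub>0\<close> of \<open>'e\<close>, the planes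
  \<open>g {x + L x | x \<in> V\<^sub>0}\<close> are parametrized by \<open>L \<in> Hom(V\<^sub>0, V\<^sub>0\<^sup>\<bottom>)\<close>. Such \<open>L\<close> are extended by \<open>0\<close> to
  \<open>V\<^sub>0\<^sup>\<bottom>\<close> and thus form a subspace of the endomorphisms of \<open>'e\<close>. A chart \<open>\<phi>\<close> of \<open>M\<close> and an
  automorphism \<open>g\<close> give the chart \<open>(p, V) \<mapsto> (\<phi> p, L)\<close> with \<open>T\<^sub>p\<phi>(V) = g {x + L x | x \<in> V\<^sub>0}\<close>.
\<close>

definition grassmann_bundle :: "nat \<Rightarrow> ('m \<times> 'e::euclidean_space set) set" where
  "grassmann_bundle d = {(p, V). subspace V \<and> dim V = d}"

definition ref_plane :: "nat \<Rightarrow> 'e::euclidean_space set" where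
  "ref_plane d = (SOME V. subspace V \<and> dim V = d)"

definition hom_model :: "nat \<Rightarrow> ('e::euclidean_space \<Rightarrow>\<^sub>L 'e) set" where
  "hom_model d = {L. (\<forall>x\<in>ref_plane d. blinfun_apply L x \<in> orthogonal_comp (ref_plane d)) \<and>
                     (\<forall>x\<in>orthogonal_comp (ref_plane d). blinfun_apply L x = 0)}"

definition graph_plane :: "nat \<Rightarrow> ('e::euclidean_space \<Rightarrow>\<^sub>L 'e) \<Rightarrow> 'e set" where
  "graph_plane d L = (\<lambda>x. x + blinfun_apply L x) ` ref_plane d"

definition grassmann_model :: "nat \<Rightarrow> ('e::euclidean_space \<times> ('e \<Rightarrow>\<^sub>L 'e)) set" where
  "grassmann_model d = UNIV \<times> hom_model d"

definition grassmann_chart ::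
    "('m, 'e::euclidean_space) atlas \<Rightarrow> nat \<Rightarrow> ('m, 'e) chart \<Rightarrow> ('e \<Rightarrow> 'e) \<Rightarrow>
     ('m \<times> 'e set, 'e \<times> ('e \<Rightarrow>\<^sub>L 'e)) chart" where
  "grassmann_chart A d c g =
     (let represents = (\<lambda>p V L. L \<in> hom_model d \<and>
            (\<lambda>v. tangent_coord A c (p, v)) ` V = g ` graph_plane d L)
      in ({(p, V) \<in> grassmann_bundle d. p \<in> fst c \<and> (\<exists>L. represents p V L)},
          (\<lambda>(p, V). (snd c p, THE L. represents p V L))))"

definition grassmann_atlas ::
    "('m, 'e::euclidean_space) atlas \<Rightarrow> nat \<Rightarrow> ('m \<times> 'e set, 'e \<times> ('e \<Rightarrow>\<^sub>L 'e)) atlas" where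
  "grassmann_atlas A d = {grassmann_chart A d c g | c g. c \<in> A \<and> linear g \<and> bij g}"

definition section_of :: "('m \<Rightarrow> 'e set) \<Rightarrow> 'm \<Rightarrow> 'm \<times> 'e set" where
  "section_of R p = (p, R p)"

text \<open>\<open>R\<close> (of fiber dimension \<open>d\<close>) is continuously differentiable with respect to \<open>E\<close>.\<close>

definition C1_with_respect_to ::
    "('m::topological_space, 'e::euclidean_space) atlas \<Rightarrow> nat \<Rightarrow>
     ('m \<Rightarrow> 'e set) \<Rightarrow> ('m \<Rightarrow> 'e set) \<Rightarrow> bool" where
  "C1_with_respect_to A d R E \<longleftrightarrow>
     (\<exists>H :: 'm \<times> 'e \<Rightarrow> ('m \<times> 'e set) \<times> ('e \<times> ('e \<Rightarrow>\<^sub>L 'e)).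
        continuous_map (subtopology (tangent_topology A UNIV) (total_space E))
          (tangent_topology (grassmann_atlas A d) (grassmann_model d)) H \<and>
        (\<forall>p. \<exists>h. linear h \<and>
           (\<forall>v\<in>E p. h v \<in> grassmann_model d \<and> H (p, v) = (section_of R p, h v))) \<and>
        (\<forall>\<xi>\<in>total_space E. tangent_map (grassmann_atlas A d) A fst (H \<xi>) = \<xi>) \<and>
        (\<forall>a b \<gamma> \<gamma>'. C1_arc A a b \<gamma> \<gamma>' \<and> (\<forall>t\<in>{a..b}. \<gamma>' t \<in> total_space E) \<longrightarrow>
           (\<forall>t\<in>{a..b}.
              has_velocity (grassmann_atlas A d) (section_of R \<circ> \<gamma>) {a..b} t (H (\<gamma>' t)))))"

end

theory Submission imports Defs
begin

text \<open>
  Seen in a chart at \<open>x\<close>, a plane \<open>R y\<close> with \<open>y\<close> near \<open>x\<close> is a graph over \<open>R x\<close> in the splitting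
  \<open>R x \<oplus> S x\<close>. Applying \<open>f\<close> multiplies the slope of such a graph by at most
  \<open>\<kappa> = \<parallel>T\<^sup>S f\<parallel> / m(T\<^sup>R f) < 1\<close>, while \<open>R\<close> is mapped to \<open>R\<close>. So an estimate for \<open>R\<close> at a point improves when it
  is derived from the same estimate at the preimage of the point, and the whole proof consists in going
  back along orbits and using such a contraction. Four quantities are treated in this way.

  The splitting is continuous. The projections \<open>piR\<close> onto \<open>R\<close> along \<open>S\<close> are uniformly bounded, since
  domination keeps the two bundles apart (\<open>piR_bound\<close>). A limit of these projections at a point need not
  preserve \<open>R\<close> and \<open>S\<close>, but \<open>f\<close> and its inverse carry limits to limits and contract the blocks which
  measure this failure. So the only limit is \<open>piR\<close> itself (\<open>accumulates_eq_piR\<close>).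

  \<open>R\<close> is Lipschitz along arcs tangent to \<open>E\<close>. If such an arc is pulled back by \<open>f\<close>, its length grows at most by
  the factor \<open>1 / m(T\<^sup>E f)\<close>; pushing planes forward again multiplies slopes by \<open>\<kappa>\<close>. The bunching condition says
  that \<open>\<kappa> / m(T\<^sup>E f)\<close> is at most a constant \<open>k < 1\<close>. So the quotient of slope and length is contracted
  up to a bounded term that comes from the Lipschitz continuity of \<open>Tf\<close> (\<open>slope_arc\<close>).

  The derivative exists as a continuous object. If \<open>R\<close> is differentiable along \<open>E\<close>, then its derivative is, in a
  chart, a bilinear map \<open>h\<close> that assigns to \<open>v \<in> E\<close> and \<open>r \<in> R\<close> a vector of \<open>S\<close>. Differentiating the invariance
  of \<open>R\<close> shows that \<open>h\<close> is a fixed point of an affine transformation whose inhomogeneous part is the second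
  derivative of \<open>f\<close>. Its linear part contracts by bunching, so \<open>h\<close> is defined as the limit of iterates, and the
  oscillation of \<open>h\<close> at a point, on which only the linear part acts, has to vanish (\<open>hc_tendsto\<close>).

  The fixed point is the derivative. The error made when \<open>R\<close> is replaced by its linear approximation by \<open>h\<close> along an
  arc, divided by the length, is bounded because \<open>R\<close> is Lipschitz and \<open>h\<close> is bounded. As \<open>R\<close> and \<open>h\<close> are both
  invariant, this quotient is contracted as well; so it tends to zero (\<open>first_order_h\<close>).

  It remains to express this in the Grassmann bundle. A plane that turns with velocity \<open>h\<close> has a
  differentiable coordinate in every standard chart (\<open>coords_derivative\<close>). The map \<open>H\<close> is defined by means of
  these derivatives of coordinates, and their behaviour under a change of charts (\<open>coords_change\<close>, \<open>R_coord_deriv_change\<close>)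
  shows that \<open>H (p, v)\<close> has the expected coordinates in all charts at once, whence its continuity
  and its compatibility with arcs (\<open>R_C1\<close>).
\<close>

section \<open>Twice differentiable maps\<close>

definition D1 :: "('a::euclidean_space \<Rightarrow> 'a) \<Rightarrow> 'a \<Rightarrow> 'a \<Rightarrow>\<^sub>L 'a" where
  "D1 F u = Blinfun (frechet_derivative F (at u))"

definition D2 :: "('a::euclidean_space \<Rightarrow> 'a) \<Rightarrow> 'a \<Rightarrow> 'a \<Rightarrow>\<^sub>L ('a \<Rightarrow>\<^sub>L 'a)" where
  "D2 F u = Blinfun (frechet_derivative (D1 F) (at u))"

lemma D1_eqI: "(F has_derivative blinfun_apply L) (at u) \<Longrightarrow> D1 F u = L"
  unfolding D1_def by (metis blinfun_apply_inverse frechet_derivative_at)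

lemma D2_eqI: "(D1 F has_derivative blinfun_apply L) (at u) \<Longrightarrow> D2 F u = L"
  unfolding D2_def by (metis blinfun_apply_inverse frechet_derivative_at)

lemma D1_has_derivative:
  assumes "F differentiable (at u)"
  shows "(F has_derivative blinfun_apply (D1 F u)) (at u)"
  using assms unfolding D1_def
  by (metis bounded_linear_Blinfun_apply frechet_derivative_works has_derivative_bounded_linear)

text \<open>A family of linear maps on a Euclidean space is determined by its values on the basis; the
  following operation turns values on the basis into the linear map, and thereby pointwise
  statements about derivatives into statements in operator norm.\<close>

definition rank_one :: "'a::euclidean_space \<Rightarrow> 'b::real_normed_vector \<Rightarrow> 'a \<Rightarrow>\<^sub>L 'b" where
  "rank_one b w = blinfun_scaleR_left w o\<^sub>L blinfun_inner_left b"

lemma rank_one_apply [simp]: "blinfun_apply (rank_one b w) x = (x \<bullet> b) *\<^sub>R w"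
  by (simp add: rank_one_def inner_commute)

lemma bounded_linear_rank_one: "bounded_linear (rank_one (b::'a::euclidean_space))"
proof (rule bounded_linear_intro[where K = "norm b"])
  show "norm (rank_one b x) \<le> norm x * norm b" for x :: 'b
  proof (rule norm_blinfun_bound)
    fix z :: 'a
    have "norm (rank_one b x z) = \<bar>z \<bullet> b\<bar> * norm x" by simp
    also have "\<dots> \<le> (norm z * norm b) * norm x"
      by (intro mult_right_mono Cauchy_Schwarz_ineq2) auto
    finally show "norm (rank_one b x z) \<le> norm x * norm b * norm z" by (simp add: mult_ac)
  qed simp
qed (auto intro!: blinfun_eqI simp: scaleR_add_right blinfun.add_left blinfun.scaleR_left mult_ac)

lemma blinfun_sum_rank_one:
  fixes L :: "'a::euclidean_space \<Rightarrow>\<^sub>L 'b::real_normed_vector"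
  shows "(\<Sum>b\<in>Basis. rank_one b (blinfun_apply L b)) = L"
proof (rule blinfun_eqI)
  fix x :: 'a
  have "blinfun_apply L x = blinfun_apply L (\<Sum>b\<in>Basis. (x \<bullet> b) *\<^sub>R b)"
    by (simp add: euclidean_representation)
  also have "\<dots> = (\<Sum>b\<in>Basis. (x \<bullet> b) *\<^sub>R blinfun_apply L b)"
    by (simp add: blinfun.sum_right blinfun.scaleR_right)
  finally show "(\<Sum>b\<in>Basis. rank_one b (blinfun_apply L b)) x = L x"
    by (simp add: blinfun.sum_left)
qed

lemma tendsto_blinfun_pointwise:
  fixes G :: "'i \<Rightarrow> 'a::euclidean_space \<Rightarrow>\<^sub>L 'b::real_normed_vector"
  assumes "\<And>x. ((\<lambda>i. blinfun_apply (G i) x) \<longlongrightarrow> blinfun_apply L x) F"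
  shows "(G \<longlongrightarrow> L) F"
proof -
  have "((\<lambda>i. \<Sum>b\<in>Basis. rank_one b (G i b)) \<longlongrightarrow> (\<Sum>b\<in>Basis. rank_one b (L b))) F"
    by (intro tendsto_sum bounded_linear.tendsto[OF bounded_linear_rank_one] assms)
  then show ?thesis by (simp add: blinfun_sum_rank_one)
qed

lemma Ck2_D1:
  assumes "Ck_on 2 F D" "u \<in> D"
  shows "(F has_derivative blinfun_apply (D1 F u)) (at u)"
  using assms by (intro D1_has_derivative) (simp add: numeral_2_eq_2)

text \<open>The hypothesis speaks of the partial derivatives one direction at a time; since the space has a finite
  basis, they combine into a derivative of \<open>D1 F\<close> as a map into the space of linear maps.\<close>

lemma Ck2_D2:
  assumes "Ck_on 2 F D" "open D" "u \<in> D"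
  shows "(D1 F has_derivative blinfun_apply (D2 F u)) (at u)"
proof -
  have d: "(\<lambda>x. frechet_derivative F (at x) b) differentiable (at u)" for b
    using assms by (simp add: numeral_2_eq_2)
  have "(\<lambda>x. \<Sum>b\<in>Basis. rank_one b (frechet_derivative F (at x) b)) differentiable (at u)"
    by (intro differentiable_sum ballI finite_Basis)
      (metis d bounded_linear_rank_one bounded_linear_imp_differentiable
        differentiable_compose)
  then obtain G where G: "((\<lambda>x. \<Sum>b\<in>Basis. rank_one b (frechet_derivative F (at x) b)) has_derivative G) (at u)"
    unfolding differentiable_def by blast
  have "(D1 F has_derivative G) (at u)"
  proof (rule has_derivative_transform_within_open[OF G assms(2,3)])
    fix x assume "x \<in> D"
    then have "bounded_linear (frechet_derivative F (at x))"
      using assms(1) by (metis Ck2_D1 has_derivative_bounded_linear frechet_derivative_at)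
    then show "(\<Sum>b\<in>Basis. rank_one b (frechet_derivative F (at x) b)) = D1 F x"
      unfolding D1_def by (metis (mono_tags, lifting) blinfun_sum_rank_one bounded_linear_Blinfun_apply sum.cong)
  qed
  then show ?thesis
    unfolding D2_def
    by (metis bounded_linear_Blinfun_apply frechet_derivative_at has_derivative_bounded_linear)
qed

lemma Ck2_D1_isCont:
  assumes "Ck_on 2 F D" "open D" "u \<in> D"
  shows "isCont (D1 F) u"
  using Ck2_D2[OF assms] has_derivative_continuous by blast

lemma Ck2_D2_isCont:
  assumes "Ck_on 2 F D" "open D" "u \<in> D"
  shows "isCont (D2 F) u"
proof -
  have eq: "frechet_derivative (\<lambda>x. frechet_derivative F (at x) v) (at x) w = D2 F x w v"
    if "x \<in> D" for x v w
  proof -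
    have "((\<lambda>x. D1 F x v) has_derivative (\<lambda>w. D2 F x w v)) (at x)"
      by (rule bounded_linear.has_derivative[OF blinfun.bounded_linear_left Ck2_D2])
        (use assms that in auto)
    moreover have "D1 F y v = frechet_derivative F (at y) v" if "y \<in> D" for y
      by (metis Ck2_D1 that assms(1) frechet_derivative_at)
    ultimately have "((\<lambda>x. frechet_derivative F (at x) v) has_derivative (\<lambda>w. D2 F x w v)) (at x)"
      using has_derivative_transform_within_open[OF _ assms(2) that] by (metis (no_types, lifting))
    then show ?thesis by (metis frechet_derivative_at)
  qed
  have "continuous_on D (\<lambda>x. frechet_derivative (\<lambda>x. frechet_derivative F (at x) v) (at x) w)" for v w
    using assms(1) by (simp add: numeral_2_eq_2)
  then have "continuous_on D (\<lambda>x. D2 F x w v)" for v w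
    by (rule continuous_on_cong[THEN iffD1, rotated 2]) (use eq in auto)
  then have "((\<lambda>x. D2 F x w v) \<longlongrightarrow> D2 F u w v) (at u)" for v w
    using assms by (meson continuous_on_eq_continuous_at isContD)
  then show ?thesis
    unfolding isCont_def by (intro tendsto_blinfun_pointwise)
qed

lemma D1_compose:
  assumes "(F has_derivative blinfun_apply (D1 F u)) (at u)" "(G has_derivative blinfun_apply (D1 G (F u))) (at (F u))"
  shows "D1 (G \<circ> F) u = D1 G (F u) o\<^sub>L D1 F u"
proof (rule D1_eqI)
  have "blinfun_apply (D1 G (F u) o\<^sub>L D1 F u) = D1 G (F u) \<circ> D1 F u" by auto
  then show "((G \<circ> F) has_derivative blinfun_apply (D1 G (F u) o\<^sub>L D1 F u)) (at u)"
    using diff_chain_at[OF assms] by metis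
qed

lemma D1_cong:
  assumes "open D" "u \<in> D" "\<And>x. x \<in> D \<Longrightarrow> F x = G x"
  shows "D1 F u = D1 G u"
proof -
  have "(F has_derivative L) (at u) \<longleftrightarrow> (G has_derivative L) (at u)" for L
    using has_derivative_transform_within_open[OF _ assms(1,2), of F L UNIV G]
      has_derivative_transform_within_open[OF _ assms(1,2), of G L UNIV F] assms(3) by auto
  then show ?thesis
    by (simp add: D1_def frechet_derivative_def)
qed

lemma D2_cong:
  assumes "open D" "u \<in> D" "\<And>x. x \<in> D \<Longrightarrow> F x = G x"
  shows "D2 F u = D2 G u"
proof -
  have "D1 F x = D1 G x" if "x \<in> D" for x using D1_cong[OF assms(1) that assms(3)] by simp
  then have "(D1 F has_derivative L) (at u) \<longleftrightarrow> (D1 G has_derivative L) (at u)" for L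
    using has_derivative_transform_within_open[OF _ assms(1,2), of "D1 F" L UNIV "D1 G"]
      has_derivative_transform_within_open[OF _ assms(1,2), of "D1 G" L UNIV "D1 F"] by auto
  then show ?thesis
    by (simp add: D2_def frechet_derivative_def)
qed

lemma D2_compose:
  assumes F: "Ck_on 2 F D" "open D" "u \<in> D" and G: "Ck_on 2 G D'" "open D'" and FD: "F ` D \<subseteq> D'"
  shows "D2 (G \<circ> F) u v r = D2 G (F u) (D1 F u v) (D1 F u r) + D1 G (F u) (D2 F u v r)"
proof -
  have fu: "F u \<in> D'" using F FD by auto
  have eq: "D1 (G \<circ> F) x = D1 G (F x) o\<^sub>L D1 F x" if "x \<in> D" for x
    using that by (intro D1_compose Ck2_D1[OF F(1)] Ck2_D1[OF G(1)]) (use FD in auto)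
  let ?L = "\<lambda>h. (D1 G (F u) o\<^sub>L D2 F u h) + (D2 G (F u) (D1 F u h) o\<^sub>L D1 F u)"
  have "((\<lambda>x. D1 G (F x) o\<^sub>L D1 F x) has_derivative ?L) (at u)"
    using bounded_bilinear.FDERIV[OF bounded_bilinear_blinfun_compose
        diff_chain_at[OF Ck2_D1[OF F(1,3)] Ck2_D2[OF G fu]] Ck2_D2[OF F]]
    by (simp add: comp_def)
  then have *: "(D1 (G \<circ> F) has_derivative ?L) (at u)"
    by (rule has_derivative_transform_within_open[OF _ F(2,3)]) (simp add: eq)
  have "D2 (G \<circ> F) u = Blinfun ?L"
    unfolding D2_def frechet_derivative_at[OF *, symmetric] ..
  then have "D2 (G \<circ> F) u v = ?L v"
    by (simp add: bounded_linear_Blinfun_apply[OF has_derivative_bounded_linear[OF *]])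
  then show ?thesis by (simp add: blinfun.add_left)
qed

section \<open>Tangent maps in charts\<close>

text \<open>The coordinate expression of \<open>\<phi>\<close>.\<close>

definition rep :: "('m \<Rightarrow> 'm) \<Rightarrow> ('m, 'e) chart \<Rightarrow> ('m, 'e) chart \<Rightarrow> 'e \<Rightarrow> 'e" where
  "rep \<phi> c c' = snd c' \<circ> \<phi> \<circ> chart_inv c"

lemma Ck_on_mono: "Ck_on k F D \<Longrightarrow> D' \<subseteq> D \<Longrightarrow> Ck_on k F D'"
  by (induction k arbitrary: F) (auto intro: continuous_on_subset)

locale smooth_manifold =
  fixes A :: "('m::t2_space, 'e::euclidean_space) atlas"
  assumes atlas: "smooth_atlas A"
begin

abbreviation "C2 \<phi> \<equiv> Ck_map A 2 \<phi>"
abbreviation "T \<equiv> tangent_at A"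

text \<open>The derivative of the chart \<open>c\<close> at \<open>p\<close>, as a map on \<open>T\<^sub>p\<close>.\<close>

definition tau :: "('m, 'e) chart \<Rightarrow> 'm \<Rightarrow> 'e \<Rightarrow> 'e" where
  "tau c p v = tangent_coord A c (p, v)"

lemma chart_homeo: "c \<in> A \<Longrightarrow> homeomorphism (fst c) (snd c ` fst c) (snd c) (chart_inv c)"
  and chart_open: "c \<in> A \<Longrightarrow> open (fst c)"
  and chart_image_open: "c \<in> A \<Longrightarrow> open (snd c ` fst c)"
  using atlas by (auto simp: smooth_atlas_def)

lemma chart_inv_chart [simp]: "c \<in> A \<Longrightarrow> p \<in> fst c \<Longrightarrow> chart_inv c (snd c p) = p"
  using chart_homeo by (auto simp: homeomorphism_def)

lemma chart_at: "chart_at A p \<in> A" "p \<in> fst (chart_at A p)"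
proof -
  have "p \<in> (\<Union>c\<in>A. fst c)"
    using atlas by (simp add: smooth_atlas_def)
  then have "\<exists>c. c \<in> A \<and> p \<in> fst c" by blast
  from someI_ex[OF this] show "chart_at A p \<in> A" "p \<in> fst (chart_at A p)"
    by (auto simp: chart_at_def)
qed

lemma open_chart_image:
  assumes "c \<in> A" "open U" shows "open (snd c ` (fst c \<inter> U))"
proof -
  have "openin (top_of_set (snd c ` fst c)) (snd c ` (fst c \<inter> U))"
    by (rule homeomorphism_imp_open_map[OF chart_homeo[OF assms(1)]])
      (use assms in \<open>auto simp: openin_open\<close>)
  then show ?thesis using chart_image_open[OF assms(1)] openin_open_trans by blast
qed

lemma C2_continuous: "C2 \<phi> \<Longrightarrow> continuous_on UNIV \<phi>"
  by (simp add: Ck_map_def)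

lemma C2_tendsto: "C2 \<phi> \<Longrightarrow> (q \<longlongrightarrow> p) F \<Longrightarrow> ((\<lambda>i. \<phi> (q i)) \<longlongrightarrow> \<phi> p) F"
  using C2_continuous continuous_on_tendsto_compose[of UNIV \<phi> q p F] by auto

lemma C2_vimage: "C2 \<phi> \<Longrightarrow> open U \<Longrightarrow> open (\<phi> -` U)"
  using C2_continuous open_vimage by blast

lemma C2_id: "C2 id"
  using atlas by (auto simp: Ck_map_def smooth_atlas_def continuous_on_id)

abbreviation "dm \<phi> c c' \<equiv> snd c ` (fst c \<inter> \<phi> -` fst c')"

lemma C2_dm:
  assumes "C2 \<phi>" "c \<in> A" "c' \<in> A"
  shows "open (dm \<phi> c c')" "Ck_on 2 (rep \<phi> c c') (dm \<phi> c c')"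
  using open_chart_image[OF assms(2) C2_vimage[OF assms(1) chart_open[OF assms(3)]]] assms
  by (auto simp: Ck_map_def rep_def)

lemma rep_apply [simp]: "c \<in> A \<Longrightarrow> p \<in> fst c \<Longrightarrow> rep \<phi> c c' (snd c p) = snd c' (\<phi> p)"
  by (simp add: rep_def)

lemma rep_D1:
  assumes "C2 \<phi>" "c \<in> A" "c' \<in> A" "p \<in> fst c" "\<phi> p \<in> fst c'"
  shows "(rep \<phi> c c' has_derivative blinfun_apply (D1 (rep \<phi> c c') (snd c p))) (at (snd c p))"
  using assms by (intro Ck2_D1[OF C2_dm(2)]) auto

lemma rep_D2:
  assumes "C2 \<phi>" "c \<in> A" "c' \<in> A" "p \<in> fst c" "\<phi> p \<in> fst c'"
  shows "(D1 (rep \<phi> c c') has_derivative blinfun_apply (D2 (rep \<phi> c c') (snd c p))) (at (snd c p))"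
  using assms by (intro Ck2_D2[OF C2_dm(2,1)]) auto

lemma rep_id_self:
  assumes "c \<in> A" "p \<in> fst c"
  shows "D1 (rep id c c) (snd c p) = id_blinfun" "D2 (rep id c c) (snd c p) = 0"
proof -
  have eq: "rep id c c u = u" if "u \<in> snd c ` fst c" for u
    using that assms(1) by auto
  have *: "D1 (rep id c c) u = id_blinfun" if "u \<in> snd c ` fst c" for u
  proof (rule D1_eqI)
    show "(rep id c c has_derivative blinfun_apply id_blinfun) (at u)"
      by (rule has_derivative_transform_within_open[OF _ chart_image_open[OF assms(1)] that, of "\<lambda>x. x"])
        (use eq in \<open>auto simp: id_blinfun.rep_eq\<close>)
  qed
  then show "D1 (rep id c c) (snd c p) = id_blinfun" using assms by auto
  show "D2 (rep id c c) (snd c p) = 0"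
  proof (rule D2_eqI)
    show "(D1 (rep id c c) has_derivative blinfun_apply 0) (at (snd c p))"
      by (rule has_derivative_transform_within_open[OF _ chart_image_open[OF assms(1)], of "\<lambda>x. id_blinfun"])
        (use * assms in \<open>auto simp: zero_blinfun.rep_eq\<close>)
  qed
qed

lemma rep_compose:
  assumes "C2 \<phi>" "C2 \<psi>" "c \<in> A" "c' \<in> A" "c'' \<in> A"
    and "p \<in> fst c" "\<phi> p \<in> fst c'" "\<psi> (\<phi> p) \<in> fst c''"
  shows "D1 (rep (\<psi> \<circ> \<phi>) c c'') (snd c p) = D1 (rep \<psi> c' c'') (snd c' (\<phi> p)) o\<^sub>L D1 (rep \<phi> c c') (snd c p)"
    and "D2 (rep (\<psi> \<circ> \<phi>) c c'') (snd c p) v r =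
      D2 (rep \<psi> c' c'') (snd c' (\<phi> p)) (D1 (rep \<phi> c c') (snd c p) v) (D1 (rep \<phi> c c') (snd c p) r)
      + D1 (rep \<psi> c' c'') (snd c' (\<phi> p)) (D2 (rep \<phi> c c') (snd c p) v r)"
proof -
  let ?D = "snd c ` (fst c \<inter> (\<phi> -` (fst c' \<inter> \<psi> -` fst c'')))"
  let ?F = "rep \<phi> c c'" and ?G = "rep \<psi> c' c''"
  have D: "open ?D"
    using assms by (intro open_chart_image C2_vimage open_Int chart_open) auto
  have p: "snd c p \<in> ?D" using assms by auto
  have eq: "rep (\<psi> \<circ> \<phi>) c c'' u = (?G \<circ> ?F) u" if "u \<in> ?D" for u
    using that assms by auto
  have F: "Ck_on 2 ?F ?D"
    by (rule Ck_on_mono[OF C2_dm(2)]) (use assms in auto)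
  have G: "Ck_on 2 ?G (dm \<psi> c' c'')" "open (dm \<psi> c' c'')"
    using C2_dm assms by auto
  have FD: "?F ` ?D \<subseteq> dm \<psi> c' c''" using assms by auto
  have Fp: "?F (snd c p) = snd c' (\<phi> p)" using assms by auto
  have "D1 (?G \<circ> ?F) (snd c p) = D1 ?G (?F (snd c p)) o\<^sub>L D1 ?F (snd c p)"
    by (rule D1_compose[OF Ck2_D1[OF F p] Ck2_D1[OF G(1)]]) (use FD p in blast)
  then show "D1 (rep (\<psi> \<circ> \<phi>) c c'') (snd c p) = D1 ?G (snd c' (\<phi> p)) o\<^sub>L D1 ?F (snd c p)"
    using D1_cong[OF D p, of "rep (\<psi> \<circ> \<phi>) c c''" "?G \<circ> ?F"] eq by (simp add: Fp)
  show "D2 (rep (\<psi> \<circ> \<phi>) c c'') (snd c p) v r =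
      D2 ?G (snd c' (\<phi> p)) (D1 ?F (snd c p) v) (D1 ?F (snd c p) r)
      + D1 ?G (snd c' (\<phi> p)) (D2 ?F (snd c p) v r)"
    using D2_compose[OF F D p G FD, of v r]
      D2_cong[OF D p, of "rep (\<psi> \<circ> \<phi>) c c''" "?G \<circ> ?F"] eq by (simp add: Fp)
qed

text \<open>Velocities of images of straight lines, in terms of which tangent vectors are defined, are values of
  the Frechet derivative.\<close>

lemma line_vector_derivative:
  assumes "(F has_derivative blinfun_apply L) (at u)"
  shows "((\<lambda>t::real. F (u + t *\<^sub>R v)) has_vector_derivative L v) (at 0)"
proof -
  have "((\<lambda>t::real. u + t *\<^sub>R v) has_vector_derivative v) (at 0)"
    by (auto intro!: derivative_eq_intros simp: has_vector_derivative_def)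
  moreover have "(F has_derivative blinfun_apply L) (at ((\<lambda>t::real. u + t *\<^sub>R v) 0))"
    using assms by simp
  ultimately have "(F \<circ> (\<lambda>t::real. u + t *\<^sub>R v) has_vector_derivative L v) (at 0)"
    using vector_derivative_diff_chain_within[of "\<lambda>t::real. u + t *\<^sub>R v" v 0 UNIV F "blinfun_apply L"]
      has_derivative_at_withinI by auto
  then show ?thesis by (simp add: comp_def)
qed

lemma tau_eq:
  assumes "c \<in> A" "p \<in> fst c"
  shows "tau c p v = D1 (rep id (chart_at A p) c) (snd (chart_at A p) p) v"
proof -
  let ?a = "chart_at A p"
  have "((\<lambda>t. rep id ?a c (snd ?a p + t *\<^sub>R v)) has_vector_derivative D1 (rep id ?a c) (snd ?a p) v) (at 0)"
    by (intro line_vector_derivative rep_D1 C2_id chart_at) (use assms in auto)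
  then show ?thesis
    unfolding tau_def tangent_coord_def line_at_def Let_def by (simp add: vector_derivative_at rep_def comp_def)
qed

lemma tangent_at_eq:
  assumes "C2 \<phi>"
  shows "T \<phi> p v = D1 (rep \<phi> (chart_at A p) (chart_at A (\<phi> p))) (snd (chart_at A p) p) v"
proof -
  let ?a = "chart_at A p" and ?b = "chart_at A (\<phi> p)"
  have "((\<lambda>t. rep \<phi> ?a ?b (snd ?a p + t *\<^sub>R v)) has_vector_derivative D1 (rep \<phi> ?a ?b) (snd ?a p) v) (at 0)"
    by (intro line_vector_derivative rep_D1 assms chart_at)
  then show ?thesis
    unfolding tangent_at_def tangent_map_def line_at_def Let_def by (simp add: vector_derivative_at rep_def comp_def)
qed

lemma tau_natural:
  assumes "C2 \<phi>" "c \<in> A" "c' \<in> A" "p \<in> fst c" "\<phi> p \<in> fst c'"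
  shows "tau c' (\<phi> p) (T \<phi> p v) = D1 (rep \<phi> c c') (snd c p) (tau c p v)"
proof -
  let ?a = "chart_at A p" and ?b = "chart_at A (\<phi> p)"
  have "D1 (rep (id \<circ> \<phi>) ?a c') (snd ?a p) = D1 (rep id ?b c') (snd ?b (\<phi> p)) o\<^sub>L D1 (rep \<phi> ?a ?b) (snd ?a p)"
    by (rule rep_compose) (use assms chart_at C2_id in auto)
  moreover have "D1 (rep (\<phi> \<circ> id) ?a c') (snd ?a p) = D1 (rep \<phi> c c') (snd c (id p)) o\<^sub>L D1 (rep id ?a c) (snd ?a p)"
    by (rule rep_compose) (use assms chart_at C2_id in auto)
  ultimately show ?thesis
    using assms by (simp add: tau_eq tangent_at_eq del: comp_apply flip: blinfun_apply_blinfun_compose)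
qed

lemma T_id [simp]: "T id p v = v"
  using rep_id_self(1)[OF chart_at, of p] by (simp add: tangent_at_eq[OF C2_id])

lemma tau_chart_at [simp]: "tau (chart_at A p) p v = v"
  using rep_id_self(1)[OF chart_at, of p] by (simp add: tau_eq[OF chart_at])

lemma tau_change:
  assumes "c \<in> A" "c' \<in> A" "p \<in> fst c" "p \<in> fst c'"
  shows "tau c' p v = D1 (rep id c c') (snd c p) (tau c p v)"
  using tau_natural[OF C2_id assms(1,2,3)] assms by simp

definition tau_inv :: "('m, 'e) chart \<Rightarrow> 'm \<Rightarrow> 'e \<Rightarrow> 'e" where
  "tau_inv c p w = D1 (rep id c (chart_at A p)) (snd c p) w"

lemma tau_inv_tau [simp]: "c \<in> A \<Longrightarrow> p \<in> fst c \<Longrightarrow> tau_inv c p (tau c p v) = v"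
  using tau_change[of c "chart_at A p" p v] chart_at by (simp add: tau_inv_def)

lemma tau_tau_inv [simp]:
  assumes "c \<in> A" "p \<in> fst c"
  shows "tau c p (tau_inv c p w) = w"
proof -
  let ?a = "chart_at A p"
  have "D1 (rep (id \<circ> id) c c) (snd c p) = D1 (rep id ?a c) (snd ?a (id p)) o\<^sub>L D1 (rep id c ?a) (snd c p)"
    by (rule rep_compose) (use assms chart_at C2_id in auto)
  then have "D1 (rep id ?a c) (snd ?a p) (D1 (rep id c ?a) (snd c p) w) = D1 (rep id c c) (snd c p) w"
    by (metis blinfun_apply_blinfun_compose comp_id id_apply)
  then show ?thesis
    using assms by (simp add: tau_inv_def tau_eq rep_id_self)
qed

lemma tau_bounded_linear: "c \<in> A \<Longrightarrow> p \<in> fst c \<Longrightarrow> bounded_linear (tau c p)"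
  by (subst ext[OF tau_eq]) (auto intro: bounded_linear_intros)

lemma tau_linear: "c \<in> A \<Longrightarrow> p \<in> fst c \<Longrightarrow> linear (tau c p)"
  using tau_bounded_linear bounded_linear.linear by blast

lemma tau_inv_linear: "linear (tau_inv c p)"
  unfolding tau_inv_def
  by (intro bounded_linear.linear bounded_linear_intros)

lemmas tau_simps = linear_add[OF tau_linear] linear_diff[OF tau_linear] linear_scale[OF tau_linear]
  linear_0[OF tau_linear] linear_neg[OF tau_linear]
lemmas tau_inv_simps = linear_add[OF tau_inv_linear] linear_diff[OF tau_inv_linear]
  linear_scale[OF tau_inv_linear] linear_0[OF tau_inv_linear] linear_neg[OF tau_inv_linear]

lemma T_linear: "C2 \<phi> \<Longrightarrow> linear (T \<phi> p)"
  by (subst ext[OF tangent_at_eq]) (auto intro!: bounded_linear.linear bounded_linear_intros)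

lemmas T_simps = linear_add[OF T_linear] linear_diff[OF T_linear] linear_scale[OF T_linear]
  linear_0[OF T_linear] linear_neg[OF T_linear]

lemma C2_compose_T:
  assumes "C2 \<phi>" "C2 \<psi>" "C2 (\<psi> \<circ> \<phi>)"
  shows "T (\<psi> \<circ> \<phi>) p v = T \<psi> (\<phi> p) (T \<phi> p v)"
proof -
  have "D1 (rep (\<psi> \<circ> \<phi>) (chart_at A p) (chart_at A (\<psi> (\<phi> p)))) (snd (chart_at A p) p) =
     D1 (rep \<psi> (chart_at A (\<phi> p)) (chart_at A (\<psi> (\<phi> p)))) (snd (chart_at A (\<phi> p)) (\<phi> p)) o\<^sub>L
     D1 (rep \<phi> (chart_at A p) (chart_at A (\<phi> p))) (snd (chart_at A p) p)"
    by (rule rep_compose) (use assms chart_at in auto)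
  then show ?thesis
    using assms by (simp add: tangent_at_eq del: comp_apply) simp
qed

text \<open>The second derivative of \<open>\<phi>\<close> in the charts \<open>c\<close> and \<open>c'\<close>, as a bilinear map from \<open>T\<^sub>p\<close> to
  \<open>T\<^bsub>\<phi> p\<^esub>\<close>. It depends on the charts, and measures how the derivative of a plane field, computed in
  charts, fails to be transported by the tangent map alone.\<close>

definition beta :: "('m \<Rightarrow> 'm) \<Rightarrow> ('m, 'e) chart \<Rightarrow> ('m, 'e) chart \<Rightarrow> 'm \<Rightarrow> 'e \<Rightarrow> 'e \<Rightarrow> 'e" where
  "beta \<phi> c c' p v r = tau_inv c' (\<phi> p) (D2 (rep \<phi> c c') (snd c p) (tau c p v) (tau c p r))"

text \<open>The chain rule for second derivatives. With \<open>\<phi> = id\<close> or \<open>\<psi> = id\<close> it says how \<open>beta\<close> depends on the charts.\<close>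

lemma beta_compose:
  assumes "C2 \<phi>" "C2 \<psi>" "c \<in> A" "c' \<in> A" "c'' \<in> A"
    and "p \<in> fst c" "\<phi> p \<in> fst c'" "\<psi> (\<phi> p) \<in> fst c''"
  shows "beta (\<psi> \<circ> \<phi>) c c'' p v r =
    beta \<psi> c' c'' (\<phi> p) (T \<phi> p v) (T \<phi> p r) + T \<psi> (\<phi> p) (beta \<phi> c c' p v r)"
proof -
  have "tau c'' (\<psi> (\<phi> p)) (T \<psi> (\<phi> p) (beta \<phi> c c' p v r)) =
      D1 (rep \<psi> c' c'') (snd c' (\<phi> p)) (D2 (rep \<phi> c c') (snd c p) (tau c p v) (tau c p r))"
    using assms by (simp add: tau_natural[where c = c'] beta_def del: comp_apply)
  then have "T \<psi> (\<phi> p) (beta \<phi> c c' p v r) = tau_inv c'' (\<psi> (\<phi> p))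
      (D1 (rep \<psi> c' c'') (snd c' (\<phi> p)) (D2 (rep \<phi> c c') (snd c p) (tau c p v) (tau c p r)))"
    using assms by (metis tau_inv_tau)
  then show ?thesis
    unfolding beta_def[of "\<psi> \<circ> \<phi>"] beta_def[of \<psi>]
    using assms rep_compose(2)[OF assms]
    by (simp add: tau_natural[where c = c] tau_inv_simps del: comp_apply) simp
qed

lemma beta_bilinear:
  assumes "c \<in> A" "p \<in> fst c"
  shows "linear (\<lambda>v. beta \<phi> c c' p v r)" "linear (beta \<phi> c c' p v)"
  unfolding beta_def
  by (auto intro!: linearI simp: tau_simps assms tau_inv_simps blinfun.add_right blinfun.add_left
      blinfun.scaleR_right blinfun.scaleR_left)

lemmas beta_simps = linear_add[OF beta_bilinear(1)] linear_diff[OF beta_bilinear(1)]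
  linear_scale[OF beta_bilinear(1)] linear_0[OF beta_bilinear(1)]
  linear_add[OF beta_bilinear(2)] linear_diff[OF beta_bilinear(2)]
  linear_scale[OF beta_bilinear(2)] linear_0[OF beta_bilinear(2)]

lemma beta_id_self: "c \<in> A \<Longrightarrow> p \<in> fst c \<Longrightarrow> beta id c c p v r = 0"
  unfolding beta_def by (simp add: rep_id_self tau_inv_simps)

section \<open>Convergence in the tangent bundle\<close>

lemma chart_tendsto:
  assumes "(q \<longlongrightarrow> p) F" "c \<in> A" "p \<in> fst c"
  shows "((\<lambda>i. snd c (q i)) \<longlongrightarrow> snd c p) F" "\<forall>\<^sub>F i in F. q i \<in> fst c"
proof -
  show e: "\<forall>\<^sub>F i in F. q i \<in> fst c"
    using topological_tendstoD[OF assms(1) chart_open] assms by blast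
  have "continuous_on (fst c) (snd c)"
    using chart_homeo[OF assms(2)] by (simp add: homeomorphism_def)
  then show "((\<lambda>i. snd c (q i)) \<longlongrightarrow> snd c p) F"
    using continuous_on_tendsto_compose assms(1,3) e by blast
qed

lemma rep_D_tendsto:
  assumes "C2 \<phi>" "c \<in> A" "c' \<in> A" "p \<in> fst c" "\<phi> p \<in> fst c'" "(q \<longlongrightarrow> p) F"
  shows "((\<lambda>i. D1 (rep \<phi> c c') (snd c (q i))) \<longlongrightarrow> D1 (rep \<phi> c c') (snd c p)) F"
    and "((\<lambda>i. D2 (rep \<phi> c c') (snd c (q i))) \<longlongrightarrow> D2 (rep \<phi> c c') (snd c p)) F"
proof -
  have p: "snd c p \<in> dm \<phi> c c'" using assms by auto
  show "((\<lambda>i. D1 (rep \<phi> c c') (snd c (q i))) \<longlongrightarrow> D1 (rep \<phi> c c') (snd c p)) F"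
    by (rule isCont_tendsto_compose[OF Ck2_D1_isCont[OF C2_dm(2,1) p] chart_tendsto(1)]) (use assms in auto)
  show "((\<lambda>i. D2 (rep \<phi> c c') (snd c (q i))) \<longlongrightarrow> D2 (rep \<phi> c c') (snd c p)) F"
    by (rule isCont_tendsto_compose[OF Ck2_D2_isCont[OF C2_dm(2,1) p] chart_tendsto(1)]) (use assms in auto)
qed

text \<open>Convergence of \<open>(q i, w i)\<close> to \<open>(p, v)\<close> in the tangent bundle. The preferred charts at the points \<open>q i\<close> may jump, so
  it is not convergence of \<open>w i\<close> in the vector space that represents all tangent spaces.\<close>

definition tends_TM :: "'i filter \<Rightarrow> ('i \<Rightarrow> 'm) \<Rightarrow> ('i \<Rightarrow> 'e) \<Rightarrow> 'm \<Rightarrow> 'e \<Rightarrow> bool" where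
  "tends_TM F q w p v \<longleftrightarrow> (q \<longlongrightarrow> p) F \<and>
     (\<forall>c\<in>A. p \<in> fst c \<longrightarrow> ((\<lambda>i. tau c (q i) (w i)) \<longlongrightarrow> tau c p v) F)"

lemma tends_TMD:
  assumes "tends_TM F q w p v"
  shows "(q \<longlongrightarrow> p) F" "c \<in> A \<Longrightarrow> p \<in> fst c \<Longrightarrow> ((\<lambda>i. tau c (q i) (w i)) \<longlongrightarrow> tau c p v) F"
  using assms by (auto simp: tends_TM_def)

lemma tends_TM_map:
  assumes "(q \<longlongrightarrow> p) F" "c \<in> A" "p \<in> fst c" "((\<lambda>i. tau c (q i) (w i)) \<longlongrightarrow> tau c p v) F" "C2 \<phi>"
  shows "tends_TM F (\<lambda>i. \<phi> (q i)) (\<lambda>i. T \<phi> (q i) (w i)) (\<phi> p) (T \<phi> p v)"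
  unfolding tends_TM_def
proof (intro conjI ballI impI)
  show l: "((\<lambda>i. \<phi> (q i)) \<longlongrightarrow> \<phi> p) F" using C2_tendsto assms by blast
  fix c' assume c': "c' \<in> A" "\<phi> p \<in> fst c'"
  have "((\<lambda>i. D1 (rep \<phi> c c') (snd c (q i)) (tau c (q i) (w i))) \<longlongrightarrow>
      D1 (rep \<phi> c c') (snd c p) (tau c p v)) F"
    using assms c' by (intro blinfun.tendsto rep_D_tendsto)
  then have "((\<lambda>i. D1 (rep \<phi> c c') (snd c (q i)) (tau c (q i) (w i))) \<longlongrightarrow>
      tau c' (\<phi> p) (T \<phi> p v)) F"
    using assms c' by (simp add: tau_natural[where c = c] del: comp_apply)
  then show "((\<lambda>i. tau c' (\<phi> (q i)) (T \<phi> (q i) (w i))) \<longlongrightarrow> tau c' (\<phi> p) (T \<phi> p v)) F"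
  proof (rule Lim_transform_eventually)
    show "\<forall>\<^sub>F i in F. D1 (rep \<phi> c c') (snd c (q i)) (tau c (q i) (w i)) = tau c' (\<phi> (q i)) (T \<phi> (q i) (w i))"
      using chart_tendsto(2)[OF assms(1-3)] chart_tendsto(2)[OF l c']
      by eventually_elim (use assms c' in \<open>simp add: tau_natural[where c = c] del: comp_apply\<close>)
  qed
qed

lemma tends_TMI:
  assumes "(q \<longlongrightarrow> p) F" "c \<in> A" "p \<in> fst c" "((\<lambda>i. tau c (q i) (w i)) \<longlongrightarrow> tau c p v) F"
  shows "tends_TM F q w p v"
  using tends_TM_map[OF assms C2_id] by simp

lemma tends_TM_T:
  assumes "tends_TM F q w p v" "C2 \<phi>"
  shows "tends_TM F (\<lambda>i. \<phi> (q i)) (\<lambda>i. T \<phi> (q i) (w i)) (\<phi> p) (T \<phi> p v)"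
  by (rule tends_TM_map[OF tends_TMD(1)[OF assms(1)] chart_at tends_TMD(2)[OF assms(1) chart_at] assms(2)])

lemma tends_TM_lincomb:
  assumes x: "tends_TM F q x p u" and y: "tends_TM F q y p v"
  shows "tends_TM F q (\<lambda>i. a *\<^sub>R x i + b *\<^sub>R y i) p (a *\<^sub>R u + b *\<^sub>R v)"
proof (rule tends_TMI[OF tends_TMD(1)[OF x] chart_at])
  let ?c = "chart_at A p"
  have "((\<lambda>i. a *\<^sub>R tau ?c (q i) (x i) + b *\<^sub>R tau ?c (q i) (y i)) \<longlongrightarrow> a *\<^sub>R tau ?c p u + b *\<^sub>R tau ?c p v) F"
    by (intro tendsto_intros tends_TMD(2)[OF x chart_at] tends_TMD(2)[OF y chart_at])
  then have "((\<lambda>i. a *\<^sub>R tau ?c (q i) (x i) + b *\<^sub>R tau ?c (q i) (y i)) \<longlongrightarrow> tau ?c p (a *\<^sub>R u + b *\<^sub>R v)) F"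
    by (simp add: tau_simps chart_at)
  then show "((\<lambda>i. tau ?c (q i) (a *\<^sub>R x i + b *\<^sub>R y i)) \<longlongrightarrow> tau ?c p (a *\<^sub>R u + b *\<^sub>R v)) F"
    by (rule Lim_transform_eventually)
      (use chart_tendsto(2)[OF tends_TMD(1)[OF x] chart_at] in eventually_elim, simp add: tau_simps chart_at)
qed

lemma tends_TM_diff:
  assumes "tends_TM F q x p u" "tends_TM F q y p v"
  shows "tends_TM F q (\<lambda>i. x i - y i) p (u - v)"
  using tends_TM_lincomb[OF assms, of 1 "-1"] by simp

lemma eventually_subbasis:
  assumes "openin (topology_generated_by \<S>) U" "l \<in> U"
    and "\<And>V. V \<in> \<S> \<Longrightarrow> l \<in> V \<Longrightarrow> \<forall>\<^sub>F i in F. g i \<in> V"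
  shows "\<forall>\<^sub>F i in F. g i \<in> U"
proof -
  have "generate_topology_on \<S> U" using assms(1) by (simp add: openin_topology_generated_by_iff)
  then show ?thesis using assms(2)
  proof induction
    case (Int a b)
    then show ?case by (auto intro: eventually_conj)
  next
    case (UN K)
    then obtain k where k: "k \<in> K" "l \<in> k" by auto
    then have "\<forall>\<^sub>F i in F. g i \<in> k" using UN by blast
    then show ?case by (rule eventually_mono) (use k in auto)
  qed (use assms(3) in auto)
qed

lemma openin_tangent:
  assumes "c \<in> A" "open B"
  shows "openin (tangent_topology A UNIV) {\<xi>. fst \<xi> \<in> fst c \<and> (snd c (fst \<xi>), tau c (fst \<xi>) (snd \<xi>)) \<in> B}"
  unfolding tangent_topology_def
  by (rule topology_generated_by_Basis, rule CollectI, intro exI[of _ c] exI[of _ B]) (use assms in \<open>simp add: tau_def\<close>)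

lemma topspace_tangent [simp]: "topspace (tangent_topology A UNIV) = UNIV"
proof -
  have "\<xi> \<in> topspace (tangent_topology A UNIV)" for \<xi>
    using openin_subset[OF openin_tangent[OF chart_at(1)[of "fst \<xi>"] open_UNIV]] chart_at(2)[of "fst \<xi>"]
    by auto
  then show ?thesis by auto
qed

lemma tends_TM_iff_limitin:
  "tends_TM F q w p v \<longleftrightarrow> limitin (tangent_topology A UNIV) (\<lambda>i. (q i, w i)) (p, v) F"
proof
  assume t: "tends_TM F q w p v"
  show "limitin (tangent_topology A UNIV) (\<lambda>i. (q i, w i)) (p, v) F"
    unfolding limitin_def
  proof (intro conjI allI impI)
    fix U assume U: "openin (tangent_topology A UNIV) U \<and> (p, v) \<in> U"
    show "\<forall>\<^sub>F i in F. (q i, w i) \<in> U"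
    proof (rule eventually_subbasis)
      show "openin (topology_generated_by {{\<xi>. fst \<xi> \<in> fst c \<and> snd \<xi> \<in> UNIV \<and> (snd c (fst \<xi>), tangent_coord A c \<xi>) \<in> B} | c B.
        c \<in> A \<and> open B}) U" using U by (simp add: tangent_topology_def)
      show "(p, v) \<in> U" using U by simp
      fix V assume "V \<in> {{\<xi>. fst \<xi> \<in> fst c \<and> snd \<xi> \<in> UNIV \<and> (snd c (fst \<xi>), tangent_coord A c \<xi>) \<in> B} | c B.
        c \<in> A \<and> open B}" "(p, v) \<in> V"
      then obtain c B where c: "c \<in> A" "open B" "p \<in> fst c" "(snd c p, tau c p v) \<in> B"
        "V = {\<xi>. fst \<xi> \<in> fst c \<and> (snd c (fst \<xi>), tangent_coord A c \<xi>) \<in> B}"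
        by (auto simp: tau_def)
      have "((\<lambda>i. (snd c (q i), tau c (q i) (w i))) \<longlongrightarrow> (snd c p, tau c p v)) F"
        using tends_TMD[OF t] c by (intro tendsto_Pair chart_tendsto) auto
      from topological_tendstoD[OF this c(2,4)] chart_tendsto(2)[OF tends_TMD(1)[OF t] c(1,3)]
      show "\<forall>\<^sub>F i in F. (q i, w i) \<in> V"
        by eventually_elim (use c in \<open>simp add: tau_def\<close>)
    qed
  qed simp
next
  assume l: "limitin (tangent_topology A UNIV) (\<lambda>i. (q i, w i)) (p, v) F"
  have ev: "\<forall>\<^sub>F i in F. q i \<in> fst c \<and> (snd c (q i), tau c (q i) (w i)) \<in> B"
    if "c \<in> A" "p \<in> fst c" "open B" "(snd c p, tau c p v) \<in> B" for c B
    using l openin_tangent[OF that(1,3)] that by (auto simp: limitin_def dest!: spec)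
  have c: "((\<lambda>i. (snd c (q i), tau c (q i) (w i))) \<longlongrightarrow> (snd c p, tau c p v)) F"
    if "c \<in> A" "p \<in> fst c" for c
  proof (rule topological_tendstoI)
    fix S assume "open S" "(snd c p, tau c p v) \<in> S"
    from ev[OF that this] show "\<forall>\<^sub>F i in F. (snd c (q i), tau c (q i) (w i)) \<in> S"
      by eventually_elim simp
  qed
  let ?c = "chart_at A p"
  have "((\<lambda>i. chart_inv ?c (snd ?c (q i))) \<longlongrightarrow> chart_inv ?c (snd ?c p)) F"
  proof (rule continuous_on_tendsto_compose[of "snd ?c ` fst ?c" "chart_inv ?c" "\<lambda>i. snd ?c (q i)"])
    show "continuous_on (snd ?c ` fst ?c) (chart_inv ?c)"
      using chart_homeo[OF chart_at(1)[of p]] by (simp add: homeomorphism_def)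
    show "((\<lambda>i. snd ?c (q i)) \<longlongrightarrow> snd ?c p) F"
      using tendsto_fst[OF c[OF chart_at]] by simp
    show "\<forall>\<^sub>F i in F. snd ?c (q i) \<in> snd ?c ` fst ?c"
      using ev[OF chart_at[of p] open_UNIV] by (auto elim: eventually_mono)
  qed (use chart_at in auto)
  moreover have "\<forall>\<^sub>F i in F. q i \<in> fst ?c"
    using ev[OF chart_at open_UNIV] by (auto elim: eventually_mono)
  ultimately have "(q \<longlongrightarrow> chart_inv ?c (snd ?c p)) F"
    by (elim Lim_transform_eventually) (auto elim!: eventually_mono simp: chart_at)
  then have "(q \<longlongrightarrow> p) F" by (simp add: chart_at)
  then show "tends_TM F q w p v"
    unfolding tends_TM_def using tendsto_snd[OF c] by auto
qed

lemma finsler_tendsto: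
  assumes "finsler_metric A N" "tends_TM F q w p v"
  shows "((\<lambda>i. N (q i) (w i)) \<longlongrightarrow> N p v) F"
proof -
  have "continuous_map (tangent_topology A UNIV) euclidean (\<lambda>(p, v). N p v)"
    using assms by (simp add: finsler_metric_def)
  from continuous_map_limit[OF this assms(2)[unfolded tends_TM_iff_limitin]]
  show ?thesis by (simp add: comp_def)
qed

end

section \<open>Projections along complementary subspaces\<close>

definition complementary :: "'a::real_vector set \<Rightarrow> 'a set \<Rightarrow> bool" where
  "complementary V W \<longleftrightarrow> subspace V \<and> subspace W \<and> V \<inter> W = {0} \<and> (\<forall>v. \<exists>r\<in>V. \<exists>s\<in>W. v = r + s)"

definition proj_along :: "'a::real_vector set \<Rightarrow> 'a set \<Rightarrow> 'a \<Rightarrow> 'a" where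
  "proj_along V W v = (THE r. r \<in> V \<and> v - r \<in> W)"

lemma proj_along_unique:
  assumes VW: "complementary V W" and r: "r \<in> V" "v - r \<in> W"
  shows "proj_along V W v = r"
  unfolding proj_along_def
proof (rule the_equality)
  fix r' assume r': "r' \<in> V \<and> v - r' \<in> W"
  have "r' - r \<in> V" using r r' VW subspace_diff by (auto simp: complementary_def)
  moreover have "(v - r) - (v - r') \<in> W" using r r' VW subspace_diff unfolding complementary_def by blast
  ultimately have "r' - r \<in> V \<inter> W" by simp
  then have "r' - r = 0" using VW unfolding complementary_def by blast
  then show "r' = r" by simp
qed (use r in auto)

lemma proj_along_in:
  assumes "complementary V W"
  shows "proj_along V W v \<in> V" "v - proj_along V W v \<in> W"
proof -
  obtain r s where "r \<in> V" "s \<in> W" "v = r + s" using assms unfolding complementary_def by blast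
  then have "r \<in> V" "v - r \<in> W" by auto
  then show "proj_along V W v \<in> V" "v - proj_along V W v \<in> W" using proj_along_unique[OF assms] by auto
qed

lemma proj_along_linear:
  assumes VW: "complementary V W"
  shows "linear (proj_along V W)"
proof (rule linearI)
  have s: "subspace V" "subspace W" using VW by (auto simp: complementary_def)
  note i = proj_along_in[OF VW]
  fix v w a
  have "v + w - (proj_along V W v + proj_along V W w) = (v - proj_along V W v) + (w - proj_along V W w)"
    by (simp add: algebra_simps)
  then show "proj_along V W (v + w) = proj_along V W v + proj_along V W w"
    using subspace_add[OF s(1) i(1) i(1)] subspace_add[OF s(2) i(2) i(2)] by (intro proj_along_unique[OF VW]) metis+
  have "a *\<^sub>R v - a *\<^sub>R proj_along V W v = a *\<^sub>R (v - proj_along V W v)" by (simp add: algebra_simps)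
  then show "proj_along V W (a *\<^sub>R v) = a *\<^sub>R proj_along V W v"
    using subspace_scale[OF s(1) i(1)] subspace_scale[OF s(2) i(2)] by (intro proj_along_unique[OF VW]) metis+
qed

lemma complementary_orthogonal:
  fixes V :: "'a::euclidean_space set"
  assumes V: "subspace V"
  shows "complementary V (orthogonal_comp V)"
proof -
  have "\<exists>r\<in>V. \<exists>s\<in>orthogonal_comp V. v = r + s" for v
  proof -
    have sp: "span V = V" using V by (simp add: span_eq_iff)
    obtain y z where yz: "y \<in> span V" "\<And>w. w \<in> span V \<Longrightarrow> orthogonal z w" "v = y + z"
      using orthogonal_subspace_decomp_exists[of V v] by blast
    have "z \<in> orthogonal_comp V" using yz(2) by (auto simp: orthogonal_comp_def sp orthogonal_commute)
    then show ?thesis using yz(1,3) by (auto simp: sp)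
  qed
  moreover have "V \<inter> orthogonal_comp V = {0}"
  proof -
    have "x = 0" if "x \<in> V" "x \<in> orthogonal_comp V" for x
      using that by (auto simp: orthogonal_comp_def orthogonal_self)
    then show ?thesis using subspace_0[OF V] subspace_0[OF subspace_orthogonal_comp] by blast
  qed
  ultimately show ?thesis
    using V subspace_orthogonal_comp unfolding complementary_def by blast
qed

section \<open>Dominated splittings are continuous\<close>

text \<open>Domination and bunching in a form free of division: one constant \<open>k\<close> serves both, and the
  inequalities also make sense for zero vectors and hence for bundles with zero fibers.\<close>

locale dominated = smooth_manifold A for A :: "('m::t2_space, 'e::euclidean_space) atlas" +
  fixes N :: "'m \<Rightarrow> 'e \<Rightarrow> real" and f :: "'m \<Rightarrow> 'm" and R S E :: "'m \<Rightarrow> 'e set"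
    and d :: nat and k :: real
  assumes compact_M: "compact (UNIV :: 'm set)"
    and finsler: "finsler_metric A N"
    and bij_f: "bij f" and C2_f: "C2 f" and C2_g: "C2 (inv f)"
    and R_sub: "subspace (R p)" and T_R: "T f p ` R p = R (f p)"
    and S_sub: "subspace (S p)" and T_S: "T f p ` S p = S (f p)"
    and E_sub: "subspace (E p)" and T_E: "T f p ` E p = E (f p)"
    and R_Int_S: "R p \<inter> S p = {0}" and R_plus_S: "\<exists>r\<in>R p. \<exists>s\<in>S p. v = r + s"
    and dim_R: "dim (R p) = d"
    and k0: "0 < k" and k1: "k < 1"
    and domination: "\<lbrakk>r \<in> R p; s \<in> S p\<rbrakk> \<Longrightarrow> N (f p) (T f p s) * N p r \<le> k * N p s * N (f p) (T f p r)"
    and bunching: "\<lbrakk>r \<in> R p; s \<in> S p; v \<in> E p\<rbrakk> \<Longrightarrow>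
      N (f p) (T f p s) * N p r * N p v \<le> k * N p s * N (f p) (T f p r) * N (f p) (T f p v)"
begin

abbreviation "g \<equiv> inv f"

lemma fg [simp]: "f (g p) = p" and gf [simp]: "g (f p) = p"
  using bij_f by (auto simp: bij_is_surj surj_f_inv_f bij_is_inj)

lemma T_gf [simp]: "T g (f p) (T f p v) = v"
proof -
  have "g \<circ> f = id" by auto
  then show ?thesis using C2_compose_T[OF C2_f C2_g, of p v] C2_id by simp
qed

lemma T_fg [simp]: "T f (g p) (T g p v) = v"
proof -
  have "f \<circ> g = id" by auto
  then show ?thesis using C2_compose_T[OF C2_g C2_f, of p v] C2_id by simp
qed

lemma N_nonneg [simp]: "0 \<le> N p v" and N_eq_0 [simp]: "N p v = 0 \<longleftrightarrow> v = 0"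
  and N_scale [simp]: "N p (a *\<^sub>R v) = \<bar>a\<bar> * N p v" and N_triangle: "N p (v + w) \<le> N p v + N p w"
  using finsler by (auto simp: finsler_metric_def)

lemma N_zero [simp]: "N p 0 = 0" by simp

lemma N_pos: "v \<noteq> 0 \<Longrightarrow> 0 < N p v"
  using N_nonneg[of p v] N_eq_0[of p v] by linarith

lemma N_minus [simp]: "N p (- v) = N p v"
  using N_scale[of p "-1" v] by simp

lemma N_diff: "N p (v - w) \<le> N p v + N p w"
  using N_triangle[of p v "- w"] by simp

lemma N_commute: "N p (v - w) = N p (w - v)"
  using N_minus[of p "v - w"] by simp

lemma N_diff_le: "N p v - N p w \<le> N p (v - w)"
  using N_triangle[of p "v - w" w] by simp

lemma T_eq_0 [simp]: "T f p v = 0 \<longleftrightarrow> v = 0"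
  using T_gf[of p v] T_simps(4)[OF C2_f] T_simps(4)[OF C2_g] by metis

lemma R_T: "r \<in> R p \<Longrightarrow> T f p r \<in> R (f p)" and S_T: "s \<in> S p \<Longrightarrow> T f p s \<in> S (f p)"
  and E_T: "v \<in> E p \<Longrightarrow> T f p v \<in> E (f p)"
  using T_R T_S T_E by blast+

lemma R_Tg: "r \<in> R p \<Longrightarrow> T g p r \<in> R (g p)" and S_Tg: "s \<in> S p \<Longrightarrow> T g p s \<in> S (g p)"
  and E_Tg: "v \<in> E p \<Longrightarrow> T g p v \<in> E (g p)"
proof -
  have *: "T g p x \<in> X (g p)" if "x \<in> X p" "\<And>p. T f p ` X p = X (f p)" for X x
  proof -
    have "x \<in> T f (g p) ` X (g p)" using that by simp
    then obtain y where "y \<in> X (g p)" "x = T f (g p) y" by blast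
    then show ?thesis using T_gf[of "g p" y] by simp
  qed
  show "r \<in> R p \<Longrightarrow> T g p r \<in> R (g p)" "s \<in> S p \<Longrightarrow> T g p s \<in> S (g p)"
    "v \<in> E p \<Longrightarrow> T g p v \<in> E (g p)"
    using *[of r R] *[of s S] *[of v E] T_R T_S T_E by blast+
qed

subsection \<open>Uniform estimates from compactness\<close>

text \<open>Compactness turns a bound near each point into a global one.\<close>

lemma compact_bound:
  assumes "\<And>p. \<exists>C. \<forall>\<^sub>F q in nhds p. P C q" and "\<And>C C' q. P C q \<Longrightarrow> C \<le> C' \<Longrightarrow> P C' q"
  shows "\<exists>C::real. \<forall>q::'m. P C q"
proof -
  have "\<exists>C U. open U \<and> p \<in> U \<and> (\<forall>q\<in>U. P C q)" for p
    using assms(1)[of p] unfolding eventually_nhds by blast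
  then obtain C U where U: "\<And>p. open (U p)" "\<And>p. p \<in> U p" "\<And>p q. q \<in> U p \<Longrightarrow> P (C p) q"
    by metis
  obtain D where D: "finite D" "UNIV \<subseteq> (\<Union>p\<in>D. U p)"
    by (rule compactE_image[OF compact_M, of UNIV U]) (use U(1,2) in blast)+
  show ?thesis
  proof (intro exI allI)
    fix q obtain p where p: "p \<in> D" "q \<in> U p" using D(2) by blast
    then have "C p \<le> Max (C ` D)" using D(1) by auto
    then show "P (Max (C ` D)) q" using U(3)[OF p(2)] assms(2) by blast
  qed
qed

lemma tends_TM_const: "c \<in> A \<Longrightarrow> p \<in> fst c \<Longrightarrow> (q \<longlongrightarrow> p) F \<Longrightarrow> tends_TM F q (\<lambda>i. tau_inv c (q i) w) p (tau_inv c p w)"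
  and tends_TM_nhds: "c \<in> A \<Longrightarrow> p \<in> fst c \<Longrightarrow>
    tends_TM (nhds p \<times>\<^sub>F nhds w) fst (\<lambda>i. tau_inv c (fst i) (snd i)) p (tau_inv c p w)"
proof -
  assume c: "c \<in> A" "p \<in> fst c"
  show "tends_TM F q (\<lambda>i. tau_inv c (q i) w) p (tau_inv c p w)" if q: "(q \<longlongrightarrow> p) F"
  proof (rule tends_TMI[OF q c])
    have "\<forall>\<^sub>F i in F. w = tau c (q i) (tau_inv c (q i) w)"
      using chart_tendsto(2)[OF q c] by eventually_elim (use c in simp)
    then show "((\<lambda>i. tau c (q i) (tau_inv c (q i) w)) \<longlongrightarrow> tau c p (tau_inv c p w)) F"
      using c by (simp add: tendsto_eventually eventually_mono)
  qed
  have q: "(fst \<longlongrightarrow> p) (nhds p \<times>\<^sub>F nhds w)" and w: "(snd \<longlongrightarrow> w) (nhds p \<times>\<^sub>F nhds w)"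
    by (auto simp: filterlim_fst filterlim_snd)
  show "tends_TM (nhds p \<times>\<^sub>F nhds w) fst (\<lambda>i. tau_inv c (fst i) (snd i)) p (tau_inv c p w)"
  proof (rule tends_TMI[OF q c])
    have "\<forall>\<^sub>F i in nhds p \<times>\<^sub>F nhds w. snd i = tau c (fst i) (tau_inv c (fst i) (snd i))"
      using chart_tendsto(2)[OF q c] by eventually_elim (use c in simp)
    with w have "((\<lambda>i. tau c (fst i) (tau_inv c (fst i) (snd i))) \<longlongrightarrow> w) (nhds p \<times>\<^sub>F nhds w)"
      by (rule Lim_transform_eventually)
    then show "((\<lambda>i. tau c (fst i) (tau_inv c (fst i) (snd i))) \<longlongrightarrow> tau c p (tau_inv c p w)) (nhds p \<times>\<^sub>F nhds w)"
      using c by simp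
  qed
qed

text \<open>A continuous function on \<open>TM\<close> that is absolutely homogeneous on the fibers is equicontinuous
  with respect to the base point, relative to the length of the vector: by homogeneity it suffices to
  look at the unit sphere, which is compact. All uniform estimates below are instances of this.\<close>

lemma homogeneous_uniform:
  fixes G :: "'m \<Rightarrow> 'e \<Rightarrow> real"
  assumes c: "c \<in> A" "p \<in> fst c" and e: "0 < e"
    and cont: "\<And>q w v. tends_TM (nhds p \<times>\<^sub>F nhds (v::'e)) q w p (tau_inv c p v) \<Longrightarrow>
       ((\<lambda>i. G (q i) (w i)) \<longlongrightarrow> G p (tau_inv c p v)) (nhds p \<times>\<^sub>F nhds v)"
    and hom: "\<And>q a w. G q (a *\<^sub>R w) = \<bar>a\<bar> * G q w"
  shows "\<forall>\<^sub>F q in nhds p. \<forall>w. \<bar>G q (tau_inv c q w) - G p (tau_inv c p w)\<bar> \<le> e * norm w"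
proof -
  let ?H = "\<lambda>q w. G q (tau_inv c q w)"
  have l1: "((\<lambda>i. ?H (fst i) (snd i)) \<longlongrightarrow> ?H p w) (nhds p \<times>\<^sub>F nhds w)" for w
    by (rule cont[OF tends_TM_nhds[OF c]])
  have l2: "((\<lambda>i. ?H p (snd i)) \<longlongrightarrow> ?H p w) (nhds p \<times>\<^sub>F nhds w)" for w
  proof (rule cont, rule tends_TMI[OF _ c])
    show "((\<lambda>i. tau c p (tau_inv c p (snd i))) \<longlongrightarrow> tau c p (tau_inv c p w)) (nhds p \<times>\<^sub>F nhds w)"
      using c by (auto simp: filterlim_snd)
  qed auto
  have "\<exists>U V. open U \<and> p \<in> U \<and> open V \<and> w \<in> V \<and> (\<forall>q\<in>U. \<forall>x\<in>V. \<bar>?H q x - ?H p x\<bar> < e)" for w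
  proof -
    have "((\<lambda>i. ?H (fst i) (snd i) - ?H p (snd i)) \<longlongrightarrow> 0) (nhds p \<times>\<^sub>F nhds w)"
      using tendsto_diff[OF l1 l2, of w] by simp
    from tendstoD[OF this e] have "\<forall>\<^sub>F i in nhds p \<times>\<^sub>F nhds w. \<bar>?H (fst i) (snd i) - ?H p (snd i)\<bar> < e"
      by simp
    then obtain P Q where "eventually P (nhds p)" "eventually Q (nhds w)"
      "\<And>q x. P q \<Longrightarrow> Q x \<Longrightarrow> \<bar>?H q x - ?H p x\<bar> < e"
      unfolding eventually_prod_filter by auto
    then show ?thesis unfolding eventually_nhds by metis
  qed
  then obtain U V where UV: "\<And>w. open (U w)" "\<And>w. p \<in> U w" "\<And>w. open (V w)" "\<And>w. w \<in> V w"
    "\<And>w q x. q \<in> U w \<Longrightarrow> x \<in> V w \<Longrightarrow> \<bar>?H q x - ?H p x\<bar> < e"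
    by metis
  obtain D where D: "finite D" "sphere 0 1 \<subseteq> (\<Union>w\<in>D. V w)"
    by (rule compactE_image[OF compact_sphere[of "0::'e" 1], of UNIV V]) (use UV(3,4) in blast)+
  have "\<forall>\<^sub>F q in nhds p. \<forall>w\<in>D. q \<in> U w"
    using D(1) UV(1,2) by (intro eventually_ball_finite) (auto intro: eventually_nhds_in_open)
  then show ?thesis
  proof eventually_elim
    case (elim q)
    show ?case
    proof
      fix w :: 'e
      show "\<bar>?H q w - ?H p w\<bar> \<le> e * norm w"
      proof (cases "w = 0")
        case True
        have "G q 0 = 0" for q using hom[of q 0 0] by simp
        then show ?thesis using True by (simp add: tau_inv_simps)
      next
        case False
        let ?x = "w /\<^sub>R norm w"
        have "?x \<in> sphere 0 1" using False by simp
        then obtain z where "z \<in> D" "?x \<in> V z" using D(2) by blast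
        then have "\<bar>?H q ?x - ?H p ?x\<bar> < e" using UV(5) elim by blast
        moreover have "?H q' w = norm w * ?H q' ?x" for q'
          using False hom[of q' "norm w" "tau_inv c q' ?x"] by (simp flip: tau_inv_simps(3))
        ultimately show ?thesis
          using False by (simp add: abs_mult mult.commute flip: right_diff_distrib)
      qed
    qed
  qed
qed

lemma homogeneous_bound:
  fixes G :: "'m \<Rightarrow> 'e \<Rightarrow> real"
  assumes c: "c \<in> A" "p \<in> fst c"
    and cont: "\<And>q w v. tends_TM (nhds p \<times>\<^sub>F nhds (v::'e)) q w p (tau_inv c p v) \<Longrightarrow>
       ((\<lambda>i. G (q i) (w i)) \<longlongrightarrow> G p (tau_inv c p v)) (nhds p \<times>\<^sub>F nhds v)"
    and hom: "\<And>q a w. G q (a *\<^sub>R w) = \<bar>a\<bar> * G q w"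
  shows "\<exists>C>0. (\<forall>\<^sub>F q in nhds p. \<forall>w. \<bar>G q (tau_inv c q w)\<bar> \<le> C * norm w)"
    and "(\<And>w. w \<noteq> 0 \<Longrightarrow> G p w \<noteq> 0) \<Longrightarrow> \<exists>C>0. (\<forall>\<^sub>F q in nhds p. \<forall>w. norm w \<le> C * \<bar>G q (tau_inv c q w)\<bar>)"
proof -
  let ?H = "\<lambda>q w. G q (tau_inv c q w)"
  have hu: "\<forall>\<^sub>F q in nhds p. \<forall>w. \<bar>?H q w - ?H p w\<bar> \<le> e * norm w" if "0 < e" for e
    by (rule homogeneous_uniform[where G = G and e = e, OF c that]) (erule cont, rule hom)
  have l: "((\<lambda>x. ?H p x) \<longlongrightarrow> ?H p w) (nhds w)" for w
  proof -
    have "((\<lambda>i. ?H p (snd i)) \<longlongrightarrow> ?H p w) (nhds p \<times>\<^sub>F nhds w)"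
    proof (rule cont, rule tends_TMI[OF _ c])
      show "((\<lambda>i. tau c p (tau_inv c p (snd i))) \<longlongrightarrow> tau c p (tau_inv c p w)) (nhds p \<times>\<^sub>F nhds w)"
        using c by (auto simp: filterlim_snd)
    qed auto
    moreover have "filterlim (\<lambda>x. (p, x)) (nhds p \<times>\<^sub>F nhds w) (nhds w)"
      by (intro filterlim_Pair tendsto_const filterlim_ident)
    ultimately show ?thesis using filterlim_compose by fastforce
  qed
  have cont_p: "continuous_on (sphere 0 1) (\<lambda>x. \<bar>?H p x\<bar>)"
    unfolding continuous_on_def
    by (intro ballI tendsto_rabs tendsto_mono[OF _ l]) (simp add: at_within_def inf.coboundedI1)
  have sc: "\<bar>?H q w\<bar> = norm w * \<bar>?H q (w /\<^sub>R norm w)\<bar>" if "w \<noteq> 0" for q w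
    using that hom[of q "norm w" "tau_inv c q (w /\<^sub>R norm w)"] by (simp add: abs_mult flip: tau_inv_simps(3))
  have z: "?H q 0 = 0" for q using hom[of q 0 0] by (simp add: tau_inv_simps)
  have ne: "sphere 0 1 \<noteq> ({} :: 'e set)" by simp
  obtain x1 where x1: "x1 \<in> sphere 0 1" "\<And>x. x \<in> sphere 0 1 \<Longrightarrow> \<bar>?H p x\<bar> \<le> \<bar>?H p x1\<bar>"
    using continuous_attains_sup[OF compact_sphere ne cont_p] by blast
  have up: "\<bar>?H p w\<bar> \<le> \<bar>?H p x1\<bar> * norm w" for w
    using sc[of w p] x1(2)[of "w /\<^sub>R norm w"] z[of p]
    by (cases "w = 0") (auto simp: mult.commute intro!: mult_left_mono)
  show "\<exists>C>0. (\<forall>\<^sub>F q in nhds p. \<forall>w. \<bar>?H q w\<bar> \<le> C * norm w)"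
  proof (intro exI[of _ "\<bar>?H p x1\<bar> + 1"] conjI)
    show "\<forall>\<^sub>F q in nhds p. \<forall>w. \<bar>?H q w\<bar> \<le> (\<bar>?H p x1\<bar> + 1) * norm w"
      using hu[OF zero_less_one]
    proof eventually_elim
      case (elim q)
      show ?case
      proof
        fix w show "\<bar>?H q w\<bar> \<le> (\<bar>?H p x1\<bar> + 1) * norm w"
          using elim[rule_format, of w] up[of w] by (simp add: distrib_right)
      qed
    qed
  qed auto
  assume nz: "\<And>w. w \<noteq> 0 \<Longrightarrow> G p w \<noteq> 0"
  obtain x2 where x2: "x2 \<in> sphere 0 1" "\<And>x. x \<in> sphere 0 1 \<Longrightarrow> \<bar>?H p x2\<bar> \<le> \<bar>?H p x\<bar>"
    using continuous_attains_inf[OF compact_sphere ne cont_p] by blast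
  define m where "m = \<bar>?H p x2\<bar>"
  have "tau_inv c p x2 \<noteq> 0"
    using x2(1) tau_tau_inv[OF c, of x2] tau_simps(4)[OF c] by auto
  then have m: "0 < m" using nz by (auto simp: m_def)
  have low: "m * norm w \<le> \<bar>?H p w\<bar>" for w
    using sc[of w p] x2(2)[of "w /\<^sub>R norm w"] z[of p]
    by (cases "w = 0") (auto simp: mult.commute m_def intro!: mult_left_mono)
  show "\<exists>C>0. (\<forall>\<^sub>F q in nhds p. \<forall>w. norm w \<le> C * \<bar>G q (tau_inv c q w)\<bar>)"
  proof (intro exI[of _ "2 / m"] conjI)
    have "0 < m / 2" using m by simp
    show "\<forall>\<^sub>F q in nhds p. \<forall>w. norm w \<le> 2 / m * \<bar>G q (tau_inv c q w)\<bar>"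
      using hu[OF \<open>0 < m / 2\<close>]
    proof eventually_elim
      case (elim q)
      show ?case
      proof
        fix w
        have "m * norm w - m / 2 * norm w \<le> \<bar>?H q w\<bar>"
          using elim[rule_format, of w] low[of w] by linarith
        then show "norm w \<le> 2 / m * \<bar>G q (tau_inv c q w)\<bar>"
          using m by (simp add: field_simps)
      qed
    qed
  qed (use m in auto)
qed

lemma N_cont: "tends_TM F q w p v \<Longrightarrow> ((\<lambda>i. N (q i) (w i)) \<longlongrightarrow> N p v) F"
  by (rule finsler_tendsto[OF finsler])

lemma N_T_cont: "C2 \<phi> \<Longrightarrow> tends_TM F q w p v \<Longrightarrow> ((\<lambda>i. N (\<phi> (q i)) (T \<phi> (q i) (w i))) \<longlongrightarrow> N (\<phi> p) (T \<phi> p v)) F"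
  by (rule N_cont[OF tends_TM_T])

lemma N_chart_bounds:
  assumes c: "c \<in> A" "p \<in> fst c"
  shows "\<exists>C>0. \<forall>\<^sub>F q in nhds p. \<forall>w. norm w \<le> C * N q (tau_inv c q w) \<and> N q (tau_inv c q w) \<le> C * norm w"
proof -
  obtain C1 where C1: "C1 > 0" "\<forall>\<^sub>F q in nhds p. \<forall>w. \<bar>N q (tau_inv c q w)\<bar> \<le> C1 * norm w"
    using homogeneous_bound(1)[OF c, of N, OF N_cont N_scale] by blast
  obtain C2 where C2: "C2 > 0" "\<forall>\<^sub>F q in nhds p. \<forall>w. norm w \<le> C2 * \<bar>N q (tau_inv c q w)\<bar>"
    using homogeneous_bound(2)[OF c, of N, OF N_cont N_scale] by auto
  show ?thesis
  proof (intro exI[of _ "max C1 C2"] conjI)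
    show "\<forall>\<^sub>F q in nhds p. \<forall>w. norm w \<le> max C1 C2 * N q (tau_inv c q w) \<and> N q (tau_inv c q w) \<le> max C1 C2 * norm w"
      using C1(2) C2(2)
    proof eventually_elim
      case (elim q)
      show ?case
      proof (intro allI conjI)
        fix w
        have "C2 * N q (tau_inv c q w) \<le> max C1 C2 * N q (tau_inv c q w)" "C1 * norm w \<le> max C1 C2 * norm w"
          by (auto intro!: mult_right_mono)
        then show "norm w \<le> max C1 C2 * N q (tau_inv c q w)" "N q (tau_inv c q w) \<le> max C1 C2 * norm w"
          using elim(1)[rule_format, of w] elim(2)[rule_format, of w] by auto
      qed
    qed
  qed (use C1 in auto)
qed

lemma T_bound:
  assumes "C2 \<phi>"
  shows "\<exists>C\<ge>1. \<forall>p v. N (\<phi> p) (T \<phi> p v) \<le> C * N p v"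
proof -
  have "\<exists>C. \<forall>q. \<forall>v. N (\<phi> q) (T \<phi> q v) \<le> C * N q v"
  proof (rule compact_bound)
    fix p
    let ?c = "chart_at A p"
    obtain C1 where C1: "C1 > 0" "\<forall>\<^sub>F q in nhds p. \<forall>w. \<bar>N (\<phi> q) (T \<phi> q (tau_inv ?c q w))\<bar> \<le> C1 * norm w"
      using homogeneous_bound(1)[OF chart_at, where G = "\<lambda>q v. N (\<phi> q) (T \<phi> q v)", OF N_T_cont[OF assms], of p]
      by (auto simp: T_simps[OF assms])
    obtain C2 where C2: "C2 > 0" "\<forall>\<^sub>F q in nhds p. \<forall>w. norm w \<le> C2 * N q (tau_inv ?c q w) \<and> N q (tau_inv ?c q w) \<le> C2 * norm w"
      using N_chart_bounds[OF chart_at] by blast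
    have "\<forall>\<^sub>F q in nhds p. \<forall>v. N (\<phi> q) (T \<phi> q v) \<le> (C1 * C2) * N q v"
      using C1(2) C2(2) chart_tendsto(2)[OF filterlim_ident chart_at, of p]
    proof eventually_elim
      case (elim q)
      show ?case
      proof
        fix v
        have "N (\<phi> q) (T \<phi> q v) \<le> C1 * norm (tau ?c q v)"
          using elim(1)[rule_format, of "tau ?c q v"] elim(3) chart_at by simp
        also have "\<dots> \<le> C1 * (C2 * N q v)"
          using elim(2)[rule_format, of "tau ?c q v"] elim(3) chart_at C1(1) by simp
        finally show "N (\<phi> q) (T \<phi> q v) \<le> (C1 * C2) * N q v" by simp
      qed
    qed
    then show "\<exists>C. \<forall>\<^sub>F q in nhds p. \<forall>v. N (\<phi> q) (T \<phi> q v) \<le> C * N q v" by blast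
  qed (meson N_nonneg mult_right_mono order_trans)
  then obtain C where "\<And>q v. N (\<phi> q) (T \<phi> q v) \<le> C * N q v" by blast
  then have "N (\<phi> q) (T \<phi> q v) \<le> max C 1 * N q v" for q v
    by (meson N_nonneg max.cobounded1 mult_right_mono order_trans)
  then show ?thesis by (intro exI[of _ "max C 1"]) auto
qed

lemma T_f_bound: "\<exists>C\<ge>1. \<forall>p v. N (f p) (T f p v) \<le> C * N p v \<and> N p v \<le> C * N (f p) (T f p v)"
proof -
  obtain C1 where C1: "C1 \<ge> 1" "\<And>p v. N (f p) (T f p v) \<le> C1 * N p v" using T_bound[OF C2_f] by blast
  obtain C2 where C2: "C2 \<ge> 1" "\<And>p v. N (g p) (T g p v) \<le> C2 * N p v" using T_bound[OF C2_g] by blast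
  show ?thesis
  proof (intro exI[of _ "max C1 C2"] conjI allI)
    fix p v
    have "C1 * N p v \<le> max C1 C2 * N p v" "C2 * N (f p) (T f p v) \<le> max C1 C2 * N (f p) (T f p v)"
      by (auto intro!: mult_right_mono)
    then show "N (f p) (T f p v) \<le> max C1 C2 * N p v" "N p v \<le> max C1 C2 * N (f p) (T f p v)"
      using C1(2)[of p v] C2(2)[of "f p" "T f p v"] by auto
  qed (use C1 in auto)
qed

subsection \<open>The projection onto \<open>R\<close> along \<open>S\<close>\<close>

definition piR :: "'m \<Rightarrow> 'e \<Rightarrow> 'e" where
  "piR p = proj_along (R p) (S p)"

lemma complementary_RS: "complementary (R p) (S p)"
  using R_sub S_sub R_Int_S R_plus_S by (simp add: complementary_def)

lemma piR_unique: "r \<in> R p \<Longrightarrow> v - r \<in> S p \<Longrightarrow> piR p v = r"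
  unfolding piR_def by (rule proj_along_unique[OF complementary_RS])

lemma piR_R [simp]: "piR p v \<in> R p" and piR_S [simp]: "v - piR p v \<in> S p"
  unfolding piR_def using proj_along_in[OF complementary_RS] by auto

lemma piR_id [simp]: "r \<in> R p \<Longrightarrow> piR p r = r" and piR_0 [simp]: "s \<in> S p \<Longrightarrow> piR p s = 0"
  using piR_unique subspace_0[OF R_sub] subspace_0[OF S_sub] by auto

lemma piR_linear: "linear (piR p)"
  unfolding piR_def by (rule proj_along_linear[OF complementary_RS])

lemmas piR_simps = linear_add[OF piR_linear] linear_diff[OF piR_linear] linear_scale[OF piR_linear]
  linear_0[OF piR_linear] linear_neg[OF piR_linear]

lemma piR_T: "piR (f p) (T f p v) = T f p (piR p v)"
  using R_T[OF piR_R] S_T[OF piR_S] by (intro piR_unique) (simp_all flip: T_simps[OF C2_f])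

lemma piR_Tg: "piR (g p) (T g p v) = T g p (piR p v)"
  using R_Tg[OF piR_R] S_Tg[OF piR_S] by (intro piR_unique) (simp_all flip: T_simps[OF C2_g])

text \<open>If \<open>r + s\<close> is small compared with \<open>r\<close>, then \<open>r\<close> and \<open>s\<close> have nearly equal length, and so do
  their images; but the image of \<open>s\<close> is shorter than that of \<open>r\<close> by the factor \<open>k\<close>. Hence the angle
  between \<open>R\<close> and \<open>S\<close> is bounded from below, without any continuity of the splitting.\<close>

lemma piR_bound: "\<exists>C\<ge>1. \<forall>p v. N p (piR p v) \<le> C * N p v \<and> N p (v - piR p v) \<le> C * N p v"
proof -
  obtain C where C: "C \<ge> 1" "\<And>p v. N (f p) (T f p v) \<le> C * N p v" "\<And>p v. N p v \<le> C * N (f p) (T f p v)"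
    using T_f_bound by blast
  let ?B = "2 * C^2 / (1 - k)"
  have *: "N p (piR p v) \<le> ?B * N p v" for p v
  proof (cases "piR p v = 0")
    case False
    define r s where "r = piR p v" and "s = v - piR p v"
    have rs: "r \<in> R p" "s \<in> S p" "v = r + s" by (auto simp: r_def s_def)
    let ?Tr = "N (f p) (T f p r)" and ?Ts = "N (f p) (T f p s)"
    have nr: "0 < N p r" using False N_pos r_def by blast
    have "N p s \<le> N p r + N p v" using N_diff[of p v r] rs(3) by simp
    then have "?Ts * N p r \<le> k * (N p r + N p v) * ?Tr"
      using domination[OF rs(1,2)] k0
      by (meson N_nonneg dual_order.trans mult_left_mono mult_right_mono less_imp_le)
    also have "\<dots> \<le> k * N p r * ?Tr + k * N p v * (C * N p r)"
      using mult_left_mono[OF C(2)[of p r], of "k * N p v"] k0 by (simp add: algebra_simps)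
    finally have "?Ts * N p r \<le> (k * ?Tr + k * C * N p v) * N p r" by (simp add: algebra_simps)
    then have 1: "?Ts \<le> k * ?Tr + k * C * N p v" using nr by simp
    have "?Tr \<le> ?Ts + C * N p v"
      using N_diff[of "f p" "T f p v" "T f p s"] C(2)[of p v] rs(3) by (simp add: T_simps[OF C2_f])
    moreover have "k * C * N p v \<le> C * N p v" using k1 C(1) by (simp add: mult_right_mono)
    ultimately have "(1 - k) * ?Tr \<le> 2 * C * N p v" using 1 by (simp add: algebra_simps)
    then have "?Tr \<le> 2 * C * N p v / (1 - k)" using k1 by (simp add: field_simps)
    then have "N p r \<le> C * (2 * C * N p v / (1 - k))"
      using C(3)[of p r] mult_left_mono[of ?Tr "2 * C * N p v / (1 - k)" C] C(1) by linarith
    then show ?thesis by (simp add: r_def power2_eq_square mult_ac)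
  qed (use k1 in simp)
  have B: "0 \<le> ?B" using k1 by simp
  show ?thesis
  proof (intro exI[of _ "?B + 1"] conjI allI)
    fix p v
    show "N p (piR p v) \<le> (?B + 1) * N p v" "N p (v - piR p v) \<le> (?B + 1) * N p v"
      unfolding distrib_right mult_1 using *[of p v] N_diff[of p v "piR p v"] N_nonneg[of p v] by linarith+
  qed (use B in simp)
qed

text \<open>\<open>accumulates p G\<close>: the projections \<open>piR q\<close> accumulate at \<open>G\<close> as \<open>q\<close> tends to \<open>p\<close>. Accumulation is expressed by
  a filter finer than the neighbourhood filter, so that it is carried along by \<open>f\<close> and its inverse.\<close>

definition accumulates :: "'m \<Rightarrow> ('e \<Rightarrow> 'e) \<Rightarrow> bool" where
  "accumulates p G \<longleftrightarrow> (\<exists>F. F \<noteq> bot \<and> F \<le> nhds p \<and>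
     (\<forall>v w. tends_TM F (\<lambda>q. q) w p v \<longrightarrow> tends_TM F (\<lambda>q. q) (\<lambda>q. piR q (w q)) p (G v)))"

text \<open>The bundles are invariant, so that the projections commute with \<open>Tf\<close>.\<close>

lemma accumulates_T:
  assumes "accumulates p G" shows "accumulates (f p) (\<lambda>v. T f p (G (T g (f p) v)))"
proof -
  obtain F where F: "F \<noteq> bot" "F \<le> nhds p"
    and lim: "\<And>v w. tends_TM F (\<lambda>q. q) w p v \<Longrightarrow> tends_TM F (\<lambda>q. q) (\<lambda>q. piR q (w q)) p (G v)"
    using assms by (auto simp: accumulates_def)
  show ?thesis unfolding accumulates_def
  proof (intro exI[of _ "filtermap f F"] conjI allI impI)
    have "(f \<longlongrightarrow> f p) F" using C2_tendsto[OF C2_f, of "\<lambda>q. q" p F] F(2) by (simp add: filterlim_def)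
    then show "filtermap f F \<le> nhds (f p)" by (simp add: filterlim_def)
    fix v w assume "tends_TM (filtermap f F) (\<lambda>q. q) w (f p) v"
    then have "tends_TM F f (\<lambda>q. w (f q)) (f p) v" by (simp add: tends_TM_def filterlim_filtermap)
    from lim[of "\<lambda>q. T g (f q) (w (f q))", simplified] tends_TM_T[OF this C2_g]
    have "tends_TM F (\<lambda>q. q) (\<lambda>q. piR q (T g (f q) (w (f q)))) p (G (T g (f p) v))" by simp
    from tends_TM_T[OF this C2_f]
    have "tends_TM F f (\<lambda>q. T f q (piR q (T g (f q) (w (f q))))) (f p) (T f p (G (T g (f p) v)))" .
    moreover have "T f q (piR q (T g (f q) (w (f q)))) = piR (f q) (w (f q))" for q
      using T_fg[of "f q"] by (simp flip: piR_T)
    ultimately show "tends_TM (filtermap f F) (\<lambda>q. q) (\<lambda>q. piR q (w q)) (f p) (T f p (G (T g (f p) v)))"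
      by (simp add: tends_TM_def filterlim_filtermap)
  qed (use F in \<open>simp add: filtermap_bot_iff\<close>)
qed

lemma accumulates_Tg:
  assumes "accumulates p G" shows "accumulates (g p) (\<lambda>v. T g p (G (T f (g p) v)))"
proof -
  obtain F where F: "F \<noteq> bot" "F \<le> nhds p"
    and lim: "\<And>v w. tends_TM F (\<lambda>q. q) w p v \<Longrightarrow> tends_TM F (\<lambda>q. q) (\<lambda>q. piR q (w q)) p (G v)"
    using assms by (auto simp: accumulates_def)
  show ?thesis unfolding accumulates_def
  proof (intro exI[of _ "filtermap g F"] conjI allI impI)
    have "(g \<longlongrightarrow> g p) F" using C2_tendsto[OF C2_g, of "\<lambda>q. q" p F] F(2) by (simp add: filterlim_def)
    then show "filtermap g F \<le> nhds (g p)" by (simp add: filterlim_def)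
    fix v w assume "tends_TM (filtermap g F) (\<lambda>q. q) w (g p) v"
    then have "tends_TM F g (\<lambda>q. w (g q)) (g p) v" by (simp add: tends_TM_def filterlim_filtermap)
    from lim[of "\<lambda>q. T f (g q) (w (g q))", simplified] tends_TM_T[OF this C2_f]
    have "tends_TM F (\<lambda>q. q) (\<lambda>q. piR q (T f (g q) (w (g q)))) p (G (T f (g p) v))" by simp
    from tends_TM_T[OF this C2_g]
    have "tends_TM F g (\<lambda>q. T g q (piR q (T f (g q) (w (g q))))) (g p) (T g p (G (T f (g p) v)))" .
    moreover have "T g q (piR q (T f (g q) (w (g q)))) = piR (g q) (w (g q))" for q
      using T_gf[of "g q"] by (simp flip: piR_Tg)
    ultimately show "tends_TM (filtermap g F) (\<lambda>q. q) (\<lambda>q. piR q (w q)) (g p) (T g p (G (T f (g p) v)))"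
      by (simp add: tends_TM_def filterlim_filtermap)
  qed (use F in \<open>simp add: filtermap_bot_iff\<close>)
qed

lemma dim_S: "dim (S p) = DIM('e) - d"
proof -
  have "{x + y |x y. x \<in> R p \<and> y \<in> S p} = UNIV" using R_plus_S[of p] by blast
  then have "DIM('e) + dim (R p \<inter> S p) = dim (R p) + dim (S p)"
    using dim_sums_Int[OF R_sub S_sub, of p p] by simp
  then show ?thesis by (simp add: R_Int_S dim_R)
qed

text \<open>Accumulation points inherit the algebra of the projections and, in the limit, domination: images of
  \<open>G\<close> dominate its kernel. The ranks can only drop in the limit.\<close>

lemma accumulates_props:
  assumes "accumulates p G" and C: "\<And>p v. N p (piR p v) \<le> C * N p v"
  shows "linear G" "N p (G v) \<le> C * N p v" "G (G v) = G v"
    and "N (f p) (T f p (u - G u)) * N p (G v) \<le> k * N p (u - G u) * N (f p) (T f p (G v))"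
    and "dim (range G) \<le> d" "dim (range (\<lambda>v. v - G v)) \<le> DIM('e) - d"
proof -
  obtain F where F: "F \<noteq> bot" "F \<le> nhds p"
    and lim: "\<And>v w. tends_TM F (\<lambda>q. q) w p v \<Longrightarrow> tends_TM F (\<lambda>q. q) (\<lambda>q. piR q (w q)) p (G v)"
    using assms by (auto simp: accumulates_def)
  let ?c = "chart_at A p"
  note c = chart_at[of p]
  have id: "((\<lambda>q. q) \<longlongrightarrow> p) F" using F(2) by (simp add: filterlim_def)
  define w where "w v q = tau_inv ?c q v" for v q
  have w: "tends_TM F (\<lambda>q. q) (w v) p v" for v
    using tends_TM_const[OF c id, of v] tau_inv_tau[OF c, of v] by (simp add: w_def[abs_def])
  have Pw: "tends_TM F (\<lambda>q. q) (\<lambda>q. piR q (w v q)) p (G v)" for v by (rule lim[OF w])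
  have uniq: "u = v" if "tends_TM F (\<lambda>q. q) x p u" "tends_TM F (\<lambda>q. q) x p v" for x u v
    using tendsto_unique[OF F(1) tends_TMD(2)[OF that(1) c] tends_TMD(2)[OF that(2) c]] by simp
  have ev: "\<forall>\<^sub>F q in F. q \<in> fst ?c" using chart_tendsto(2)[OF id c] .
  have tadd: "tends_TM F (\<lambda>q. q) (\<lambda>q. a *\<^sub>R x q + b *\<^sub>R y q) p (a *\<^sub>R u + b *\<^sub>R v)"
    if "tends_TM F (\<lambda>q. q) x p u" "tends_TM F (\<lambda>q. q) y p v" for a b x y u v
    by (rule tends_TM_lincomb[OF that])
  have lin: "G (a *\<^sub>R u + b *\<^sub>R v) = a *\<^sub>R G u + b *\<^sub>R G v" for a b u v
    using uniq[OF lim[OF tadd[OF w[of u] w[of v], of a b]]] tadd[OF Pw[of u] Pw[of v], of a b]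
    by (simp add: piR_simps)
  show l: "linear G"
    using lin[of 1 _ 1] lin[of _ _ 0] by (intro linearI) auto
  show "N p (G v) \<le> C * N p v"
    by (rule tendsto_le[OF F(1) tendsto_mult_left[OF N_cont[OF w]] N_cont[OF Pw]]) (use C in simp)
  have GG: "G (G v) = G v" for v
    using uniq[OF lim[OF Pw[of v]]] Pw[of v] by simp
  then show "G (G v) = G v" .
  have Qw: "tends_TM F (\<lambda>q. q) (\<lambda>q. w u q - piR q (w u q)) p (u - G u)" for u
    using tadd[OF w[of u] Pw[of u], of 1 "-1"] by simp
  show "N (f p) (T f p (u - G u)) * N p (G v) \<le> k * N p (u - G u) * N (f p) (T f p (G v))"
  proof (rule tendsto_le[OF F(1)])
    let ?l = "\<lambda>q. N (f q) (T f q (w u q - piR q (w u q))) * N q (piR q (w v q))"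
      and ?r = "\<lambda>q. k * N q (w u q - piR q (w u q)) * N (f q) (T f q (piR q (w v q)))"
    show "(?r \<longlongrightarrow> k * N p (u - G u) * N (f p) (T f p (G v))) F"
      by (intro tendsto_mult tendsto_const N_cont[OF Qw] N_T_cont[OF C2_f Pw])
    show "(?l \<longlongrightarrow> N (f p) (T f p (u - G u)) * N p (G v)) F"
      by (intro tendsto_mult N_cont[OF Pw] N_T_cont[OF C2_f Qw])
    show "\<forall>\<^sub>F q in F. ?l q \<le> ?r q" by (intro always_eventually allI domination piR_R piR_S)
  qed
  define P where "P q = Blinfun (\<lambda>v. tau ?c q (piR q (w v q)))" for q
  define P0 where "P0 = Blinfun (\<lambda>v. tau ?c p (G (tau_inv ?c p v)))"
  have P0: "blinfun_apply P0 = (\<lambda>v. tau ?c p (G (tau_inv ?c p v)))"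
    unfolding P0_def by (intro bounded_linear_Blinfun_apply linear_conv_bounded_linear[THEN iffD1]
        linear_compose[of G "tau ?c p", unfolded comp_def] linear_compose[of "tau_inv ?c p" "\<lambda>v. tau ?c p (G v)", unfolded comp_def]
        tau_linear tau_inv_linear l c)
  have Pa: "blinfun_apply (P q) = (\<lambda>v. tau ?c q (piR q (tau_inv ?c q v)))" if "q \<in> fst ?c" for q
    unfolding P_def w_def by (intro bounded_linear_Blinfun_apply linear_conv_bounded_linear[THEN iffD1]
        linear_compose[of "piR q" "tau ?c q", unfolded comp_def] linear_compose[of "tau_inv ?c q" "\<lambda>v. tau ?c q (piR q v)", unfolded comp_def]
        tau_linear tau_inv_linear piR_linear c that)
  have "(P \<longlongrightarrow> P0) F"
  proof (rule tendsto_blinfun_pointwise)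
    fix x
    have "((\<lambda>q. tau ?c q (piR q (w x q))) \<longlongrightarrow> tau ?c p (G x)) F"
      using tends_TMD(2)[OF Pw c] .
    then show "((\<lambda>q. P q x) \<longlongrightarrow> P0 x) F"
      by (rule Lim_transform_eventually[THEN tendsto_eq_rhs])
        (use ev in \<open>eventually_elim, simp add: Pa w_def\<close>, simp add: P0 tau_inv_def rep_id_self[OF c])
  qed
  then have "\<forall>\<^sub>F q in F. dist (P q) P0 < 1 / 2" by (rule tendstoD) simp
  then obtain q where q: "dist (P q) P0 < 1 / 2" "q \<in> fst ?c"
    using eventually_happens[OF eventually_conj[OF _ ev]] F(1) by metis
  have near: "norm (P q x - P0 x) < norm x" if "x \<noteq> 0" for x
  proof -
    have "norm (P q x - P0 x) \<le> norm (P q - P0) * norm x"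
      by (metis blinfun.diff_left norm_blinfun)
    also have "\<dots> \<le> 1 / 2 * norm x" using q(1) by (intro mult_right_mono) (auto simp: dist_norm)
    also have "\<dots> < norm x" using that by simp
    finally show ?thesis .
  qed
  have idem: "P0 (P0 x) = P0 x" for x
    using GG tau_inv_tau[OF c] by (simp add: P0)
  have idq: "tau_inv ?c q (tau ?c q v) = v" "tau ?c q (tau_inv ?c q v) = v" for v using c q(2) by auto
  have dim_tau: "dim (tau ?c q ` X) = dim X" for X
  proof (rule dim_image_eq)
    show "linear (tau ?c q)" using tau_linear c(1) q(2) by blast
    show "inj_on (tau ?c q) (span X)" by (metis idq(1) inj_onI)
  qed
  have dim_tau0: "dim (tau_inv ?c p ` X) \<le> dim X" for X
    by (rule dim_image_le[OF tau_inv_linear])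
  have inj1: "x = 0" if "x \<in> range P0" "P q x = 0" for x
  proof -
    have "P0 x = x" using that(1) idem by auto
    then show ?thesis using near[of x] that(2) by (cases "x = 0") auto
  qed
  have lq: "linear (P q)" "linear P0" by (simp_all add: blinfun.bounded_linear_right bounded_linear.linear)
  have lq': "linear (\<lambda>x. x - P q x)" "linear (\<lambda>x. x - P0 x)"
    using linear_compose_sub[OF linear_ident] lq by auto
  have "dim (range G) \<le> dim (tau_inv ?c p ` range P0)"
  proof (rule dim_subset)
    have "G v = tau_inv ?c p (P0 (tau ?c p v))" for v
      by (simp only: P0 tau_inv_tau[OF c])
    then show "range G \<subseteq> tau_inv ?c p ` range P0" by blast
  qed
  also have "\<dots> \<le> dim (range P0)" by (rule dim_tau0)
  also have "\<dots> = dim (P q ` range P0)"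
  proof (rule dim_image_eq[symmetric])
    have "span (range P0) = range P0" using linear_subspace_image[OF lq(2) subspace_UNIV] by simp
    moreover have "inj_on (P q) (range P0)"
      using linear_inj_on_iff_eq_0[OF lq(1) linear_subspace_image[OF lq(2) subspace_UNIV]] inj1 by blast
    ultimately show "inj_on (P q) (span (range P0))" by metis
  qed (rule lq)
  also have "\<dots> \<le> dim (tau ?c q ` R q)"
    by (rule dim_subset) (auto simp: Pa q)
  finally show "dim (range G) \<le> d" by (simp add: dim_tau dim_R)
  have inj2: "x = 0" if "x \<in> range (\<lambda>x. x - P0 x)" "x - P q x = 0" for x
  proof -
    have "P0 x = 0" using that(1) idem by (auto simp: blinfun.diff_right)
    then show ?thesis using near[of x] that(2) by (cases "x = 0") auto
  qed
  have "dim (range (\<lambda>v. v - G v)) \<le> dim (tau_inv ?c p ` range (\<lambda>x. x - P0 x))"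
  proof (rule dim_subset)
    have "v - G v = tau_inv ?c p (tau ?c p v - P0 (tau ?c p v))" for v
      by (simp only: P0 tau_inv_simps tau_inv_tau[OF c])
    then show "range (\<lambda>v. v - G v) \<subseteq> tau_inv ?c p ` range (\<lambda>x. x - P0 x)" by blast
  qed
  also have "\<dots> \<le> dim (range (\<lambda>x. x - P0 x))" by (rule dim_tau0)
  also have "\<dots> = dim ((\<lambda>x. x - P q x) ` range (\<lambda>x. x - P0 x))"
  proof (rule dim_image_eq[symmetric])
    have "span (range (\<lambda>x. x - P0 x)) = range (\<lambda>x. x - P0 x)" using linear_subspace_image[OF lq'(2) subspace_UNIV] by simp
    moreover have "inj_on (\<lambda>x. x - P q x) (range (\<lambda>x. x - P0 x))"
      using linear_inj_on_iff_eq_0[OF lq'(1) linear_subspace_image[OF lq'(2) subspace_UNIV]] inj2 by blast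
    ultimately show "inj_on (\<lambda>x. x - P q x) (span (range (\<lambda>x. x - P0 x)))" by metis
  qed (rule lq')
  also have "\<dots> \<le> dim (tau ?c q ` S q)"
  proof (rule dim_subset)
    have "x - P q x = tau ?c q (tau_inv ?c q x - piR q (tau_inv ?c q x))" for x
      by (simp add: Pa q tau_simps[OF c(1) q(2)] idq)
    then show "(\<lambda>x. x - P q x) ` range (\<lambda>x. x - P0 x) \<subseteq> tau ?c q ` S q" by auto
  qed
  finally show "dim (range (\<lambda>v. v - G v)) \<le> DIM('e) - d" by (simp add: dim_tau dim_S)
qed

text \<open>The off-diagonal blocks of an accumulation point \<open>G\<close> with respect to \<open>R \<oplus> S\<close> are bounded, and
  transport by \<open>f\<close> or by its inverse improves the bound by the factor \<open>k\<close>; so they vanish. The diagonal blocks are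
  projections. If \<open>G\<close> killed some \<open>r \<in> R\<close> and fixed some \<open>s \<in> S\<close>, then \<open>s\<close> would dominate \<open>r\<close>, because
  the image of \<open>G\<close> dominates its kernel; but \<open>r\<close> dominates \<open>s\<close>. The ranks exclude what remains.\<close>

lemma accumulates_eq_piR:
  assumes "accumulates p G" shows "G v = piR p v"
proof -
  obtain C where C: "C \<ge> 1" "\<And>p v. N p (piR p v) \<le> C * N p v" "\<And>p v. N p (v - piR p v) \<le> C * N p v"
    using piR_bound by blast
  note props = accumulates_props[OF _ C(2)]
  have zero: "x = 0" if "\<And>n. N p x \<le> C^2 * k ^ n * b" for p x b
  proof -
    have "(\<lambda>n. C^2 * k ^ n * b) \<longlonglongrightarrow> C^2 * 0 * b"
      by (intro tendsto_intros LIMSEQ_realpow_zero) (use k0 k1 in auto)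
    then have "N p x \<le> 0" using that by (intro LIMSEQ_le_const) auto
    then show ?thesis using N_nonneg[of p x] N_eq_0[of p x] by linarith
  qed
  have bd: "N p (G v) \<le> C * N p v" if "accumulates p G" for p G v by (rule props(2)[OF that])
  have S_block: "N p (piR p (G s)) \<le> C^2 * k ^ n * N p s" if "accumulates p G" "s \<in> S p" for p G s n
    using that
  proof (induction n arbitrary: p G s)
    case 0
    have "N p (piR p (G s)) \<le> C * (C * N p s)"
      using C(2)[of p "G s"] bd[OF 0(1), of s] C(1) by (meson mult_left_mono order_trans zero_le_one)
    then show ?case by (simp add: power2_eq_square)
  next
    case (Suc n)
    show ?case
    proof (cases "s = 0")
      case True
      then show ?thesis using linear_0[OF props(1)[OF Suc.prems(1)]] by (simp add: piR_simps)
    next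
      case False
      let ?r = "piR p (G s)"
      have "N (f p) (piR (f p) (T f p (G (T g (f p) (T f p s))))) \<le> C^2 * k ^ n * N (f p) (T f p s)"
        using Suc.IH[OF accumulates_T[OF Suc.prems(1)] S_T[OF Suc.prems(2)]] .
      then have 1: "N (f p) (T f p ?r) \<le> C^2 * k ^ n * N (f p) (T f p s)" by (simp add: piR_T)
      have "N (f p) (T f p s) * N p ?r \<le> k * N p s * N (f p) (T f p ?r)"
        by (rule domination) (use Suc.prems in auto)
      also have "\<dots> \<le> k * N p s * (C^2 * k ^ n * N (f p) (T f p s))"
        using 1 k0 by (intro mult_left_mono) auto
      finally have "N (f p) (T f p s) * N p ?r \<le> N (f p) (T f p s) * (C^2 * k ^ Suc n * N p s)"
        by (simp add: mult_ac)
      moreover have "0 < N (f p) (T f p s)" using False by (intro N_pos) simp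
      ultimately show ?thesis by (simp only: mult_le_cancel_left_pos)
    qed
  qed
  have R_block: "N p (G r - piR p (G r)) \<le> C^2 * k ^ n * N p r" if "accumulates p G" "r \<in> R p" for p G r n
    using that
  proof (induction n arbitrary: p G r)
    case 0
    have "N p (G r - piR p (G r)) \<le> C * (C * N p r)"
      using C(3)[of p "G r"] bd[OF 0(1), of r] C(1) by (meson mult_left_mono order_trans zero_le_one)
    then show ?case by (simp add: power2_eq_square)
  next
    case (Suc n)
    show ?case
    proof (cases "r = 0")
      case True
      then show ?thesis using linear_0[OF props(1)[OF Suc.prems(1)]] by (simp add: piR_simps)
    next
      case False
      let ?y = "G r - piR p (G r)"
      let ?r' = "T g p r" and ?y' = "T g p ?y"
      have "N (g p) (T g p (G (T f (g p) ?r')) - piR (g p) (T g p (G (T f (g p) ?r')))) \<le> C^2 * k ^ n * N (g p) ?r'"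
        using Suc.IH[OF accumulates_Tg[OF Suc.prems(1)] R_Tg[OF Suc.prems(2)]] .
      then have 1: "N (g p) ?y' \<le> C^2 * k ^ n * N (g p) ?r'"
        by (simp add: piR_Tg T_simps[OF C2_g])
      have "N p ?y * N (g p) ?r' \<le> k * N (g p) ?y' * N p r"
        using domination[of ?r' "g p" ?y'] R_Tg[OF Suc.prems(2)] S_Tg[OF piR_S] by simp
      also have "\<dots> \<le> k * (C^2 * k ^ n * N (g p) ?r') * N p r"
        using 1 k0 by (intro mult_right_mono mult_left_mono) auto
      finally have "N (g p) ?r' * N p ?y \<le> N (g p) ?r' * (C^2 * k ^ Suc n * N p r)"
        by (simp add: mult_ac)
      moreover have "0 < N (g p) ?r'" using False T_fg[of p r] T_eq_0[of "g p" ?r'] by (intro N_pos) auto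
      ultimately show ?thesis by (simp only: mult_le_cancel_left_pos)
    qed
  qed
  note P = props[OF assms]
  have GS: "G s \<in> S p" if "s \<in> S p" for s
    using zero[OF S_block[OF assms that]] piR_S[of "G s" p] by simp
  have GR: "G r \<in> R p" if "r \<in> R p" for r
  proof -
    have "G r - piR p (G r) = 0" by (rule zero[OF R_block[OF assms that]])
    then show ?thesis using piR_R[of p "G r"] by simp
  qed
  have not_both: False if "r \<in> R p" "G r \<noteq> r" "s \<in> S p" "G s \<noteq> 0" for r s
  proof -
    let ?r = "r - G r" and ?s = "G s"
    have "?r \<in> R p" using that GR subspace_diff[OF R_sub] by blast
    then have 1: "N (f p) (T f p ?s) * N p ?r \<le> k * N p ?s * N (f p) (T f p ?r)"
      using GS that by (intro domination) auto
    have 2: "N (f p) (T f p ?r) * N p ?s \<le> k * N p ?r * N (f p) (T f p ?s)"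
      using P(4)[of r s] by simp
    have pos: "0 < N (f p) (T f p ?s)" "0 < N p ?r" using that by (auto intro!: N_pos)
    from 2 k0 have "k * (N p ?s * N (f p) (T f p ?r)) \<le> k * (k * (N (f p) (T f p ?s) * N p ?r))"
      by (intro mult_left_mono) (auto simp: mult_ac)
    with 1 have "1 * (N (f p) (T f p ?s) * N p ?r) \<le> (k * k) * (N (f p) (T f p ?s) * N p ?r)"
      by (simp add: mult_ac)
    moreover have "0 < N (f p) (T f p ?s) * N p ?r" using pos by simp
    ultimately have "1 \<le> k * k" by (simp only: mult_le_cancel_right_pos)
    moreover have "k * k < 1 * 1" by (intro mult_strict_mono) (use k0 k1 in auto)
    ultimately show False by simp
  qed
  have sub: "subspace (range G)" "subspace (range (\<lambda>v. v - G v))"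
    using linear_subspace_image[OF _ subspace_UNIV] P(1) linear_compose_sub[OF linear_ident P(1)] by blast+
  have "(\<forall>r\<in>R p. G r = r) \<and> (\<forall>s\<in>S p. G s = 0)"
  proof (cases "\<forall>r\<in>R p. G r = r")
    case True
    have "G s = 0" if s: "s \<in> S p" for s
    proof (rule ccontr)
      assume n: "G s \<noteq> 0"
      then have "G s \<notin> R p" using GS[OF s] R_Int_S by blast
      then have "dim (insert (G s) (R p)) = Suc d"
        by (simp add: dim_insert span_eq_iff[THEN iffD2, OF R_sub] dim_R)
      moreover have "insert (G s) (R p) \<subseteq> range G" using True by (metis insert_subset rangeI subsetI)
      ultimately show False using dim_subset[of "insert (G s) (R p)" "range G"] P(5) by simp
    qed
    with True show ?thesis by blast
  next
    case False
    then obtain r where r: "r \<in> R p" "G r \<noteq> r" by blast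
    then have GS0: "G s = 0" if "s \<in> S p" for s using not_both that by blast
    let ?r = "r - G r"
    have "?r \<in> R p" using r GR subspace_diff[OF R_sub] by blast
    moreover have "?r \<noteq> 0" using r(2) by (metis eq_iff_diff_eq_0)
    ultimately have "?r \<notin> S p" using R_Int_S by blast
    then have "?r \<notin> span (S p)" by (simp only: span_eq_iff[THEN iffD2, OF S_sub] not_False_eq_True)
    then have "dim (insert ?r (S p)) = Suc (DIM('e) - d)"
      using dim_insert[of ?r "S p"] dim_S[of p] by simp
    moreover have "insert ?r (S p) \<subseteq> range (\<lambda>v. v - G v)"
    proof -
      have "s \<in> range (\<lambda>v. v - G v)" if "s \<in> S p" for s
        by (rule range_eqI[of _ _ s]) (use GS0[OF that] in simp)
      then show ?thesis by blast
    qed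
    ultimately show ?thesis
      using dim_subset[of "insert ?r (S p)" "range (\<lambda>v. v - G v)"] P(6) by simp
  qed
  then have "G (piR p v) = piR p v" "G (v - piR p v) = 0" by auto
  then show ?thesis using linear_add[OF P(1), of "piR p v" "v - piR p v"] by simp
qed

definition Pc :: "('m, 'e) chart \<Rightarrow> 'm \<Rightarrow> 'e \<Rightarrow>\<^sub>L 'e" where
  "Pc c q = Blinfun (\<lambda>w. tau c q (piR q (tau_inv c q w)))"

lemma Pc_apply: "c \<in> A \<Longrightarrow> q \<in> fst c \<Longrightarrow> Pc c q w = tau c q (piR q (tau_inv c q w))"
  unfolding Pc_def by (subst bounded_linear_Blinfun_apply)
    (auto intro!: linear_conv_bounded_linear[THEN iffD1]
        linear_compose[of "piR q" "tau c q", unfolded comp_def] linear_compose[of "tau_inv c q" "\<lambda>v. tau c q (piR q v)", unfolded comp_def]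
        tau_linear tau_inv_linear piR_linear)

text \<open>The projections near \<open>p\<close> stay in a compact set of linear maps and have a single accumulation point.\<close>

lemma Pc_continuous_nhds:
  assumes c: "c \<in> A" "p \<in> fst c"
  shows "(Pc c \<longlongrightarrow> Pc c p) (nhds p)"
proof (rule ccontr)
  assume "\<not> ?thesis"
  then obtain e where e: "e > 0" "\<not> (\<forall>\<^sub>F q in nhds p. dist (Pc c q) (Pc c p) < e)"
    unfolding tendsto_iff by blast
  obtain C1 where C1: "C1 > 0" "\<forall>\<^sub>F q in nhds p. \<forall>w. norm w \<le> C1 * N q (tau_inv c q w) \<and> N q (tau_inv c q w) \<le> C1 * norm w"
    using N_chart_bounds[OF c] by blast
  obtain C where C: "C \<ge> 1" "\<And>p v. N p (piR p v) \<le> C * N p v" using piR_bound by blast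
  have "\<forall>\<^sub>F q in nhds p. norm (Pc c q) \<le> C1 * (C * C1)"
    using C1(2) chart_tendsto(2)[OF filterlim_ident c]
  proof eventually_elim
    case (elim q)
    show ?case
    proof (rule norm_blinfun_bound)
      fix w
      have "norm (Pc c q w) \<le> C1 * N q (piR q (tau_inv c q w))"
        using elim(1)[rule_format, of "Pc c q w"] elim(2) c by (simp add: Pc_apply)
      also have "\<dots> \<le> C1 * (C * (C1 * norm w))"
        using C(2)[of q "tau_inv c q w"] elim(1)[rule_format, of w] C1(1) C(1)
        by (meson mult_left_mono order_trans less_imp_le zero_le_one)
      finally show "norm (Pc c q w) \<le> C1 * (C * C1) * norm w" by (simp add: mult_ac)
    qed (use C1 C in auto)
  qed
  then have bd: "\<forall>\<^sub>F q in nhds p. Pc c q \<in> cball 0 (C1 * (C * C1))" by simp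
  define F0 where "F0 = inf (nhds p) (principal {q. \<not> dist (Pc c q) (Pc c p) < e})"
  have "F0 \<noteq> bot"
    using e(2) by (auto simp: F0_def trivial_limit_def eventually_inf_principal)
  then have "filtermap (Pc c) F0 \<noteq> bot" by (simp add: filtermap_bot_iff)
  moreover have "\<forall>\<^sub>F L in filtermap (Pc c) F0. L \<in> cball 0 (C1 * (C * C1))"
    using bd by (simp add: F0_def eventually_filtermap eventually_inf_principal eventually_mono)
  ultimately obtain L where L: "inf (nhds L) (filtermap (Pc c) F0) \<noteq> bot"
    using compact_cball[of "0 :: 'e \<Rightarrow>\<^sub>L 'e"] unfolding compact_filter by blast
  define F where "F = inf F0 (filtercomap (Pc c) (nhds L))"
  have F: "F \<noteq> bot"
  proof
    assume "F = bot"
    then have "eventually (\<lambda>_. False) F" by simp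
    then obtain P Q where PQ: "eventually P F0" "eventually Q (filtercomap (Pc c) (nhds L))" "\<And>x. P x \<Longrightarrow> Q x \<Longrightarrow> False"
      unfolding F_def eventually_inf by blast
    then obtain Q' where Q': "eventually Q' (nhds L)" "\<And>x. Q' (Pc c x) \<Longrightarrow> Q x"
      unfolding eventually_filtercomap by blast
    have "eventually (\<lambda>l. \<not> Q' l) (filtermap (Pc c) F0)"
      unfolding eventually_filtermap using PQ(1) by eventually_elim (use PQ(3) Q'(2) in blast)
    then have "eventually (\<lambda>_. False) (inf (nhds L) (filtermap (Pc c) F0))"
      unfolding eventually_inf using Q'(1) by blast
    then show False using L by (simp add: trivial_limit_def)
  qed
  have Fp: "F \<le> nhds p" by (simp add: F_def F0_def le_infI1)
  then have id: "((\<lambda>q. q) \<longlongrightarrow> p) F" by (simp add: filterlim_def)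
  have lim: "(Pc c \<longlongrightarrow> L) F"
    unfolding F_def by (meson filterlim_filtercomap filterlim_mono inf.cobounded2 order_refl)
  have "accumulates p (\<lambda>v. tau_inv c p (L (tau c p v)))"
    unfolding accumulates_def
  proof (intro exI[of _ F] conjI allI impI F Fp)
    fix v w assume t: "tends_TM F (\<lambda>q. q) w p v"
    show "tends_TM F (\<lambda>q. q) (\<lambda>q. piR q (w q)) p (tau_inv c p (L (tau c p v)))"
    proof (rule tends_TMI[OF id c])
      have "((\<lambda>q. Pc c q (tau c q (w q))) \<longlongrightarrow> L (tau c p v)) F"
        by (intro blinfun.tendsto lim tends_TMD(2)[OF t c])
      then have "((\<lambda>q. Pc c q (tau c q (w q))) \<longlongrightarrow> tau c p (tau_inv c p (L (tau c p v)))) F" using c by simp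
      then show "((\<lambda>q. tau c q (piR q (w q))) \<longlongrightarrow> tau c p (tau_inv c p (L (tau c p v)))) F"
        by (rule Lim_transform_eventually)
          (use chart_tendsto(2)[OF id c] in eventually_elim, use c in \<open>simp add: Pc_apply\<close>)
    qed
  qed
  from accumulates_eq_piR[OF this] have "tau_inv c p (L (tau c p v)) = piR p v" for v .
  then have "L w = Pc c p w" for w using c by (metis Pc_apply tau_tau_inv)
  then have "L = Pc c p" by (simp add: blinfun_eqI)
  then have "\<forall>\<^sub>F q in F. dist (Pc c q) (Pc c p) < e" using tendstoD[OF lim e(1)] by simp
  moreover have "\<forall>\<^sub>F q in F. \<not> dist (Pc c q) (Pc c p) < e"
    unfolding F_def by (rule filter_leD[OF inf_le1]) (simp add: F0_def eventually_inf_principal)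
  ultimately have "\<forall>\<^sub>F q in F. False" by eventually_elim simp
  then show False using F by (simp add: trivial_limit_def)
qed

lemma Pc_tendsto: "c \<in> A \<Longrightarrow> p \<in> fst c \<Longrightarrow> (q \<longlongrightarrow> p) F \<Longrightarrow> ((\<lambda>i. Pc c (q i)) \<longlongrightarrow> Pc c p) F"
  by (rule filterlim_compose[OF Pc_continuous_nhds])

lemma piR_tendsto:
  assumes t: "tends_TM F q w p v"
  shows "tends_TM F q (\<lambda>i. piR (q i) (w i)) p (piR p v)"
proof (rule tends_TMI[OF _ chart_at])
  let ?c = "chart_at A p"
  show q: "(q \<longlongrightarrow> p) F" using tends_TMD(1)[OF t] .
  have "((\<lambda>i. Pc ?c (q i) (tau ?c (q i) (w i))) \<longlongrightarrow> Pc ?c p (tau ?c p v)) F"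
    by (intro blinfun.tendsto Pc_tendsto chart_at q tends_TMD(2)[OF t])
  then have "((\<lambda>i. Pc ?c (q i) (tau ?c (q i) (w i))) \<longlongrightarrow> tau ?c p (piR p v)) F"
    using Pc_apply[OF chart_at, of p v] tau_inv_tau[OF chart_at, of p v] by simp
  then show "((\<lambda>i. tau ?c (q i) (piR (q i) (w i))) \<longlongrightarrow> tau ?c p (piR p v)) F"
    by (rule Lim_transform_eventually)
      (use chart_tendsto(2)[OF q chart_at] in eventually_elim, simp add: Pc_apply chart_at)
qed

end

section \<open>Uniform estimates in finitely many charts\<close>

lemma ex_pos2I:
  assumes "(0::real) < C" "(0::real) < e" "P C e"
  shows "\<exists>C>0. \<exists>e>0. P C e"
  using assms by blast

text \<open>Quantitative statements refer to finitely many charts. At \<open>x\<close> the chart \<open>cc x\<close> is used; \<open>x\<close> belongs to the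
  compact part \<open>K (cc x)\<close> of its domain, so that constants can be chosen independently of \<open>x\<close>.\<close>

locale dominated_charts = dominated A N f R S E d k
  for A :: "('m::t2_space, 'e::euclidean_space) atlas" and N f R S E d k +
  fixes cc :: "'m \<Rightarrow> ('m, 'e) chart" and K :: "('m, 'e) chart \<Rightarrow> 'm set"
  assumes cc_A: "cc x \<in> A" and cc_finite: "finite (range cc)"
    and K_compact: "compact (K (cc x))" and K_sub: "K (cc x) \<subseteq> fst (cc x)"
    and cc_K: "x \<in> interior (K (cc x))"
begin

lemma cc_in: "x \<in> K (cc x)" "x \<in> fst (cc x)"
  using cc_K interior_subset K_sub by blast+

lemma chart_inj: "c \<in> A \<Longrightarrow> x \<in> fst c \<Longrightarrow> y \<in> fst c \<Longrightarrow> snd c x = snd c y \<Longrightarrow> x = y"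
  by (metis chart_inv_chart)

lemma uniformize_compact:
  assumes c: "c \<in> A" and X: "compact X" "X \<subseteq> fst c"
    and loc: "\<And>p. p \<in> X \<Longrightarrow> \<exists>C. \<forall>\<^sub>F z in nhds p \<times>\<^sub>F nhds p. Q C (fst z) (snd z)"
    and mono: "\<And>C C' x y. Q C x y \<Longrightarrow> C \<le> C' \<Longrightarrow> Q C' x y"
  shows "\<exists>C>0. \<exists>e>0. \<forall>x\<in>X. \<forall>y\<in>fst c. norm (snd c y - snd c x) < e \<longrightarrow> Q (C::real) x y"
proof (cases "X = {}")
  case False
  have "\<exists>C U. open U \<and> p \<in> U \<and> (\<forall>x\<in>U. \<forall>y\<in>U. Q C x y)" if p: "p \<in> X" for p
  proof -
    obtain C P P' where P: "eventually P (nhds p)" "eventually P' (nhds p)"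
      "\<And>x y. P x \<Longrightarrow> P' y \<Longrightarrow> Q C x y"
      using loc[OF p] unfolding eventually_prod_filter fst_conv snd_conv by blast
    from eventually_conj[OF P(1,2)] obtain U where "open U" "p \<in> U" "\<forall>x\<in>U. P x \<and> P' x"
      unfolding eventually_nhds by auto
    then show ?thesis using P(3) by metis
  qed
  then obtain C U where U: "\<And>p. p \<in> X \<Longrightarrow> open (U p)" "\<And>p. p \<in> X \<Longrightarrow> p \<in> U p"
    "\<And>p x y. p \<in> X \<Longrightarrow> x \<in> U p \<Longrightarrow> y \<in> U p \<Longrightarrow> Q (C p) x y"
    by metis
  obtain D where D: "D \<subseteq> X" "finite D" "X \<subseteq> (\<Union>p\<in>D. U p)"
    by (rule compactE_image[OF X(1), of X U]) (use U(1,2) in blast)+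
  have "continuous_on X (snd c)"
    using chart_homeo[OF c] X(2) continuous_on_subset by (auto simp: homeomorphism_def)
  then have cX: "compact (snd c ` X)" using X(1) compact_continuous_image by blast
  have cov: "snd c ` X \<subseteq> \<Union>((\<lambda>p. snd c ` (fst c \<inter> U p)) ` D)"
    using D(3) X(2) by blast
  obtain e where e: "0 < e" "\<And>u. u \<in> snd c ` X \<Longrightarrow> \<exists>B\<in>(\<lambda>p. snd c ` (fst c \<inter> U p)) ` D. ball u e \<subseteq> B"
    by (rule Heine_Borel_lemma[OF cX cov]) (use open_chart_image[OF c U(1)] D(1) in blast)+
  define C0 where "C0 = max 1 (Max (C ` D))"
  show ?thesis
  proof (rule ex_pos2I[of C0 e]; (intro ballI impI)?)
    fix x y assume xy: "x \<in> X" "y \<in> fst c" "norm (snd c y - snd c x) < e"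
    obtain p where p: "p \<in> D" "ball (snd c x) e \<subseteq> snd c ` (fst c \<inter> U p)" using e(2) xy(1) by blast
    have "snd c x \<in> ball (snd c x) e" "snd c y \<in> ball (snd c x) e"
      using e(1) xy(3) by (auto simp: dist_norm norm_minus_commute)
    then have "x \<in> U p" "y \<in> U p"
      using p(2) chart_inj[OF c] xy X(2) by blast+
    then have "Q (C p) x y" using U(3) p(1) D(1) by blast
    moreover have "C p \<le> C0" using D(2) p(1) by (auto simp: C0_def intro: max.coboundedI2)
    ultimately show "Q C0 x y" using mono by blast
  qed (use e(1) in \<open>auto simp: C0_def\<close>)
qed (auto intro: exI[of _ 1])

lemma finite_uniform:
  fixes Q :: "'i \<Rightarrow> real \<Rightarrow> real \<Rightarrow> bool"
  assumes "finite I" "\<And>i. i \<in> I \<Longrightarrow> \<exists>C>0. \<exists>e>0. Q i C e"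
    and mono: "\<And>i C C' e e'. Q i C e \<Longrightarrow> C \<le> C' \<Longrightarrow> e' \<le> e \<Longrightarrow> Q i C' e'"
  shows "\<exists>C>0. \<exists>e>0. \<forall>i\<in>I. Q i C e"
  using assms(1,2)
proof (induction I)
  case (insert i I)
  obtain C e where 1: "C > 0" "e > 0" "\<forall>i\<in>I. Q i C e" using insert by blast
  obtain C' e' where 2: "C' > 0" "e' > 0" "Q i C' e'" using insert.prems[of i] by blast
  show ?case
  proof (rule ex_pos2I[of "max C C'" "min e e'"]; (intro ballI)?)
    fix j assume "j \<in> insert i I"
    then show "Q j (max C C') (min e e')"
      using mono[OF _ max.cobounded1 min.cobounded1] mono[OF 2(3) max.cobounded2 min.cobounded2] 1(3) by blast
  qed (use 1 2 in auto)
qed (auto intro: exI[of _ 1])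

text \<open>From estimates that hold for pairs of points near a given point to estimates for all pairs of
  points at distance less than some \<open>e\<close> in charts, with one constant.\<close>

lemma uniformize:
  fixes Q :: "('m, 'e) chart \<Rightarrow> ('m, 'e) chart \<Rightarrow> real \<Rightarrow> 'm \<Rightarrow> 'm \<Rightarrow> bool"
  assumes \<phi>: "C2 \<phi>"
    and loc: "\<And>c c' p. \<lbrakk>c \<in> A; c' \<in> A; p \<in> fst c; \<phi> p \<in> fst c'\<rbrakk> \<Longrightarrow>
      \<exists>C. \<forall>\<^sub>F z in nhds p \<times>\<^sub>F nhds p. Q c c' C (fst z) (snd z)"
    and mono: "\<And>c c' C C' x y. Q c c' C x y \<Longrightarrow> C \<le> C' \<Longrightarrow> Q c c' C' x y"
  shows "\<exists>C>0. \<exists>e>0. \<forall>c\<in>range cc. \<forall>c'\<in>range cc. \<forall>x\<in>K c. \<phi> x \<in> K c' \<longrightarrow>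
    (\<forall>y\<in>fst c. norm (snd c y - snd c x) < e \<longrightarrow> Q c c' C x y)"
proof -
  have "\<exists>C>0. \<exists>e>0. \<forall>i\<in>range cc \<times> range cc. \<forall>x\<in>K (fst i) \<inter> \<phi> -` K (snd i).
      \<forall>y\<in>fst (fst i). norm (snd (fst i) y - snd (fst i) x) < e \<longrightarrow> Q (fst i) (snd i) C x y"
  proof (rule finite_uniform)
    show "finite (range cc \<times> range cc)" using cc_finite by simp
    fix i assume "i \<in> range cc \<times> range cc"
    then obtain a b where i: "i = (cc a, cc b)" by auto
    have "closed (\<phi> -` K (cc b))"
      using C2_continuous[OF \<phi>] compact_imp_closed[OF K_compact] closed_vimage by blast
    then have X: "compact (K (cc a) \<inter> \<phi> -` K (cc b))" using K_compact compact_Int_closed by blast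
    have "\<exists>C>0. \<exists>e>0. \<forall>x\<in>K (cc a) \<inter> \<phi> -` K (cc b). \<forall>y\<in>fst (cc a).
       norm (snd (cc a) y - snd (cc a) x) < e \<longrightarrow> Q (cc a) (cc b) C x y"
      by (rule uniformize_compact[OF cc_A X _ loc mono]) (use K_sub cc_A in auto)
    then show "\<exists>C>0. \<exists>e>0. \<forall>x\<in>K (fst i) \<inter> \<phi> -` K (snd i). \<forall>y\<in>fst (fst i).
       norm (snd (fst i) y - snd (fst i) x) < e \<longrightarrow> Q (fst i) (snd i) C x y"
      by (simp add: i)
  next
    fix i C C' e and e' :: real
    assume "\<forall>x\<in>K (fst i) \<inter> \<phi> -` K (snd i). \<forall>y\<in>fst (fst i). norm (snd (fst i) y - snd (fst i) x) < e \<longrightarrow> Q (fst i) (snd i) C x y"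
      "C \<le> C'" "e' \<le> e"
    then show "\<forall>x\<in>K (fst i) \<inter> \<phi> -` K (snd i). \<forall>y\<in>fst (fst i). norm (snd (fst i) y - snd (fst i) x) < e' \<longrightarrow> Q (fst i) (snd i) C' x y"
      using mono by (meson order_less_le_trans)
  qed
  then show ?thesis by fastforce
qed

abbreviation cdist :: "'m \<Rightarrow> 'm \<Rightarrow> real" where
  "cdist x y \<equiv> norm (snd (cc x) y - snd (cc x) x)"

lemma uniformize_cc:
  fixes Q :: "('m, 'e) chart \<Rightarrow> ('m, 'e) chart \<Rightarrow> real \<Rightarrow> 'm \<Rightarrow> 'm \<Rightarrow> bool"
  assumes "C2 \<phi>"
    and "\<And>c c' p. \<lbrakk>c \<in> A; c' \<in> A; p \<in> fst c; \<phi> p \<in> fst c'\<rbrakk> \<Longrightarrow>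
      \<exists>C. \<forall>\<^sub>F z in nhds p \<times>\<^sub>F nhds p. Q c c' C (fst z) (snd z)"
    and "\<And>c c' C C' x y. Q c c' C x y \<Longrightarrow> C \<le> C' \<Longrightarrow> Q c c' C' x y"
  shows "\<exists>C>0. \<exists>e>0. \<forall>x y. y \<in> fst (cc x) \<longrightarrow> cdist x y < e \<longrightarrow> Q (cc x) (cc (\<phi> x)) C x y"
proof -
  have "\<exists>C>0. \<exists>e>0. \<forall>c\<in>range cc. \<forall>c'\<in>range cc. \<forall>x\<in>K c. \<phi> x \<in> K c' \<longrightarrow>
    (\<forall>y\<in>fst c. norm (snd c y - snd c x) < e \<longrightarrow> Q c c' C x y)"
    by (rule uniformize[where Q = Q, OF assms(1)]) (use assms(2,3) in blast)+
  then show ?thesis using cc_in by (meson rangeI)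
qed

lemma norm_bounds:
  "\<exists>C>0. \<forall>c\<in>range cc. \<forall>x\<in>K c. \<forall>w. norm w \<le> C * N x (tau_inv c x w) \<and> N x (tau_inv c x w) \<le> C * norm w"
  (is ?A)
  and norm_bounds_near:
  "\<exists>C>0. \<exists>e>0. \<forall>x y. y \<in> fst (cc x) \<longrightarrow> cdist x y < e \<longrightarrow> (\<forall>v. norm (tau (cc x) y v) \<le> C * N y v)"
  (is ?B)
proof -
  define Q where "Q c (c'::('m, 'e) chart) C (x::'m) y \<longleftrightarrow>
    (\<forall>w. norm w \<le> C * N y (tau_inv c y w) \<and> N y (tau_inv c y w) \<le> C * norm w)" for c c' C x y
  have "\<exists>C>0. \<exists>e>0. \<forall>c\<in>range cc. \<forall>c'\<in>range cc. \<forall>x\<in>K c. id x \<in> K c' \<longrightarrow>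
    (\<forall>y\<in>fst c. norm (snd c y - snd c x) < e \<longrightarrow> Q c c' C x y)"
  proof (rule uniformize[where Q = Q, OF C2_id])
    fix c c' p assume "c \<in> A" "p \<in> fst c"
    from N_chart_bounds[OF this] obtain C where "C > 0"
      "\<forall>\<^sub>F y in nhds p. \<forall>w. norm w \<le> C * N y (tau_inv c y w) \<and> N y (tau_inv c y w) \<le> C * norm w" by blast
    then show "\<exists>C. \<forall>\<^sub>F z in nhds p \<times>\<^sub>F nhds p. Q c c' C (fst z) (snd z)"
      unfolding Q_def
      by (intro exI[of _ C] eventually_compose_filterlim[OF _ filterlim_snd])
  next
    fix c c' C C' x y assume Q: "Q c c' C x y" "C \<le> C'"
    show "Q c c' C' x y" unfolding Q_def
    proof (intro allI conjI)
      fix w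
      have "C * N y (tau_inv c y w) \<le> C' * N y (tau_inv c y w)" "C * norm w \<le> C' * norm w"
        using Q(2) by (auto intro!: mult_right_mono)
      then show "norm w \<le> C' * N y (tau_inv c y w)" "N y (tau_inv c y w) \<le> C' * norm w"
        using Q(1)[unfolded Q_def, rule_format, of w] by auto
    qed
  qed
  then obtain C e where C: "C > 0" "e > 0" and *: "\<And>c x y. c \<in> range cc \<Longrightarrow> x \<in> K c \<Longrightarrow> y \<in> fst c \<Longrightarrow>
    norm (snd c y - snd c x) < e \<Longrightarrow> Q c c C x y"
    by (metis id_apply)
  show ?A
  proof (intro exI[of _ C] conjI C(1) ballI)
    fix c x assume "c \<in> range cc" "x \<in> K c"
    then have "Q c c C x x" using *[of c x x] K_sub C(2) by auto
    then show "\<forall>w. norm w \<le> C * N x (tau_inv c x w) \<and> N x (tau_inv c x w) \<le> C * norm w"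
      by (simp add: Q_def)
  qed
  show ?B
  proof (rule ex_pos2I[of C e]; (intro C allI impI)?)
    fix x y v assume "y \<in> fst (cc x)" "cdist x y < e"
    then have "Q (cc x) (cc x) C x y" using *[of "cc x" x y] cc_in by blast
    from this[unfolded Q_def, rule_format, of "tau (cc x) y v"]
    show "norm (tau (cc x) y v) \<le> C * N y v"
      using tau_inv_tau[OF cc_A \<open>y \<in> fst (cc x)\<close>] by simp
  qed
qed

text \<open>Bounded second derivatives make the first derivatives Lipschitz, uniformly in all charts in use.\<close>

lemma rep_Lipschitz:
  assumes "C2 \<phi>"
  shows "\<exists>C>0. \<exists>e>0. \<forall>c\<in>range cc. \<forall>c'\<in>range cc. \<forall>x\<in>K c. \<phi> x \<in> K c' \<longrightarrow>
    (\<forall>y\<in>fst c. norm (snd c y - snd c x) < e \<longrightarrow> \<phi> y \<in> fst c' \<and>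
      norm (snd c' (\<phi> y) - snd c' (\<phi> x)) \<le> C * norm (snd c y - snd c x) \<and>
      norm (D1 (rep \<phi> c c') (snd c y) - D1 (rep \<phi> c c') (snd c x)) \<le> C * norm (snd c y - snd c x) \<and>
      norm (D2 (rep \<phi> c c') (snd c x)) \<le> C)"
proof (rule uniformize[OF assms])
  fix c c' p assume c: "c \<in> A" "c' \<in> A" "p \<in> fst c" "\<phi> p \<in> fst c'"
  let ?F = "rep \<phi> c c'" and ?u = "snd c p"
  have lim: "((\<lambda>q. norm (D2 ?F (snd c q))) \<longlongrightarrow> norm (D2 ?F ?u)) (nhds p)"
    "((\<lambda>q. norm (D1 ?F (snd c q))) \<longlongrightarrow> norm (D1 ?F ?u)) (nhds p)"
    by (intro tendsto_norm rep_D_tendsto assms c filterlim_ident)+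
  define B where "B = max (norm (D2 ?F ?u)) (norm (D1 ?F ?u)) + 1"
  have "\<forall>\<^sub>F q in nhds p. norm (D2 ?F (snd c q)) < B" "\<forall>\<^sub>F q in nhds p. norm (D1 ?F (snd c q)) < B"
    using order_tendstoD(2)[OF lim(1), of B] order_tendstoD(2)[OF lim(2), of B] by (auto simp: B_def)
  moreover have "\<forall>\<^sub>F q in nhds p. q \<in> fst c" "\<forall>\<^sub>F q in nhds p. \<phi> q \<in> fst c'"
    using chart_tendsto(2)[OF filterlim_ident c(1,3)] chart_tendsto(2)[OF C2_tendsto[OF assms filterlim_ident] c(2,4)] by auto
  ultimately have "\<forall>\<^sub>F q in nhds p. norm (D2 ?F (snd c q)) < B \<and> norm (D1 ?F (snd c q)) < B \<and> q \<in> fst c \<and> \<phi> q \<in> fst c'"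
    by eventually_elim simp
  then obtain U where U: "open U" "p \<in> U"
    "\<And>q. q \<in> U \<Longrightarrow> norm (D2 ?F (snd c q)) < B \<and> norm (D1 ?F (snd c q)) < B \<and> q \<in> fst c \<and> \<phi> q \<in> fst c'"
    unfolding eventually_nhds by blast
  have "open (snd c ` (fst c \<inter> U))" "?u \<in> snd c ` (fst c \<inter> U)"
    using open_chart_image c U by auto
  then obtain r where r: "r > 0" "ball ?u r \<subseteq> snd c ` (fst c \<inter> U)" using open_contains_ball by blast
  have ball: "\<exists>q\<in>U. u = snd c q" if "u \<in> ball ?u r" for u using r(2) that by blast
  have L1: "norm (?F u - ?F v) \<le> B * norm (u - v)" if "u \<in> ball ?u r" "v \<in> ball ?u r" for u v
  proof (rule differentiable_bound[OF convex_ball])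
    fix x assume "x \<in> ball ?u r"
    then obtain q where q: "q \<in> U" "x = snd c q" using ball by blast
    show "(?F has_derivative D1 ?F x) (at x within ball ?u r)"
      using has_derivative_at_withinI[OF rep_D1[OF assms c(1,2), of q]] U(3)[OF q(1)] q(2) by simp
    show "onorm (blinfun_apply (D1 ?F x)) \<le> B"
      using U(3)[OF q(1)] q(2) by (simp add: norm_blinfun.rep_eq)
  qed (use that in auto)
  have L2: "norm (D1 ?F u - D1 ?F v) \<le> B * norm (u - v)" if "u \<in> ball ?u r" "v \<in> ball ?u r" for u v
  proof (rule differentiable_bound[OF convex_ball])
    fix x assume "x \<in> ball ?u r"
    then obtain q where q: "q \<in> U" "x = snd c q" using ball by blast
    show "(D1 ?F has_derivative D2 ?F x) (at x within ball ?u r)"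
      using has_derivative_at_withinI[OF rep_D2[OF assms c(1,2), of q]] U(3)[OF q(1)] q(2) by simp
    show "onorm (blinfun_apply (D2 ?F x)) \<le> B"
      using U(3)[OF q(1)] q(2) by (simp add: norm_blinfun.rep_eq)
  qed (use that in auto)
  have "\<forall>\<^sub>F q in nhds p. snd c q \<in> ball ?u r \<and> q \<in> U"
    using eventually_conj[OF topological_tendstoD[OF chart_tendsto(1)[OF filterlim_ident c(1,3)] open_ball, of ?u r]
      eventually_nhds_in_open[OF U(1,2)]] r(1) by simp
  then have "\<forall>\<^sub>F z in nhds p \<times>\<^sub>F nhds p. (snd c (fst z) \<in> ball ?u r \<and> fst z \<in> U) \<and> (snd c (snd z) \<in> ball ?u r \<and> snd z \<in> U)"
    by (intro eventually_conj[OF eventually_compose_filterlim[OF _ filterlim_fst] eventually_compose_filterlim[OF _ filterlim_snd]])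
  then have "\<forall>\<^sub>F z in nhds p \<times>\<^sub>F nhds p. \<phi> (snd z) \<in> fst c' \<and>
      norm (snd c' (\<phi> (snd z)) - snd c' (\<phi> (fst z))) \<le> B * norm (snd c (snd z) - snd c (fst z)) \<and>
      norm (D1 ?F (snd c (snd z)) - D1 ?F (snd c (fst z))) \<le> B * norm (snd c (snd z) - snd c (fst z)) \<and>
      norm (D2 ?F (snd c (fst z))) \<le> B"
  proof eventually_elim
    case (elim z)
    then show ?case
      using L1[of "snd c (snd z)" "snd c (fst z)"] L2[of "snd c (snd z)" "snd c (fst z)"]
        U(3)[of "fst z"] U(3)[of "snd z"] c(1) by auto
  qed
  then show "\<exists>C. \<forall>\<^sub>F z in nhds p \<times>\<^sub>F nhds p. \<phi> (snd z) \<in> fst c' \<and>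
      norm (snd c' (\<phi> (snd z)) - snd c' (\<phi> (fst z))) \<le> C * norm (snd c (snd z) - snd c (fst z)) \<and>
      norm (D1 ?F (snd c (snd z)) - D1 ?F (snd c (fst z))) \<le> C * norm (snd c (snd z) - snd c (fst z)) \<and>
      norm (D2 ?F (snd c (fst z))) \<le> C" by blast
next
  fix c c' C C' x y
  assume *: "\<phi> y \<in> fst c' \<and>
      norm (snd c' (\<phi> y) - snd c' (\<phi> x)) \<le> C * norm (snd c y - snd c x) \<and>
      norm (D1 (rep \<phi> c c') (snd c y) - D1 (rep \<phi> c c') (snd c x)) \<le> C * norm (snd c y - snd c x) \<and>
      norm (D2 (rep \<phi> c c') (snd c x)) \<le> C" and "C \<le> C'"
  then have "C * norm (snd c y - snd c x) \<le> C' * norm (snd c y - snd c x)" by (intro mult_right_mono) auto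
  with * \<open>C \<le> C'\<close> show "\<phi> y \<in> fst c' \<and>
      norm (snd c' (\<phi> y) - snd c' (\<phi> x)) \<le> C' * norm (snd c y - snd c x) \<and>
      norm (D1 (rep \<phi> c c') (snd c y) - D1 (rep \<phi> c c') (snd c x)) \<le> C' * norm (snd c y - snd c x) \<and>
      norm (D2 (rep \<phi> c c') (snd c x)) \<le> C'" by linarith
qed

lemma rep_Lipschitz_cc:
  assumes "C2 \<phi>"
  shows "\<exists>C>0. \<exists>e>0. \<forall>x y. y \<in> fst (cc x) \<longrightarrow> cdist x y < e \<longrightarrow>
     \<phi> y \<in> fst (cc (\<phi> x)) \<and> cdist (\<phi> x) (\<phi> y) \<le> C * cdist x y \<and>
     norm (D1 (rep \<phi> (cc x) (cc (\<phi> x))) (snd (cc x) y) - D1 (rep \<phi> (cc x) (cc (\<phi> x))) (snd (cc x) x)) \<le> C * cdist x y"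
  using rep_Lipschitz[OF assms] cc_in by (meson rangeI)

lemma beta_bound:
  assumes "C2 \<phi>"
  shows "\<exists>C>0. \<forall>c\<in>range cc. \<forall>c'\<in>range cc. \<forall>x\<in>K c. \<phi> x \<in> K c' \<longrightarrow>
    (\<forall>v r. N (\<phi> x) (beta \<phi> c c' x v r) \<le> C * N x v * N x r)"
proof -
  obtain C1 e where C1: "C1 > 0" "e > 0" and L: "\<And>c c' x y. c \<in> range cc \<Longrightarrow> c' \<in> range cc \<Longrightarrow> x \<in> K c \<Longrightarrow> \<phi> x \<in> K c' \<Longrightarrow>
      y \<in> fst c \<Longrightarrow> norm (snd c y - snd c x) < e \<Longrightarrow> norm (D2 (rep \<phi> c c') (snd c x)) \<le> C1"
    using rep_Lipschitz[OF assms] by blast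
  have 1: "norm (D2 (rep \<phi> c c') (snd c x)) \<le> C1"
    if "c \<in> range cc" "c' \<in> range cc" "x \<in> K c" "\<phi> x \<in> K c'" for c c' x
    using L[OF that, of x] that(1,3) C1 K_sub by auto
  obtain C2 where C2: "C2 > 0" "\<And>c x w. c \<in> range cc \<Longrightarrow> x \<in> K c \<Longrightarrow> norm w \<le> C2 * N x (tau_inv c x w) \<and> N x (tau_inv c x w) \<le> C2 * norm w"
    using norm_bounds by blast
  show ?thesis
  proof (intro exI[of _ "C2 * (C1 * C2 * C2)"] conjI ballI allI impI)
    fix c c' x v r assume c: "c \<in> range cc" "c' \<in> range cc" "x \<in> K c" "\<phi> x \<in> K c'"
    then have cA: "c \<in> A" "x \<in> fst c" using cc_A K_sub by auto
    have n: "norm (tau c x u) \<le> C2 * N x u" for u using C2(2)[OF c(1,3), of "tau c x u"] cA by simp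
    have "N (\<phi> x) (beta \<phi> c c' x v r) \<le> C2 * norm (D2 (rep \<phi> c c') (snd c x) (tau c x v) (tau c x r))"
      unfolding beta_def using C2(2)[OF c(2,4)] by blast
    also have "norm (D2 (rep \<phi> c c') (snd c x) (tau c x v) (tau c x r)) \<le> (C1 * (C2 * N x v)) * (C2 * N x r)"
      by (intro order_trans[OF norm_blinfun] mult_mono n 1 c) (use C1 C2 in auto)
    finally show "N (\<phi> x) (beta \<phi> c c' x v r) \<le> C2 * (C1 * C2 * C2) * N x v * N x r"
      using C2(1) by (simp add: mult_ac)
  qed (use C1 C2 in simp)
qed

text \<open>Estimates at nearby points cost a little of the contraction, hence the room between \<open>k\<close> and \<open>k'\<close>.\<close>

definition k' :: real where "k' = (1 + k) / 2"

lemma k': "k < k'" "k' < 1" "0 < k'"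
  using k0 k1 by (auto simp: k'_def)

text \<open>The vector \<open>v \<in> T\<^sub>y\<close> moved to \<open>T\<^sub>x\<close> by means of the chart at \<open>x\<close>.\<close>

definition tr :: "'m \<Rightarrow> 'm \<Rightarrow> 'e \<Rightarrow> 'e" where
  "tr x y v = tau_inv (cc x) x (tau (cc x) y v)"

lemma tr_self [simp]: "tr x x v = v"
  using cc_A cc_in by (simp add: tr_def)

lemma homogeneous_uniform_pair:
  fixes G :: "'m \<Rightarrow> 'e \<Rightarrow> real"
  assumes c: "c \<in> A" "p \<in> fst c" and e: "0 < e"
    and cont: "\<And>q w v. tends_TM (nhds p \<times>\<^sub>F nhds (v::'e)) q w p (tau_inv c p v) \<Longrightarrow>
       ((\<lambda>i. G (q i) (w i)) \<longlongrightarrow> G p (tau_inv c p v)) (nhds p \<times>\<^sub>F nhds v)"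
    and hom: "\<And>q a w. G q (a *\<^sub>R w) = \<bar>a\<bar> * G q w"
  shows "\<forall>\<^sub>F z in nhds p \<times>\<^sub>F nhds p. \<forall>w. \<bar>G (fst z) (tau_inv c (fst z) w) - G (snd z) (tau_inv c (snd z) w)\<bar> \<le> e * norm w"
proof -
  have *: "\<forall>\<^sub>F q in nhds p. \<forall>w. \<bar>G q (tau_inv c q w) - G p (tau_inv c p w)\<bar> \<le> (e / 2) * norm w"
    by (rule homogeneous_uniform[where G = G, OF c]) (use e in simp, erule cont, rule hom)
  have "\<forall>\<^sub>F z in nhds p \<times>\<^sub>F nhds p.
      (\<forall>w. \<bar>G (fst z) (tau_inv c (fst z) w) - G p (tau_inv c p w)\<bar> \<le> (e / 2) * norm w) \<and>
      (\<forall>w. \<bar>G (snd z) (tau_inv c (snd z) w) - G p (tau_inv c p w)\<bar> \<le> (e / 2) * norm w)"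
    by (intro eventually_conj[OF eventually_compose_filterlim[OF * filterlim_fst] eventually_compose_filterlim[OF * filterlim_snd]])
  then show ?thesis
  proof eventually_elim
    case (elim z)
    show ?case
    proof
      fix w :: 'e
      have "(e / 2) * norm w + (e / 2) * norm w = e * norm w" by simp
      then show "\<bar>G (fst z) (tau_inv c (fst z) w) - G (snd z) (tau_inv c (snd z) w)\<bar> \<le> e * norm w"
        using elim[THEN conjunct1, rule_format, of w] elim[THEN conjunct2, rule_format, of w] by linarith
    qed
  qed
qed

lemma block_norms_close:
  assumes c: "c \<in> A" "p \<in> fst c" and e: "0 < e"
  shows "\<forall>\<^sub>F z in nhds p \<times>\<^sub>F nhds p. \<forall>w.
     \<bar>N (fst z) (piR (fst z) (tau_inv c (fst z) w)) - N (snd z) (piR (snd z) (tau_inv c (snd z) w))\<bar> \<le> e * norm w \<and>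
     \<bar>N (fst z) (tau_inv c (fst z) w - piR (fst z) (tau_inv c (fst z) w)) - N (snd z) (tau_inv c (snd z) w - piR (snd z) (tau_inv c (snd z) w))\<bar> \<le> e * norm w \<and>
     \<bar>N (f (fst z)) (T f (fst z) (piR (fst z) (tau_inv c (fst z) w))) - N (f (snd z)) (T f (snd z) (piR (snd z) (tau_inv c (snd z) w)))\<bar> \<le> e * norm w \<and>
     \<bar>N (f (fst z)) (T f (fst z) (tau_inv c (fst z) w - piR (fst z) (tau_inv c (fst z) w))) - N (f (snd z)) (T f (snd z) (tau_inv c (snd z) w - piR (snd z) (tau_inv c (snd z) w)))\<bar> \<le> e * norm w"
proof -
  have Q: "tends_TM F q (\<lambda>i. w i - piR (q i) (w i)) p (v - piR p v)" if "tends_TM F q w p v"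
    for F :: "('m \<times> 'e) filter" and q w v
    by (rule tends_TM_diff[OF that piR_tendsto[OF that]])
  have h: "a *\<^sub>R w - piR q (a *\<^sub>R w) = a *\<^sub>R (w - piR q w)" for a q w
    by (simp add: piR_simps scaleR_diff_right)
  have "\<forall>\<^sub>F z in nhds p \<times>\<^sub>F nhds p. \<forall>w. \<bar>N (fst z) (piR (fst z) (tau_inv c (fst z) w)) - N (snd z) (piR (snd z) (tau_inv c (snd z) w))\<bar> \<le> e * norm w"
    by (rule homogeneous_uniform_pair[where G = "\<lambda>q v. N q (piR q v)", OF c e])
      (erule N_cont[OF piR_tendsto], simp add: piR_simps)
  moreover have "\<forall>\<^sub>F z in nhds p \<times>\<^sub>F nhds p. \<forall>w. \<bar>N (fst z) (tau_inv c (fst z) w - piR (fst z) (tau_inv c (fst z) w)) - N (snd z) (tau_inv c (snd z) w - piR (snd z) (tau_inv c (snd z) w))\<bar> \<le> e * norm w"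
    by (rule homogeneous_uniform_pair[where G = "\<lambda>q v. N q (v - piR q v)", OF c e])
      (erule N_cont[OF Q], simp only: h N_scale)
  moreover have "\<forall>\<^sub>F z in nhds p \<times>\<^sub>F nhds p. \<forall>w. \<bar>N (f (fst z)) (T f (fst z) (piR (fst z) (tau_inv c (fst z) w))) - N (f (snd z)) (T f (snd z) (piR (snd z) (tau_inv c (snd z) w)))\<bar> \<le> e * norm w"
    by (rule homogeneous_uniform_pair[where G = "\<lambda>q v. N (f q) (T f q (piR q v))", OF c e])
      (erule N_T_cont[OF C2_f piR_tendsto], simp add: piR_simps T_simps[OF C2_f])
  moreover have "\<forall>\<^sub>F z in nhds p \<times>\<^sub>F nhds p. \<forall>w. \<bar>N (f (fst z)) (T f (fst z) (tau_inv c (fst z) w - piR (fst z) (tau_inv c (fst z) w))) - N (f (snd z)) (T f (snd z) (tau_inv c (snd z) w - piR (snd z) (tau_inv c (snd z) w)))\<bar> \<le> e * norm w"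
    by (rule homogeneous_uniform_pair[where G = "\<lambda>q v. N (f q) (T f q (v - piR q v))", OF c e])
      (erule N_T_cont[OF C2_f Q], simp only: h N_scale T_simps(3)[OF C2_f])
  ultimately show ?thesis by eventually_elim blast
qed

text \<open>\<open>slope x y a\<close>: seen in the chart at \<open>x\<close>, the plane \<open>R y\<close> lies in the cone of slope \<open>a\<close> about \<open>R x\<close>.
  The smallest such \<open>a\<close> is the distance from \<open>R x\<close> to \<open>R y\<close>.\<close>

definition slope :: "'m \<Rightarrow> 'm \<Rightarrow> real \<Rightarrow> bool" where
  "slope x y a \<longleftrightarrow> (\<forall>r\<in>R y. N x (tr x y r - piR x (tr x y r)) \<le> a * N x (piR x (tr x y r)))"

lemma slope_mono: "slope x y a \<Longrightarrow> a \<le> b \<Longrightarrow> slope x y b"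
  unfolding slope_def by (meson N_nonneg mult_right_mono order_trans)

lemma slope_near: "\<exists>e>0. \<forall>x y. y \<in> fst (cc x) \<longrightarrow> cdist x y < e \<longrightarrow> slope x y 1"
proof -
  have "\<exists>C>(0::real). \<exists>e>0. \<forall>x y. y \<in> fst (cc x) \<longrightarrow> cdist x y < e \<longrightarrow>
      (\<forall>r\<in>R y. N x (tau_inv (cc x) x (tau (cc x) y r) - piR x (tau_inv (cc x) x (tau (cc x) y r)))
        \<le> N x (piR x (tau_inv (cc x) x (tau (cc x) y r))))"
  proof (rule uniformize_cc[OF C2_id, where Q = "\<lambda>c c' C x y. \<forall>r\<in>R y. N x (tau_inv c x (tau c y r) - piR x (tau_inv c x (tau c y r)))
        \<le> N x (piR x (tau_inv c x (tau c y r)))"])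
    fix c c' p assume c: "c \<in> A" "p \<in> fst c"
    obtain C where C: "C > 0" "\<forall>\<^sub>F y in nhds p. \<forall>w. norm w \<le> C * N y (tau_inv c y w) \<and> N y (tau_inv c y w) \<le> C * norm w"
      using N_chart_bounds[OF c] by blast
    define e where "e = 1 / (2 * C)"
    have e: "e > 0" using C by (simp add: e_def)
    have "\<forall>\<^sub>F z in nhds p \<times>\<^sub>F nhds p. \<forall>r\<in>R (snd z). N (fst z) (tau_inv c (fst z) (tau c (snd z) r) - piR (fst z) (tau_inv c (fst z) (tau c (snd z) r)))
        \<le> N (fst z) (piR (fst z) (tau_inv c (fst z) (tau c (snd z) r)))"
      using block_norms_close[OF c e] eventually_compose_filterlim[OF C(2) filterlim_snd, of "nhds p"]
        eventually_compose_filterlim[OF chart_tendsto(2)[OF filterlim_ident c] filterlim_snd, of "nhds p"]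
    proof eventually_elim
      case (elim z)
      show ?case
      proof
        fix r assume r: "r \<in> R (snd z)"
        let ?w = "tau c (snd z) r"
        have id: "tau_inv c (snd z) ?w = r" using c elim(3) by simp
        have "norm ?w \<le> C * N (snd z) r" using elim(2)[rule_format, of ?w] id by simp
        then have "2 * (e * norm ?w) \<le> N (snd z) r" using C(1) by (simp add: e_def field_simps)
        then show "N (fst z) (tau_inv c (fst z) ?w - piR (fst z) (tau_inv c (fst z) ?w))
          \<le> N (fst z) (piR (fst z) (tau_inv c (fst z) ?w))"
          using elim(1)[rule_format, of ?w] r id by (auto simp: abs_le_iff)
      qed
    qed
    then show "\<exists>C. \<forall>\<^sub>F z in nhds p \<times>\<^sub>F nhds p. \<forall>r\<in>R (snd z). N (fst z) (tau_inv c (fst z) (tau c (snd z) r) - piR (fst z) (tau_inv c (fst z) (tau c (snd z) r)))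
        \<le> N (fst z) (piR (fst z) (tau_inv c (fst z) (tau c (snd z) r)))" by blast
  qed
  then show ?thesis unfolding slope_def tr_def by auto
qed

text \<open>The bunching condition survives if the vector of \<open>E\<close> is taken at a nearby point. The values of the functions involved
  depend continuously on the point because \<open>R\<close> and \<open>S\<close> do; \<open>E\<close> is compared with itself at \<open>y\<close>, where the
  original condition is available.\<close>

lemma bunching_near: "\<exists>e>0. \<forall>x y. y \<in> fst (cc x) \<longrightarrow> cdist x y < e \<longrightarrow>
    (\<forall>r\<in>R x. \<forall>s\<in>S x. \<forall>v\<in>E y. N (f x) (T f x s) * N x r * N y v \<le> k' * N x s * N (f x) (T f x r) * N (f y) (T f y v))"
proof -
  obtain C0 where C0: "C0 \<ge> 1" "\<And>p v. N p v \<le> C0 * N (f p) (T f p v)"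
    using T_f_bound by blast
  have "\<exists>C>(0::real). \<exists>e>0. \<forall>x y. y \<in> fst (cc x) \<longrightarrow> cdist x y < e \<longrightarrow>
      (\<forall>r\<in>R x. \<forall>s\<in>S x. \<forall>v\<in>E y. N (f x) (T f x s) * N x r * N y v \<le> k' * N x s * N (f x) (T f x r) * N (f y) (T f y v))"
  proof (rule uniformize_cc[OF C2_id, where Q = "\<lambda>c c' C x y. \<forall>r\<in>R x. \<forall>s\<in>S x. \<forall>v\<in>E y.
        N (f x) (T f x s) * N x r * N y v \<le> k' * N x s * N (f x) (T f x r) * N (f y) (T f y v)"])
    fix c c' p assume c: "c \<in> A" "p \<in> fst c"
    obtain C where C: "C > 0" "\<forall>\<^sub>F y in nhds p. \<forall>w. norm w \<le> C * N y (tau_inv c y w) \<and> N y (tau_inv c y w) \<le> C * norm w"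
      using N_chart_bounds[OF c] by blast
    (* chosen so that k (1 + t)^2 <= k' (1 - t)^2 *)
    define t where "t = (1 - k) / 10"
    have t: "0 < t" "t < 1" "k * (1 + t)^2 \<le> k' * (1 - t)^2"
    proof -
      show "0 < t" "t < 1" using k0 k1 by (auto simp: t_def)
      have k: "k = 1 - 10 * t" by (simp add: t_def field_simps)
      show "k * (1 + t)^2 \<le> k' * (1 - t)^2"
      proof -
        have "(1 + t)^2 \<le> 1 + 3 * t" using \<open>0 < t\<close> \<open>t < 1\<close> by (simp add: power2_eq_square algebra_simps)
        then have "k * (1 + t)^2 \<le> k * (1 + 3 * t)" using k0 by simp
        also have "\<dots> \<le> k' * (1 - 2 * t)"
        proof -
          have "k' = 1 - 5 * t" by (simp add: k'_def t_def field_simps)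
          moreover have "(1 - 10 * t) * (1 + 3 * t) \<le> (1 - 5 * t) * (1 - 2 * t)"
            using \<open>0 < t\<close> by (simp add: algebra_simps)
          ultimately show ?thesis using k by metis
        qed
        also have "\<dots> \<le> k' * (1 - t)^2"
          using k'(3) by (intro mult_left_mono) (auto simp: power2_eq_square algebra_simps)
        finally show ?thesis .
      qed
    qed
    define e where "e = t / (C * C0)"
    have e: "e > 0" using C C0 t by (simp add: e_def)
    have "\<forall>\<^sub>F z in nhds p \<times>\<^sub>F nhds p. \<forall>r\<in>R (fst z). \<forall>s\<in>S (fst z). \<forall>v\<in>E (snd z).
        N (f (fst z)) (T f (fst z) s) * N (fst z) r * N (snd z) v \<le> k' * N (fst z) s * N (f (fst z)) (T f (fst z) r) * N (f (snd z)) (T f (snd z) v)"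
      using block_norms_close[OF c e] eventually_compose_filterlim[OF C(2) filterlim_fst, of "nhds p"]
        eventually_compose_filterlim[OF chart_tendsto(2)[OF filterlim_ident c] filterlim_fst, of "nhds p"]
    proof eventually_elim
      case (elim z)
      obtain x y where z: "z = (x, y)" by fastforce
      show ?case unfolding z fst_conv snd_conv
      proof (intro ballI)
        fix r s v assume rsv: "r \<in> R x" "s \<in> S x" "v \<in> E y"
        define r' where "r' = piR y (tau_inv c y (tau c x r))"
        define s' where "s' = tau_inv c y (tau c x s) - piR y (tau_inv c y (tau c x s))"
        have id: "tau_inv c x (tau c x u) = u" for u using c elim(3) z by simp
        have en: "e * norm (tau c x u) \<le> t * N x u" "e * norm (tau c x u) \<le> t * N (f x) (T f x u)" for u
        proof -
          have "norm (tau c x u) \<le> C * N x u" using elim(2)[rule_format, of "tau c x u"] id z by simp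
          then have 1: "e * norm (tau c x u) \<le> t / C0 * N x u" using C(1) t C0(1) by (simp add: e_def field_simps)
          have "t / C0 * N x u \<le> t / 1 * N x u" using t C0(1) by (intro mult_right_mono divide_left_mono) auto
          with 1 show "e * norm (tau c x u) \<le> t * N x u" by simp
          have "t / C0 * N x u \<le> t / C0 * (C0 * N (f x) (T f x u))" using t C0 by (intro mult_left_mono) auto
          with 1 show "e * norm (tau c x u) \<le> t * N (f x) (T f x u)" using C0(1) by simp
        qed
        note B = elim(1)[unfolded z fst_conv snd_conv, rule_format]
        have 1: "(1 - t) * N x r \<le> N y r'" "N (f y) (T f y r') \<le> (1 + t) * N (f x) (T f x r)"
          using B[of "tau c x r"] en[of r] rsv(1) by (auto simp: id r'_def[symmetric] algebra_simps abs_le_iff)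
        have 2: "(1 - t) * N (f x) (T f x s) \<le> N (f y) (T f y s')" "N y s' \<le> (1 + t) * N x s"
          using B[of "tau c x s"] en[of s] rsv(2) by (auto simp: id s'_def[symmetric] algebra_simps abs_le_iff)
        have "((1 - t) * N (f x) (T f x s)) * ((1 - t) * N x r) * N y v \<le> N (f y) (T f y s') * N y r' * N y v"
          using 1 2 t by (intro mult_right_mono mult_mono) auto
        also have "\<dots> \<le> k * N y s' * N (f y) (T f y r') * N (f y) (T f y v)"
          by (rule bunching) (use rsv in \<open>auto simp: r'_def s'_def\<close>)
        also have "\<dots> \<le> k * ((1 + t) * N x s) * ((1 + t) * N (f x) (T f x r)) * N (f y) (T f y v)"
          using 1 2 t k0 by (intro mult_right_mono mult_mono mult_left_mono) auto
        also have "\<dots> = k * (1 + t)^2 * (N x s * N (f x) (T f x r) * N (f y) (T f y v))"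
          by (simp add: power2_eq_square)
        also have "\<dots> \<le> k' * (1 - t)^2 * (N x s * N (f x) (T f x r) * N (f y) (T f y v))"
          by (intro mult_right_mono t) auto
        finally have "(1 - t)^2 * (N (f x) (T f x s) * N x r * N y v) \<le> (1 - t)^2 * (k' * N x s * N (f x) (T f x r) * N (f y) (T f y v))"
          by (simp add: power2_eq_square mult_ac)
        moreover have "0 < (1 - t)^2" using t by simp
        ultimately show "N (f x) (T f x s) * N x r * N y v \<le> k' * N x s * N (f x) (T f x r) * N (f y) (T f y v)"
          by (simp only: mult_le_cancel_left_pos)
      qed
    qed
    then show "\<exists>C. \<forall>\<^sub>F z in nhds p \<times>\<^sub>F nhds p. \<forall>r\<in>R (fst z). \<forall>s\<in>S (fst z). \<forall>v\<in>E (snd z).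
        N (f (fst z)) (T f (fst z) s) * N (fst z) r * N (snd z) v \<le> k' * N (fst z) s * N (f (fst z)) (T f (fst z) r) * N (f (snd z)) (T f (snd z) v)" by blast
  qed
  then show ?thesis by blast
qed

end

section \<open>\<open>R\<close> is Lipschitz along arcs tangent to \<open>E\<close>\<close>

context dominated_charts
begin

text \<open>Arcs tangent to \<open>E\<close> with velocity \<open>w\<close>, described in all charts rather than the preferred ones. The domain is
  arbitrary in order to allow for segments \<open>closed_segment s t\<close> without an orientation.\<close>

definition E_arc :: "real set \<Rightarrow> (real \<Rightarrow> 'm) \<Rightarrow> (real \<Rightarrow> 'e) \<Rightarrow> bool" where
  "E_arc I \<gamma> w \<longleftrightarrow> (\<forall>t\<in>I. w t \<in> E (\<gamma> t) \<and> tends_TM (at t within I) \<gamma> w (\<gamma> t) (w t) \<and>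
     (\<forall>c\<in>A. \<gamma> t \<in> fst c \<longrightarrow>
        ((\<lambda>s. snd c (\<gamma> s)) has_vector_derivative tau c (\<gamma> t) (w t)) (at t within I)))"

lemma E_arcD:
  assumes "E_arc I \<gamma> w" "t \<in> I"
  shows "w t \<in> E (\<gamma> t)" "tends_TM (at t within I) \<gamma> w (\<gamma> t) (w t)" "(\<gamma> \<longlongrightarrow> \<gamma> t) (at t within I)"
    and "c \<in> A \<Longrightarrow> \<gamma> t \<in> fst c \<Longrightarrow> ((\<lambda>s. snd c (\<gamma> s)) has_vector_derivative tau c (\<gamma> t) (w t)) (at t within I)"
proof -
  show "w t \<in> E (\<gamma> t)" and t: "tends_TM (at t within I) \<gamma> w (\<gamma> t) (w t)"
    and "c \<in> A \<Longrightarrow> \<gamma> t \<in> fst c \<Longrightarrow> ((\<lambda>s. snd c (\<gamma> s)) has_vector_derivative tau c (\<gamma> t) (w t)) (at t within I)"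
    using assms by (auto simp: E_arc_def)
  show "(\<gamma> \<longlongrightarrow> \<gamma> t) (at t within I)" by (rule tends_TMD(1)[OF t])
qed

lemma tends_TM_mono: "tends_TM F q w p v \<Longrightarrow> F' \<le> F \<Longrightarrow> tends_TM F' q w p v"
  unfolding tends_TM_def by (blast intro: tendsto_mono)

lemma E_arc_subset: "E_arc I \<gamma> w \<Longrightarrow> J \<subseteq> I \<Longrightarrow> E_arc J \<gamma> w"
  unfolding E_arc_def
  by (blast intro: tends_TM_mono[OF _ at_le] has_vector_derivative_within_subset)

lemma chart_vector_derivative:
  assumes "C2 \<phi>" "c \<in> A" "c' \<in> A" "\<gamma> t \<in> fst c" "\<phi> (\<gamma> t) \<in> fst c'" "t \<in> I"
    and lim: "(\<gamma> \<longlongrightarrow> \<gamma> t) (at t within I)"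
    and der: "((\<lambda>s. snd c (\<gamma> s)) has_vector_derivative tau c (\<gamma> t) v) (at t within I)"
  shows "((\<lambda>s. snd c' (\<phi> (\<gamma> s))) has_vector_derivative tau c' (\<phi> (\<gamma> t)) (T \<phi> (\<gamma> t) v)) (at t within I)"
proof -
  have "(rep \<phi> c c' has_derivative D1 (rep \<phi> c c') (snd c (\<gamma> t))) (at (snd c (\<gamma> t)) within (\<lambda>s. snd c (\<gamma> s)) ` I)"
    using rep_D1[OF assms(1-5)] has_derivative_at_withinI by blast
  from vector_derivative_diff_chain_within[OF der this]
  have "((\<lambda>s. rep \<phi> c c' (snd c (\<gamma> s))) has_vector_derivative tau c' (\<phi> (\<gamma> t)) (T \<phi> (\<gamma> t) v)) (at t within I)"
    using tau_natural[OF assms(1-5), of v] by (simp add: comp_def)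
  then show ?thesis unfolding has_vector_derivative_def
  proof (rule has_derivative_transform_eventually)
    show "\<forall>\<^sub>F s in at t within I. rep \<phi> c c' (snd c (\<gamma> s)) = snd c' (\<phi> (\<gamma> s))"
      using chart_tendsto(2)[OF lim assms(2,4)] by eventually_elim (use assms in simp)
  qed (use assms in auto)
qed

text \<open>Everything below follows an arc backwards along the orbit of \<open>f\<close>.\<close>

lemma E_arc_back: "E_arc I \<gamma> w \<Longrightarrow> E_arc I (\<lambda>t. g (\<gamma> t)) (\<lambda>t. T g (\<gamma> t) (w t))"
  unfolding E_arc_def[of _ "\<lambda>t. g (\<gamma> t)"]
proof (intro ballI conjI impI)
  fix t assume a: "E_arc I \<gamma> w" "t \<in> I"
  show "T g (\<gamma> t) (w t) \<in> E (g (\<gamma> t))" using E_arcD(1)[OF a] E_Tg by blast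
  show "tends_TM (at t within I) (\<lambda>t. g (\<gamma> t)) (\<lambda>t. T g (\<gamma> t) (w t)) (g (\<gamma> t)) (T g (\<gamma> t) (w t))"
    using tends_TM_T[OF E_arcD(2)[OF a] C2_g] .
  fix c assume "c \<in> A" "g (\<gamma> t) \<in> fst c"
  then show "((\<lambda>s. snd c (g (\<gamma> s))) has_vector_derivative tau c (g (\<gamma> t)) (T g (\<gamma> t) (w t))) (at t within I)"
    using chart_vector_derivative[OF C2_g chart_at(1) _ chart_at(2) _ a(2) E_arcD(3)[OF a]
        E_arcD(4)[OF a chart_at]] by blast
qed

text \<open>The mean value inequality in the chart at the initial point.\<close>

lemma arc_cdist:
  "\<exists>C>0. \<exists>e>0. \<forall>\<gamma> w s t b. E_arc (closed_segment s t) \<gamma> w \<longrightarrow>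
     (\<forall>\<tau>\<in>closed_segment s t. N (\<gamma> \<tau>) (w \<tau>) \<le> b \<and> \<gamma> \<tau> \<in> fst (cc (\<gamma> s)) \<and> cdist (\<gamma> s) (\<gamma> \<tau>) < e) \<longrightarrow>
     (\<forall>\<tau>\<in>closed_segment s t. cdist (\<gamma> s) (\<gamma> \<tau>) \<le> C * b * \<bar>\<tau> - s\<bar>)"
proof -
  obtain C e where C: "C > 0" "e > 0"
    and *: "\<And>x y v. y \<in> fst (cc x) \<Longrightarrow> cdist x y < e \<Longrightarrow> norm (tau (cc x) y v) \<le> C * N y v"
    using norm_bounds_near by blast
  show ?thesis
  proof (rule ex_pos2I[of C e]; (intro C allI impI ballI)?)
    fix \<gamma> w and s t b \<tau> :: real
    let ?I = "closed_segment s t" and ?c = "cc (\<gamma> s)"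
    assume a: "E_arc ?I \<gamma> w" and \<tau>: "\<tau> \<in> ?I"
      and b: "\<forall>\<tau>\<in>?I. N (\<gamma> \<tau>) (w \<tau>) \<le> b \<and> \<gamma> \<tau> \<in> fst ?c \<and> cdist (\<gamma> s) (\<gamma> \<tau>) < e"
    have "norm (snd ?c (\<gamma> \<tau>) - snd ?c (\<gamma> s)) \<le> (C * b) * norm (\<tau> - s)"
    proof (rule differentiable_bound[OF convex_closed_segment])
      fix x assume x: "x \<in> ?I"
      show "((\<lambda>x. snd ?c (\<gamma> x)) has_derivative (\<lambda>h. h *\<^sub>R tau ?c (\<gamma> x) (w x))) (at x within ?I)"
        using E_arcD(4)[OF a x cc_A] b x by (simp add: has_vector_derivative_def)
      have n: "norm (tau ?c (\<gamma> x) (w x)) \<le> C * b"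
        using *[of "\<gamma> x" "\<gamma> s" "w x"] b x C(1) by (meson mult_left_mono order_trans less_imp_le)
      show "onorm (\<lambda>h. h *\<^sub>R tau ?c (\<gamma> x) (w x)) \<le> C * b"
      proof (rule onorm_le)
        fix h :: real
        show "norm (h *\<^sub>R tau ?c (\<gamma> x) (w x)) \<le> C * b * norm h"
          using mult_left_mono[OF n, of "\<bar>h\<bar>"] by (simp add: mult.commute)
      qed
    qed (use \<tau> in auto)
    then show "cdist (\<gamma> s) (\<gamma> \<tau>) \<le> C * b * \<bar>\<tau> - s\<bar>" by simp
  qed
qed

text \<open>Transport in charts commutes with \<open>Tf\<close> only up to the variation of the derivative of \<open>f\<close>.\<close>

lemma tr_T_error:
  "\<exists>C>0. \<exists>e>0. \<forall>x y. y \<in> fst (cc x) \<longrightarrow> cdist x y < e \<longrightarrow> f y \<in> fst (cc (f x)) \<and>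
     (\<forall>v. N (f x) (tr (f x) (f y) (T f y v) - T f x (tr x y v)) \<le> C * cdist x y * N x (tr x y v))"
proof -
  obtain C1 e where C1: "C1 > 0" "e > 0" and 1: "\<And>x y. y \<in> fst (cc x) \<Longrightarrow> cdist x y < e \<Longrightarrow>
     f y \<in> fst (cc (f x)) \<and>
     norm (D1 (rep f (cc x) (cc (f x))) (snd (cc x) y) - D1 (rep f (cc x) (cc (f x))) (snd (cc x) x)) \<le> C1 * cdist x y"
    using rep_Lipschitz_cc[OF C2_f] by blast
  obtain C2 where C2: "C2 > 0" "\<And>c x w. c \<in> range cc \<Longrightarrow> x \<in> K c \<Longrightarrow> norm w \<le> C2 * N x (tau_inv c x w) \<and> N x (tau_inv c x w) \<le> C2 * norm w"
    using norm_bounds by blast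
  show ?thesis
  proof (rule ex_pos2I[of "C2 * C1 * C2" e]; (intro allI impI conjI)?)
    fix x y v assume xy: "y \<in> fst (cc x)" "cdist x y < e"
    then show fy: "f y \<in> fst (cc (f x))" using 1 by blast
    let ?w = "tau (cc x) y v"
    let ?D = "\<lambda>z. D1 (rep f (cc x) (cc (f x))) (snd (cc x) z)"
    have a: "tau (cc (f x)) (f y) (T f y v) = ?D y ?w"
      by (rule tau_natural[OF C2_f cc_A cc_A xy(1) fy])
    have "tau (cc (f x)) (f x) (T f x (tr x y v)) = ?D x ?w"
      using tau_natural[OF C2_f cc_A cc_A cc_in(2) cc_in(2), of x "tr x y v"] cc_A cc_in by (simp add: tr_def)
    then have "T f x (tr x y v) = tau_inv (cc (f x)) (f x) (?D x ?w)"
      using cc_A cc_in by (metis tau_inv_tau)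
    then have "tr (f x) (f y) (T f y v) - T f x (tr x y v) = tau_inv (cc (f x)) (f x) ((?D y - ?D x) ?w)"
      unfolding tr_def[of "f x"] a by (simp add: tau_inv_simps blinfun.diff_left)
    then have "N (f x) (tr (f x) (f y) (T f y v) - T f x (tr x y v)) \<le> C2 * norm ((?D y - ?D x) ?w)"
      using C2(2)[of "cc (f x)" "f x"] cc_in by auto
    also have "norm ((?D y - ?D x) ?w) \<le> (C1 * cdist x y) * (C2 * N x (tr x y v))"
    proof (intro order_trans[OF norm_blinfun] mult_mono)
      show "norm (?D y - ?D x) \<le> C1 * cdist x y" using 1[OF xy] by blast
      show "norm ?w \<le> C2 * N x (tr x y v)"
        using C2(2)[of "cc x" x ?w] cc_in by (auto simp: tr_def)
    qed (use C1 in auto)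
    finally show "N (f x) (tr (f x) (f y) (T f y v) - T f x (tr x y v)) \<le> C2 * C1 * C2 * cdist x y * N x (tr x y v)"
      using C2(1) by (simp add: mult_ac)
  qed (use C1 C2 in auto)
qed

definition contracts :: "'m \<Rightarrow> real \<Rightarrow> bool" where
  "contracts x \<kappa> \<longleftrightarrow> (\<forall>r\<in>R x. \<forall>s\<in>S x. N (f x) (T f x s) * N x r \<le> \<kappa> * N x s * N (f x) (T f x r))"

lemma contractsD: "contracts x \<kappa> \<Longrightarrow> r \<in> R x \<Longrightarrow> s \<in> S x \<Longrightarrow> N (f x) (T f x s) * N x r \<le> \<kappa> * N x s * N (f x) (T f x r)"
  by (auto simp: contracts_def)

text \<open>\<open>\<kappa>\<close> is the quotient of the norm on \<open>S\<close> and the conorm on \<open>R\<close>. It depends on \<open>x\<close>: what bunching bounds is the product of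
  \<open>\<kappa>\<close> and the rate at which preimages of vectors of \<open>E\<close> are lengthened.\<close>

lemma contraction_rate:
  "\<exists>e>0. \<forall>x. \<exists>\<kappa>\<ge>0. \<kappa> \<le> k' \<and> contracts x \<kappa> \<and>
     (\<forall>y v. y \<in> fst (cc x) \<longrightarrow> cdist x y < e \<longrightarrow> v \<in> E y \<longrightarrow> \<kappa> * N y v \<le> k' * N (f y) (T f y v))"
proof -
  obtain e where e: "e > 0" and *: "\<And>x y r s v. y \<in> fst (cc x) \<Longrightarrow> cdist x y < e \<Longrightarrow> r \<in> R x \<Longrightarrow> s \<in> S x \<Longrightarrow> v \<in> E y \<Longrightarrow>
    N (f x) (T f x s) * N x r * N y v \<le> k' * N x s * N (f x) (T f x r) * N (f y) (T f y v)"
    using bunching_near by blast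
  have "\<exists>\<kappa>\<ge>0. \<kappa> \<le> k' \<and> contracts x \<kappa> \<and>
     (\<forall>y v. y \<in> fst (cc x) \<longrightarrow> cdist x y < e \<longrightarrow> v \<in> E y \<longrightarrow> \<kappa> * N y v \<le> k' * N (f y) (T f y v))" for x
  proof -
    let ?q = "\<lambda>r s. N (f x) (T f x s) * N x r / (N x s * N (f x) (T f x r))"
    define Z where "Z = insert 0 {?q r s | r s. r \<in> R x - {0} \<and> s \<in> S x - {0}}"
    have pos: "0 < N x s * N (f x) (T f x r)" if "r \<in> R x - {0}" "s \<in> S x - {0}" for r s
      using that by (auto intro!: mult_pos_pos N_pos)
    have le: "z \<le> k" if "z \<in> Z" for z
      using that pos domination k0 by (auto simp: Z_def divide_le_eq mult_ac)
    have bdd: "bdd_above Z" using le by (meson bdd_aboveI)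
    have "Sup Z \<le> k" using le by (intro cSup_least) (auto simp: Z_def)
    moreover have "0 \<le> Sup Z" by (intro cSup_upper bdd) (auto simp: Z_def)
    moreover have "contracts x (Sup Z)"
      unfolding contracts_def
    proof (intro ballI)
      fix r s assume rs: "r \<in> R x" "s \<in> S x"
      show "N (f x) (T f x s) * N x r \<le> Sup Z * N x s * N (f x) (T f x r)"
      proof (cases "r = 0 \<or> s = 0")
        case False
        then have "?q r s \<le> Sup Z" using rs by (intro cSup_upper bdd) (auto simp: Z_def)
        then show ?thesis using pos[of r s] rs False by (simp add: divide_le_eq mult_ac)
      qed (auto simp: T_simps[OF C2_f])
    qed
    moreover have "Sup Z * N y v \<le> k' * N (f y) (T f y v)" if y: "y \<in> fst (cc x)" "cdist x y < e" "v \<in> E y" for y v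
    proof (cases "v = 0")
      case False
      then have v: "0 < N y v" by (rule N_pos)
      have "Sup Z \<le> k' * N (f y) (T f y v) / N y v"
      proof (rule cSup_least)
        fix z assume "z \<in> Z"
        then consider "z = 0" | r s where "r \<in> R x - {0}" "s \<in> S x - {0}" "z = ?q r s" by (auto simp: Z_def)
        then show "z \<le> k' * N (f y) (T f y v) / N y v"
        proof cases
          case 2
          then show ?thesis using *[of y x r s v] y pos[OF 2(1,2)] v
            by (simp add: divide_le_eq le_divide_eq mult_ac)
        qed (use k' in simp)
      qed (simp add: Z_def)
      then show ?thesis using v by (simp add: le_divide_eq)
    qed (simp add: T_simps[OF C2_f])
    ultimately show ?thesis using k'(1) by (intro exI[of _ "Sup Z"]) auto
  qed
  then show ?thesis using e by blast
qed

text \<open>One application of \<open>f\<close> multiplies the slope by the contraction rate; the Lipschitz continuity of the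
  derivative of \<open>f\<close> costs a term proportional to the distance of the base points.\<close>

lemma slope_step:
  "\<exists>C>0. \<exists>e>0. \<forall>x y a \<kappa>. y \<in> fst (cc x) \<longrightarrow> cdist x y < e \<longrightarrow> 0 \<le> a \<longrightarrow> 0 \<le> \<kappa> \<longrightarrow> \<kappa> \<le> 1 \<longrightarrow> slope x y a \<longrightarrow>
     contracts x \<kappa> \<longrightarrow> slope (f x) (f y) (\<kappa> * a + C * cdist x y)"
proof -
  obtain C1 e1 where C1: "C1 > 0" "e1 > 0" and 1: "\<And>x y v. y \<in> fst (cc x) \<Longrightarrow> cdist x y < e1 \<Longrightarrow>
     N (f x) (tr (f x) (f y) (T f y v) - T f x (tr x y v)) \<le> C1 * cdist x y * N x (tr x y v)"
    using tr_T_error by blast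
  obtain e2 where e2: "e2 > 0" "\<And>x y. y \<in> fst (cc x) \<Longrightarrow> cdist x y < e2 \<Longrightarrow> slope x y 1" using slope_near by blast
  obtain Cp where Cp: "Cp \<ge> 1" "\<And>p v. N p (piR p v) \<le> Cp * N p v" "\<And>p v. N p (v - piR p v) \<le> Cp * N p v"
    using piR_bound by blast
  obtain C0 where C0: "C0 \<ge> 1" "\<And>p v. N p v \<le> C0 * N (f p) (T f p v)" using T_f_bound by blast
  define m where "m = 2 * Cp * C1 * C0"
  have m: "m > 0" using Cp C1 C0 by (simp add: m_def)
  show ?thesis
  proof (rule ex_pos2I[of "4 * m" "min (1 / (2 * m)) (min e1 e2)"]; (intro allI impI)?)
    fix x y a0 \<kappa> assume y: "y \<in> fst (cc x)" and d: "cdist x y < min (1 / (2 * m)) (min e1 e2)" and a0: "0 \<le> a0"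
      and \<kappa>: "0 \<le> \<kappa>" "\<kappa> \<le> 1" and sl: "slope x y a0"
      and con: "contracts x \<kappa>"
    let ?d = "cdist x y"
    have md: "m * ?d \<le> 1 / 2" using d m by (simp add: field_simps)
    define a where "a = min a0 1"
    have a: "0 \<le> a" "a \<le> 1" "a \<le> a0" using a0 by (auto simp: a_def)
    have "slope x y a" using sl e2(2)[OF y] d by (cases "a0 \<le> 1") (simp_all add: a_def)
    have "slope (f x) (f y) (\<kappa> * a + 4 * m * ?d)"
      unfolding slope_def
    proof
      fix r' assume "r' \<in> R (f y)"
      then obtain r where r: "r \<in> R y" "r' = T f y r" using T_R by blast
      define \<rho> \<sigma> where "\<rho> = piR x (tr x y r)" and "\<sigma> = tr x y r - piR x (tr x y r)"
      define err where "err = tr (f x) (f y) r' - T f x (tr x y r)"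
      have rs: "tr x y r = \<rho> + \<sigma>" "\<rho> \<in> R x" "\<sigma> \<in> S x" by (auto simp: \<rho>_def \<sigma>_def)
      have sig: "N x \<sigma> \<le> a * N x \<rho>" using \<open>slope x y a\<close> r(1) by (auto simp: slope_def \<rho>_def \<sigma>_def)
      have "N x (tr x y r) \<le> N x \<rho> + N x \<sigma>" using N_triangle rs(1) by metis
      also have "\<dots> \<le> N x \<rho> + 1 * N x \<rho>" using sig a by (intro add_left_mono order_trans[OF sig] mult_right_mono) auto
      finally have trr: "N x (tr x y r) \<le> 2 * N x \<rho>" by simp
      let ?M = "N (f x) (T f x \<rho>)"
      have "N (f x) err \<le> C1 * ?d * N x (tr x y r)" using 1[OF y, of r] d r(2) by (simp add: err_def)
      also have "\<dots> \<le> C1 * ?d * (2 * (C0 * ?M))"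
        using trr C0(2)[of x \<rho>] C1 by (intro mult_left_mono) auto
      finally have err: "Cp * N (f x) err \<le> m * ?d * ?M"
        using mult_left_mono[of "N (f x) err" "C1 * ?d * (2 * (C0 * ?M))" Cp] Cp(1) by (simp add: m_def mult_ac)
      have im: "tr (f x) (f y) r' = T f x \<rho> + T f x \<sigma> + err"
        by (simp add: err_def rs(1) T_simps[OF C2_f])
      have P: "piR (f x) (tr (f x) (f y) r') = T f x \<rho> + piR (f x) err"
        unfolding im piR_simps using R_T[OF rs(2)] S_T[OF rs(3)] by simp
      have Q: "tr (f x) (f y) r' - piR (f x) (tr (f x) (f y) r') = T f x \<sigma> + (err - piR (f x) err)"
        unfolding P unfolding im by simp
      have "N (f x) (T f x \<sigma>) \<le> \<kappa> * a * ?M"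
      proof (cases "\<rho> = 0")
        case True
        then show ?thesis using sig N_eq_0[of x \<sigma>] N_nonneg[of x \<sigma>] by (simp add: T_simps[OF C2_f])
      next
        case False
        then have n: "0 < N x \<rho>" by (rule N_pos)
        have "N (f x) (T f x \<sigma>) * N x \<rho> \<le> \<kappa> * N x \<sigma> * ?M" by (rule contractsD[OF con rs(2,3)])
        also have "\<dots> \<le> \<kappa> * (a * N x \<rho>) * ?M" using sig \<kappa> by (intro mult_right_mono mult_left_mono) auto
        finally have "N (f x) (T f x \<sigma>) * N x \<rho> \<le> (\<kappa> * a * ?M) * N x \<rho>" by (simp add: mult_ac)
        then show ?thesis using n by simp
      qed
      then have "N (f x) (T f x \<sigma> + (err - piR (f x) err)) \<le> \<kappa> * a * ?M + m * ?d * ?M"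
        using N_triangle[of "f x" "T f x \<sigma>" "err - piR (f x) err"] Cp(3)[of "f x" err] err by linarith
      also have "\<dots> = (\<kappa> * a + m * ?d) * ?M" by (simp add: algebra_simps)
      also have "\<dots> \<le> ((\<kappa> * a + 4 * m * ?d) * (1 - m * ?d)) * ?M"
      proof (rule mult_right_mono)
        have "(\<kappa> * a) * (m * ?d) \<le> 1 * (m * ?d)"
          using \<kappa> a m by (intro mult_right_mono mult_le_one) auto
        moreover have "(m * ?d) * (m * ?d) \<le> (1/2) * (m * ?d)" using md m by (intro mult_right_mono) auto
        ultimately show "\<kappa> * a + m * ?d \<le> (\<kappa> * a + 4 * m * ?d) * (1 - m * ?d)"
          by (simp add: algebra_simps)
      qed simp
      also have "\<dots> = (\<kappa> * a + 4 * m * ?d) * (?M - m * ?d * ?M)" by (simp add: algebra_simps)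
      also have "\<dots> \<le> (\<kappa> * a + 4 * m * ?d) * N (f x) (T f x \<rho> + piR (f x) err)"
      proof (rule mult_left_mono)
        show "?M - m * ?d * ?M \<le> N (f x) (T f x \<rho> + piR (f x) err)"
          using N_diff[of "f x" "T f x \<rho> + piR (f x) err" "piR (f x) err"] Cp(2)[of "f x" err] err by simp
      qed (use \<kappa> a m in simp)
      finally show "N (f x) (tr (f x) (f y) r' - piR (f x) (tr (f x) (f y) r'))
          \<le> (\<kappa> * a + 4 * m * ?d) * N (f x) (piR (f x) (tr (f x) (f y) r'))"
        by (simp only: Q) (simp only: P)
    qed
    moreover have "\<kappa> * a \<le> \<kappa> * a0" using a \<kappa> by (intro mult_left_mono)
    ultimately show "slope (f x) (f y) (\<kappa> * a0 + 4 * m * ?d)" using slope_mono by auto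
  qed (use m C1 e2 in auto)
qed

text \<open>Follow the arc backwards. As long as the preimages stay short, each step back gains the contraction rate
  at \<open>R\<close> and may lengthen the arc, but by bunching the product of the two factors is at most \<open>k'\<close>. If a preimage is
  not short, then neither is the original arc, so that the bound \<open>1\<close> for the slope of nearby planes suffices.\<close>

lemma slope_arc:
  "\<exists>L>0. \<exists>e>0. \<forall>\<gamma> w s t b. E_arc (closed_segment s t) \<gamma> w \<longrightarrow>
     (\<forall>\<tau>\<in>closed_segment s t. N (\<gamma> \<tau>) (w \<tau>) \<le> b \<and> \<gamma> \<tau> \<in> fst (cc (\<gamma> s)) \<and> cdist (\<gamma> s) (\<gamma> \<tau>) < e) \<longrightarrow>
     slope (\<gamma> s) (\<gamma> t) (L * b * \<bar>t - s\<bar>)"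
proof -
  obtain C1 e1 where C1: "C1 > 0" "e1 > 0" and arc: "\<And>\<gamma> w s t b \<tau>. E_arc (closed_segment s t) \<gamma> w \<Longrightarrow>
     (\<forall>\<tau>\<in>closed_segment s t. N (\<gamma> \<tau>) (w \<tau>) \<le> b \<and> \<gamma> \<tau> \<in> fst (cc (\<gamma> s)) \<and> cdist (\<gamma> s) (\<gamma> \<tau>) < e1) \<Longrightarrow>
     \<tau> \<in> closed_segment s t \<Longrightarrow> cdist (\<gamma> s) (\<gamma> \<tau>) \<le> C1 * b * \<bar>\<tau> - s\<bar>"
    using arc_cdist by blast
  obtain C2 e2 where C2: "C2 > 0" "e2 > 0" and step: "\<And>x y a \<kappa>. y \<in> fst (cc x) \<Longrightarrow> cdist x y < e2 \<Longrightarrow> 0 \<le> a \<Longrightarrow> 0 \<le> \<kappa> \<Longrightarrow> \<kappa> \<le> 1 \<Longrightarrow>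
     slope x y a \<Longrightarrow> contracts x \<kappa> \<Longrightarrow> slope (f x) (f y) (\<kappa> * a + C2 * cdist x y)"
    using slope_step by blast
  obtain e3 where e3: "e3 > 0" "\<And>x y. y \<in> fst (cc x) \<Longrightarrow> cdist x y < e3 \<Longrightarrow> slope x y 1" using slope_near by blast
  obtain e4 where e4: "e4 > 0" and rate: "\<And>x. \<exists>\<kappa>\<ge>0. \<kappa> \<le> k' \<and> contracts x \<kappa> \<and>
     (\<forall>y v. y \<in> fst (cc x) \<longrightarrow> cdist x y < e4 \<longrightarrow> v \<in> E y \<longrightarrow> \<kappa> * N y v \<le> k' * N (f y) (T f y v))"
    using contraction_rate by blast
  obtain C5 e5 where C5: "C5 > 0" "e5 > 0" and pull: "\<And>x y. y \<in> fst (cc x) \<Longrightarrow> cdist x y < e5 \<Longrightarrow>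
     g y \<in> fst (cc (g x)) \<and> cdist (g x) (g y) \<le> C5 * cdist x y"
    using rep_Lipschitz_cc[OF C2_g] by blast
  obtain C0 where C0: "C0 \<ge> 1" "\<And>p v. N p v \<le> C0 * N (f p) (T f p v)" using T_f_bound by blast
  define e1' where "e1' = min (min e1 e2) (min e3 e4)"
  define e where "e = min (min e1' e5) (e1' / C5)"
  have e1': "e1' > 0" using C1 C2 e3 e4 by (simp add: e1'_def)
  have e: "e > 0" "e \<le> e1'" "e \<le> e5" using e1' C5 by (simp_all add: e_def)
  have "e \<le> e1' / C5" by (simp add: e_def)
  then have e': "C5 * e \<le> e1'" using C5(1) by (simp add: field_simps)
  define L where "L = max (C2 * (C1 * C0) / (1 - k')) (C1 * C0 / e)"
  have "C1 * C0 / e > 0" using C1 C0 e by simp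
  then have L: "L > 0" "C2 * (C1 * C0) \<le> L * (1 - k')" "C1 * C0 \<le> L * e"
  proof -
    assume "C1 * C0 / e > 0"
    then show "L > 0" by (simp add: L_def less_max_iff_disj)
    have "C2 * (C1 * C0) / (1 - k') \<le> L" "C1 * C0 / e \<le> L" by (auto simp: L_def)
    then show "C2 * (C1 * C0) \<le> L * (1 - k')" "C1 * C0 \<le> L * e" using k' e by (simp_all add: pos_divide_le_eq)
  qed
  have main: "slope (\<gamma> s) (\<gamma> t) (L * b * \<bar>t - s\<bar> + k' ^ n)"
    if "E_arc (closed_segment s t) \<gamma> w" and
      "\<forall>\<tau>\<in>closed_segment s t. N (\<gamma> \<tau>) (w \<tau>) \<le> b \<and> \<gamma> \<tau> \<in> fst (cc (\<gamma> s)) \<and> cdist (\<gamma> s) (\<gamma> \<tau>) < e" for n \<gamma> w s t b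
    using that
  proof (induction n arbitrary: \<gamma> w b)
    case 0
    have "0 \<le> b" using 0(2) N_nonneg[of "\<gamma> s" "w s"] by (meson ends_in_segment(1) order_trans)
    then have "1 \<le> L * b * \<bar>t - s\<bar> + k' ^ 0" using L by simp
    moreover have "slope (\<gamma> s) (\<gamma> t) 1"
      using 0(2)[rule_format, of t] e by (intro e3(2)) (simp_all add: e1'_def)
    ultimately show ?case using slope_mono by blast
  next
    case (Suc n)
    have b: "0 \<le> b" using Suc.prems(2) N_nonneg[of "\<gamma> s" "w s"] by (meson ends_in_segment(1) order_trans)
    let ?I = "closed_segment s t"
    let ?\<gamma> = "\<lambda>t. g (\<gamma> t)" and ?w = "\<lambda>t. T g (\<gamma> t) (w t)"
    have arc': "E_arc ?I ?\<gamma> ?w" by (rule E_arc_back[OF Suc.prems(1)])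
    have near: "?\<gamma> \<tau> \<in> fst (cc (?\<gamma> s)) \<and> cdist (?\<gamma> s) (?\<gamma> \<tau>) < e1'" if "\<tau> \<in> ?I" for \<tau>
    proof -
      have *: "\<gamma> \<tau> \<in> fst (cc (\<gamma> s))" "cdist (\<gamma> s) (\<gamma> \<tau>) < e" using Suc.prems(2) that by auto
      then have "?\<gamma> \<tau> \<in> fst (cc (?\<gamma> s))" "cdist (?\<gamma> s) (?\<gamma> \<tau>) \<le> C5 * cdist (\<gamma> s) (\<gamma> \<tau>)"
        using pull[of "\<gamma> \<tau>" "\<gamma> s"] e by auto
      moreover have "C5 * cdist (\<gamma> s) (\<gamma> \<tau>) < C5 * e" using * C5 by simp
      ultimately show ?thesis using e' by linarith
    qed
    obtain \<kappa> where \<kappa>: "0 \<le> \<kappa>" "\<kappa> \<le> k'" "contracts (?\<gamma> s) \<kappa>"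
      "\<And>y v. y \<in> fst (cc (?\<gamma> s)) \<Longrightarrow> cdist (?\<gamma> s) y < e4 \<Longrightarrow> v \<in> E y \<Longrightarrow> \<kappa> * N y v \<le> k' * N (f y) (T f y v)"
      using rate[of "?\<gamma> s"] by blast
    (* b' bounds the speed of the preimage; it satisfies \<kappa> b' <= k' b, which is the gain of the step *)
    define b' where "b' = (if \<kappa> = 0 then C0 * b else min (k' * b / \<kappa>) (C0 * b))"
    have b': "\<kappa> * b' \<le> k' * b" "b' \<le> C0 * b" "0 \<le> b'"
      using \<kappa> k' b C0 by (auto simp: b'_def min_def field_simps)
    have speed: "N (?\<gamma> \<tau>) (?w \<tau>) \<le> b'" if "\<tau> \<in> ?I" for \<tau>
    proof -
      have "N (\<gamma> \<tau>) (w \<tau>) \<le> b" using Suc.prems(2) that by blast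
      moreover have "N (?\<gamma> \<tau>) (?w \<tau>) \<le> C0 * N (\<gamma> \<tau>) (w \<tau>)" using C0(2)[of "?\<gamma> \<tau>" "?w \<tau>"] by simp
      ultimately have 1: "N (?\<gamma> \<tau>) (?w \<tau>) \<le> C0 * b" using C0(1) by (meson mult_left_mono order_trans zero_le_one)
      have "\<kappa> * N (?\<gamma> \<tau>) (?w \<tau>) \<le> k' * N (\<gamma> \<tau>) (w \<tau>)"
        using \<kappa>(4)[of "?\<gamma> \<tau>" "?w \<tau>"] near[OF that] E_arcD(1)[OF arc' that] by (simp add: e1'_def)
      also have "\<dots> \<le> k' * b" using \<open>N (\<gamma> \<tau>) (w \<tau>) \<le> b\<close> k' by simp
      finally show ?thesis using 1 \<kappa>(1) by (auto simp: b'_def field_simps)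
    qed
    have dist: "cdist (?\<gamma> s) (?\<gamma> \<tau>) \<le> C1 * b' * \<bar>\<tau> - s\<bar>" if "\<tau> \<in> ?I" for \<tau>
      by (rule arc[OF arc' _ that]) (use speed near in \<open>auto simp: e1'_def\<close>)
    have dist': "C1 * b' * \<bar>\<tau> - s\<bar> \<le> C1 * C0 * b * \<bar>t - s\<bar>" if "\<tau> \<in> ?I" for \<tau>
    proof -
      have "\<bar>\<tau> - s\<bar> \<le> \<bar>t - s\<bar>" using that by (auto simp: closed_segment_eq_real_ivl split: if_splits)
      then have "b' * \<bar>\<tau> - s\<bar> \<le> (C0 * b) * \<bar>t - s\<bar>" using b' by (intro mult_mono) auto
      then show ?thesis using C1 by (simp add: mult.assoc)
    qed
    show ?case
    proof (cases "\<forall>\<tau>\<in>?I. cdist (?\<gamma> s) (?\<gamma> \<tau>) < e")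
      case True
      let ?a = "L * b' * \<bar>t - s\<bar> + k' ^ n" and ?d = "cdist (?\<gamma> s) (?\<gamma> t)"
      have "slope (?\<gamma> s) (?\<gamma> t) ?a"
        by (rule Suc.IH[OF arc']) (use speed near True in auto)
      then have "slope (f (?\<gamma> s)) (f (?\<gamma> t)) (\<kappa> * ?a + C2 * ?d)"
        using near[of t] L b' k' \<kappa> by (intro step) (auto simp: e1'_def)
      moreover have "\<kappa> * ?a + C2 * ?d \<le> L * b * \<bar>t - s\<bar> + k' ^ Suc n"
      proof -
        have "\<kappa> * b' * (L * \<bar>t - s\<bar>) \<le> k' * b * (L * \<bar>t - s\<bar>)" using b' L by (intro mult_right_mono) auto
        moreover have "\<kappa> * k' ^ n \<le> k' * k' ^ n" using \<kappa> k' by (intro mult_right_mono) auto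
        moreover have "C2 * ?d \<le> C2 * (C1 * C0 * b * \<bar>t - s\<bar>)"
          using order_trans[OF dist[of t] dist'[of t]] C2 by (intro mult_left_mono) auto
        moreover have "C2 * (C1 * C0) * (b * \<bar>t - s\<bar>) \<le> L * (1 - k') * (b * \<bar>t - s\<bar>)"
          using L(2) b by (intro mult_right_mono) auto
        ultimately show ?thesis by (simp add: algebra_simps)
      qed
      ultimately show ?thesis using slope_mono by auto
    next
      case False
      then obtain \<tau> where \<tau>: "\<tau> \<in> ?I" "e \<le> cdist (?\<gamma> s) (?\<gamma> \<tau>)" by force
      then have "e \<le> C1 * C0 * b * \<bar>t - s\<bar>" using dist[OF \<tau>(1)] dist'[OF \<tau>(1)] by linarith
      also have "\<dots> = C1 * C0 * (b * \<bar>t - s\<bar>)" by simp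
      also have "\<dots> \<le> L * e * (b * \<bar>t - s\<bar>)" using L(3) b by (intro mult_right_mono) auto
      finally have "e * 1 \<le> e * (L * b * \<bar>t - s\<bar>)" by (simp add: mult_ac)
      then have "1 \<le> L * b * \<bar>t - s\<bar>" using e(1) by (simp only: mult_le_cancel_left_pos)
      then have "1 \<le> L * b * \<bar>t - s\<bar> + k' ^ Suc n" using k' by (simp add: add_increasing2)
      moreover have "slope (\<gamma> s) (\<gamma> t) 1"
        using Suc.prems(2)[rule_format, of t] e by (intro e3(2)) (simp_all add: e1'_def)
      ultimately show ?thesis using slope_mono by blast
    qed
  qed
  show ?thesis
  proof (rule ex_pos2I[of L e]; (intro allI impI)?)
    fix \<gamma> w and s t b :: real
    assume a: "E_arc (closed_segment s t) \<gamma> w"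
      "\<forall>\<tau>\<in>closed_segment s t. N (\<gamma> \<tau>) (w \<tau>) \<le> b \<and> \<gamma> \<tau> \<in> fst (cc (\<gamma> s)) \<and> cdist (\<gamma> s) (\<gamma> \<tau>) < e"
    show "slope (\<gamma> s) (\<gamma> t) (L * b * \<bar>t - s\<bar>)" unfolding slope_def
    proof
      fix r assume r: "r \<in> R (\<gamma> t)"
      let ?x = "tr (\<gamma> s) (\<gamma> t) r" and ?p = "\<gamma> s"
      have "(\<lambda>n. (L * b * \<bar>t - s\<bar> + k' ^ n) * N ?p (piR ?p ?x)) \<longlonglongrightarrow> (L * b * \<bar>t - s\<bar> + 0) * N ?p (piR ?p ?x)"
        by (intro tendsto_intros LIMSEQ_realpow_zero) (use k' in auto)
      then show "N ?p (?x - piR ?p ?x) \<le> L * b * \<bar>t - s\<bar> * N ?p (piR ?p ?x)"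
        using main[OF a] r by (intro LIMSEQ_le_const) (auto simp: slope_def)
    qed
  qed (use L e in auto)
qed

text \<open>Short arcs have speed close to the initial one; the bound then depends on the velocity at \<open>s\<close> only,
  which makes it possible to contract it further.\<close>

lemma slope_arc_local:
  "\<exists>L>0. \<forall>a b \<gamma> w s \<epsilon>. E_arc {a..b} \<gamma> w \<longrightarrow> s \<in> {a..b} \<longrightarrow> 0 < \<epsilon> \<longrightarrow>
     (\<forall>\<^sub>F t in at s within {a..b}. slope (\<gamma> s) (\<gamma> t) (L * (N (\<gamma> s) (w s) + \<epsilon>) * \<bar>t - s\<bar>))"
proof -
  obtain L e where L: "L > 0" "e > 0" and *: "\<And>\<gamma> w s t b. E_arc (closed_segment s t) \<gamma> w \<Longrightarrow>
     (\<forall>\<tau>\<in>closed_segment s t. N (\<gamma> \<tau>) (w \<tau>) \<le> b \<and> \<gamma> \<tau> \<in> fst (cc (\<gamma> s)) \<and> cdist (\<gamma> s) (\<gamma> \<tau>) < e) \<Longrightarrow>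
     slope (\<gamma> s) (\<gamma> t) (L * b * \<bar>t - s\<bar>)"
    using slope_arc by blast
  show ?thesis
  proof (intro exI[of _ L] conjI L allI impI)
    fix a b s \<epsilon> :: real and \<gamma> w assume arc: "E_arc {a..b} \<gamma> w" and s: "s \<in> {a..b}" and \<epsilon>: "0 < \<epsilon>"
    let ?F = "at s within {a..b}"
    note lim = E_arcD(2,3)[OF arc s]
    have "\<forall>\<^sub>F t in ?F. N (\<gamma> t) (w t) < N (\<gamma> s) (w s) + \<epsilon>"
      using order_tendstoD(2)[OF N_cont[OF lim(1)], of "N (\<gamma> s) (w s) + \<epsilon>"] \<epsilon> by simp
    moreover have "\<forall>\<^sub>F t in ?F. \<gamma> t \<in> fst (cc (\<gamma> s))" using chart_tendsto(2)[OF lim(2) cc_A cc_in(2)] .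
    moreover have "\<forall>\<^sub>F t in ?F. dist (snd (cc (\<gamma> s)) (\<gamma> t)) (snd (cc (\<gamma> s)) (\<gamma> s)) < e"
      by (rule tendstoD[OF chart_tendsto(1)[OF lim(2) cc_A cc_in(2)] L(2)])
    ultimately have "\<forall>\<^sub>F t in ?F. N (\<gamma> t) (w t) < N (\<gamma> s) (w s) + \<epsilon> \<and> \<gamma> t \<in> fst (cc (\<gamma> s)) \<and> cdist (\<gamma> s) (\<gamma> t) < e"
      by eventually_elim (simp add: dist_norm)
    then obtain \<delta> where \<delta>: "\<delta> > 0" "\<And>t. t \<in> {a..b} \<Longrightarrow> t \<noteq> s \<Longrightarrow> dist t s < \<delta> \<Longrightarrow>
        N (\<gamma> t) (w t) < N (\<gamma> s) (w s) + \<epsilon> \<and> \<gamma> t \<in> fst (cc (\<gamma> s)) \<and> cdist (\<gamma> s) (\<gamma> t) < e"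
      unfolding eventually_at by blast
    have \<delta>': "N (\<gamma> t) (w t) \<le> N (\<gamma> s) (w s) + \<epsilon> \<and> \<gamma> t \<in> fst (cc (\<gamma> s)) \<and> cdist (\<gamma> s) (\<gamma> t) < e"
      if "t \<in> {a..b}" "dist t s < \<delta>" for t
      using \<delta>(2)[OF that(1) _ that(2)] cc_in \<epsilon> L by (cases "t = s") auto
    show "\<forall>\<^sub>F t in ?F. slope (\<gamma> s) (\<gamma> t) (L * (N (\<gamma> s) (w s) + \<epsilon>) * \<bar>t - s\<bar>)"
      unfolding eventually_at
    proof (intro exI[of _ \<delta>] conjI \<delta> ballI impI)
      fix t assume t: "t \<in> {a..b}" "t \<noteq> s \<and> dist t s < \<delta>"
      have seg: "closed_segment s t \<subseteq> {a..b}" using s t by (auto simp: closed_segment_eq_real_ivl)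
      have "dist \<tau> s < \<delta>" if "\<tau> \<in> closed_segment s t" for \<tau>
        using that t by (auto simp: closed_segment_eq_real_ivl dist_real_def split: if_splits)
      then show "slope (\<gamma> s) (\<gamma> t) (L * (N (\<gamma> s) (w s) + \<epsilon>) * \<bar>t - s\<bar>)"
        using \<delta>' seg by (intro *[OF E_arc_subset[OF arc seg]]) blast
    qed
  qed
qed

end

section \<open>The derivative of \<open>R\<close> along \<open>E\<close>\<close>

context dominated_charts
begin

abbreviation Q :: "'m \<Rightarrow> 'e \<Rightarrow> 'e" where "Q p v \<equiv> v - piR p v"

lemma Q_simps: "Q p (v + w) = Q p v + Q p w" "Q p (v - w) = Q p v - Q p w" "Q p (a *\<^sub>R v) = a *\<^sub>R Q p v" "Q p 0 = 0"
  by (simp_all add: piR_simps scaleR_diff_right)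

lemma Q_T: "Q (f p) (T f p v) = T f p (Q p v)"
  by (simp add: piR_T T_simps[OF C2_f])

text \<open>Iterates of the graph transform, acting on candidates for the derivative: a bilinear map
  \<open>(v, r) \<mapsto> h v r \<in> S\<close> says how fast \<open>R\<close> turns towards \<open>h v r\<close> at \<open>r \<in> R\<close> when the base point moves with
  velocity \<open>v \<in> E\<close>, as seen in the chart \<open>cc x\<close>. As \<open>cc\<close> jumps, the iterates are not
  continuous, so the continuity of their limit needs an argument of its own.\<close>

primrec h_iter :: "nat \<Rightarrow> 'm \<Rightarrow> 'e \<Rightarrow> 'e \<Rightarrow> 'e" where
  "h_iter 0 x v r = 0"
| "h_iter (Suc n) x v r = T f (g x) (h_iter n (g x) (T g x v) (T g x r)) +
     Q x (beta f (cc (g x)) (cc x) (g x) (T g x v) (T g x r))"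

definition h :: "'m \<Rightarrow> 'e \<Rightarrow> 'e \<Rightarrow> 'e" where
  "h x v r = lim (\<lambda>n. h_iter n x v r)"

lemmas beta_cc_simps = beta_simps[OF cc_A cc_in(2)]

lemma h_iter_linear: "linear (\<lambda>v. h_iter n x v r)" "linear (h_iter n x v)"
proof -
  have "h_iter n x (u + v) r = h_iter n x u r + h_iter n x v r" "h_iter n x (a *\<^sub>R v) r = a *\<^sub>R h_iter n x v r"
    "h_iter n x v (r + s) = h_iter n x v r + h_iter n x v s" "h_iter n x v (a *\<^sub>R r) = a *\<^sub>R h_iter n x v r" for u v r s a
    by (induction n arbitrary: x u v r s)
      (simp_all add: T_simps[OF C2_f] T_simps[OF C2_g] beta_cc_simps Q_simps piR_simps algebra_simps)
  then show "linear (\<lambda>v. h_iter n x v r)" "linear (h_iter n x v)" by (auto intro!: linearI)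
qed

lemma h_iter_S: "h_iter n x v r \<in> S x"
proof (induction n arbitrary: x v r)
  case (Suc n)
  have "T f (g x) (h_iter n (g x) (T g x v) (T g x r)) \<in> S x" using S_T[OF Suc.IH, of "g x"] by simp
  then show ?case by (simp add: subspace_add[OF S_sub])
qed (simp add: subspace_0[OF S_sub])

text \<open>Successive iterates differ by the transport of the first difference along \<open>n\<close> steps of the orbit. For a step the
  factor is a quotient of norms as in the bunching condition, that is, at most \<open>k\<close>.\<close>

lemma h_iter_step:
  "\<exists>B>0. \<forall>n x. \<forall>v\<in>E x. \<forall>r\<in>R x. N x (h_iter (Suc n) x v r - h_iter n x v r) \<le> B * k ^ n * N x v * N x r"
proof -
  obtain Cp where Cp: "Cp \<ge> 1" "\<And>p v. N p (Q p v) \<le> Cp * N p v" using piR_bound by blast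
  obtain C0 where C0: "C0 \<ge> 1" "\<And>p v. N p v \<le> C0 * N (f p) (T f p v)" using T_f_bound by blast
  obtain Cb where Cb: "Cb > 0" "\<And>c c' x v r. c \<in> range cc \<Longrightarrow> c' \<in> range cc \<Longrightarrow> x \<in> K c \<Longrightarrow> f x \<in> K c' \<Longrightarrow>
    N (f x) (beta f c c' x v r) \<le> Cb * N x v * N x r"
    using beta_bound[OF C2_f] by blast
  define B where "B = Cp * Cb * C0 * C0"
  have B: "B > 0" using Cp Cb C0 by (simp add: B_def)
  have gb: "N (g x) (T g x v) \<le> C0 * N x v" for x v using C0(2)[of "g x" "T g x v"] by simp
  have "N x (h_iter (Suc n) x v r - h_iter n x v r) \<le> B * k ^ n * N x v * N x r" if "v \<in> E x" "r \<in> R x" for n x v r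
    using that
  proof (induction n arbitrary: x v r)
    case 0
    let ?v = "T g x v" and ?r = "T g x r"
    have "N x (h_iter (Suc 0) x v r - h_iter 0 x v r) \<le> Cp * N x (beta f (cc (g x)) (cc x) (g x) ?v ?r)"
      using Cp(2) by (simp add: T_simps[OF C2_f])
    also have "\<dots> \<le> Cp * (Cb * N (g x) ?v * N (g x) ?r)"
      using Cb(2)[of "cc (g x)" "cc x" "g x" ?v ?r] cc_in Cp(1) by (intro mult_left_mono) auto
    also have "\<dots> \<le> Cp * (Cb * (C0 * N x v) * (C0 * N x r))"
      using gb Cp Cb C0 by (intro mult_left_mono mult_mono) auto
    finally show ?case by (simp add: B_def mult_ac)
  next
    case (Suc n)
    let ?v = "T g x v" and ?r = "T g x r" and ?y = "g x"
    define \<delta> where "\<delta> = h_iter (Suc n) ?y ?v ?r - h_iter n ?y ?v ?r"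
    have eq: "h_iter (Suc (Suc n)) x v r - h_iter (Suc n) x v r = T f ?y \<delta>"
      by (simp add: \<delta>_def T_simps[OF C2_f])
    have vr: "?v \<in> E ?y" "?r \<in> R ?y" using Suc.prems E_Tg R_Tg by auto
    have \<delta>: "\<delta> \<in> S ?y" unfolding \<delta>_def by (intro subspace_diff[OF S_sub] h_iter_S)
    have IH: "N ?y \<delta> \<le> B * k ^ n * N ?y ?v * N ?y ?r" using Suc.IH[OF vr] by (simp add: \<delta>_def del: h_iter.simps)
    show ?case
    proof (cases "?v = 0 \<or> ?r = 0")
      case True
      then have "N ?y \<delta> \<le> 0" using IH by auto
      then have "\<delta> = 0" using N_nonneg[of ?y \<delta>] N_eq_0[of ?y \<delta>] by linarith
      then show ?thesis unfolding eq using B k0 by (simp add: T_simps[OF C2_f])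
    next
      case False
      then have pos: "0 < N ?y ?r * N ?y ?v" by (auto intro!: mult_pos_pos N_pos)
      have "N x (T f ?y \<delta>) * N ?y ?r * N ?y ?v \<le> k * N ?y \<delta> * N x r * N x v"
        using bunching[OF vr(2) \<delta> vr(1)] by simp
      also have "\<dots> \<le> k * (B * k ^ n * N ?y ?v * N ?y ?r) * N x r * N x v"
        using IH k0 by (intro mult_right_mono mult_left_mono) auto
      finally have "N x (T f ?y \<delta>) * (N ?y ?r * N ?y ?v) \<le> (B * k ^ Suc n * N x v * N x r) * (N ?y ?r * N ?y ?v)"
        by (simp add: mult_ac)
      then show ?thesis unfolding eq using pos by (simp only: mult_le_cancel_right_pos)
    qed
  qed
  then show ?thesis using B by blast
qed

lemma norm_le_N: "\<exists>C>0. \<forall>w. norm w \<le> C * N p w \<and> N p w \<le> C * norm w"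
proof -
  obtain C where "C > 0" and *: "\<forall>\<^sub>F q in nhds p. \<forall>w. norm w \<le> C * N q (tau_inv (chart_at A p) q w) \<and> N q (tau_inv (chart_at A p) q w) \<le> C * norm w"
    using N_chart_bounds[OF chart_at] by blast
  moreover have "tau_inv (chart_at A p) p w = w" for w using tau_inv_tau[OF chart_at, of p w] by simp
  ultimately show ?thesis using eventually_nhds_x_imp_x[OF *] by auto
qed

lemma h_iter_tendsto_h:
  assumes "v \<in> E x" "r \<in> R x"
  shows "(\<lambda>n. h_iter n x v r) \<longlonglongrightarrow> h x v r"
proof -
  obtain B where B: "B > 0" "\<And>n x v r. v \<in> E x \<Longrightarrow> r \<in> R x \<Longrightarrow> N x (h_iter (Suc n) x v r - h_iter n x v r) \<le> B * k ^ n * N x v * N x r"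
    using h_iter_step by blast
  obtain C where C: "C > 0" "\<And>w. norm w \<le> C * N x w" using norm_le_N by blast
  have "summable (\<lambda>n. h_iter (Suc n) x v r - h_iter n x v r)"
  proof (rule summable_comparison_test')
    show "summable (\<lambda>n. C * B * N x v * N x r * k ^ n)"
      using k0 k1 by (intro summable_mult summable_geometric) auto
    show "norm (h_iter (Suc n) x v r - h_iter n x v r) \<le> C * B * N x v * N x r * k ^ n" for n
    proof -
      have "norm (h_iter (Suc n) x v r - h_iter n x v r) \<le> C * (B * k ^ n * N x v * N x r)"
        using C(2) B(2)[OF assms, of n] C(1) by (meson mult_left_mono order_trans less_imp_le)
      then show ?thesis by (simp add: mult_ac)
    qed
  qed
  then have "(\<lambda>m. \<Sum>n<m. h_iter (Suc n) x v r - h_iter n x v r) \<longlonglongrightarrow> (\<Sum>n. h_iter (Suc n) x v r - h_iter n x v r)"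
    by (rule summable_LIMSEQ)
  then have "(\<lambda>m. h_iter m x v r - h_iter 0 x v r) \<longlonglongrightarrow> (\<Sum>n. h_iter (Suc n) x v r - h_iter n x v r)"
    by (simp only: sum_lessThan_telescope[of "\<lambda>n. h_iter n x v r"])
  then have "convergent (\<lambda>m. h_iter m x v r)"
    by (intro convergentI) (simp only: h_iter.simps(1) diff_zero)
  then show ?thesis unfolding h_def by (simp add: convergent_LIMSEQ_iff)
qed

lemma h_S:
  assumes "v \<in> E x" "r \<in> R x" shows "h x v r \<in> S x"
  by (rule closed_sequentially[OF closed_subspace[OF S_sub] h_iter_S h_iter_tendsto_h[OF assms]])

lemma h_linear_v:
  assumes "v \<in> E x" "v' \<in> E x" "r \<in> R x"
  shows "h x (a *\<^sub>R v + b *\<^sub>R v') r = a *\<^sub>R h x v r + b *\<^sub>R h x v' r"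
proof (rule LIMSEQ_unique)
  show "(\<lambda>n. h_iter n x (a *\<^sub>R v + b *\<^sub>R v') r) \<longlonglongrightarrow> h x (a *\<^sub>R v + b *\<^sub>R v') r"
    using assms subspace_add[OF E_sub] subspace_scale[OF E_sub] by (intro h_iter_tendsto_h) auto
  have "h_iter n x (a *\<^sub>R v + b *\<^sub>R v') r = a *\<^sub>R h_iter n x v r + b *\<^sub>R h_iter n x v' r" for n
    using linear_add[OF h_iter_linear(1)] linear_scale[OF h_iter_linear(1)] by metis
  then show "(\<lambda>n. h_iter n x (a *\<^sub>R v + b *\<^sub>R v') r) \<longlonglongrightarrow> a *\<^sub>R h x v r + b *\<^sub>R h x v' r"
    using assms by (auto intro!: tendsto_intros h_iter_tendsto_h)
qed

lemma h_linear_r: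
  assumes "v \<in> E x" "r \<in> R x" "r' \<in> R x"
  shows "h x v (a *\<^sub>R r + b *\<^sub>R r') = a *\<^sub>R h x v r + b *\<^sub>R h x v r'"
proof (rule LIMSEQ_unique)
  show "(\<lambda>n. h_iter n x v (a *\<^sub>R r + b *\<^sub>R r')) \<longlonglongrightarrow> h x v (a *\<^sub>R r + b *\<^sub>R r')"
    using assms subspace_add[OF R_sub] subspace_scale[OF R_sub] by (intro h_iter_tendsto_h) auto
  have "h_iter n x v (a *\<^sub>R r + b *\<^sub>R r') = a *\<^sub>R h_iter n x v r + b *\<^sub>R h_iter n x v r'" for n
    using linear_add[OF h_iter_linear(2)] linear_scale[OF h_iter_linear(2)] by metis
  then show "(\<lambda>n. h_iter n x v (a *\<^sub>R r + b *\<^sub>R r')) \<longlonglongrightarrow> a *\<^sub>R h x v r + b *\<^sub>R h x v r'"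
    using assms by (auto intro!: tendsto_intros h_iter_tendsto_h)
qed

lemma N_tendsto: "(z \<longlongrightarrow> u) F \<Longrightarrow> ((\<lambda>i. N p (z i)) \<longlongrightarrow> N p u) F"
  by (rule N_cont, rule tends_TMI[OF tendsto_const chart_at]) simp

lemma h_bound: "\<exists>C>0. \<forall>x. \<forall>v\<in>E x. \<forall>r\<in>R x. N x (h x v r) \<le> C * N x v * N x r"
proof -
  obtain B where B: "B > 0" "\<And>n x v r. v \<in> E x \<Longrightarrow> r \<in> R x \<Longrightarrow> N x (h_iter (Suc n) x v r - h_iter n x v r) \<le> B * k ^ n * N x v * N x r"
    using h_iter_step by blast
  have *: "N x (h_iter n x v r) \<le> B / (1 - k) * (1 - k ^ n) * (N x v * N x r)" if "v \<in> E x" "r \<in> R x" for n x v r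
  proof (induction n)
    case (Suc n)
    have "N x (h_iter (Suc n) x v r) \<le> N x (h_iter n x v r) + N x (h_iter (Suc n) x v r - h_iter n x v r)"
      using N_triangle[of x "h_iter n x v r" "h_iter (Suc n) x v r - h_iter n x v r"] by simp
    also have "\<dots> \<le> B / (1 - k) * (1 - k ^ n) * (N x v * N x r) + B * k ^ n * (N x v * N x r)"
      using Suc B(2)[OF that, of n] by (simp add: mult.assoc)
    also have "\<dots> = (B / (1 - k) * (1 - k ^ n) + B * k ^ n) * (N x v * N x r)" by (simp add: algebra_simps)
    also have "B / (1 - k) * (1 - k ^ n) + B * k ^ n = B / (1 - k) * (1 - k ^ Suc n)"
      using k1 by (simp add: field_simps)
    finally show ?case .
  qed simp
  have "N x (h x v r) \<le> B / (1 - k) * N x v * N x r" if vr: "v \<in> E x" "r \<in> R x" for x v r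
  proof (rule LIMSEQ_le_const2[OF N_tendsto[OF h_iter_tendsto_h[OF vr]]], intro exI allI impI)
    fix n
    have "B / (1 - k) * (1 - k ^ n) * (N x v * N x r) \<le> B / (1 - k) * 1 * (N x v * N x r)"
      using B k0 k1 by (intro mult_right_mono mult_left_mono) auto
    then show "N x (h_iter n x v r) \<le> B / (1 - k) * N x v * N x r" using *[OF vr, of n] by (simp add: mult.assoc)
  qed
  then show ?thesis using B k1 by (intro exI[of _ "B / (1 - k)"]) auto
qed

text \<open>The invariance of \<open>R\<close>, differentiated: \<open>R\<close> turns at \<open>f x\<close> as prescribed by \<open>Tf\<close>, with a correction by
  the second derivative of \<open>f\<close>.\<close>

lemma h_invariant:
  assumes "v \<in> E x" "r \<in> R x"
  shows "h (f x) (T f x v) (T f x r) = T f x (h x v r) + Q (f x) (beta f (cc x) (cc (f x)) x v r)"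
proof (rule LIMSEQ_unique)
  show "(\<lambda>n. h_iter (Suc n) (f x) (T f x v) (T f x r)) \<longlonglongrightarrow> h (f x) (T f x v) (T f x r)"
    using h_iter_tendsto_h[OF E_T[OF assms(1)] R_T[OF assms(2)]] by (rule LIMSEQ_Suc)
  have "(\<lambda>n. T f x (h_iter n x v r) + Q (f x) (beta f (cc x) (cc (f x)) x v r)) \<longlonglongrightarrow> T f x (h x v r) + Q (f x) (beta f (cc x) (cc (f x)) x v r)"
    by (intro tendsto_intros linear_continuous_at[unfolded isCont_def linear_conv_bounded_linear[symmetric], THEN tendsto_compose_filtermap[THEN iffD1]]
      bounded_linear.tendsto[OF _ h_iter_tendsto_h[OF assms]] linear_conv_bounded_linear[THEN iffD1, OF T_linear[OF C2_f]])
  then show "(\<lambda>n. h_iter (Suc n) (f x) (T f x v) (T f x r)) \<longlonglongrightarrow> T f x (h x v r) + Q (f x) (beta f (cc x) (cc (f x)) x v r)"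
    by simp
qed

text \<open>The same derivative as seen in an arbitrary chart \<open>c\<close>.\<close>

definition hc :: "('m, 'e) chart \<Rightarrow> 'm \<Rightarrow> 'e \<Rightarrow> 'e \<Rightarrow> 'e" where
  "hc c x v r = h x v r + Q x (beta id (cc x) c x v r)"

lemma hc_cc [simp]: "hc (cc x) x v r = h x v r"
  by (simp add: hc_def beta_id_self[OF cc_A cc_in(2)] piR_simps)

lemma hc_S: "v \<in> E x \<Longrightarrow> r \<in> R x \<Longrightarrow> hc c x v r \<in> S x"
  unfolding hc_def by (intro subspace_add[OF S_sub] h_S) auto

text \<open>In this form the invariance holds for any charts that are held fixed near \<open>x\<close> and \<open>f x\<close>, whereas \<open>cc\<close> jumps.\<close>

lemma hc_transform:
  assumes vr: "v \<in> E x" "r \<in> R x" and c: "c \<in> A" "c' \<in> A" "x \<in> fst c" "f x \<in> fst c'"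
  shows "hc c' (f x) (T f x v) (T f x r) = T f x (hc c x v r) + Q (f x) (beta f c c' x v r)"
proof -
  have 1: "beta (id \<circ> f) (cc x) c' x v r =
    beta id (cc (f x)) c' (f x) (T f x v) (T f x r) + T id (f x) (beta f (cc x) (cc (f x)) x v r)"
    by (rule beta_compose) (use c C2_f C2_id cc_A cc_in in auto)
  have 2: "beta (f \<circ> id) (cc x) c' x v r = beta f c c' (id x) (T id x v) (T id x r) + T f (id x) (beta id (cc x) c x v r)"
    by (rule beta_compose) (use c C2_f C2_id cc_A cc_in in auto)
  have "beta id (cc (f x)) c' (f x) (T f x v) (T f x r) + beta f (cc x) (cc (f x)) x v r =
     beta f c c' x v r + T f x (beta id (cc x) c x v r)"
    using 1 2 by simp
  then have "Q (f x) (beta f (cc x) (cc (f x)) x v r) + Q (f x) (beta id (cc (f x)) c' (f x) (T f x v) (T f x r)) =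
     T f x (Q x (beta id (cc x) c x v r)) + Q (f x) (beta f c c' x v r)"
    unfolding Q_T[symmetric] Q_simps(1)[symmetric] by (simp add: add.commute)
  then show ?thesis
    unfolding hc_def h_invariant[OF vr] T_simps(1)[OF C2_f] by simp
qed

lemma hc_change:
  assumes c: "c \<in> A" "c' \<in> A" "x \<in> fst c" "x \<in> fst c'"
  shows "hc c' x v r = hc c x v r + Q x (beta id c c' x v r)"
proof -
  have "beta (id \<circ> id) (cc x) c' x v r = beta id c c' (id x) (T id x v) (T id x r) + T id (id x) (beta id (cc x) c x v r)"
    by (rule beta_compose) (use c C2_id cc_A cc_in in auto)
  then have "beta id (cc x) c' x v r = beta id c c' x v r + beta id (cc x) c x v r" by simp
  then show ?thesis unfolding hc_def by (simp only: Q_simps(1)) simp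
qed

lemma hc_linear_v:
  assumes "v \<in> E x" "v' \<in> E x" "r \<in> R x"
  shows "hc c x (a *\<^sub>R v + b *\<^sub>R v') r = a *\<^sub>R hc c x v r + b *\<^sub>R hc c x v' r"
  unfolding hc_def h_linear_v[OF assms] by (simp add: beta_cc_simps piR_simps algebra_simps)

lemma hc_linear_r:
  assumes "v \<in> E x" "r \<in> R x" "r' \<in> R x"
  shows "hc c x v (a *\<^sub>R r + b *\<^sub>R r') = a *\<^sub>R hc c x v r + b *\<^sub>R hc c x v r'"
  unfolding hc_def h_linear_r[OF assms] by (simp add: beta_cc_simps piR_simps algebra_simps)

lemma hc_bound: "\<exists>C>0. \<forall>c\<in>range cc. \<forall>x\<in>K c. \<forall>v\<in>E x. \<forall>r\<in>R x. N x (hc c x v r) \<le> C * N x v * N x r"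
proof -
  obtain Cp where Cp: "Cp \<ge> 1" "\<And>p v. N p (Q p v) \<le> Cp * N p v" using piR_bound by blast
  obtain Ch where Ch: "Ch > 0" "\<And>x v r. v \<in> E x \<Longrightarrow> r \<in> R x \<Longrightarrow> N x (h x v r) \<le> Ch * N x v * N x r" using h_bound by blast
  obtain Cb where Cb: "Cb > 0" "\<And>c c' x v r. c \<in> range cc \<Longrightarrow> c' \<in> range cc \<Longrightarrow> x \<in> K c \<Longrightarrow> x \<in> K c' \<Longrightarrow>
    N x (beta id c c' x v r) \<le> Cb * N x v * N x r"
    using beta_bound[OF C2_id] unfolding id_apply by blast
  show ?thesis
  proof (intro exI[of _ "Ch + Cp * Cb"] conjI ballI)
    fix c x v r assume c: "c \<in> range cc" "x \<in> K c" and vr: "v \<in> E x" "r \<in> R x"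
    have "N x (Q x (beta id (cc x) c x v r)) \<le> Cp * (Cb * N x v * N x r)"
      using order_trans[OF Cp(2) mult_left_mono[OF Cb(2)[OF rangeI c(1) cc_in(1) c(2)]]] Cp(1) by simp
    then show "N x (hc c x v r) \<le> (Ch + Cp * Cb) * N x v * N x r"
      unfolding hc_def using N_triangle[of x "h x v r" "Q x (beta id (cc x) c x v r)"] Ch(2)[OF vr]
      by (simp add: algebra_simps)
  qed (use Ch Cp Cb in \<open>simp add: add_pos_pos\<close>)
qed

subsection \<open>Continuity of the derivative\<close>

lemma beta_tendsto:
  assumes \<phi>: "C2 \<phi>" and c: "c \<in> A" "c' \<in> A" "p \<in> fst c" "\<phi> p \<in> fst c'"
    and w: "tends_TM F q w p v" and u: "tends_TM F q u p r"
  shows "tends_TM F (\<lambda>i. \<phi> (q i)) (\<lambda>i. beta \<phi> c c' (q i) (w i) (u i)) (\<phi> p) (beta \<phi> c c' p v r)"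
proof (rule tends_TMI[OF C2_tendsto[OF \<phi> tends_TMD(1)[OF w]] c(2,4)])
  have "((\<lambda>i. D2 (rep \<phi> c c') (snd c (q i)) (tau c (q i) (w i)) (tau c (q i) (u i))) \<longlongrightarrow>
      D2 (rep \<phi> c c') (snd c p) (tau c p v) (tau c p r)) F"
    by (intro blinfun.tendsto rep_D_tendsto \<phi> c tends_TMD[OF w] tends_TMD[OF u])
  then have "((\<lambda>i. D2 (rep \<phi> c c') (snd c (q i)) (tau c (q i) (w i)) (tau c (q i) (u i))) \<longlongrightarrow>
      tau c' (\<phi> p) (beta \<phi> c c' p v r)) F"
    using c by (simp add: beta_def)
  then show "((\<lambda>i. tau c' (\<phi> (q i)) (beta \<phi> c c' (q i) (w i) (u i))) \<longlongrightarrow> tau c' (\<phi> p) (beta \<phi> c c' p v r)) F"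
  proof (rule Lim_transform_eventually)
    show "\<forall>\<^sub>F i in F. D2 (rep \<phi> c c') (snd c (q i)) (tau c (q i) (w i)) (tau c (q i) (u i)) =
       tau c' (\<phi> (q i)) (beta \<phi> c c' (q i) (w i) (u i))"
      using chart_tendsto(2)[OF C2_tendsto[OF \<phi> tends_TMD(1)[OF w]] c(2,4)]
      by eventually_elim (use c in \<open>simp add: beta_def\<close>)
  qed
qed

lemma N_tau_inv_0: "c \<in> A \<Longrightarrow> p \<in> fst c \<Longrightarrow> (z \<longlongrightarrow> 0) F \<Longrightarrow> ((\<lambda>i. N p (tau_inv c p (z i))) \<longlongrightarrow> 0) F"
  using N_tendsto[OF bounded_linear.tendsto[OF linear_conv_bounded_linear[THEN iffD1, OF tau_inv_linear[of c p]]], of z 0 F p]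
  by (simp add: tau_inv_simps)

text \<open>The oscillation of \<open>hc\<close> at \<open>(p, v, r)\<close> is bounded, and \<open>f\<close> contracts it by the bunching condition.
  So it is bounded by \<open>C * k ^ n\<close> for each \<open>n\<close>, up to terms which vanish in the limit.\<close>

lemma hc_oscillation:
  "\<exists>C>0. \<forall>n p v r q w u \<epsilon>. tends_TM F q w p v \<longrightarrow> tends_TM F q u p r \<longrightarrow> (\<forall>i. w i \<in> E (q i) \<and> u i \<in> R (q i)) \<longrightarrow>
     v \<in> E p \<longrightarrow> r \<in> R p \<longrightarrow> 0 < \<epsilon> \<longrightarrow>
     (\<forall>\<^sub>F i in F. N p (tr p (q i) (hc (cc p) (q i) (w i) (u i)) - h p v r) \<le> C * k ^ n * N p v * N p r + \<epsilon>)"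
proof -
  obtain Ch where Ch: "Ch > 0" "\<And>c x v r. c \<in> range cc \<Longrightarrow> x \<in> K c \<Longrightarrow> v \<in> E x \<Longrightarrow> r \<in> R x \<Longrightarrow> N x (hc c x v r) \<le> Ch * N x v * N x r"
    using hc_bound by blast
  obtain Cn where Cn: "Cn > 0" "\<And>c x w. c \<in> range cc \<Longrightarrow> x \<in> K c \<Longrightarrow> norm w \<le> Cn * N x (tau_inv c x w) \<and> N x (tau_inv c x w) \<le> Cn * norm w"
    using norm_bounds by blast
  obtain C0 where C0: "C0 \<ge> 1" "\<And>p v. N (f p) (T f p v) \<le> C0 * N p v" using T_f_bound by blast
  define C where "C = (Cn * Cn + 1) * Ch"
  have C: "C > 0" using Cn Ch by (simp add: C_def add_pos_pos)
  have "\<forall>\<^sub>F i in F. N p (tr p (q i) (hc (cc p) (q i) (w i) (u i)) - h p v r) \<le> C * k ^ n * N p v * N p r + \<epsilon>"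
    if "tends_TM F q w p v" "tends_TM F q u p r" "\<And>i. w i \<in> E (q i)" "\<And>i. u i \<in> R (q i)" "v \<in> E p" "r \<in> R p" "0 < \<epsilon>"
    for n p v r q w u \<epsilon>
    using that
  proof (induction n arbitrary: p v r q w u \<epsilon>)
    case 0
    note [simp] = cc_A cc_in
    have "((\<lambda>i. Cn * Cn * (Ch * N (q i) (w i) * N (q i) (u i))) \<longlongrightarrow> Cn * Cn * (Ch * N p v * N p r)) F"
      by (intro tendsto_intros N_cont 0)
    from order_tendstoD(2)[OF this, of "Cn * Cn * (Ch * N p v * N p r) + \<epsilon>"] 0(7)
    have "\<forall>\<^sub>F i in F. Cn * Cn * (Ch * N (q i) (w i) * N (q i) (u i)) < Cn * Cn * (Ch * N p v * N p r) + \<epsilon>" by simp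
    moreover have "\<forall>\<^sub>F i in F. q i \<in> interior (K (cc p))"
      using topological_tendstoD[OF tends_TMD(1)[OF 0(1)] open_interior cc_K] .
    ultimately show ?case
    proof eventually_elim
      case (elim i)
      then have qK: "q i \<in> K (cc p)" using interior_subset by blast
      let ?a = "hc (cc p) (q i) (w i) (u i)"
      have "N p (tr p (q i) ?a) \<le> Cn * norm (tau (cc p) (q i) ?a)"
        using Cn(2)[of "cc p" p] by (auto simp: tr_def)
      also have "\<dots> \<le> Cn * (Cn * N (q i) ?a)"
      proof (intro mult_left_mono)
        have "tau_inv (cc p) (q i) (tau (cc p) (q i) ?a) = ?a" using qK K_sub by (intro tau_inv_tau cc_A) blast
        then show "norm (tau (cc p) (q i) ?a) \<le> Cn * N (q i) ?a"
          using Cn(2)[of "cc p" "q i" "tau (cc p) (q i) ?a"] qK by simp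
      qed (use Cn in simp)
      also have "\<dots> \<le> Cn * (Cn * (Ch * N (q i) (w i) * N (q i) (u i)))"
        using Ch(2)[of "cc p" "q i"] qK 0(3,4) Cn(1) by (intro mult_left_mono) auto
      finally have 1: "N p (tr p (q i) ?a) \<le> Cn * Cn * (Ch * N p v * N p r) + \<epsilon>" using elim(1) by (simp add: mult.assoc)
      have "N p (h p v r) \<le> Ch * N p v * N p r" using Ch(2)[of "cc p" p v r] 0(5,6) by simp
      then have "N p (tr p (q i) ?a - h p v r) \<le> Cn * Cn * (Ch * N p v * N p r) + \<epsilon> + Ch * N p v * N p r"
        using N_diff[of p "tr p (q i) ?a" "h p v r"] 1 by linarith
      then show ?case by (simp add: C_def algebra_simps)
    qed
  next
    case (Suc n)
    define p' v' r' where "p' = g p" and "v' = T g p v" and "r' = T g p r"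
    define q' w' u' where "q' i = g (q i)" and "w' i = T g (q i) (w i)" and "u' i = T g (q i) (u i)" for i
    have fp: "f p' = p" "f (q' i) = q i" and Tp: "T f p' v' = v" "T f p' r' = r" "T f (q' i) (w' i) = w i" "T f (q' i) (u' i) = u i" for i
      by (auto simp: p'_def v'_def r'_def q'_def w'_def u'_def)
    have t: "tends_TM F q' w' p' v'" "tends_TM F q' u' p' r'"
      unfolding q'_def w'_def u'_def p'_def v'_def r'_def using tends_TM_T[OF Suc.prems(1) C2_g] tends_TM_T[OF Suc.prems(2) C2_g] by auto
    have m: "w' i \<in> E (q' i)" "u' i \<in> R (q' i)" "v' \<in> E p'" "r' \<in> R p'" for i
      unfolding q'_def w'_def u'_def p'_def v'_def r'_def using Suc.prems(3-6) E_Tg R_Tg by auto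
    let ?c' = "cc p'" and ?c = "cc p"
    have c': "?c' \<in> A" "p' \<in> fst ?c'" and c: "?c \<in> A" "p \<in> fst ?c" using cc_A cc_in by auto
    have c'f: "f p' \<in> fst ?c" using c fp by simp
    define a where "a i = tau ?c' (q' i) (hc ?c' (q' i) (w' i) (u' i))" for i
    define a0 where "a0 = tau ?c' p' (h p' v' r')"
    define \<delta> where "\<delta> i = tr p' (q' i) (hc ?c' (q' i) (w' i) (u' i)) - h p' v' r'" for i
    define X where "X i = tr p (q i) (hc ?c (q i) (w i) (u i)) - h p v r" for i
    have IH: "\<forall>\<^sub>F i in F. N p' (\<delta> i) \<le> C * k ^ n * N p' v' * N p' r' + \<eta>" if "0 < \<eta>" for \<eta>
      unfolding \<delta>_def by (rule Suc.IH[OF t m that])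
    have ad: "a i - a0 = tau ?c' p' (\<delta> i)" for i
      using c' by (simp add: a_def a0_def \<delta>_def tr_def tau_simps)
    have dt: "\<delta> i = tau_inv ?c' p' (a i - a0)" for i unfolding ad using c' by simp
    obtain Z where Z: "\<forall>\<^sub>F i in F. norm (a i) \<le> Z"
    proof
      show "\<forall>\<^sub>F i in F. norm (a i) \<le> norm a0 + Cn * (C * k ^ n * N p' v' * N p' r' + 1)"
        using IH[OF zero_less_one]
      proof eventually_elim
        case (elim i)
        have "norm (a i - a0) \<le> Cn * N p' (\<delta> i)" using Cn(2)[of ?c' p' "a i - a0"] cc_in by (simp add: dt)
        also have "\<dots> \<le> Cn * (C * k ^ n * N p' v' * N p' r' + 1)" using elim Cn by (intro mult_left_mono) auto
        finally show ?case using norm_triangle_ineq2[of "a i" a0] by linarith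
      qed
    qed
    have small: "((\<lambda>i. (L i - L0) (a i)) \<longlongrightarrow> 0) F" if "(L \<longlongrightarrow> L0) F" for L :: "'a \<Rightarrow> 'e \<Rightarrow>\<^sub>L 'e" and L0
    proof (rule Lim_null_comparison)
      show "\<forall>\<^sub>F i in F. norm ((L i - L0) (a i)) \<le> norm (L i - L0) * Z"
        using Z by eventually_elim (meson mult_left_mono norm_blinfun norm_ge_zero order_trans)
      have "((\<lambda>i. norm (L i - L0) * Z) \<longlongrightarrow> norm (L0 - L0) * Z) F"
        by (intro tendsto_intros that)
      then show "((\<lambda>i. norm (L i - L0) * Z) \<longlongrightarrow> 0) F" by simp
    qed
    (* the component of \<delta> in R tends to 0, because hc takes values in S, which is continuous *)
    define e2 where "e2 i = N p' (piR p' (\<delta> i))" for i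
    have e2: "(e2 \<longlongrightarrow> 0) F"
    proof -
      have "((\<lambda>i. N p' (tau_inv ?c' p' (- (Pc ?c' (q' i) - Pc ?c' p') (a i)))) \<longlongrightarrow> 0) F"
        using tendsto_minus[OF small[OF Pc_tendsto[OF c' tends_TMD(1)[OF t(1)]]]]
        by (intro N_tau_inv_0 c') (simp add: uminus_blinfun.rep_eq)
      then show ?thesis
      proof (rule Lim_transform_eventually)
        show "\<forall>\<^sub>F i in F. N p' (tau_inv ?c' p' (- (Pc ?c' (q' i) - Pc ?c' p') (a i))) = e2 i"
          using chart_tendsto(2)[OF tends_TMD(1)[OF t(1)] c']
        proof eventually_elim
          case (elim i)
          have "Pc ?c' (q' i) (a i) = 0"
            unfolding Pc_apply[OF c'(1) elim] using c' elim hc_S[OF m(1,2)] by (simp add: a_def tau_simps)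
          then have "- (Pc ?c' (q' i) - Pc ?c' p') (a i) = Pc ?c' p' (a i)"
            by (simp add: blinfun.diff_left)
          also have "\<dots> = tau ?c' p' (piR p' (\<delta> i))"
            using c' h_S[OF m(3,4)] by (simp add: Pc_apply dt a0_def tau_inv_simps piR_simps tau_simps)
          finally show ?case unfolding e2_def by (simp only: tau_inv_tau[OF c'])
        qed
      qed
    qed
    define e1 where "e1 i = N p (X i - T f p' (\<delta> i))" for i
    have e1: "(e1 \<longlongrightarrow> 0) F"
    proof -
      let ?D = "\<lambda>x. D1 (rep f ?c' ?c) (snd ?c' x)"
      let ?b = "\<lambda>i. tau ?c (q i) (Q (q i) (beta f ?c' ?c (q' i) (w' i) (u' i)))"
      let ?bp = "tau ?c p (Q p (beta f ?c' ?c p' v' r'))"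
      have "tends_TM F (\<lambda>i. f (q' i)) (\<lambda>i. beta f ?c' ?c (q' i) (w' i) (u' i)) (f p') (beta f ?c' ?c p' v' r')"
        by (rule beta_tendsto[OF C2_f c'(1) c(1) c'(2) c'f t])
      then have "tends_TM F q (\<lambda>i. beta f ?c' ?c (q' i) (w' i) (u' i)) p (beta f ?c' ?c p' v' r')" by (simp add: fp)
      from tends_TMD(2)[OF tends_TM_diff[OF this piR_tendsto[OF this]] c]
      have "(?b \<longlongrightarrow> ?bp) F" .
      then have bl: "((\<lambda>i. ?b i - ?bp) \<longlongrightarrow> 0) F" by (rule LIM_zero)
      have dl: "((\<lambda>i. (?D (q' i) - ?D p') (a i)) \<longlongrightarrow> 0) F"
        by (rule small[OF rep_D_tendsto(1)[OF C2_f c'(1) c(1) c'(2) c'f tends_TMD(1)[OF t(1)]]])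
      have "((\<lambda>i. N p (tau_inv ?c p ((?D (q' i) - ?D p') (a i) + (?b i - ?bp)))) \<longlongrightarrow> 0) F"
        by (intro N_tau_inv_0 c) (use tendsto_add[OF dl bl] in simp)
      then show ?thesis
      proof (rule Lim_transform_eventually)
        show "\<forall>\<^sub>F i in F. N p (tau_inv ?c p ((?D (q' i) - ?D p') (a i) + (?b i - ?bp))) = e1 i"
          using chart_tendsto(2)[OF tends_TMD(1)[OF t(1)] c'] chart_tendsto(2)[OF tends_TMD(1)[OF Suc.prems(1)] c]
        proof eventually_elim
          case (elim i)
          have nat1: "tau ?c (f (q' i)) (T f (q' i) z) = ?D (q' i) (tau ?c' (q' i) z)" for z
            by (rule tau_natural[OF C2_f c'(1) c(1) elim(1)]) (use elim fp in simp)
          have nat0: "tau ?c (f p') (T f p' z) = ?D p' (tau ?c' p' z)" for z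
            by (rule tau_natural[OF C2_f c'(1) c(1) c'(2) c'f])
          have "hc ?c (f (q' i)) (T f (q' i) (w' i)) (T f (q' i) (u' i)) =
              T f (q' i) (hc ?c' (q' i) (w' i) (u' i)) + Q (f (q' i)) (beta f ?c' ?c (q' i) (w' i) (u' i))"
            by (rule hc_transform[OF m(1,2) c'(1) c(1) elim(1)]) (use elim fp in simp)
          then have 1: "tau ?c (q i) (hc ?c (q i) (w i) (u i)) = ?D (q' i) (a i) + ?b i"
            using nat1[of "hc ?c' (q' i) (w' i) (u' i)"] c(1) elim(2) by (simp only: fp Tp a_def tau_simps(1))
          have "hc ?c (f p') (T f p' v') (T f p' r') = T f p' (hc ?c' p' v' r') + Q (f p') (beta f ?c' ?c p' v' r')"
            by (rule hc_transform[OF m(3,4) c'(1) c(1) c'(2) c'f])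
          then have 0: "tau ?c p (h p v r) = ?D p' a0 + ?bp"
            using nat0[of "h p' v' r'"] c by (simp only: fp Tp a0_def tau_simps(1) hc_cc)
          have "tau ?c p (T f p' (\<delta> i)) = ?D p' (a i - a0)"
            using nat0[of "\<delta> i"] by (simp add: fp ad)
          moreover have "tau ?c p (X i) = ?D (q' i) (a i) + ?b i - (?D p' a0 + ?bp)"
            unfolding X_def tau_simps(2)[OF c] 0 tr_def tau_tau_inv[OF c] 1 ..
          ultimately have "tau ?c p (X i - T f p' (\<delta> i)) = (?D (q' i) - ?D p') (a i) + (?b i - ?bp)"
            by (simp add: tau_simps(2)[OF c] blinfun.diff_left blinfun.diff_right)
          then show ?case using tau_inv_tau[OF c] by (metis e1_def)
        qed
      qed
    qed
    have split: "N p (X i) \<le> e1 i + C0 * e2 i + N p (T f p' (Q p' (\<delta> i)))" "N p' (Q p' (\<delta> i)) \<le> N p' (\<delta> i) + e2 i" for i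
    proof -
      have "X i = (X i - T f p' (\<delta> i)) + (T f p' (piR p' (\<delta> i)) + T f p' (Q p' (\<delta> i)))"
        by (simp add: T_simps[OF C2_f])
      then have "N p (X i) \<le> e1 i + (N p (T f p' (piR p' (\<delta> i))) + N p (T f p' (Q p' (\<delta> i))))"
        unfolding e1_def by (metis N_triangle add_left_mono order_trans)
      moreover have "N p (T f p' (piR p' (\<delta> i))) \<le> C0 * e2 i"
        using C0(2)[of p' "piR p' (\<delta> i)"] by (simp add: fp e2_def)
      ultimately show "N p (X i) \<le> e1 i + C0 * e2 i + N p (T f p' (Q p' (\<delta> i)))" by linarith
      show "N p' (Q p' (\<delta> i)) \<le> N p' (\<delta> i) + e2 i" unfolding e2_def by (rule N_diff)
    qed
    have "\<exists>M\<ge>0. \<forall>i \<eta>. N p' (\<delta> i) \<le> C * k ^ n * N p' v' * N p' r' + \<eta> \<longrightarrow> e2 i \<le> \<eta> \<longrightarrow> 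
        N p (T f p' (Q p' (\<delta> i))) \<le> C * k ^ Suc n * N p v * N p r + M * \<eta>"
    proof (cases "v' = 0 \<or> r' = 0")
      case True
      show ?thesis
      proof (intro exI[of _ "2 * C0"] conjI allI impI)
        fix i \<eta> assume "N p' (\<delta> i) \<le> C * k ^ n * N p' v' * N p' r' + \<eta>" "e2 i \<le> \<eta>"
        then have qd: "N p' (Q p' (\<delta> i)) \<le> 2 * \<eta>" using split(2)[of i] True by auto
        have "N p (T f p' (Q p' (\<delta> i))) \<le> C0 * (2 * \<eta>)"
          using order_trans[OF C0(2)[of p' "Q p' (\<delta> i)"] mult_left_mono[OF qd]] C0(1) by (simp add: fp)
        moreover have "0 \<le> C * k ^ Suc n * N p v * N p r" using C k0 by simp
        ultimately show "N p (T f p' (Q p' (\<delta> i))) \<le> C * k ^ Suc n * N p v * N p r + 2 * C0 * \<eta>" by simp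
      qed (use C0 in simp)
    next
      case False
      then have pos: "0 < N p' r' * N p' v'" by (auto intro!: mult_pos_pos N_pos)
      let ?M = "k * 2 * (N p r * N p v) / (N p' r' * N p' v')"
      show ?thesis
      proof (intro exI[of _ ?M] conjI allI impI)
        fix i \<eta> assume *: "N p' (\<delta> i) \<le> C * k ^ n * N p' v' * N p' r' + \<eta>" "e2 i \<le> \<eta>"
        have "N p (T f p' (Q p' (\<delta> i))) * N p' r' * N p' v' \<le> k * N p' (Q p' (\<delta> i)) * N p r * N p v"
          using bunching[OF m(4) piR_S m(3), of "\<delta> i"] by (simp add: fp Tp)
        also have "\<dots> \<le> k * (C * k ^ n * N p' v' * N p' r' + 2 * \<eta>) * N p r * N p v"
          using split(2)[of i] * k0 by (intro mult_right_mono mult_left_mono) auto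
        also have "\<dots> = (C * k ^ Suc n * N p v * N p r) * (N p' r' * N p' v') + \<eta> * (k * 2 * (N p r * N p v))"
          by (simp add: algebra_simps)
        also have "k * 2 * (N p r * N p v) = ?M * (N p' r' * N p' v')"
          by (rule nonzero_divide_eq_eq[THEN iffD1, OF less_imp_neq[OF pos, symmetric] refl])
        finally have "N p (T f p' (Q p' (\<delta> i))) * (N p' r' * N p' v') \<le> (C * k ^ Suc n * N p v * N p r + ?M * \<eta>) * (N p' r' * N p' v')"
          by (simp only: distrib_left distrib_right mult_ac)
        then show "N p (T f p' (Q p' (\<delta> i))) \<le> C * k ^ Suc n * N p v * N p r + ?M * \<eta>"
          using pos by (simp only: mult_le_cancel_right_pos)
      qed (use k0 pos in simp)
    qed
    then obtain M where M: "M \<ge> 0" "\<And>i \<eta>. N p' (\<delta> i) \<le> C * k ^ n * N p' v' * N p' r' + \<eta> \<Longrightarrow> e2 i \<le> \<eta> \<Longrightarrow>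
        N p (T f p' (Q p' (\<delta> i))) \<le> C * k ^ Suc n * N p v * N p r + M * \<eta>" by blast
    define \<eta> where "\<eta> = \<epsilon> / (1 + C0 + M)"
    have "(1 + C0 + M) * \<eta> = \<epsilon>" using C0(1) M(1) by (simp add: \<eta>_def)
    then have \<eta>: "\<eta> + C0 * \<eta> + M * \<eta> = \<epsilon>" by (simp add: distrib_right)
    have \<eta>0: "\<eta> > 0" using Suc.prems(7) C0(1) M(1) by (simp add: \<eta>_def)
    show ?case
      using IH[OF \<eta>0] order_tendstoD(2)[OF e1 \<eta>0] order_tendstoD(2)[OF e2 \<eta>0]
    proof eventually_elim
      case (elim i)
      have "C0 * e2 i \<le> C0 * \<eta>" using elim(3) C0(1) by (intro mult_left_mono) auto
      then show ?case using split(1)[of i] M(2)[OF elim(1)] elim \<eta> by (simp add: X_def)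
    qed
  qed
  then show ?thesis using C by (intro exI[of _ C]) blast
qed

text \<open>The oscillation at a point is at most \<open>C * k ^ n\<close> for all \<open>n\<close>, hence zero.\<close>

lemma hc_tendsto:
  assumes w: "tends_TM F q w p v" and u: "tends_TM F q u p r" and m: "\<And>i. w i \<in> E (q i)" "\<And>i. u i \<in> R (q i)"
    and vr: "v \<in> E p" "r \<in> R p" and c: "c \<in> A" "p \<in> fst c"
  shows "tends_TM F q (\<lambda>i. hc c (q i) (w i) (u i)) p (hc c p v r)"
proof -
  note q = tends_TMD(1)[OF w]
  let ?c = "cc p"
  obtain C where C0: "C > 0" and osc: "\<forall>n p v r q w u \<epsilon>. tends_TM F q w p v \<longrightarrow> tends_TM F q u p r \<longrightarrow>
     (\<forall>i. w i \<in> E (q i) \<and> u i \<in> R (q i)) \<longrightarrow> v \<in> E p \<longrightarrow> r \<in> R p \<longrightarrow> 0 < \<epsilon> \<longrightarrow>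
     (\<forall>\<^sub>F i in F. N p (tr p (q i) (hc (cc p) (q i) (w i) (u i)) - h p v r) \<le> C * k ^ n * N p v * N p r + \<epsilon>)"
    by (rule exE[OF hc_oscillation[of F]], elim conjE, rule that, assumption, assumption)
  have C: "C > 0" "\<And>n \<epsilon>. 0 < \<epsilon> \<Longrightarrow>
     \<forall>\<^sub>F i in F. N p (tr p (q i) (hc ?c (q i) (w i) (u i)) - h p v r) \<le> C * k ^ n * N p v * N p r + \<epsilon>"
    using C0 osc[rule_format, OF w u _ vr] m by auto
  obtain Cn where Cn: "Cn > 0" "\<And>w. norm w \<le> Cn * N p (tau_inv ?c p w)"
    using norm_bounds cc_in by blast
  have "tends_TM F q (\<lambda>i. hc ?c (q i) (w i) (u i)) p (hc ?c p v r)"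
  proof (rule tends_TMI[OF q cc_A cc_in(2)], rule tendstoI)
    fix e :: real assume e: "0 < e"
    define \<epsilon> where "\<epsilon> = e / (3 * Cn)"
    have \<epsilon>: "0 < \<epsilon>" using e Cn by (simp add: \<epsilon>_def)
    have "(\<lambda>n. C * k ^ n * N p v * N p r) \<longlonglongrightarrow> C * 0 * N p v * N p r"
      by (intro tendsto_intros LIMSEQ_realpow_zero) (use k0 k1 in auto)
    then have "\<forall>\<^sub>F n in sequentially. C * k ^ n * N p v * N p r < \<epsilon>"
      using order_tendstoD(2)[of _ "C * 0 * N p v * N p r" sequentially \<epsilon>] \<epsilon> by simp
    then obtain n where n: "C * k ^ n * N p v * N p r < \<epsilon>" using eventually_happens by force
    show "\<forall>\<^sub>F i in F. dist (tau ?c (q i) (hc ?c (q i) (w i) (u i))) (tau ?c p (hc ?c p v r)) < e"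
      using C(2)[OF \<epsilon>, of n]
    proof eventually_elim
      case (elim i)
      let ?d = "tau ?c (q i) (hc ?c (q i) (w i) (u i)) - tau ?c p (hc ?c p v r)"
      have "tau_inv ?c p ?d = tr p (q i) (hc ?c (q i) (w i) (u i)) - h p v r"
        using cc_A cc_in by (simp add: tau_inv_simps tr_def)
      then have b: "N p (tau_inv ?c p ?d) \<le> 2 * \<epsilon>" using elim n by simp
      have "norm ?d \<le> Cn * (2 * \<epsilon>)" using order_trans[OF Cn(2) mult_left_mono[OF b]] Cn(1) by simp
      also have "\<dots> < e" using e Cn by (simp add: \<epsilon>_def)
      finally show ?case by (simp add: dist_norm)
    qed
  qed
  moreover have "tends_TM F q (\<lambda>i. beta id ?c c (q i) (w i) (u i)) p (beta id ?c c p v r)"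
    using beta_tendsto[OF C2_id cc_A c(1) cc_in(2), of p] w u c by simp
  note b = tends_TM_diff[OF this piR_tendsto[OF this]]
  ultimately have s: "tends_TM F q (\<lambda>i. hc ?c (q i) (w i) (u i) + Q (q i) (beta id ?c c (q i) (w i) (u i))) p
      (hc ?c p v r + Q p (beta id ?c c p v r))"
    using tends_TM_lincomb[of F q _ p _ _ _ 1 1, OF _ b] by simp
  have e: "hc c p v r = hc ?c p v r + Q p (beta id ?c c p v r)"
    by (rule hc_change[OF cc_A c(1) cc_in(2) c(2)])
  show ?thesis
  proof (rule tends_TMI[OF q c])
    show "((\<lambda>i. tau c (q i) (hc c (q i) (w i) (u i))) \<longlongrightarrow> tau c p (hc c p v r)) F"
      unfolding e
    proof (rule Lim_transform_eventually[OF tends_TMD(2)[OF s c]])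
      show "\<forall>\<^sub>F i in F. tau c (q i) (hc ?c (q i) (w i) (u i) + Q (q i) (beta id ?c c (q i) (w i) (u i))) =
         tau c (q i) (hc c (q i) (w i) (u i))"
        using chart_tendsto(2)[OF q c] chart_tendsto(2)[OF q cc_A cc_in(2)]
        by eventually_elim (use hc_change[OF cc_A c(1)] in metis)
    qed
  qed
qed

end

section \<open>Differentiability along arcs\<close>

context dominated_charts
begin

text \<open>Taylor expansion of the derivative of \<open>f\<close> along the arc: to first order, the error in \<open>tr_T_error\<close> is the second
  derivative.\<close>

lemma T_first_order:
  assumes arc: "E_arc {a..b} \<gamma> w" and s: "s \<in> {a..b}" and \<eta>: "0 < \<eta>"
  defines "x \<equiv> \<gamma> s"
  shows "\<forall>\<^sub>F t in at s within {a..b}. \<forall>r. N (f x) (tr (f x) (f (\<gamma> t)) (T f (\<gamma> t) r) - T f x (tr x (\<gamma> t) r)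
      - (t - s) *\<^sub>R beta f (cc x) (cc (f x)) x (w s) (tr x (\<gamma> t) r)) \<le> \<eta> * \<bar>t - s\<bar> * N x (tr x (\<gamma> t) r)"
proof -
  let ?F = "at s within {a..b}" and ?c = "cc x" and ?c' = "cc (f x)"
  let ?D = "\<lambda>y. D1 (rep f ?c ?c') (snd ?c y)"
  let ?D2 = "D2 (rep f ?c ?c') (snd ?c x) (tau ?c x (w s))"
  note lim = E_arcD(3)[OF arc s]
  have c: "?c \<in> A" "x \<in> fst ?c" "?c' \<in> A" "f x \<in> fst ?c'" using cc_A cc_in by auto
  obtain Cn where Cn: "Cn > 0" "\<And>c x w. c \<in> range cc \<Longrightarrow> x \<in> K c \<Longrightarrow> norm w \<le> Cn * N x (tau_inv c x w) \<and> N x (tau_inv c x w) \<le> Cn * norm w"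
    using norm_bounds by blast
  have d: "((\<lambda>t. snd ?c (\<gamma> t)) has_vector_derivative tau ?c x (w s)) ?F"
    using E_arcD(4)[OF arc s c(1)] c(2) by (simp add: x_def)
  have "(D1 (rep f ?c ?c') has_derivative D2 (rep f ?c ?c') (snd ?c x)) (at (snd ?c x) within (\<lambda>t. snd ?c (\<gamma> t)) ` {a..b})"
    using rep_D2[OF C2_f c(1,3,2,4)] has_derivative_at_withinI by blast
  from vector_derivative_diff_chain_within[OF d[unfolded x_def] this[unfolded x_def]]
  have "((\<lambda>t. ?D (\<gamma> t)) has_vector_derivative ?D2) ?F"
    by (simp add: comp_def x_def)
  moreover have "0 < \<eta> / (Cn * Cn)" using \<eta> Cn by simp
  ultimately have "\<forall>\<^sub>F t in ?F. norm (?D (\<gamma> t) - ?D (\<gamma> s) - (t - s) *\<^sub>R ?D2) \<le> \<eta> / (Cn * Cn) * norm (t - s)"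
    unfolding has_vector_derivative_def has_derivative_within_alt2 by blast
  moreover have "\<forall>\<^sub>F t in ?F. \<gamma> t \<in> fst ?c"
    using chart_tendsto(2)[OF lim c(1)] c(2) by (simp add: x_def)
  moreover have "\<forall>\<^sub>F t in ?F. f (\<gamma> t) \<in> fst ?c'"
    using chart_tendsto(2)[OF C2_tendsto[OF C2_f lim] c(3)] c(4) by (simp add: x_def)
  ultimately show ?thesis
  proof eventually_elim
    case (elim t)
    show ?case
    proof
      fix r
      let ?y = "\<gamma> t" and ?z = "tau ?c (\<gamma> t) r"
      let ?L = "?D ?y - ?D x - (t - s) *\<^sub>R ?D2"
      have tz: "tau ?c x (tr x ?y r) = ?z" using c by (simp add: tr_def)
      have 1: "tau ?c' (f ?y) (T f ?y r) = ?D ?y ?z" by (rule tau_natural[OF C2_f c(1,3) elim(2,3)])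
      have 2: "T f x (tr x ?y r) = tau_inv ?c' (f x) (?D x ?z)"
        using tau_natural[OF C2_f c(1,3,2,4), of "tr x ?y r"] c tz by (metis tau_inv_tau)
      have "tr (f x) (f ?y) (T f ?y r) - T f x (tr x ?y r) - (t - s) *\<^sub>R beta f ?c ?c' x (w s) (tr x ?y r)
          = tau_inv ?c' (f x) (?L ?z)"
        unfolding tr_def[of "f x"] 1 2 beta_def tz
        by (simp add: tau_inv_simps blinfun.diff_left blinfun.scaleR_left)
      then have "N (f x) (tr (f x) (f ?y) (T f ?y r) - T f x (tr x ?y r) - (t - s) *\<^sub>R beta f ?c ?c' x (w s) (tr x ?y r))
          \<le> Cn * norm (?L ?z)"
        using Cn(2)[of ?c' "f x"] cc_in by auto
      also have "norm (?L ?z) \<le> (\<eta> / (Cn * Cn) * \<bar>t - s\<bar>) * (Cn * N x (tr x ?y r))"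
      proof (intro order_trans[OF norm_blinfun] mult_mono)
        show "norm ?L \<le> \<eta> / (Cn * Cn) * \<bar>t - s\<bar>" using elim(1) by (simp add: x_def)
        show "norm ?z \<le> Cn * N x (tr x ?y r)" using Cn(2)[of ?c x ?z] cc_in by (auto simp: tr_def)
      qed (use \<eta> in auto)
      finally show "N (f x) (tr (f x) (f ?y) (T f ?y r) - T f x (tr x ?y r) - (t - s) *\<^sub>R beta f ?c ?c' x (w s) (tr x ?y r))
          \<le> \<eta> * \<bar>t - s\<bar> * N x (tr x ?y r)"
        using Cn(1) by (simp add: field_simps)
    qed
  qed
qed

text \<open>The relative error of the first order approximation of \<open>R\<close> by \<open>h\<close> along an arc is bounded because
  \<open>R\<close> is Lipschitz along the arc and \<open>h\<close> is bounded. Both \<open>R\<close> and \<open>h\<close> are invariant, so the error at a point is obtained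
  from the error at its preimage, and by bunching it is contracted. Going back \<open>n\<close> steps along the fixed
  arc shows that it is at most \<open>C * k' ^ n\<close>.\<close>

definition first_order :: "(real \<Rightarrow> 'm) \<Rightarrow> (real \<Rightarrow> 'e) \<Rightarrow> real \<Rightarrow> real \<Rightarrow> real \<Rightarrow> bool" where
  "first_order \<gamma> w s t \<epsilon> \<longleftrightarrow> (\<forall>r\<in>R (\<gamma> t). let x = \<gamma> s; u = tr x (\<gamma> t) r in
     N x (Q x u - (t - s) *\<^sub>R h x (w s) (piR x u)) \<le> \<epsilon> * \<bar>t - s\<bar> * N x (piR x u))"

lemma first_order_iterated:
  "\<exists>C>0. \<forall>n a b \<gamma> w s \<epsilon>. E_arc {a..b} \<gamma> w \<longrightarrow> s \<in> {a..b} \<longrightarrow> 0 < \<epsilon> \<longrightarrow>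
     (\<forall>\<^sub>F t in at s within {a..b}. first_order \<gamma> w s t (C * k' ^ n * N (\<gamma> s) (w s) + \<epsilon>))"
proof -
  obtain L where L: "L > 0" and slope: "\<And>a b \<gamma> w s \<epsilon>. E_arc {a..b} \<gamma> w \<Longrightarrow> s \<in> {a..b} \<Longrightarrow> 0 < \<epsilon> \<Longrightarrow>
     \<forall>\<^sub>F t in at s within {a..b}. slope (\<gamma> s) (\<gamma> t) (L * (N (\<gamma> s) (w s) + \<epsilon>) * \<bar>t - s\<bar>)"
    using slope_arc_local by blast
  obtain Ch where Ch: "Ch > 0" "\<And>x v r. v \<in> E x \<Longrightarrow> r \<in> R x \<Longrightarrow> N x (h x v r) \<le> Ch * N x v * N x r" using h_bound by blast
  obtain Cb where Cb: "Cb > 0" "\<And>c c' x v r. c \<in> range cc \<Longrightarrow> c' \<in> range cc \<Longrightarrow> x \<in> K c \<Longrightarrow> f x \<in> K c' \<Longrightarrow>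
    N (f x) (beta f c c' x v r) \<le> Cb * N x v * N x r" using beta_bound[OF C2_f] by blast
  obtain Cp where Cp: "Cp \<ge> 1" "\<And>p v. N p (piR p v) \<le> Cp * N p v" "\<And>p v. N p (Q p v) \<le> Cp * N p v" using piR_bound by blast
  obtain C0 where C0: "C0 \<ge> 1" "\<And>p v. N p v \<le> C0 * N (f p) (T f p v)" using T_f_bound by blast
  obtain er where er: "er > 0" and rate: "\<And>x. \<exists>\<kappa>\<ge>0. \<kappa> \<le> k' \<and> contracts x \<kappa> \<and>
     (\<forall>y v. y \<in> fst (cc x) \<longrightarrow> cdist x y < er \<longrightarrow> v \<in> E y \<longrightarrow> \<kappa> * N y v \<le> k' * N (f y) (T f y v))"
    using contraction_rate by blast
  define C where "C = L + Ch"
  have C: "C > 0" using L Ch by (simp add: C_def)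
  have "\<forall>\<^sub>F t in at s within {a..b}. first_order \<gamma> w s t (C * k' ^ n * N (\<gamma> s) (w s) + \<epsilon>)"
    if "E_arc {a..b} \<gamma> w" "s \<in> {a..b}" "0 < \<epsilon>" for n a b \<gamma> w s \<epsilon>
    using that
  proof (induction n arbitrary: \<gamma> w \<epsilon>)
    case 0
    have "0 < \<epsilon> / L" using 0 L by simp
    from slope[OF 0(1,2) this] show ?case
    proof eventually_elim
      case (elim t)
      show ?case unfolding first_order_def Let_def
      proof
        fix r assume r: "r \<in> R (\<gamma> t)"
        let ?x = "\<gamma> s" and ?u = "tr (\<gamma> s) (\<gamma> t) r"
        have 1: "N ?x (Q ?x ?u) \<le> L * (N ?x (w s) + \<epsilon> / L) * \<bar>t - s\<bar> * N ?x (piR ?x ?u)"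
          using elim r by (auto simp: slope_def)
        have "N ?x (h ?x (w s) (piR ?x ?u)) \<le> Ch * N ?x (w s) * N ?x (piR ?x ?u)"
          by (intro Ch E_arcD(1)[OF 0(1,2)] piR_R)
        then have 2: "\<bar>t - s\<bar> * N ?x (h ?x (w s) (piR ?x ?u)) \<le> \<bar>t - s\<bar> * (Ch * N ?x (w s) * N ?x (piR ?x ?u))"
          by (intro mult_left_mono) auto
        have "L * (N ?x (w s) + \<epsilon> / L) = L * N ?x (w s) + \<epsilon>" using L by (simp add: field_simps)
        with 1 have 3: "N ?x (Q ?x ?u) \<le> (L * N ?x (w s) + \<epsilon>) * \<bar>t - s\<bar> * N ?x (piR ?x ?u)" by simp
        have "N ?x (Q ?x ?u - (t - s) *\<^sub>R h ?x (w s) (piR ?x ?u)) \<le> N ?x (Q ?x ?u) + \<bar>t - s\<bar> * N ?x (h ?x (w s) (piR ?x ?u))"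
          using N_diff[of ?x "Q ?x ?u" "(t - s) *\<^sub>R h ?x (w s) (piR ?x ?u)"] by simp
        also have "\<dots> \<le> (L * N ?x (w s) + \<epsilon>) * \<bar>t - s\<bar> * N ?x (piR ?x ?u) + \<bar>t - s\<bar> * (Ch * N ?x (w s) * N ?x (piR ?x ?u))"
          by (intro add_mono 2 3)
        also have "\<dots> = (C * k' ^ 0 * N ?x (w s) + \<epsilon>) * \<bar>t - s\<bar> * N ?x (piR ?x ?u)"
          by (simp add: C_def algebra_simps)
        finally show "N ?x (Q ?x ?u - (t - s) *\<^sub>R h ?x (w s) (piR ?x ?u))
          \<le> (C * k' ^ 0 * N ?x (w s) + \<epsilon>) * \<bar>t - s\<bar> * N ?x (piR ?x ?u)" .
      qed
    qed
  next
    case (Suc n)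
    let ?F = "at s within {a..b}"
    define \<beta> where "\<beta> t = g (\<gamma> t)" for t
    define w' where "w' t = T g (\<gamma> t) (w t)" for t
    define x v where "x = \<beta> s" and "v = w' s"
    have arc: "E_arc {a..b} \<beta> w'" using E_arc_back[OF Suc.prems(1)] by (simp add: \<beta>_def[abs_def] w'_def[abs_def])
    have f\<beta>: "f (\<beta> t) = \<gamma> t" "T f (\<beta> t) (w' t) = w t" for t by (simp_all add: \<beta>_def w'_def)
    have fx: "\<gamma> s = f x" "w s = T f x v" using f\<beta>[of s] by (simp_all add: x_def v_def)
    have v: "v \<in> E x" using E_arcD(1)[OF arc Suc.prems(2)] by (simp add: x_def v_def)
    obtain \<kappa> where \<kappa>: "0 \<le> \<kappa>" "\<kappa> \<le> k'" "contracts x \<kappa>" "\<kappa> * N x v \<le> k' * N (f x) (T f x v)"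
      using rate[of x] cc_in er v by (metis diff_self norm_zero)
    define X where "X = C * k' ^ Suc n * N (f x) (T f x v)"
    have X: "0 \<le> X" using C k' by (simp add: X_def)
    (* the constants are chosen such that each part of the error is at most a fraction of \<epsilon> *)
    define e1 where "e1 = \<epsilon> / 8"
    define \<eta>2 where "\<eta>2 = \<epsilon> / (2 * (X + \<epsilon>))"
    define \<eta>' where "\<eta>' = e1 / C0"
    define \<eta> where "\<eta> = \<eta>' / (4 * Cp)"
    define c1 where "c1 = L * (N x v + 1)"
    define c2 where "c2 = Cp * (Cb * N x v + \<eta>) * 2"
    define M where "M = Cp * Cb * N x v * c1 + Ch * N (f x) (T f x v) * c2"
    define \<tau> where "\<tau> = min (1 / c1) (min (\<eta>' / (2 * (M + 1))) (\<eta>2 / (2 * (c2 * C0 + 1))))"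
    have e: "0 < \<epsilon>" using Suc.prems by simp
    have c1: "0 < c1" unfolding c1_def using L by (intro mult_pos_pos add_nonneg_pos) auto
    have \<eta>: "0 < e1" "0 < \<eta>'" "0 < \<eta>" using e C0(1) Cp(1) by (simp_all add: e1_def \<eta>'_def \<eta>_def)
    have \<eta>2: "0 < \<eta>2" "\<eta>2 \<le> 1 / 2" using e X by (simp_all add: \<eta>2_def field_simps)
    have c2: "0 \<le> c2" unfolding c2_def using Cp(1) Cb(1) \<eta> by (intro mult_nonneg_nonneg add_nonneg_nonneg) auto
    have "0 \<le> M" unfolding M_def using Cp(1) Cb(1) Ch(1) c1 c2 by (intro mult_nonneg_nonneg add_nonneg_nonneg) auto
    with c1 \<eta> \<eta>2 c2 have pos: "0 < e1" "0 < \<eta>2" "\<eta>2 \<le> 1 / 2" "0 < \<eta>'" "0 < \<eta>" "0 < c1" "0 \<le> c2" "0 \<le> M" by auto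
    have \<tau>: "0 < \<tau>" using pos C0 by (auto simp: \<tau>_def add_nonneg_pos)
    have ev\<tau>: "\<forall>\<^sub>F t in ?F. \<bar>t - s\<bar> < \<tau>"
      unfolding eventually_at using \<tau> by (intro exI[of _ \<tau>]) (auto simp: dist_real_def)
    show ?case
      using Suc.IH[OF arc Suc.prems(2) pos(1)] slope[OF arc Suc.prems(2) zero_less_one]
        T_first_order[OF arc Suc.prems(2) pos(5)] ev\<tau>
    proof eventually_elim
      case (elim t)
      define \<theta> where "\<theta> = t - s"
      have \<theta>: "\<bar>\<theta>\<bar> < \<tau>" using elim(4) by (simp add: \<theta>_def)
      have small: "c1 * \<bar>\<theta>\<bar> \<le> 1" "M * \<bar>\<theta>\<bar> \<le> \<eta>' / 2" "c2 * C0 * \<bar>\<theta>\<bar> \<le> \<eta>2 / 2"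
      proof -
        have "\<bar>\<theta>\<bar> \<le> 1 / c1" using \<theta> by (simp add: \<tau>_def)
        then show "c1 * \<bar>\<theta>\<bar> \<le> 1" using pos by (simp add: field_simps)
        have "\<bar>\<theta>\<bar> \<le> \<eta>' / (2 * (M + 1))" using \<theta> by (simp add: \<tau>_def)
        then have "(M + 1) * \<bar>\<theta>\<bar> \<le> \<eta>' / 2" using pos by (simp add: field_simps)
        then show "M * \<bar>\<theta>\<bar> \<le> \<eta>' / 2" by (simp add: distrib_right)
        have "\<bar>\<theta>\<bar> \<le> \<eta>2 / (2 * (c2 * C0 + 1))" using \<theta> by (simp add: \<tau>_def)
        moreover have "0 \<le> c2 * C0" using pos C0 by simp
        ultimately have "(c2 * C0 + 1) * \<bar>\<theta>\<bar> \<le> \<eta>2 / 2" by (simp add: field_simps)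
        then show "c2 * C0 * \<bar>\<theta>\<bar> \<le> \<eta>2 / 2" by (simp add: distrib_right)
      qed
      show ?case unfolding first_order_def Let_def
      proof
        fix r' assume "r' \<in> R (\<gamma> t)"
        then have "r' \<in> T f (\<beta> t) ` R (\<beta> t)" using T_R[of "\<beta> t"] by (simp add: f\<beta>)
        then obtain r where r: "r \<in> R (\<beta> t)" "r' = T f (\<beta> t) r" by blast
        define u where "u = tr x (\<beta> t) r"
        define \<rho> \<sigma> where "\<rho> = piR x u" and "\<sigma> = Q x u"
        have u: "u = \<rho> + \<sigma>" "\<rho> \<in> R x" "\<sigma> \<in> S x" by (auto simp: \<rho>_def \<sigma>_def)
        define bt where "bt = beta f (cc x) (cc (f x)) x v"
        have bt: "N (f x) (bt z) \<le> Cb * N x v * N x z" for z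
          unfolding bt_def by (rule Cb) (use cc_in in auto)
        have bt_add: "bt (y + z) = bt y + bt z" for y z unfolding bt_def by (rule beta_cc_simps(5))
        define U where "U = tr (f x) (\<gamma> t) r'"
        define err where "err = U - T f x u - \<theta> *\<^sub>R bt u"
        have sl: "N x \<sigma> \<le> c1 * \<bar>\<theta>\<bar> * N x \<rho>"
          using elim(2) r(1) by (auto simp: slope_def \<rho>_def \<sigma>_def u_def x_def v_def c1_def \<theta>_def)
        have "c1 * \<bar>\<theta>\<bar> * N x \<rho> \<le> 1 * N x \<rho>" using small(1) by (intro mult_right_mono) auto
        then have Nu: "N x u \<le> 2 * N x \<rho>" using sl N_triangle[of x \<rho> \<sigma>] u(1) by simp
        have err: "N (f x) err \<le> \<eta> * \<bar>\<theta>\<bar> * (2 * N x \<rho>)"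
        proof -
          have "N (f x) err \<le> \<eta> * \<bar>\<theta>\<bar> * N x u"
            using elim(3)[rule_format, of r] by (simp add: err_def U_def bt_def u_def \<theta>_def r(2) f\<beta> fx[symmetric] flip: x_def v_def)
          also have "\<dots> \<le> \<eta> * \<bar>\<theta>\<bar> * (2 * N x \<rho>)" using Nu pos by (intro mult_left_mono) auto
          finally show ?thesis .
        qed
        define \<rho>' where "\<rho>' = piR (f x) U"
        have U: "U = T f x \<rho> + T f x \<sigma> + (\<theta> *\<^sub>R bt u + err)" by (simp add: err_def u(1) T_simps[OF C2_f])
        have \<rho>': "\<rho>' = T f x \<rho> + piR (f x) (\<theta> *\<^sub>R bt u + err)"
          unfolding \<rho>'_def U piR_simps(1) using R_T[OF u(2)] S_T[OF u(3)] by simp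
        have diff: "N (f x) (\<rho>' - T f x \<rho>) \<le> c2 * \<bar>\<theta>\<bar> * N x \<rho>"
        proof -
          have "N (f x) (\<theta> *\<^sub>R bt u) \<le> \<bar>\<theta>\<bar> * (Cb * N x v * (2 * N x \<rho>))"
          proof -
            have "N (f x) (bt u) \<le> Cb * N x v * (2 * N x \<rho>)"
              by (rule order_trans[OF bt mult_left_mono[OF Nu]]) (use Cb in simp)
            then show ?thesis by (simp only: N_scale) (intro mult_left_mono, auto)
          qed
          then have "N (f x) (\<theta> *\<^sub>R bt u + err) \<le> \<bar>\<theta>\<bar> * (Cb * N x v * (2 * N x \<rho>)) + \<eta> * \<bar>\<theta>\<bar> * (2 * N x \<rho>)"
            using N_triangle[of "f x" "\<theta> *\<^sub>R bt u" err] err by linarith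
          then have "Cp * N (f x) (\<theta> *\<^sub>R bt u + err) \<le> Cp * (\<bar>\<theta>\<bar> * (Cb * N x v * (2 * N x \<rho>)) + \<eta> * \<bar>\<theta>\<bar> * (2 * N x \<rho>))"
            using Cp(1) by (intro mult_left_mono) auto
          then have "Cp * N (f x) (\<theta> *\<^sub>R bt u + err) \<le> c2 * \<bar>\<theta>\<bar> * N x \<rho>" by (simp add: c2_def algebra_simps)
          then show ?thesis using Cp(2)[of "f x" "\<theta> *\<^sub>R bt u + err"] by (simp add: \<rho>')
        qed
        define \<delta> where "\<delta> = \<sigma> - \<theta> *\<^sub>R h x v \<rho>"
        have \<delta>S: "\<delta> \<in> S x" unfolding \<delta>_def by (intro subspace_diff[OF S_sub] subspace_scale[OF S_sub] h_S u v)
        have \<delta>: "N x \<delta> \<le> (C * k' ^ n * N x v + e1) * \<bar>\<theta>\<bar> * N x \<rho>"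
          using elim(1) r(1) unfolding first_order_def Let_def
          by (auto simp: \<delta>_def \<sigma>_def \<rho>_def u_def x_def v_def \<theta>_def)
        have \<rho>'R: "\<rho>' \<in> R (f x)" "\<rho>' - T f x \<rho> \<in> R (f x)"
          using R_T[OF u(2)] by (auto simp: \<rho>'_def intro: subspace_diff[OF R_sub])
        have "h (f x) (T f x v) \<rho>' = h (f x) (T f x v) (1 *\<^sub>R T f x \<rho> + 1 *\<^sub>R (\<rho>' - T f x \<rho>))" by simp
        also have "\<dots> = h (f x) (T f x v) (T f x \<rho>) + h (f x) (T f x v) (\<rho>' - T f x \<rho>)"
          using h_linear_r[OF E_T[OF v] R_T[OF u(2)] \<rho>'R(2), of 1 1] by simp
        also have "h (f x) (T f x v) (T f x \<rho>) = T f x (h x v \<rho>) + Q (f x) (bt \<rho>)"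
          unfolding bt_def by (rule h_invariant[OF v u(2)])
        finally have h': "h (f x) (T f x v) \<rho>' = T f x (h x v \<rho>) + Q (f x) (bt \<rho>) + h (f x) (T f x v) (\<rho>' - T f x \<rho>)" .
        have QU: "Q (f x) U = T f x \<sigma> + (\<theta> *\<^sub>R Q (f x) (bt u) + Q (f x) err)"
        proof -
          have "Q (f x) U = Q (f x) (T f x \<rho>) + Q (f x) (T f x \<sigma>) + (\<theta> *\<^sub>R Q (f x) (bt u) + Q (f x) err)"
            unfolding U by (simp only: Q_simps)
          then show ?thesis using R_T[OF u(2)] S_T[OF u(3)] by simp
        qed
        have main: "Q (f x) U - \<theta> *\<^sub>R h (f x) (T f x v) \<rho>' =
            T f x \<delta> + (\<theta> *\<^sub>R Q (f x) (bt \<sigma>) + (Q (f x) err - \<theta> *\<^sub>R h (f x) (T f x v) (\<rho>' - T f x \<rho>)))"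
          unfolding QU h' \<delta>_def u(1) bt_add Q_simps(1) T_simps(2,3)[OF C2_f] by (simp add: algebra_simps)
        have p1: "N (f x) (T f x \<delta>) \<le> (X + e1) * \<bar>\<theta>\<bar> * N (f x) (T f x \<rho>)"
        proof (cases "\<rho> = 0")
          case True
          then have "\<delta> = 0" using \<delta> N_nonneg[of x \<delta>] N_eq_0[of x \<delta>] by simp
          then show ?thesis using X pos by (simp add: T_simps[OF C2_f])
        next
          case False
          have "N (f x) (T f x \<delta>) * N x \<rho> \<le> \<kappa> * N x \<delta> * N (f x) (T f x \<rho>)"
            by (rule contractsD[OF \<kappa>(3) u(2) \<delta>S])
          also have "\<dots> \<le> \<kappa> * ((C * k' ^ n * N x v + e1) * \<bar>\<theta>\<bar> * N x \<rho>) * N (f x) (T f x \<rho>)"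
            using \<delta> \<kappa> by (intro mult_right_mono mult_left_mono) auto
          also have "\<dots> = (C * k' ^ n * (\<kappa> * N x v) + \<kappa> * e1) * (\<bar>\<theta>\<bar> * N x \<rho> * N (f x) (T f x \<rho>))"
            by (simp add: algebra_simps)
          also have "\<dots> \<le> (X + e1) * (\<bar>\<theta>\<bar> * N x \<rho> * N (f x) (T f x \<rho>))"
          proof (intro mult_right_mono add_mono)
            show "C * k' ^ n * (\<kappa> * N x v) \<le> X"
              using mult_left_mono[OF \<kappa>(4), of "C * k' ^ n"] C k' by (simp add: X_def mult_ac)
            show "\<kappa> * e1 \<le> e1" using \<kappa> k' pos by (intro mult_left_le_one_le) auto
          qed auto
          finally have "N (f x) (T f x \<delta>) * N x \<rho> \<le> ((X + e1) * \<bar>\<theta>\<bar> * N (f x) (T f x \<rho>)) * N x \<rho>" by (simp add: mult_ac)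
          then show ?thesis using N_pos[OF False, of x] by (simp only: mult_le_cancel_right_pos)
        qed
        have p2: "N (f x) (\<theta> *\<^sub>R Q (f x) (bt \<sigma>)) \<le> \<bar>\<theta>\<bar> * (Cp * Cb * N x v * c1 * \<bar>\<theta>\<bar>) * N x \<rho>"
        proof -
          have "N (f x) (Q (f x) (bt \<sigma>)) \<le> Cp * (Cb * N x v * (c1 * \<bar>\<theta>\<bar> * N x \<rho>))"
            using Cp Cb sl by (intro order_trans[OF Cp(3) mult_left_mono] order_trans[OF bt mult_left_mono]) auto
          then have "\<bar>\<theta>\<bar> * N (f x) (Q (f x) (bt \<sigma>)) \<le> \<bar>\<theta>\<bar> * (Cp * (Cb * N x v * (c1 * \<bar>\<theta>\<bar> * N x \<rho>)))"
            by (intro mult_left_mono) auto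
          then show ?thesis by (simp add: mult_ac)
        qed
        have p3: "N (f x) (Q (f x) err) \<le> \<bar>\<theta>\<bar> * (\<eta>' / 2) * N x \<rho>"
        proof -
          have "N (f x) (Q (f x) err) \<le> Cp * (\<eta> * \<bar>\<theta>\<bar> * (2 * N x \<rho>))"
            using Cp err by (intro order_trans[OF Cp(3) mult_left_mono]) auto
          also have "\<dots> = \<bar>\<theta>\<bar> * (\<eta>' / 2) * N x \<rho>" using Cp(1) by (simp add: \<eta>_def field_simps)
          finally show ?thesis .
        qed
        have p4: "N (f x) (\<theta> *\<^sub>R h (f x) (T f x v) (\<rho>' - T f x \<rho>)) \<le> \<bar>\<theta>\<bar> * (Ch * N (f x) (T f x v) * c2 * \<bar>\<theta>\<bar>) * N x \<rho>"
        proof -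
          have "N (f x) (h (f x) (T f x v) (\<rho>' - T f x \<rho>)) \<le> Ch * N (f x) (T f x v) * (c2 * \<bar>\<theta>\<bar> * N x \<rho>)"
            using Ch diff by (intro order_trans[OF Ch(2)[OF E_T[OF v] \<rho>'R(2)] mult_left_mono]) auto
          then have "\<bar>\<theta>\<bar> * N (f x) (h (f x) (T f x v) (\<rho>' - T f x \<rho>)) \<le> \<bar>\<theta>\<bar> * (Ch * N (f x) (T f x v) * (c2 * \<bar>\<theta>\<bar> * N x \<rho>))"
            by (intro mult_left_mono) auto
          then show ?thesis by (simp add: mult_ac)
        qed
        let ?n = "N (f x) (T f x \<rho>)"
        have "N (f x) (Q (f x) U - \<theta> *\<^sub>R h (f x) (T f x v) \<rho>') \<le> (X + e1) * \<bar>\<theta>\<bar> * ?n +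
            (\<bar>\<theta>\<bar> * (Cp * Cb * N x v * c1 * \<bar>\<theta>\<bar>) * N x \<rho> + (\<bar>\<theta>\<bar> * (\<eta>' / 2) * N x \<rho> + \<bar>\<theta>\<bar> * (Ch * N (f x) (T f x v) * c2 * \<bar>\<theta>\<bar>) * N x \<rho>))"
          unfolding main
          by (rule order_trans[OF N_triangle add_mono[OF p1
                order_trans[OF N_triangle add_mono[OF p2 order_trans[OF N_diff add_mono[OF p3 p4]]]]]])
        also have "\<dots> = (X + e1) * \<bar>\<theta>\<bar> * ?n + \<bar>\<theta>\<bar> * (M * \<bar>\<theta>\<bar> + \<eta>' / 2) * N x \<rho>"
          by (simp add: M_def algebra_simps)
        also have "\<dots> \<le> (X + e1) * \<bar>\<theta>\<bar> * ?n + \<bar>\<theta>\<bar> * (\<eta>' / 2 + \<eta>' / 2) * (C0 * ?n)"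
          using small(2) C0 pos by (intro add_left_mono mult_mono mult_left_mono add_right_mono) auto
        also have "\<dots> = (X + e1 + C0 * \<eta>') * \<bar>\<theta>\<bar> * ?n" by (simp add: algebra_simps)
        also have "\<dots> = (X + \<epsilon> / 4) * \<bar>\<theta>\<bar> * ?n" using C0(1) by (simp add: \<eta>'_def e1_def)
        also have "\<dots> \<le> (X + \<epsilon> / 4) * \<bar>\<theta>\<bar> * ((1 + \<eta>2) * N (f x) \<rho>')"
        proof (intro mult_left_mono)
          have "c2 * \<bar>\<theta>\<bar> * N x \<rho> \<le> c2 * \<bar>\<theta>\<bar> * (C0 * ?n)" using C0(2)[of x \<rho>] pos by (intro mult_left_mono) auto
          also have "\<dots> = (c2 * C0 * \<bar>\<theta>\<bar>) * ?n" by simp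
          also have "\<dots> \<le> \<eta>2 / 2 * ?n" using small(3) by (intro mult_right_mono) auto
          finally have n1: "?n * (1 - \<eta>2 / 2) \<le> N (f x) \<rho>'"
            using diff N_diff_le[of "f x" "T f x \<rho>" \<rho>'] N_commute[of "f x" "T f x \<rho>" \<rho>'] by (simp add: algebra_simps)
          have "\<eta>2 * \<eta>2 \<le> \<eta>2 * 1" using pos by (intro mult_left_mono) auto
          then have "1 \<le> (1 - \<eta>2 / 2) * (1 + \<eta>2)" by (simp add: algebra_simps)
          then have "?n * 1 \<le> ?n * ((1 - \<eta>2 / 2) * (1 + \<eta>2))" by (intro mult_left_mono) auto
          also have "\<dots> = (?n * (1 - \<eta>2 / 2)) * (1 + \<eta>2)" by simp
          also have "\<dots> \<le> N (f x) \<rho>' * (1 + \<eta>2)" using n1 pos by (intro mult_right_mono) auto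
          finally show "?n \<le> (1 + \<eta>2) * N (f x) \<rho>'" by (simp add: mult.commute)
        qed (use X e in auto)
        also have "\<dots> = ((X + \<epsilon> / 4) * (1 + \<eta>2)) * (\<bar>\<theta>\<bar> * N (f x) \<rho>')" by simp
        also have "\<dots> \<le> (X + \<epsilon>) * (\<bar>\<theta>\<bar> * N (f x) \<rho>')"
        proof (intro mult_right_mono)
          have "(X + \<epsilon> / 4) * \<eta>2 \<le> (X + \<epsilon>) * \<eta>2" using pos e by (intro mult_right_mono) auto
          also have "\<dots> = \<epsilon> / 2"
          proof -
            have "z * (\<epsilon> / (2 * z)) = \<epsilon> / 2" if "z \<noteq> 0" for z using that by simp
            moreover have "X + \<epsilon> \<noteq> 0" using X e by simp
            ultimately show ?thesis unfolding \<eta>2_def by blast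
          qed
          finally show "(X + \<epsilon> / 4) * (1 + \<eta>2) \<le> X + \<epsilon>" using e by (simp add: distrib_left)
        qed auto
        finally show "N (\<gamma> s) (Q (\<gamma> s) (tr (\<gamma> s) (\<gamma> t) r') - (t - s) *\<^sub>R h (\<gamma> s) (w s) (piR (\<gamma> s) (tr (\<gamma> s) (\<gamma> t) r')))
          \<le> (C * k' ^ Suc n * N (\<gamma> s) (w s) + \<epsilon>) * \<bar>t - s\<bar> * N (\<gamma> s) (piR (\<gamma> s) (tr (\<gamma> s) (\<gamma> t) r'))"
          unfolding fx X_def[symmetric] U_def[symmetric, unfolded fx] \<theta>_def[symmetric] \<rho>'_def[symmetric] by (simp add: mult.assoc)
      qed
    qed
  qed
  then show ?thesis using C by (intro exI[of _ C]) blast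
qed

lemma first_order_h:
  assumes arc: "E_arc {a..b} \<gamma> w" "s \<in> {a..b}" and \<epsilon>: "0 < \<epsilon>"
  shows "\<forall>\<^sub>F t in at s within {a..b}. first_order \<gamma> w s t \<epsilon>"
proof -
  obtain C where C: "C > 0" "\<And>n \<epsilon>. 0 < \<epsilon> \<Longrightarrow>
     \<forall>\<^sub>F t in at s within {a..b}. first_order \<gamma> w s t (C * k' ^ n * N (\<gamma> s) (w s) + \<epsilon>)"
    using first_order_iterated arc by blast
  have e: "0 < \<epsilon> / 2" using \<epsilon> by simp
  have "(\<lambda>n. C * k' ^ n * N (\<gamma> s) (w s)) \<longlonglongrightarrow> C * 0 * N (\<gamma> s) (w s)"
    by (intro tendsto_intros LIMSEQ_realpow_zero) (use k' in auto)
  then have "\<forall>\<^sub>F n in sequentially. C * k' ^ n * N (\<gamma> s) (w s) < \<epsilon> / 2"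
    using order_tendstoD(2)[of _ "C * 0 * N (\<gamma> s) (w s)" sequentially "\<epsilon> / 2"] \<epsilon> by simp
  then obtain n where n: "C * k' ^ n * N (\<gamma> s) (w s) < \<epsilon> / 2" using eventually_happens by force
  show ?thesis using C(2)[OF e, of n]
  proof eventually_elim
    case (elim t)
    have "C * k' ^ n * N (\<gamma> s) (w s) + \<epsilon> / 2 \<le> \<epsilon>" using n by simp
    then show ?case using elim unfolding first_order_def Let_def
      by (meson N_nonneg abs_ge_zero mult_right_mono order_trans)
  qed
qed

end

section \<open>Planes as graphs\<close>

context dominated_charts
begin

abbreviation V\<^sub>0 :: "'e set" where "V\<^sub>0 \<equiv> ref_plane d"
abbreviation W\<^sub>0 :: "'e set" where "W\<^sub>0 \<equiv> orthogonal_comp (ref_plane d)"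

lemma V0: "subspace V\<^sub>0" "dim V\<^sub>0 = d"
proof -
  have "\<exists>V :: 'e set. subspace V \<and> dim V = d" using R_sub dim_R by blast
  from someI_ex[OF this] show "subspace V\<^sub>0" "dim V\<^sub>0 = d" by (auto simp: ref_plane_def)
qed

lemma V0_W0: "complementary V\<^sub>0 W\<^sub>0"
  by (rule complementary_orthogonal[OF V0(1)])

text \<open>The projection onto the reference plane. A coordinate \<open>L\<close> is characterized by \<open>L PB = L\<close> and \<open>PB L = 0\<close>.\<close>

definition PB :: "'e \<Rightarrow>\<^sub>L 'e" where "PB = Blinfun (proj_along V\<^sub>0 W\<^sub>0)"

lemma PB_apply: "PB x = proj_along V\<^sub>0 W\<^sub>0 x"
  unfolding PB_def using proj_along_linear[OF V0_W0]
  by (simp add: bounded_linear_Blinfun_apply linear_conv_bounded_linear)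

lemma PB_V0 [simp]: "PB x \<in> V\<^sub>0" and PB_W0: "x - PB x \<in> W\<^sub>0"
  and PB_id [simp]: "x \<in> V\<^sub>0 \<Longrightarrow> PB x = x" and PB_0: "x \<in> W\<^sub>0 \<Longrightarrow> PB x = 0"
proof -
  have z: "0 \<in> V\<^sub>0" "0 \<in> W\<^sub>0" using V0_W0 subspace_0 by (auto simp: complementary_def)
  show "PB x \<in> V\<^sub>0" "x - PB x \<in> W\<^sub>0" using proj_along_in[OF V0_W0] by (simp_all add: PB_apply)
  show "x \<in> V\<^sub>0 \<Longrightarrow> PB x = x" "x \<in> W\<^sub>0 \<Longrightarrow> PB x = 0"
    using z by (auto simp: PB_apply intro!: proj_along_unique[OF V0_W0])
qed

lemma homD:
  assumes "L \<in> hom_model d"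
  shows "blinfun_apply L (PB x) = L x" "PB (L x) = 0" "L (L x) = 0"
proof -
  have z: "L y = 0" if "y \<in> W\<^sub>0" for y using assms that by (auto simp: hom_model_def)
  have "L (x - PB x) = 0" using z PB_W0 by blast
  then show 1: "L (PB x) = L x" by (simp add: blinfun.diff_right)
  have "L (PB x) \<in> W\<^sub>0" using assms PB_V0 by (auto simp: hom_model_def)
  then have "L x \<in> W\<^sub>0" by (simp add: 1)
  then show "PB (L x) = 0" "L (L x) = 0" using PB_0 z by auto
qed

lemma homI: "(\<And>x. blinfun_apply L (PB x) = L x) \<Longrightarrow> (\<And>x. PB (L x) = 0) \<Longrightarrow> L \<in> hom_model d"
  unfolding hom_model_def using PB_W0 PB_0 by (auto simp del: PB_V0) (metis PB_W0 diff_zero, metis blinfun.zero_right)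

definition "coords b V L \<longleftrightarrow> L \<in> hom_model d \<and> V = b ` graph_plane d L"

text \<open>For a plane \<open>V\<close> with coordinate \<open>L\<close>, \<open>emb\<close> parametrizes \<open>V\<close> by the reference plane, and \<open>Lam\<close> is the
  linear map that vanishes on \<open>V\<close> and takes a nearby plane to the difference of the coordinates.\<close>

definition emb :: "('e \<Rightarrow> 'e) \<Rightarrow> ('e \<Rightarrow>\<^sub>L 'e) \<Rightarrow> 'e \<Rightarrow>\<^sub>L 'e" where
  "emb b L = Blinfun b o\<^sub>L (PB + L)"

definition Lam :: "('e \<Rightarrow> 'e) \<Rightarrow> ('e \<Rightarrow>\<^sub>L 'e) \<Rightarrow> 'e \<Rightarrow>\<^sub>L 'e" where
  "Lam b L = (id_blinfun - PB - L) o\<^sub>L Blinfun (inv b)"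

definition lin_iso :: "('e \<Rightarrow> 'e) \<Rightarrow> bool" where "lin_iso b \<longleftrightarrow> linear b \<and> bij b"

lemma lin_iso_inv:
  assumes "lin_iso b"
  shows "inv b (b x) = x" "b (inv b x) = x" "linear b" "linear (inv b)"
proof -
  have i: "linear b" "inj b" "surj b" using assms by (auto simp: lin_iso_def bij_is_inj bij_is_surj)
  show 1: "inv b (b x) = x" "b (inv b x) = x" for x using i by (auto simp: surj_f_inv_f)
  show "linear b" by (rule i)
  show "linear (inv b)"
    using linear_add[OF i(1)] linear_scale[OF i(1)] 1 by (intro linearI) metis+
qed

lemma lin_iso_blinfun: "lin_iso b \<Longrightarrow> Blinfun b x = b x" "lin_iso b \<Longrightarrow> Blinfun (inv b) x = inv b x"
  using lin_iso_inv by (simp_all add: bounded_linear_Blinfun_apply linear_conv_bounded_linear)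

lemma emb_apply: "lin_iso b \<Longrightarrow> emb b L x = b (PB x + L x)"
  by (simp add: emb_def lin_iso_blinfun blinfun.add_left)

lemma Lam_apply: "lin_iso b \<Longrightarrow> Lam b L r = inv b r - PB (inv b r) - L (inv b r)"
  by (simp add: Lam_def lin_iso_blinfun blinfun.diff_left)

lemma coords_emb:
  assumes "lin_iso b" "coords b V L"
  shows "r \<in> V \<longleftrightarrow> (\<exists>x\<in>V\<^sub>0. r = emb b L x)" "emb b L x \<in> V"
proof -
  show *: "r \<in> V \<longleftrightarrow> (\<exists>x\<in>V\<^sub>0. r = emb b L x)" for r
    using assms by (auto simp: coords_def graph_plane_def emb_apply)
  have "emb b L x = emb b L (PB x)" using assms homD(1) by (simp add: emb_apply coords_def)
  then show "emb b L x \<in> V" using * PB_V0 by blast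
qed

lemma Lam_emb:
  assumes "lin_iso b" "L \<in> hom_model d" "L' \<in> hom_model d"
  shows "Lam b L (emb b L' x) = (L' - L) x"
  using assms homD[OF assms(2)] homD[OF assms(3)]
  by (simp add: Lam_apply emb_apply lin_iso_inv blinfun.add_right blinfun.diff_left) (metis add_0_right blinfun.add_right homD(1))

lemma Lam_zero: "lin_iso b \<Longrightarrow> coords b V L \<Longrightarrow> r \<in> V \<Longrightarrow> Lam b L r = 0"
  using coords_emb(1) Lam_emb by (auto simp: coords_def blinfun.diff_left)

lemma coords_unique:
  assumes "lin_iso b" "coords b V L" "coords b V L'"
  shows "L = L'"
proof (rule blinfun_eqI)
  fix x
  have "Lam b L (emb b L' x) = 0" using Lam_zero[OF assms(1,2)] coords_emb(2)[OF assms(1,3)] by blast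
  then show "L x = L' x" using Lam_emb[OF assms(1)] assms by (simp add: coords_def blinfun.diff_left)
qed

text \<open>A plane on which \<open>Lam\<close> is small is nearly contained in the given plane. As the dimensions agree, its projection to
  the reference plane is onto, and so the plane is a graph.\<close>

lemma coords_near:
  assumes b: "lin_iso b" and V: "coords b V L0" and \<eta>: "0 < \<eta>"
  shows "\<exists>\<epsilon>>0. \<forall>V'. subspace V' \<longrightarrow> dim V' = d \<longrightarrow> (\<forall>r\<in>V'. norm (Lam b L0 r) \<le> \<epsilon> * norm r) \<longrightarrow>
    (\<exists>L. coords b V' L \<and> norm (L - L0) \<le> \<eta>)"
proof -
  note gi = lin_iso_inv[OF b]
  have L0: "L0 \<in> hom_model d" using V by (simp add: coords_def)
  define G where "G = norm (Blinfun b) + 1"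
  have G: "G > 0" "norm (b y) \<le> G * norm y" for y
  proof -
    show "G > 0" by (simp add: G_def add_nonneg_pos)
    have "norm (b y) \<le> norm (Blinfun b) * norm y" using norm_blinfun[of "Blinfun b" y] b by (simp add: lin_iso_blinfun)
    then show "norm (b y) \<le> G * norm y" by (simp add: G_def distrib_right add_increasing2)
  qed
  define M where "M = 2 * (1 + norm L0)"
  have M: "M > 0" by (simp add: M_def add_pos_nonneg)
  define B where "B = norm PB + 1"
  have B: "B > 0" "norm (PB x) \<le> B * norm x" for x
    using norm_blinfun[of PB x] by (simp_all add: B_def add_nonneg_pos distrib_right add_increasing2)
  define \<epsilon> where "\<epsilon> = min (1 / (2 * G)) (\<eta> / (G * M * B))"
  have \<epsilon>: "\<epsilon> > 0" "\<epsilon> * G \<le> 1 / 2" "\<epsilon> * G * M * B \<le> \<eta>"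
  proof -
    show "\<epsilon> > 0" using G M B \<eta> by (simp add: \<epsilon>_def)
    have "\<epsilon> \<le> 1 / (2 * G)" "\<epsilon> \<le> \<eta> / (G * M * B)" by (auto simp: \<epsilon>_def)
    then show "\<epsilon> * G \<le> 1 / 2" "\<epsilon> * G * M * B \<le> \<eta>"
      using G(1) mult_pos_pos[OF mult_pos_pos[OF G(1) M] B(1)] by (simp_all add: pos_le_divide_eq mult_ac)
  qed
  show ?thesis
  proof (intro exI[of _ \<epsilon>] conjI allI impI \<epsilon>(1))
    fix V' assume V': "subspace V'" "dim V' = d" and near: "\<forall>r\<in>V'. norm (Lam b L0 r) \<le> \<epsilon> * norm r"
    have bound: "norm r \<le> G * M * norm (PB (inv b r))" "inv b r = 0 \<or> PB (inv b r) \<noteq> 0" if "r \<in> V'" for r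
    proof -
      let ?y = "inv b r"
      have "norm r \<le> G * norm ?y" using G(2)[of ?y] by (simp add: gi)
      then have "\<epsilon> * norm r \<le> \<epsilon> * (G * norm ?y)" using \<epsilon>(1) by (intro mult_left_mono) auto
      then have "norm (Lam b L0 r) \<le> \<epsilon> * (G * norm ?y)" using near that by (meson order_trans)
      also have "\<dots> \<le> 1 / 2 * norm ?y" using mult_right_mono[OF \<epsilon>(2), of "norm ?y"] by (simp add: mult.assoc)
      finally have 1: "norm (Lam b L0 r) \<le> 1 / 2 * norm ?y" .
      have eq: "PB ?y + L0 (PB ?y) + Lam b L0 r = ?y" by (simp add: Lam_apply[OF b] homD(1)[OF L0])
      have "norm (PB ?y + L0 (PB ?y) + Lam b L0 r) \<le> norm (PB ?y) + norm (L0 (PB ?y)) + norm (Lam b L0 r)"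
        using norm_triangle_ineq[of "PB ?y + L0 (PB ?y)" "Lam b L0 r"] norm_triangle_ineq[of "PB ?y" "L0 (PB ?y)"]
        by linarith
      then have "norm ?y \<le> norm (PB ?y) + norm (L0 (PB ?y)) + norm (Lam b L0 r)" unfolding eq .
      then have 2: "norm ?y \<le> M * norm (PB ?y)"
        using 1 norm_blinfun[of L0 "PB ?y"] by (simp add: M_def algebra_simps)
      then have "G * norm ?y \<le> G * (M * norm (PB ?y))" using G(1) by (intro mult_left_mono) auto
      then show "norm r \<le> G * M * norm (PB ?y)" using G(2)[of ?y] gi by simp
      show "?y = 0 \<or> PB ?y \<noteq> 0" using 2 by auto
    qed
    let ?f = "\<lambda>r. PB (inv b r)"
    have lf: "linear ?f"
      using linear_compose[OF gi(4) bounded_linear.linear[OF blinfun.bounded_linear_right[of PB]]] by (simp add: comp_def)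
    have inj: "inj_on ?f V'"
    proof (rule linear_inj_on_iff_eq_0[OF lf V'(1), THEN iffD2], intro ballI impI)
      fix r assume "r \<in> V'" "PB (inv b r) = 0"
      then have "inv b r = 0" using bound(2) by blast
      then show "r = 0" using gi(2)[of r] linear_0[OF gi(3)] by simp
    qed
    have img: "?f ` V' = V\<^sub>0"
    proof (rule subspace_dim_equal)
      show "subspace (?f ` V')" using linear_subspace_image[OF lf V'(1)] .
      have "dim (?f ` V') = dim V'"
        by (rule dim_image_eq[OF lf]) (use inj V'(1) in \<open>simp add: span_eq_iff[THEN iffD2]\<close>)
      then show "dim V\<^sub>0 \<le> dim (?f ` V')" using V' V0 by simp
    qed (use V0 in auto)
    obtain j where j: "range j \<subseteq> V'" "linear j" "\<And>v. v \<in> V' \<Longrightarrow> j (?f v) = v"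
      using linear_exists_left_inverse_on[OF lf V'(1) inj] by auto
    define L where "L = Blinfun (\<lambda>x. inv b (j (PB x)) - PB (inv b (j (PB x))))"
    have L: "L x = inv b (j (PB x)) - PB (inv b (j (PB x)))" for x
    proof -
      have "linear (\<lambda>x. inv b (j (PB x)))"
        using linear_compose[OF linear_compose[OF bounded_linear.linear[OF blinfun.bounded_linear_right[of PB]] j(2)] gi(4)]
        by (simp add: comp_def)
      then have "linear (\<lambda>x. inv b (j (PB x)) - PB (inv b (j (PB x))))"
        using linear_compose_sub[OF _ linear_compose[OF _ bounded_linear.linear[OF blinfun.bounded_linear_right[of PB]]]]
        by (simp add: comp_def)
      then show ?thesis unfolding L_def by (simp add: bounded_linear_Blinfun_apply linear_conv_bounded_linear)
    qed
    have LH: "L \<in> hom_model d"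
      by (rule homI) (simp_all add: L blinfun.diff_right)
    have V'L: "coords b V' L"
      unfolding coords_def graph_plane_def
    proof (intro conjI LH set_eqI iffI)
      fix r assume r: "r \<in> V'"
      have "r = b (?f r + L (?f r))" using j(3)[OF r] gi by (simp add: L)
      then show "r \<in> b ` (\<lambda>x. x + L x) ` V\<^sub>0" using PB_V0 by blast
    next
      fix r assume "r \<in> b ` (\<lambda>x. x + L x) ` V\<^sub>0"
      then obtain x where x: "x \<in> V\<^sub>0" "r = b (x + L x)" by blast
      then obtain v where v: "v \<in> V'" "x = ?f v" using img by blast
      have "r = v" using x v j(3)[OF v(1)] gi by (simp add: L)
      then show "r \<in> V'" using v by simp
    qed
    have "norm (L - L0) \<le> \<eta>"
    proof (rule norm_blinfun_bound)
      fix x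
      let ?r = "emb b L x"
      have r: "?r \<in> V'" by (rule coords_emb(2)[OF b V'L])
      have "PB (inv b ?r) = PB x" using b gi homD(2)[OF LH] by (simp add: emb_apply blinfun.add_right)
      then have "norm ?r \<le> G * M * norm (PB x)" using bound(1)[OF r] by simp
      also have "\<dots> \<le> G * M * (B * norm x)" using B(2)[of x] G(1) M by (intro mult_left_mono) auto
      finally have "norm ?r \<le> G * M * (B * norm x)" .
      then have "\<epsilon> * norm ?r \<le> \<epsilon> * (G * M * (B * norm x))" using \<epsilon>(1) by (intro mult_left_mono) auto
      also have "\<dots> = (\<epsilon> * G * M * B) * norm x" by simp
      also have "\<dots> \<le> \<eta> * norm x" by (intro mult_right_mono \<epsilon>) auto
      finally show "norm ((L - L0) x) \<le> \<eta> * norm x"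
        using near r Lam_emb[OF b L0 LH, of x] by fastforce
    qed (use \<eta> in simp)
    then show "\<exists>L. coords b V' L \<and> norm (L - L0) \<le> \<eta>" using V'L by blast
  qed
qed

text \<open>The hypothesis says that \<open>V t\<close> is, to first order in \<open>t - s\<close>, the plane \<open>V s\<close> turned with velocity \<open>hm\<close>. Since \<open>Lam\<close>
  measures differences of coordinates, it yields first that \<open>V t\<close> has a coordinate close to the one of \<open>V s\<close>, and then
  the derivative of this coordinate.\<close>

lemma coords_derivative:
  fixes V :: "real \<Rightarrow> 'e set" and hm :: "'e \<Rightarrow>\<^sub>L 'e"
  assumes b: "lin_iso b" and V: "\<forall>\<^sub>F t in at s within I. subspace (V t) \<and> dim (V t) = d" and V0: "coords b (V s) L0"
    and hm: "\<And>\<epsilon>. 0 < \<epsilon> \<Longrightarrow> \<forall>\<^sub>F t in at s within I. \<forall>r\<in>V t. norm (Lam b L0 (r - (t - s) *\<^sub>R hm r)) \<le> \<epsilon> * \<bar>t - s\<bar> * norm r"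
    and L: "\<And>t V'. coords b (V t) V' \<Longrightarrow> L t = V'"
  shows "\<forall>\<^sub>F t in at s within I. coords b (V t) (L t)"
    and "(L has_vector_derivative (Lam b L0 o\<^sub>L hm o\<^sub>L emb b L0)) (at s within I)"
proof -
  let ?F = "at s within I"
  have L0: "L0 \<in> hom_model d" "L s = L0" using V0 L by (auto simp: coords_def)
  have small: "\<forall>\<^sub>F t in ?F. \<bar>t - s\<bar> < \<tau>" if "0 < \<tau>" for \<tau>
    unfolding eventually_at using that by (intro exI[of _ \<tau>]) (auto simp: dist_real_def)
  let ?M = "norm (Lam b L0 o\<^sub>L hm)"
  have close: "\<forall>\<^sub>F t in ?F. coords b (V t) (L t) \<and> norm (L t - L0) \<le> \<eta>" if "0 < \<eta>" for \<eta>
  proof -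
    obtain \<epsilon> where \<epsilon>: "\<epsilon> > 0" "\<And>V'. subspace V' \<Longrightarrow> dim V' = d \<Longrightarrow> (\<forall>r\<in>V'. norm (Lam b L0 r) \<le> \<epsilon> * norm r) \<Longrightarrow>
       (\<exists>L. coords b V' L \<and> norm (L - L0) \<le> \<eta>)"
      using coords_near[OF b V0 \<open>0 < \<eta>\<close>] by blast
    have "0 < \<epsilon> / (1 + ?M)" using \<epsilon> by (simp add: add_pos_nonneg)
    from V hm[OF zero_less_one] small[OF this] show ?thesis
    proof eventually_elim
      case (elim t)
      have "norm (Lam b L0 r) \<le> \<epsilon> * norm r" if r: "r \<in> V t" for r
      proof -
        have "Lam b L0 r = Lam b L0 (r - (t - s) *\<^sub>R hm r) + (t - s) *\<^sub>R (Lam b L0 o\<^sub>L hm) r"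
          by (simp add: blinfun.diff_right blinfun.scaleR_right)
        then have "norm (Lam b L0 r) \<le> 1 * \<bar>t - s\<bar> * norm r + \<bar>t - s\<bar> * (?M * norm r)"
          using elim(2) r norm_blinfun[of "Lam b L0 o\<^sub>L hm" r]
          by (metis (no_types, lifting) norm_triangle_le add_mono norm_scaleR mult_left_mono abs_ge_zero)
        also have "\<dots> = ((1 + ?M) * \<bar>t - s\<bar>) * norm r" by (simp add: algebra_simps)
        also have "\<dots> \<le> \<epsilon> * norm r"
        proof (rule mult_right_mono)
          have "0 < 1 + ?M" by (simp add: add_pos_nonneg)
          then show "(1 + ?M) * \<bar>t - s\<bar> \<le> \<epsilon>" using elim(3) by (simp add: pos_less_divide_eq mult.commute)
        qed simp
        finally show ?thesis .
      qed
      then obtain L' where "coords b (V t) L'" "norm (L' - L0) \<le> \<eta>" using \<epsilon>(2)[of "V t"] elim(1) by blast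
      then show ?case using L by auto
    qed
  qed
  show "\<forall>\<^sub>F t in ?F. coords b (V t) (L t)" using close[OF zero_less_one] by eventually_elim simp
  show "(L has_vector_derivative (Lam b L0 o\<^sub>L hm o\<^sub>L emb b L0)) ?F"
    unfolding has_vector_derivative_def has_derivative_within_alt2
  proof (intro conjI allI impI bounded_linear_scaleR_left)
    fix e :: real assume e: "0 < e"
    let ?G = "norm (Blinfun b) * (norm PB + norm L0 + 1)"
    define \<epsilon> where "\<epsilon> = e / (2 * (?G + 1))"
    have G1: "0 < ?G + 1" by (simp add: add_nonneg_pos)
    have \<epsilon>: "\<epsilon> > 0" "\<epsilon> * ?G \<le> e / 2"
    proof -
      show "\<epsilon> > 0" unfolding \<epsilon>_def using e G1 by (intro divide_pos_pos mult_pos_pos) auto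
      have "\<epsilon> * (?G + 1) = e / 2" 
      proof -
        have "e / (2 * z) * z = e / 2" if "z \<noteq> 0" for z using that by simp
        then show ?thesis using less_imp_neq[OF G1, symmetric] unfolding \<epsilon>_def by blast
      qed
      then show "\<epsilon> * ?G \<le> e / 2" using \<open>\<epsilon> > 0\<close> by (simp add: distrib_left)
    qed
    define \<eta> where "\<eta> = min 1 (e / (2 * (?M * norm (Blinfun b) + 1)))"
    have \<eta>: "\<eta> > 0" "\<eta> \<le> 1" "?M * norm (Blinfun b) * \<eta> \<le> e / 2"
    proof -
      have p: "0 < ?M * norm (Blinfun b) + 1" by (simp add: add_nonneg_pos)
      show "\<eta> > 0" "\<eta> \<le> 1" using e p by (auto simp: \<eta>_def)
      have "\<eta> \<le> e / (2 * (?M * norm (Blinfun b) + 1))" by (simp add: \<eta>_def)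
      then have "(?M * norm (Blinfun b) + 1) * \<eta> \<le> e / 2" using p by (simp add: pos_le_divide_eq mult_ac)
      then show "?M * norm (Blinfun b) * \<eta> \<le> e / 2" using \<open>\<eta> > 0\<close> by (simp add: distrib_right)
    qed
    show "\<forall>\<^sub>F t in ?F. norm (L t - L s - (t - s) *\<^sub>R (Lam b L0 o\<^sub>L hm o\<^sub>L emb b L0)) \<le> e * norm (t - s)"
      using close[OF \<eta>(1)] hm[OF \<epsilon>(1)]
    proof eventually_elim
      case (elim t)
      let ?\<theta> = "t - s"
      show ?case
      proof (rule norm_blinfun_bound)
        fix x
        have Lt: "L t \<in> hom_model d" using elim by (simp add: coords_def)
        define r where "r = emb b (L t) x"
        have r: "r \<in> V t" unfolding r_def by (rule coords_emb(2)[OF b]) (use elim in simp)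
        have d: "r - emb b L0 x = Blinfun b ((L t - L0) x)"
          by (simp add: r_def emb_def blinfun.add_left blinfun.diff_left flip: blinfun.diff_right)
        have eqx: "(L t - L s - \<theta> *\<^sub>R (Lam b L0 o\<^sub>L hm o\<^sub>L emb b L0)) x =
            Lam b L0 (r - \<theta> *\<^sub>R hm r) + \<theta> *\<^sub>R (Lam b L0 o\<^sub>L hm) (r - emb b L0 x)" for \<theta>
        proof -
          have eqx: "(L t - L s - \<theta> *\<^sub>R (Lam b L0 o\<^sub>L hm o\<^sub>L emb b L0)) x = Lam b L0 r - \<theta> *\<^sub>R Lam b L0 (hm (emb b L0 x))"
            using Lam_emb[OF b L0(1) Lt, of x] by (simp add: L0(2) r_def blinfun.diff_left blinfun.scaleR_left)
          then show ?thesis by (simp add: blinfun.diff_right blinfun.scaleR_right scaleR_diff_right)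
        qed
        have "(L t - L s - ?\<theta> *\<^sub>R (Lam b L0 o\<^sub>L hm o\<^sub>L emb b L0)) x =
            Lam b L0 (r - ?\<theta> *\<^sub>R hm r) + ?\<theta> *\<^sub>R (Lam b L0 o\<^sub>L hm) (r - emb b L0 x)"
          by (rule eqx)
        also have "norm \<dots> \<le> \<epsilon> * \<bar>?\<theta>\<bar> * norm r + \<bar>?\<theta>\<bar> * (?M * norm (r - emb b L0 x))"
          using elim(2) r norm_blinfun[of "Lam b L0 o\<^sub>L hm" "r - emb b L0 x"]
          by (intro norm_triangle_le add_mono) (auto intro: mult_left_mono)
        also have "\<dots> \<le> \<epsilon> * \<bar>?\<theta>\<bar> * (?G * norm x) + \<bar>?\<theta>\<bar> * (?M * (norm (Blinfun b) * (\<eta> * norm x)))"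
        proof (intro add_mono mult_left_mono)
          have "norm ((PB + L t) x) \<le> (norm PB + norm L0 + 1) * norm x"
          proof (rule order_trans[OF norm_blinfun mult_right_mono])
            have "norm (L t) \<le> norm L0 + 1"
              using elim(1) \<eta>(2) norm_triangle_ineq2[of "L t" L0] by linarith
            then show "norm (PB + L t) \<le> norm PB + norm L0 + 1" using norm_triangle_ineq[of PB "L t"] by linarith
          qed simp
          then have "norm (Blinfun b) * norm ((PB + L t) x) \<le> norm (Blinfun b) * ((norm PB + norm L0 + 1) * norm x)"
            by (intro mult_left_mono) auto
          then show "norm r \<le> ?G * norm x"
            unfolding r_def emb_def blinfun_apply_blinfun_compose
            using norm_blinfun[of "Blinfun b" "(PB + L t) x"] by (simp add: mult.assoc)
          have "norm ((L t - L0) x) \<le> \<eta> * norm x"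
            using elim(1) by (intro order_trans[OF norm_blinfun mult_right_mono]) auto
          then show "norm (r - emb b L0 x) \<le> norm (Blinfun b) * (\<eta> * norm x)"
            unfolding d by (intro order_trans[OF norm_blinfun mult_left_mono]) auto
        qed (use \<epsilon> in auto)
        also have "\<dots> = (\<epsilon> * ?G + ?M * norm (Blinfun b) * \<eta>) * (\<bar>?\<theta>\<bar> * norm x)" by (simp add: algebra_simps)
        also have "\<dots> \<le> (e / 2 + e / 2) * (\<bar>?\<theta>\<bar> * norm x)" by (intro mult_right_mono add_mono \<epsilon> \<eta>) auto
        finally show "norm ((L t - L s - ?\<theta> *\<^sub>R (Lam b L0 o\<^sub>L hm o\<^sub>L emb b L0)) x) \<le> e * norm ?\<theta> * norm x" by simp
      qed (use e in simp)
    qed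
  qed
qed

end

section \<open>The Grassmann bundle\<close>

context dominated_charts
begin

abbreviation "GA \<equiv> grassmann_atlas A d"
abbreviation "gc \<equiv> grassmann_chart A d"

definition plane_coord :: "('e \<Rightarrow> 'e) \<Rightarrow> 'e set \<Rightarrow> 'e \<Rightarrow>\<^sub>L 'e" where
  "plane_coord b V = (THE L. coords b V L)"

lemma plane_coord_eq: "lin_iso b \<Longrightarrow> coords b V L \<Longrightarrow> plane_coord b V = L"
  unfolding plane_coord_def using coords_unique by (intro the_equality) auto

lemma tau_image: "tau c p ` V = (\<lambda>v. tangent_coord A c (p, v)) ` V"
  by (simp add: tau_def)

lemma gc_dom: "(p, V) \<in> fst (gc c b) \<longleftrightarrow> subspace V \<and> dim V = d \<and> p \<in> fst c \<and> (\<exists>L. coords b (tau c p ` V) L)"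
  by (auto simp: grassmann_chart_def Let_def grassmann_bundle_def coords_def tau_image)

lemma gc_apply: "snd (gc c b) (p, V) = (snd c p, plane_coord b (tau c p ` V))"
  by (simp add: grassmann_chart_def Let_def plane_coord_def coords_def tau_image)

lemma tau_image_plane:
  assumes "c \<in> A" "p \<in> fst c"
  shows "subspace V \<Longrightarrow> subspace (tau c p ` V)" "dim (tau c p ` V) = dim V"
    "tau_inv c p ` tau c p ` V = V" "tau c p ` tau_inv c p ` V = V"
proof -
  have inj: "inj_on (tau c p) X" for X using assms by (metis inj_onI tau_inv_tau)
  show "dim (tau c p ` V) = dim V" by (rule dim_image_eq[OF tau_linear[OF assms] inj])
qed (use assms in \<open>auto simp: image_image intro: linear_subspace_image[OF tau_linear[OF assms]]\<close>)

lemma tau_inv_image_plane: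
  assumes "c \<in> A" "p \<in> fst c"
  shows "subspace V \<Longrightarrow> subspace (tau_inv c p ` V)" "dim (tau_inv c p ` V) = dim V"
proof -
  show "subspace V \<Longrightarrow> subspace (tau_inv c p ` V)" by (rule linear_subspace_image[OF tau_inv_linear])
  show "dim (tau_inv c p ` V) = dim V"
    using tau_image_plane(2)[OF assms, of "tau_inv c p ` V"] tau_image_plane(4)[OF assms, of V] by simp
qed

lemma graph_plane_dim:
  assumes b: "lin_iso b" and L: "L \<in> hom_model d"
  shows "subspace (b ` graph_plane d L)" "dim (b ` graph_plane d L) = d" "coords b (b ` graph_plane d L) L"
proof -
  have eq: "b ` graph_plane d L = emb b L ` V\<^sub>0"
    by (auto simp: graph_plane_def emb_apply[OF b] image_image)
  have l: "linear (emb b L)" by (simp add: blinfun.bounded_linear_right bounded_linear.linear)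
  show "subspace (b ` graph_plane d L)" unfolding eq by (rule linear_subspace_image[OF l V0(1)])
  have "PB (inv b (emb b L x)) = PB x" for x
    using homD(2)[OF L] by (simp add: emb_apply[OF b] lin_iso_inv[OF b] blinfun.add_right)
  then have "inj_on (emb b L) V\<^sub>0" by (metis PB_id inj_onI)
  then have "dim (emb b L ` V\<^sub>0) = dim V\<^sub>0"
    using dim_image_eq[OF l, of V\<^sub>0] span_eq_iff[THEN iffD2, OF V0(1)] by metis
  then show "dim (b ` graph_plane d L) = d" using V0 by (simp add: eq)
  show "coords b (b ` graph_plane d L) L" using L by (simp add: coords_def)
qed

lemma gc_inj: "c \<in> A \<Longrightarrow> lin_iso b \<Longrightarrow> inj_on (snd (gc c b)) (fst (gc c b))"
proof (rule inj_onI, clarify)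
  fix p V q W assume c: "c \<in> A" and b: "lin_iso b"
    and pV: "(p, V) \<in> fst (gc c b)" and qW: "(q, W) \<in> fst (gc c b)" and eq: "snd (gc c b) (p, V) = snd (gc c b) (q, W)"
  obtain L L' where L: "coords b (tau c p ` V) L" "coords b (tau c q ` W) L'" using pV qW by (auto simp: gc_dom)
  have "p = q" using eq pV qW c by (auto simp: gc_apply gc_dom intro: chart_inj)
  moreover have "L = L'" using eq L plane_coord_eq[OF b] by (simp add: gc_apply)
  ultimately have "tau c p ` V = tau c p ` W" using L by (simp add: coords_def)
  then have "V = W" using tau_image_plane(3)[OF c] pV by (metis gc_dom)
  with \<open>p = q\<close> show "p = q \<and> V = W" by simp
qed

text \<open>The inverse of a chart of the Grassmann bundle, which occurs in the lines that define tangent vectors.\<close>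

lemma gc_inv:
  assumes c: "c \<in> A" and b: "lin_iso b" and u: "u \<in> snd c ` fst c" and L: "L \<in> hom_model d"
  defines "q \<equiv> chart_inv c u"
  shows "chart_inv (gc c b) (u, L) = (q, tau_inv c q ` b ` graph_plane d L)"
    "(q, tau_inv c q ` b ` graph_plane d L) \<in> fst (gc c b)" "q \<in> fst c" "snd c q = u"
proof -
  show q: "q \<in> fst c" "snd c q = u" using u c by (auto simp: q_def)
  show dom: "(q, tau_inv c q ` b ` graph_plane d L) \<in> fst (gc c b)"
    unfolding gc_dom using graph_plane_dim[OF b L] tau_inv_image_plane[OF c q(1)] q(1) tau_image_plane(4)[OF c q(1)] by auto
  have "snd (gc c b) (q, tau_inv c q ` b ` graph_plane d L) = (u, L)"
    using plane_coord_eq[OF b graph_plane_dim(3)[OF b L]] by (simp add: gc_apply q tau_image_plane(4)[OF c q(1)])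
  then show "chart_inv (gc c b) (u, L) = (q, tau_inv c q ` b ` graph_plane d L)"
    unfolding chart_inv_def using inv_into_f_f[OF gc_inj[OF c b] dom] by metis
qed

text \<open>In the chart made from an automorphism that takes the reference plane to \<open>V\<close>, the coordinate of \<open>V\<close> is zero.
  In particular, these charts cover the Grassmann bundle.\<close>

lemma adapted_frame:
  assumes "subspace (V :: 'e set)" "dim V = d"
  shows "\<exists>b. lin_iso b \<and> coords b V 0"
proof -
  let ?W = "orthogonal_comp V"
  note cV = complementary_orthogonal[OF assms(1)]
  have dims: "dim X + dim Y = DIM('e)" if "complementary X Y" for X Y :: "'e set"
  proof -
    have "{x + y |x y. x \<in> X \<and> y \<in> Y} = UNIV" using that unfolding complementary_def by blast
    then show ?thesis using dim_sums_Int[of X Y] that by (simp add: complementary_def)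
  qed
  have "dim W\<^sub>0 = dim ?W" using dims[OF V0_W0] dims[OF cV] V0 assms by simp
  then obtain f1 f2 :: "'e \<Rightarrow> 'e" where f: "linear f1" "f1 ` V\<^sub>0 = V" "linear f2" "f2 ` W\<^sub>0 = ?W"
    using subspace_isomorphism[OF V0(1) assms(1)] subspace_isomorphism[OF subspace_orthogonal_comp subspace_orthogonal_comp, of V\<^sub>0 V] V0 assms
    by metis
  define b where "b x = f1 (PB x) + f2 (x - PB x)" for x
  have lin: "linear b"
    by (intro linearI) (simp_all add: b_def blinfun.add_right blinfun.scaleR_right linear_add[OF f(1)] linear_add[OF f(3)]
        linear_scale[OF f(1)] linear_scale[OF f(3)] linear_diff[OF f(3)] algebra_simps)
  have "surj b"
    unfolding surj_def
  proof
    fix y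
    obtain v w where vw: "v \<in> V" "w \<in> ?W" "y = v + w" using cV unfolding complementary_def by blast
    then obtain x z where xz: "x \<in> V\<^sub>0" "z \<in> W\<^sub>0" "v = f1 x" "w = f2 z" using f by blast
    then have "PB (x + z) = x" by (simp add: blinfun.add_right PB_0)
    then show "\<exists>x. y = b x" using vw xz by (intro exI[of _ "x + z"]) (simp add: b_def)
  qed
  then have "lin_iso b" using linear_surjective_imp_injective[OF lin] lin by (simp add: lin_iso_def bij_def)
  moreover have "coords b V 0"
  proof -
    have "b x = f1 x" if "x \<in> V\<^sub>0" for x using that linear_0[OF f(3)] by (simp add: b_def)
    then have "b ` V\<^sub>0 = V" using f(2) by auto
    then show ?thesis by (simp add: coords_def hom_model_def graph_plane_def subspace_0[OF subspace_orthogonal_comp])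
  qed
  ultimately show ?thesis by blast
qed

text \<open>If a moving plane has a differentiable coordinate in one chart, then the change of charts turns it with a velocity \<open>hm\<close>
  that is determined by its values on the plane, and \<open>coords_derivative\<close> applies in the other chart. The conclusion gives
  \<open>hm\<close> only as far as it matters.\<close>

lemma coords_change:
  fixes q :: "real \<Rightarrow> 'm" and W :: "real \<Rightarrow> 'e set" and L :: "real \<Rightarrow> 'e \<Rightarrow>\<^sub>L 'e" and Ld :: "'e \<Rightarrow>\<^sub>L 'e"
  assumes c: "c \<in> A" "c' \<in> A" and b: "lin_iso b" "lin_iso b'"
    and q: "(q \<longlongrightarrow> q s) (at s within I)" "q s \<in> fst c" "q s \<in> fst c'" "s \<in> I"
    and W: "\<forall>\<^sub>F t in at s within I. subspace (W t) \<and> dim (W t) = d \<and> coords b (tau c (q t) ` W t) (L t)"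
      "coords b (tau c (q s) ` W s) (L s)" "coords b' (tau c' (q s) ` W s) L'"
    and u: "((\<lambda>t. snd c (q t)) has_vector_derivative u) (at s within I)"
    and Ld: "(L has_vector_derivative Ld) (at s within I)"
  defines "Lt \<equiv> \<lambda>t. plane_coord b' (tau c' (q t) ` W t)"
    and "D \<equiv> D1 (rep id c c') (snd c (q s))" and "DD \<equiv> D2 (rep id c c') (snd c (q s))"
  shows "\<forall>\<^sub>F t in at s within I. coords b' (tau c' (q t) ` W t) (Lt t)"
    and "\<exists>hm :: 'e \<Rightarrow>\<^sub>L 'e. (\<forall>x\<in>V\<^sub>0. blinfun_apply hm (D (emb b (L s) x)) = DD u (emb b (L s) x) + D (b (Ld x))) \<and>
       (Lt has_vector_derivative (Lam b' L' o\<^sub>L hm o\<^sub>L emb b' L')) (at s within I)"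
proof -
  let ?F = "at s within I"
  define A' where "A' t = D1 (rep id c c') (snd c (q t)) o\<^sub>L emb b (L t)" for t
  define Ad where "Ad = (D o\<^sub>L (Blinfun b o\<^sub>L Ld)) + (DD u o\<^sub>L emb b (L s))"
  have "(D1 (rep id c c') has_derivative DD) (at (snd c (q s)) within (\<lambda>t. snd c (q t)) ` I)"
    unfolding DD_def using rep_D2[OF C2_id c q(2)] q(3) by (simp add: has_derivative_at_withinI)
  from vector_derivative_diff_chain_within[OF u this]
  have d1: "((\<lambda>t. D1 (rep id c c') (snd c (q t))) has_vector_derivative DD u) ?F" by (simp add: comp_def)
  have "((\<lambda>t. PB + L t) has_vector_derivative Ld) ?F"
    using has_vector_derivative_add[OF has_vector_derivative_const Ld, of PB] by simp
  from bounded_linear.has_vector_derivative[OF bounded_bilinear.bounded_linear_right[OF bounded_bilinear_blinfun_compose] this, of "Blinfun b"]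
  have d2: "((\<lambda>t. emb b (L t)) has_vector_derivative (Blinfun b o\<^sub>L Ld)) ?F" by (simp add: emb_def)
  have Ad: "(A' has_vector_derivative Ad) ?F"
    using bounded_bilinear.has_vector_derivative[OF bounded_bilinear_blinfun_compose d1 d2]
    by (simp add: A'_def[abs_def] Ad_def D_def)
  have img: "tau c' y ` X = D1 (rep id c c') (snd c y) ` tau c y ` X" if "y \<in> fst c" "y \<in> fst c'" for y X
    using tau_change[OF c that] by (auto simp: image_image)
  have rng: "r \<in> tau c' y ` X \<Longrightarrow> \<exists>x\<in>V\<^sub>0. r = (D1 (rep id c c') (snd c y) o\<^sub>L emb b M) x"
    if y: "y \<in> fst c" "y \<in> fst c'" "coords b (tau c y ` X) M" for y X M r
  proof -
    assume "r \<in> tau c' y ` X"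
    then obtain z where z: "z \<in> tau c y ` X" "r = D1 (rep id c c') (snd c y) z" unfolding img[OF y(1,2)] by blast
    then obtain x where "x \<in> V\<^sub>0" "z = emb b M x" using coords_emb(1)[OF b(1) y(3)] by blast
    then show ?thesis using z by auto
  qed
  have Ls: "L s \<in> hom_model d" using W(2) by (simp add: coords_def)
  have A's: "A' s x \<in> tau c' (q s) ` W s" for x
    using coords_emb(2)[OF b(1) W(2)] by (simp add: A'_def img[OF q(2,3)])
  have "inj_on (A' s) V\<^sub>0"
  proof -
    have 1: "PB (inv b (emb b (L s) x)) = PB x" for x
      using homD(2)[OF Ls] by (simp add: emb_apply[OF b(1)] lin_iso_inv[OF b(1)] blinfun.add_right)
    have 2: "D1 (rep id c' c) (snd c' (q s)) (D1 (rep id c c') (snd c (q s)) z) = z" for z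
      using tau_change[OF c q(2,3), of "tau_inv c (q s) z"] tau_change[OF c(2,1) q(3,2), of "tau_inv c (q s) z"] c q(2) by simp
    show ?thesis
    proof (rule inj_onI)
      fix x y assume "x \<in> V\<^sub>0" "y \<in> V\<^sub>0" "A' s x = A' s y"
      then have "emb b (L s) x = emb b (L s) y" using 2 by (metis A'_def blinfun_apply_blinfun_compose)
      then show "x = y" using 1 \<open>x \<in> V\<^sub>0\<close> \<open>y \<in> V\<^sub>0\<close> by (metis PB_id)
    qed
  qed
  then obtain j0 where j0: "linear j0" "\<And>x. x \<in> V\<^sub>0 \<Longrightarrow> j0 (A' s x) = x"
    using linear_exists_left_inverse_on[OF _ V0(1), of "A' s"] by (auto simp: blinfun.bounded_linear_right bounded_linear.linear)
  define j where "j = Blinfun j0"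
  have j: "j (A' s x) = x" if "x \<in> V\<^sub>0" for x
    using j0 that by (simp add: j_def bounded_linear_Blinfun_apply linear_conv_bounded_linear)
  define hm where "hm = Ad o\<^sub>L j"
  have ev: "\<forall>\<^sub>F t in ?F. q t \<in> fst c" "\<forall>\<^sub>F t in ?F. q t \<in> fst c'"
    using chart_tendsto(2)[OF q(1)] c q by auto
  let ?J = "norm j + 1"
  have J: "?J > 0" "norm (j z) \<le> ?J * norm z" for z
    using norm_blinfun[of j z] by (simp_all add: add_nonneg_pos distrib_right add_increasing2)
  have Acont: "(A' \<longlongrightarrow> A' s) ?F"
    using has_vector_derivative_continuous[OF Ad] by (simp add: continuous_within)
  have plane: "\<forall>\<^sub>F t in ?F. subspace (tau c' (q t) ` W t) \<and> dim (tau c' (q t) ` W t) = d"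
    using W(1) ev(2) by eventually_elim (use tau_image_plane[OF c(2)] in auto)
  have main: "\<forall>\<^sub>F t in ?F. \<forall>r\<in>tau c' (q t) ` W t. norm (Lam b' L' (r - (t - s) *\<^sub>R hm r)) \<le> \<epsilon> * \<bar>t - s\<bar> * norm r"
    if \<epsilon>: "0 < \<epsilon>" for \<epsilon>
  proof -
    let ?N = "norm (Lam b' L') + 1" and ?H = "norm (Lam b' L' o\<^sub>L Ad) * ?J + 1"
    have pos: "0 < ?N" "0 < ?H" using J(1) by (auto intro!: add_nonneg_pos)
    define e1 where "e1 = \<epsilon> / (4 * ?J * ?N)"
    define e2 where "e2 = min (1 / (2 * ?J)) (\<epsilon> / (4 * ?J * ?H))"
    have e1: "0 < e1" "?N * e1 * (2 * ?J) = \<epsilon> / 2"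
    proof -
      show "0 < e1" unfolding e1_def using \<epsilon> pos J(1) by (intro divide_pos_pos mult_pos_pos) auto
      have "n * (\<epsilon> / (4 * J * n)) * (2 * J) = \<epsilon> / 2" if "n > 0" "J > 0" for n J using that by simp
      from this[OF pos(1) J(1)] show "?N * e1 * (2 * ?J) = \<epsilon> / 2" by (simp only: e1_def)
    qed
    have e2: "0 < e2" "?J * e2 \<le> 1 / 2" "?H * e2 * (2 * ?J) \<le> \<epsilon> / 2"
    proof -
      show "0 < e2" unfolding e2_def using \<epsilon> pos J(1) by (auto intro!: divide_pos_pos mult_pos_pos)
      have "?J * e2 \<le> ?J * (1 / (2 * ?J))" unfolding e2_def using J(1) by (intro mult_left_mono) auto
      also have "\<dots> = 1 / 2" using less_imp_neq[OF J(1)] by simp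
      finally show "?J * e2 \<le> 1 / 2" .
      have "?H * e2 * (2 * ?J) \<le> ?H * (\<epsilon> / (4 * ?J * ?H)) * (2 * ?J)"
        unfolding e2_def using J(1) pos by (intro mult_right_mono mult_left_mono) auto
      also have "\<dots> = \<epsilon> / 2"
      proof -
        have "n * (\<epsilon> / (4 * J * n)) * (2 * J) = \<epsilon> / 2" if "n > 0" "J > 0" for n J using that by simp
        from this[OF pos(2) J(1)] show ?thesis .
      qed
      finally show "?H * e2 * (2 * ?J) \<le> \<epsilon> / 2" .
    qed
    have "\<forall>\<^sub>F t in ?F. norm (A' t - A' s - (t - s) *\<^sub>R Ad) \<le> e1 * norm (t - s)"
      using Ad e1(1) unfolding has_vector_derivative_def has_derivative_within_alt2 by blast
    moreover have "\<forall>\<^sub>F t in ?F. dist (A' t) (A' s) < e2" by (rule tendstoD[OF Acont e2(1)])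
    ultimately show ?thesis using ev W(1)
    proof eventually_elim
      case (elim t)
      show ?case
      proof
        fix r assume r: "r \<in> tau c' (q t) ` W t"
        let ?\<theta> = "t - s"
        obtain x where x: "x \<in> V\<^sub>0" "r = A' t x"
          using rng[OF elim(3,4) _ r] elim(5) by (auto simp: A'_def)
        have close: "norm ((A' t - A' s) x) \<le> e2 * norm x"
          using elim(2) by (intro order_trans[OF norm_blinfun mult_right_mono]) (auto simp: dist_norm)
        have jr: "x - j r = - j ((A' t - A' s) x)" using j[OF x(1)] by (simp add: x(2) blinfun.diff_left blinfun.diff_right)
        have jclose: "norm (x - j r) \<le> ?J * e2 * norm x"
          unfolding jr norm_minus_cancel using order_trans[OF J(2) mult_left_mono[OF close]] J(1) by (simp add: mult.assoc)
        also have "\<dots> \<le> 1 / 2 * norm x" by (intro mult_right_mono e2) auto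
        finally have "norm x \<le> norm (j r) + 1 / 2 * norm x" using norm_triangle_ineq2[of x "j r"] by linarith
        then have nx: "norm x \<le> 2 * ?J * norm r" using J(2)[of r] unfolding mult.assoc[of 2] by linarith
        have z: "Lam b' L' (A' s x) = 0" by (rule Lam_zero[OF b(2) W(3) A's])
        have "Lam b' L' (r - ?\<theta> *\<^sub>R hm r) = Lam b' L' ((A' t - A' s - ?\<theta> *\<^sub>R Ad) x) + ?\<theta> *\<^sub>R (Lam b' L' o\<^sub>L Ad) (x - j r)"
          by (simp add: x(2) hm_def z blinfun.diff_left blinfun.diff_right blinfun.scaleR_left blinfun.scaleR_right scaleR_diff_right)
        also have "norm \<dots> \<le> ?N * (e1 * \<bar>?\<theta>\<bar> * norm x) + \<bar>?\<theta>\<bar> * (norm (Lam b' L' o\<^sub>L Ad) * (?J * e2 * norm x))"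
        proof (intro norm_triangle_le add_mono)
          have rem: "norm ((A' t - A' s - ?\<theta> *\<^sub>R Ad) x) \<le> e1 * \<bar>?\<theta>\<bar> * norm x"
            using elim(1) by (intro order_trans[OF norm_blinfun mult_right_mono]) auto
          show "norm (Lam b' L' ((A' t - A' s - ?\<theta> *\<^sub>R Ad) x)) \<le> ?N * (e1 * \<bar>?\<theta>\<bar> * norm x)"
            by (rule order_trans[OF norm_blinfun mult_mono]) (use rem in auto)
          show "norm (?\<theta> *\<^sub>R (Lam b' L' o\<^sub>L Ad) (x - j r)) \<le> \<bar>?\<theta>\<bar> * (norm (Lam b' L' o\<^sub>L Ad) * (?J * e2 * norm x))"
            unfolding norm_scaleR real_norm_def
            by (intro mult_left_mono order_trans[OF norm_blinfun] jclose) auto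
        qed
        also have "\<dots> \<le> ?N * (e1 * \<bar>?\<theta>\<bar> * norm x) + \<bar>?\<theta>\<bar> * (?H * e2 * norm x)"
          using e2(1) by (intro add_left_mono mult_left_mono) (auto simp: mult.assoc distrib_right intro!: mult_nonneg_nonneg)
        also have "\<dots> = (?N * e1 + ?H * e2) * \<bar>?\<theta>\<bar> * norm x" by algebra
        also have "\<dots> \<le> (?N * e1 + ?H * e2) * \<bar>?\<theta>\<bar> * (2 * ?J * norm r)"
          using nx e1(1) e2(1) pos by (intro mult_left_mono) auto
        also have "\<dots> = (?N * e1 * (2 * ?J) + ?H * e2 * (2 * ?J)) * \<bar>?\<theta>\<bar> * norm r" by algebra
        also have "\<dots> \<le> (\<epsilon> / 2 + \<epsilon> / 2) * \<bar>?\<theta>\<bar> * norm r"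
          using e1 e2 by (intro mult_right_mono add_mono) auto
        finally show "norm (Lam b' L' (r - ?\<theta> *\<^sub>R hm r)) \<le> \<epsilon> * \<bar>?\<theta>\<bar> * norm r" by simp
      qed
    qed
  qed
  have Lt: "Lt t = M" if "coords b' (tau c' (q t) ` W t) M" for t M
    unfolding Lt_def by (rule plane_coord_eq[OF b(2) that])
  show "\<forall>\<^sub>F t in ?F. coords b' (tau c' (q t) ` W t) (Lt t)"
    by (rule coords_derivative(1)[OF b(2) plane W(3) main Lt])
  have "(Lt has_vector_derivative (Lam b' L' o\<^sub>L hm o\<^sub>L emb b' L')) ?F"
    by (rule coords_derivative(2)[OF b(2) plane W(3) main Lt])
  moreover have "blinfun_apply hm (D (emb b (L s) x)) = DD u (emb b (L s) x) + D (b (Ld x))" if "x \<in> V\<^sub>0" for x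
  proof -
    have "j (D (emb b (L s) x)) = x" using j[OF that] by (simp add: A'_def D_def)
    then show ?thesis using b(1) by (simp add: hm_def Ad_def blinfun.add_left lin_iso_blinfun)
  qed
  ultimately show "\<exists>hm :: 'e \<Rightarrow>\<^sub>L 'e. (\<forall>x\<in>V\<^sub>0. blinfun_apply hm (D (emb b (L s) x)) = DD u (emb b (L s) x) + D (b (Ld x))) \<and>
       (Lt has_vector_derivative (Lam b' L' o\<^sub>L hm o\<^sub>L emb b' L')) ?F" by blast
qed

subsection \<open>The derivative of the section in coordinates\<close>

text \<open>The turning velocity of \<open>R\<close> in the chart \<open>c\<close>, extended to the whole space by means of \<open>piR\<close>.\<close>

definition turning :: "('m, 'e) chart \<Rightarrow> 'm \<Rightarrow> 'e \<Rightarrow> 'e \<Rightarrow>\<^sub>L 'e" where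
  "turning c p v = Blinfun (\<lambda>z. tau c p (hc c p v (piR p (tau_inv c p z))))"

lemma turning_apply:
  assumes "c \<in> A" "p \<in> fst c" "v \<in> E p"
  shows "turning c p v z = tau c p (hc c p v (piR p (tau_inv c p z)))"
proof -
  have "hc c p v (r + r') = hc c p v r + hc c p v r'" if "r \<in> R p" "r' \<in> R p" for r r'
    using hc_linear_r[OF assms(3) that, of c 1 1] by simp
  moreover have "hc c p v (a *\<^sub>R r) = a *\<^sub>R hc c p v r" if "r \<in> R p" for a r
    using hc_linear_r[OF assms(3) that that, of c a 0] by simp
  ultimately have "linear (\<lambda>z. tau c p (hc c p v (piR p (tau_inv c p z))))"
    by (intro linearI) (simp_all add: tau_inv_simps piR_simps tau_simps[OF assms(1,2)])
  then show ?thesis unfolding turning_def by (simp add: bounded_linear_Blinfun_apply linear_conv_bounded_linear)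
qed

definition R_coord :: "('m, 'e) chart \<Rightarrow> ('e \<Rightarrow> 'e) \<Rightarrow> 'm \<Rightarrow> 'e \<Rightarrow>\<^sub>L 'e" where
  "R_coord c b p = plane_coord b (tau c p ` R p)"

text \<open>The plane coordinate of the tangent vector of the section \<open>R\<close> over \<open>v\<close>, as predicted by \<open>coords_derivative\<close>. Together
  with the coordinate of \<open>v\<close> itself it forms \<open>section_velocity\<close>.\<close>

definition R_coord_deriv :: "('m, 'e) chart \<Rightarrow> ('e \<Rightarrow> 'e) \<Rightarrow> 'm \<Rightarrow> 'e \<Rightarrow> 'e \<Rightarrow>\<^sub>L 'e" where
  "R_coord_deriv c b p v = Lam b (R_coord c b p) o\<^sub>L turning c p v o\<^sub>L emb b (R_coord c b p)"

definition section_velocity :: "('m, 'e) chart \<Rightarrow> ('e \<Rightarrow> 'e) \<Rightarrow> 'm \<Rightarrow> 'e \<Rightarrow> 'e \<times> ('e \<Rightarrow>\<^sub>L 'e)" where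
  "section_velocity c b p v = (tau c p v, R_coord_deriv c b p v)"

lemma R_in_gc: "(p, R p) \<in> fst (gc c b) \<longleftrightarrow> p \<in> fst c \<and> (\<exists>L. coords b (tau c p ` R p) L)"
  by (simp add: gc_dom R_sub dim_R)

lemma coords_R_coord: "lin_iso b \<Longrightarrow> (p, R p) \<in> fst (gc c b) \<Longrightarrow> coords b (tau c p ` R p) (R_coord c b p)"
  unfolding R_coord_def using plane_coord_eq by (auto simp: R_in_gc)

text \<open>The coordinates \<open>R_coord_deriv\<close> transform as derivatives of coordinates should: the transition maps of the Grassmann
  bundle involve the derivative of the change of charts of the base, whose own derivative \<open>D2\<close> is the term by
  which \<open>hc\<close> depends on the chart, up to a vector in \<open>R\<close> that \<open>Lam\<close> kills.\<close>

lemma R_coord_deriv_change: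
  assumes c: "c \<in> A" "c' \<in> A" and b: "lin_iso b" "lin_iso b'"
    and p: "(p, R p) \<in> fst (gc c b)" "(p, R p) \<in> fst (gc c' b')" and v: "v \<in> E p"
    and hm: "\<And>x. x \<in> V\<^sub>0 \<Longrightarrow> blinfun_apply hm (D1 (rep id c c') (snd c p) (emb b (R_coord c b p) x)) =
      D2 (rep id c c') (snd c p) (tau c p v) (emb b (R_coord c b p) x) + D1 (rep id c c') (snd c p) (b (R_coord_deriv c b p v x))"
  shows "Lam b' (R_coord c' b' p) o\<^sub>L hm o\<^sub>L emb b' (R_coord c' b' p) = R_coord_deriv c' b' p v"
proof (rule blinfun_eqI)
  fix x'
  let ?D = "D1 (rep id c c') (snd c p)" and ?L = "R_coord c b p" and ?L' = "R_coord c' b' p"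
  have pc: "p \<in> fst c" "p \<in> fst c'" using p by (auto simp: R_in_gc)
  note cl = coords_R_coord[OF b(1) p(1)] and cl' = coords_R_coord[OF b(2) p(2)]
  define y where "y = emb b' ?L' x'"
  have "y \<in> tau c' p ` R p" unfolding y_def by (rule coords_emb(2)[OF b(2) cl'])
  then obtain \<rho> where \<rho>: "\<rho> \<in> R p" "y = tau c' p \<rho>" by blast
  define z where "z = tau c p \<rho>"
  have yz: "y = ?D z" using tau_change[OF c pc] \<rho> by (simp add: z_def)
  have "z \<in> tau c p ` R p" using \<rho> by (simp add: z_def)
  then obtain x where x: "x \<in> V\<^sub>0" "z = emb b ?L x" using coords_emb(1)[OF b(1) cl] by blast
  define m where "m = turning c p v z"
  have m: "m = tau c p (hc c p v \<rho>)" using c pc v \<rho> by (simp add: m_def z_def turning_apply)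
  have "b (R_coord_deriv c b p v x) = b (Lam b ?L m)" by (simp add: R_coord_deriv_def m_def x(2))
  also have "\<dots> = m - emb b ?L (inv b m)"
    by (simp add: Lam_apply[OF b(1)] emb_apply[OF b(1)] linear_diff[OF lin_iso_inv(3)[OF b(1)]]
        linear_add[OF lin_iso_inv(3)[OF b(1)]] lin_iso_inv[OF b(1)])
  finally have "hm y = D2 (rep id c c') (snd c p) (tau c p v) z + (?D m - ?D (emb b ?L (inv b m)))"
    using hm[OF x(1)] by (simp add: yz x(2) blinfun.diff_right)
  moreover have "Lam b' ?L' (?D (emb b ?L (inv b m))) = 0"
  proof (rule Lam_zero[OF b(2) cl'])
    obtain \<rho>' where "\<rho>' \<in> R p" "emb b ?L (inv b m) = tau c p \<rho>'" using coords_emb(2)[OF b(1) cl] by blast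
    then show "?D (emb b ?L (inv b m)) \<in> tau c' p ` R p" using tau_change[OF c pc] by auto
  qed
  ultimately have 1: "Lam b' ?L' (hm y) = Lam b' ?L' (D2 (rep id c c') (snd c p) (tau c p v) z) + Lam b' ?L' (?D m)"
    by (simp add: blinfun.add_right blinfun.diff_right)
  let ?\<beta> = "beta id c c' p v \<rho>"
  have "tau c' p ?\<beta> = D2 (rep id c c') (snd c p) (tau c p v) z" using c pc by (simp add: beta_def z_def)
  moreover have "Lam b' ?L' (tau c' p (piR p ?\<beta>)) = 0" by (rule Lam_zero[OF b(2) cl']) simp
  moreover have "turning c' p v y = tau c' p (hc c p v \<rho>) + (tau c' p ?\<beta> - tau c' p (piR p ?\<beta>))"
    using c pc v \<rho> by (simp add: turning_apply hc_change[OF c pc] tau_simps)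
  moreover have "tau c' p (hc c p v \<rho>) = ?D m" using tau_change[OF c pc] by (simp add: m)
  ultimately have "Lam b' ?L' (turning c' p v y) = Lam b' ?L' (hm y)"
    using 1 by (simp add: blinfun.add_right blinfun.diff_right)
  then show "(Lam b' ?L' o\<^sub>L hm o\<^sub>L emb b' ?L') x' = R_coord_deriv c' b' p v x'" by (simp add: R_coord_deriv_def y_def)
qed

lemma R_coord_deriv_hom:
  assumes b: "lin_iso b" and p: "(p, R p) \<in> fst (gc c b)"
  shows "R_coord_deriv c b p v \<in> hom_model d"
proof (rule homI)
  have L: "R_coord c b p \<in> hom_model d" using coords_R_coord[OF b p] by (simp add: coords_def)
  fix x
  have "emb b (R_coord c b p) (PB x) = emb b (R_coord c b p) x" using homD[OF L] by (simp add: emb_apply[OF b])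
  then show "R_coord_deriv c b p v (PB x) = R_coord_deriv c b p v x" by (simp add: R_coord_deriv_def)
  show "PB (R_coord_deriv c b p v x) = 0" using homD[OF L] by (simp add: R_coord_deriv_def Lam_apply[OF b] blinfun.diff_right)
qed

text \<open>\<open>R\<close> is a continuous section because \<open>piR\<close> is continuous.\<close>

lemma R_in_gc_open:
  assumes c: "c \<in> A" and b: "lin_iso b" and p: "(p, R p) \<in> fst (gc c b)"
  shows "\<forall>\<^sub>F q in nhds p. (q, R q) \<in> fst (gc c b)" "(R_coord c b \<longlongrightarrow> R_coord c b p) (nhds p)"
proof -
  have pc: "p \<in> fst c" using p by (simp add: R_in_gc)
  note cl = coords_R_coord[OF b p]
  have *: "\<forall>\<^sub>F q in nhds p. (q, R q) \<in> fst (gc c b) \<and> norm (R_coord c b q - R_coord c b p) \<le> \<eta>" if \<eta>: "0 < \<eta>" for \<eta>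
  proof -
    obtain \<epsilon> where \<epsilon>: "\<epsilon> > 0" "\<And>V'. subspace V' \<Longrightarrow> dim V' = d \<Longrightarrow> (\<forall>r\<in>V'. norm (Lam b (R_coord c b p) r) \<le> \<epsilon> * norm r) \<Longrightarrow>
       (\<exists>L. coords b V' L \<and> norm (L - R_coord c b p) \<le> \<eta>)"
      using coords_near[OF b cl \<eta>] by blast
    let ?n = "norm (Lam b (R_coord c b p)) + 1"
    have n: "0 < ?n" by (simp add: add_nonneg_pos)
    have "0 < \<epsilon> / ?n" using \<epsilon> n by simp
    from tendstoD[OF Pc_continuous_nhds[OF c pc] this] chart_tendsto(2)[OF filterlim_ident c pc]
    show ?thesis
    proof eventually_elim
      case (elim q)
      have "norm (Lam b (R_coord c b p) r) \<le> \<epsilon> * norm r" if r: "r \<in> tau c q ` R q" for r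
      proof -
        have "Pc c q r = r" using r c elim(2) by (auto simp: Pc_apply)
        moreover have "Lam b (R_coord c b p) (Pc c p r) = 0"
          by (rule Lam_zero[OF b cl]) (simp add: Pc_apply[OF c pc])
        ultimately have "Lam b (R_coord c b p) r = Lam b (R_coord c b p) ((Pc c q - Pc c p) r)"
          by (simp add: blinfun.diff_left blinfun.diff_right)
        also have "norm \<dots> \<le> ?n * (\<epsilon> / ?n * norm r)"
        proof (rule order_trans[OF norm_blinfun mult_mono])
          show "norm ((Pc c q - Pc c p) r) \<le> \<epsilon> / ?n * norm r"
            using elim(1) by (intro order_trans[OF norm_blinfun mult_right_mono]) (auto simp: dist_norm)
        qed auto
        also have "\<dots> = \<epsilon> * norm r" using less_imp_neq[OF n] by simp
        finally show ?thesis .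
      qed
      then obtain L where L: "coords b (tau c q ` R q) L" "norm (L - R_coord c b p) \<le> \<eta>"
        using \<epsilon>(2)[of "tau c q ` R q"] tau_image_plane[OF c elim(2)] R_sub dim_R by metis
      then show ?case using elim(2) plane_coord_eq[OF b L(1)] by (auto simp: R_in_gc R_coord_def)
    qed
  qed
  show "\<forall>\<^sub>F q in nhds p. (q, R q) \<in> fst (gc c b)" using *[OF zero_less_one] by eventually_elim simp
  show "(R_coord c b \<longlongrightarrow> R_coord c b p) (nhds p)"
  proof (rule tendstoI)
    fix e :: real assume "0 < e"
    then have "0 < e / 2" by simp
    from *[OF this] show "\<forall>\<^sub>F q in nhds p. dist (R_coord c b q) (R_coord c b p) < e"
      by eventually_elim (use \<open>0 < e\<close> in \<open>simp add: dist_norm\<close>)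
  qed
qed

lemma section_velocity_tendsto:
  assumes c: "c \<in> A" and b: "lin_iso b" and p: "(p, R p) \<in> fst (gc c b)"
    and w: "tends_TM F q w p v" and E: "\<And>i. w i \<in> E (q i)" "v \<in> E p"
  shows "((\<lambda>i. section_velocity c b (q i) (w i)) \<longlongrightarrow> section_velocity c b p v) F"
proof -
  have pc: "p \<in> fst c" using p by (simp add: R_in_gc)
  note q = tends_TMD(1)[OF w]
  have L: "((\<lambda>i. R_coord c b (q i)) \<longlongrightarrow> R_coord c b p) F"
    by (rule filterlim_compose[OF R_in_gc_open(2)[OF c b p] q])
  note cp = bounded_bilinear.tendsto[OF bounded_bilinear_blinfun_compose]
  have em: "((\<lambda>i. emb b (R_coord c b (q i))) \<longlongrightarrow> emb b (R_coord c b p)) F"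
    unfolding emb_def by (intro cp tendsto_intros L)
  have la: "((\<lambda>i. Lam b (R_coord c b (q i))) \<longlongrightarrow> Lam b (R_coord c b p)) F"
    unfolding Lam_def by (intro cp tendsto_intros L)
  have "((\<lambda>i. turning c (q i) (w i) o\<^sub>L emb b (R_coord c b (q i))) \<longlongrightarrow> turning c p v o\<^sub>L emb b (R_coord c b p)) F"
  proof (rule tendsto_blinfun_pointwise)
    fix x
    let ?z = "\<lambda>i. emb b (R_coord c b (q i)) x" and ?y = "emb b (R_coord c b p) x"
    have "tends_TM F q (\<lambda>i. tau_inv c (q i) (?z i)) p (tau_inv c p ?y)"
    proof (rule tends_TMI[OF q c pc])
      have "((\<lambda>i. ?z i) \<longlongrightarrow> tau c p (tau_inv c p ?y)) F"
        using blinfun.tendsto[OF em tendsto_const] c pc by simp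
      then show "((\<lambda>i. tau c (q i) (tau_inv c (q i) (?z i))) \<longlongrightarrow> tau c p (tau_inv c p ?y)) F"
        by (rule Lim_transform_eventually)
          (use chart_tendsto(2)[OF q c pc] in eventually_elim, use c in simp)
    qed
    note piR_tendsto[OF this]
    from tends_TMD(2)[OF hc_tendsto[OF w this E(1) piR_R E(2) piR_R c pc] c pc]
    have "((\<lambda>i. tau c (q i) (hc c (q i) (w i) (piR (q i) (tau_inv c (q i) (?z i))))) \<longlongrightarrow>
        tau c p (hc c p v (piR p (tau_inv c p ?y)))) F" .
    then have "((\<lambda>i. tau c (q i) (hc c (q i) (w i) (piR (q i) (tau_inv c (q i) (?z i))))) \<longlongrightarrow>
        (turning c p v o\<^sub>L emb b (R_coord c b p)) x) F" using turning_apply[OF c pc E(2)] by simp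
    then show "((\<lambda>i. (turning c (q i) (w i) o\<^sub>L emb b (R_coord c b (q i))) x) \<longlongrightarrow> (turning c p v o\<^sub>L emb b (R_coord c b p)) x) F"
      by (rule Lim_transform_eventually)
        (use chart_tendsto(2)[OF q c pc] in eventually_elim, use turning_apply[OF c _ E(1)] in simp)
  qed
  note lim = cp[OF la this]
  have "((\<lambda>i. R_coord_deriv c b (q i) (w i)) \<longlongrightarrow> R_coord_deriv c b p v) F"
  proof -
    have "X o\<^sub>L Y o\<^sub>L Z = X o\<^sub>L (Y o\<^sub>L Z)" for X Y Z :: "'e \<Rightarrow>\<^sub>L 'e" by (rule blinfun_eqI) simp
    then show ?thesis using lim by (simp add: R_coord_deriv_def)
  qed
  then show ?thesis unfolding section_velocity_def by (intro tendsto_Pair tends_TMD(2)[OF w c pc])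
qed

text \<open>In the chart at the point of the arc this is \<open>first_order_h\<close>: transport of \<open>R (\<gamma> t)\<close> in this chart yields the plane
  turned by \<open>h\<close>, up to an error that is negligible compared with the time.\<close>

lemma section_arc_cc:
  assumes arc: "E_arc {a..e} \<gamma> w" "s \<in> {a..e}"
    and b: "lin_iso b" "coords b (tau (cc (\<gamma> s)) (\<gamma> s) ` R (\<gamma> s)) L0"
  shows "\<forall>\<^sub>F t in at s within {a..e}. coords b (tau (cc (\<gamma> s)) (\<gamma> t) ` R (\<gamma> t)) (R_coord (cc (\<gamma> s)) b (\<gamma> t))"
    and "((\<lambda>t. R_coord (cc (\<gamma> s)) b (\<gamma> t)) has_vector_derivative R_coord_deriv (cc (\<gamma> s)) b (\<gamma> s) (w s)) (at s within {a..e})"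
proof -
  let ?F = "at s within {a..e}"
  define p where "p = \<gamma> s"
  define c where "c = cc p"
  have c: "c \<in> A" "p \<in> fst c" "p \<in> K c" "c \<in> range cc" using cc_A cc_in by (auto simp: c_def)
  have v: "w s \<in> E p" using E_arcD(1)[OF arc] by (simp add: p_def)
  have L0: "coords b (tau c p ` R p) L0" using b(2) by (simp add: p_def c_def)
  have Leq: "R_coord c b p = L0" unfolding R_coord_def by (rule plane_coord_eq[OF b(1) L0])
  obtain C where C: "C > 0" "\<And>z. norm z \<le> C * N p (tau_inv c p z)" "\<And>z. N p (tau_inv c p z) \<le> C * norm z"
    using norm_bounds c(3,4) by blast
  obtain C' where C': "C' \<ge> 1" "\<And>v. N p (piR p v) \<le> C' * N p v" using piR_bound by blast
  have dom: "\<forall>\<^sub>F t in ?F. \<gamma> t \<in> fst c"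
    using chart_tendsto(2)[OF E_arcD(3)[OF arc] c(1)] c(2) by (simp add: p_def)
  have plane: "\<forall>\<^sub>F t in ?F. subspace (tau c (\<gamma> t) ` R (\<gamma> t)) \<and> dim (tau c (\<gamma> t) ` R (\<gamma> t)) = d"
    using dom by eventually_elim (use tau_image_plane[OF c(1)] R_sub dim_R in auto)
  have main: "\<forall>\<^sub>F t in ?F. \<forall>z\<in>tau c (\<gamma> t) ` R (\<gamma> t). norm (Lam b L0 (z - (t - s) *\<^sub>R turning c p (w s) z)) \<le> \<epsilon> * \<bar>t - s\<bar> * norm z"
    if \<epsilon>: "0 < \<epsilon>" for \<epsilon>
  proof -
    let ?M = "norm (Lam b L0) + 1"
    have M: "0 < ?M" by (simp add: add_nonneg_pos)
    define e1 where "e1 = \<epsilon> / (?M * C * C' * C)"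
    have p0: "0 < ?M * C * C' * C" using M C C' by simp
    then have e1: "0 < e1" "?M * C * e1 * C' * C = \<epsilon>"
    proof -
      show "0 < e1" unfolding e1_def using \<epsilon> p0 by (rule divide_pos_pos)
      have "(?M * C * C' * C) * e1 = \<epsilon>" unfolding e1_def using less_imp_neq[OF p0] by (simp only: times_divide_eq_right nonzero_mult_div_cancel_left)
      then show "?M * C * e1 * C' * C = \<epsilon>" by (simp only: mult_ac)
    qed
    from first_order_h[OF arc e1(1)] dom show ?thesis
    proof eventually_elim
      case (elim t)
      show ?case
      proof
        fix z assume "z \<in> tau c (\<gamma> t) ` R (\<gamma> t)"
        then obtain \<rho> where \<rho>: "\<rho> \<in> R (\<gamma> t)" "z = tau c (\<gamma> t) \<rho>" by blast
        define u where "u = tr p (\<gamma> t) \<rho>"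
        have z: "z = tau c p u" "u = tau_inv c p z" using c \<rho> by (simp_all add: u_def tr_def flip: c_def)
        let ?y = "Q p u - (t - s) *\<^sub>R h p (w s) (piR p u)"
        have fo: "N p ?y \<le> e1 * \<bar>t - s\<bar> * N p (piR p u)"
          using elim(1) \<rho>(1) unfolding first_order_def Let_def u_def p_def by blast
        have "turning c p (w s) z = tau c p (h p (w s) (piR p u))"
          unfolding turning_apply[OF c(1,2) v] z(2)[symmetric] by (simp add: c_def)
        then have "z - (t - s) *\<^sub>R turning c p (w s) z = tau c p ?y + tau c p (piR p u)"
          by (simp add: z(1) tau_simps[OF c(1,2)])
        moreover have "Lam b L0 (tau c p (piR p u)) = 0" by (rule Lam_zero[OF b(1) L0]) simp
        ultimately have "Lam b L0 (z - (t - s) *\<^sub>R turning c p (w s) z) = Lam b L0 (tau c p ?y)"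
          by (simp add: blinfun.add_right)
        also have "norm \<dots> \<le> ?M * norm (tau c p ?y)"
          by (rule order_trans[OF norm_blinfun mult_right_mono]) auto
        also have "\<dots> \<le> ?M * (C * N p ?y)" using M C(2)[of "tau c p ?y"] c by (intro mult_left_mono) auto
        also have "\<dots> \<le> ?M * (C * (e1 * \<bar>t - s\<bar> * (C' * (C * norm z))))"
        proof -
          have "N p (piR p u) \<le> C' * (C * norm z)"
          proof (rule order_trans[OF C'(2) mult_left_mono])
            show "N p u \<le> C * norm z" unfolding z(2) by (rule C(3))
          qed (use C'(1) in simp)
          then have "e1 * \<bar>t - s\<bar> * N p (piR p u) \<le> e1 * \<bar>t - s\<bar> * (C' * (C * norm z))"
            using e1(1) by (intro mult_left_mono) auto
          then show ?thesis using fo M C(1) by (intro mult_left_mono) auto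
        qed
        also have "\<dots> = (?M * C * e1 * C' * C) * \<bar>t - s\<bar> * norm z" by (simp only: mult_ac)
        finally show "norm (Lam b L0 (z - (t - s) *\<^sub>R turning c p (w s) z)) \<le> \<epsilon> * \<bar>t - s\<bar> * norm z"
          unfolding e1(2) .
      qed
    qed
  qed
  have Lt: "R_coord c b (\<gamma> t) = M" if "coords b (tau c (\<gamma> t) ` R (\<gamma> t)) M" for t M
    unfolding R_coord_def by (rule plane_coord_eq[OF b(1) that])
  have V0: "coords b (tau c (\<gamma> s) ` R (\<gamma> s)) L0" using L0 by (simp add: p_def)
  show "\<forall>\<^sub>F t in ?F. coords b (tau (cc (\<gamma> s)) (\<gamma> t) ` R (\<gamma> t)) (R_coord (cc (\<gamma> s)) b (\<gamma> t))"
    using coords_derivative(1)[OF b(1) plane V0 main Lt] by (simp add: c_def p_def)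
  show "((\<lambda>t. R_coord (cc (\<gamma> s)) b (\<gamma> t)) has_vector_derivative R_coord_deriv (cc (\<gamma> s)) b (\<gamma> s) (w s)) ?F"
    using coords_derivative(2)[OF b(1) plane V0 main Lt] unfolding R_coord_deriv_def Leq[symmetric] by (simp add: c_def p_def)
qed

text \<open>The section is differentiable along arcs tangent to \<open>E\<close>: in the chart at a point of the arc this is the first order
  estimate, and every other chart is reached by a change of coordinates.\<close>

lemma section_arc:
  assumes arc: "E_arc {a..e} \<gamma> w" "s \<in> {a..e}"
    and c': "c' \<in> A" and b': "lin_iso b'" and p': "(\<gamma> s, R (\<gamma> s)) \<in> fst (gc c' b')"
  shows "\<forall>\<^sub>F t in at s within {a..e}. (\<gamma> t, R (\<gamma> t)) \<in> fst (gc c' b')"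
    and "((\<lambda>t. snd (gc c' b') (\<gamma> t, R (\<gamma> t))) has_vector_derivative section_velocity c' b' (\<gamma> s) (w s)) (at s within {a..e})"
proof -
  let ?F = "at s within {a..e}"
  let ?c = "cc (\<gamma> s)"
  have c: "?c \<in> A" "\<gamma> s \<in> fst ?c" using cc_A cc_in by auto
  have pc': "\<gamma> s \<in> fst c'" using p' by (simp add: R_in_gc)
  note \<gamma> = E_arcD(3)[OF arc]
  show "\<forall>\<^sub>F t in ?F. (\<gamma> t, R (\<gamma> t)) \<in> fst (gc c' b')"
    by (rule eventually_compose_filterlim[OF R_in_gc_open(1)[OF c' b' p'] \<gamma>])
  obtain b where b: "lin_iso b" "coords b (tau ?c (\<gamma> s) ` R (\<gamma> s)) 0"
    using adapted_frame[OF tau_image_plane(1)[OF c R_sub]] tau_image_plane(2)[OF c] dim_R by metis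
  have p: "(\<gamma> s, R (\<gamma> s)) \<in> fst (gc ?c b)" using b c by (auto simp: R_in_gc)
  have W: "\<forall>\<^sub>F t in ?F. subspace (R (\<gamma> t)) \<and> dim (R (\<gamma> t)) = d \<and> coords b (tau ?c (\<gamma> t) ` R (\<gamma> t)) (R_coord ?c b (\<gamma> t))"
    using section_arc_cc(1)[OF arc b] by (simp add: R_sub dim_R)
  obtain hm :: "'e \<Rightarrow>\<^sub>L 'e" where hm: "\<And>x. x \<in> V\<^sub>0 \<Longrightarrow> hm (D1 (rep id ?c c') (snd ?c (\<gamma> s)) (emb b (R_coord ?c b (\<gamma> s)) x)) =
      D2 (rep id ?c c') (snd ?c (\<gamma> s)) (tau ?c (\<gamma> s) (w s)) (emb b (R_coord ?c b (\<gamma> s)) x) +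
      D1 (rep id ?c c') (snd ?c (\<gamma> s)) (b (R_coord_deriv ?c b (\<gamma> s) (w s) x))"
    "((\<lambda>t. plane_coord b' (tau c' (\<gamma> t) ` R (\<gamma> t))) has_vector_derivative (Lam b' (R_coord c' b' (\<gamma> s)) o\<^sub>L hm o\<^sub>L emb b' (R_coord c' b' (\<gamma> s)))) ?F"
    using coords_change(2)[OF c(1) c' b(1) b' \<gamma> c(2) pc' arc(2) W coords_R_coord[OF b(1) p] coords_R_coord[OF b' p']
      E_arcD(4)[OF arc c] section_arc_cc(2)[OF arc b]] by blast
  note R_coord_deriv_change[OF c(1) c' b(1) b' p p' E_arcD(1)[OF arc] hm(1)]
  then have "((\<lambda>t. plane_coord b' (tau c' (\<gamma> t) ` R (\<gamma> t))) has_vector_derivative R_coord_deriv c' b' (\<gamma> s) (w s)) ?F"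
    using hm(2) by simp
  then show "((\<lambda>t. snd (gc c' b') (\<gamma> t, R (\<gamma> t))) has_vector_derivative section_velocity c' b' (\<gamma> s) (w s)) ?F"
    unfolding gc_apply section_velocity_def by (intro has_vector_derivative_Pair E_arcD(4)[OF arc c' pc'])
qed

subsection \<open>The vectors \<open>section_velocity\<close> as tangent vectors of the Grassmann bundle\<close>

text \<open>The straight line that represents \<open>section_velocity\<close> in the preferred chart of the Grassmann bundle is a curve \<open>W\<close> of
  planes over a straight line \<open>q\<close> in the base.\<close>

lemma grassmann_line:
  assumes c: "c \<in> A" and b: "lin_iso b" and p: "(p, R p) \<in> fst (gc c b)" and ca: "chart_at GA (p, R p) = gc c b"
  shows "\<exists>T q W. open T \<and> (0::real) \<in> T \<and> q 0 = p \<and> (q \<longlongrightarrow> p) (at 0) \<and>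
    (\<forall>t\<in>T. line_at GA ((p, R p), section_velocity c b p v) t = (q t, W t)) \<and>
    (\<forall>t\<in>T. subspace (W t) \<and> dim (W t) = d \<and> coords b (tau c (q t) ` W t) (R_coord c b p + t *\<^sub>R R_coord_deriv c b p v)) \<and>
    (\<forall>c'\<in>A. p \<in> fst c' \<longrightarrow> ((\<lambda>t. snd c' (q t)) has_vector_derivative tau c' p v) (at 0))"
proof -
  have pc: "p \<in> fst c" using p by (simp add: R_in_gc)
  let ?l = "\<lambda>t::real. snd c p + t *\<^sub>R tau c p v" and ?U = "snd c ` fst c"
  have U: "open ?U" using open_chart_image[OF c open_UNIV] by simp
  define T where "T = ?l -` ?U"
  have cont: "continuous_on UNIV ?l" by (intro continuous_intros)
  have T: "open T" "0 \<in> T" unfolding T_def using open_vimage[OF U cont] pc by auto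
  define q where "q t = chart_inv c (?l t)" for t
  define L where "L t = R_coord c b p + t *\<^sub>R R_coord_deriv c b p v" for t :: real
  define W where "W t = tau_inv c (q t) ` b ` graph_plane d (L t)" for t
  have H: "L t \<in> hom_model d" for t
  proof -
    have "R_coord c b p \<in> hom_model d" using coords_R_coord[OF b p] by (simp add: coords_def)
    from homD[OF this] homD[OF R_coord_deriv_hom[OF b p, of v]] show ?thesis
      unfolding L_def by (intro homI) (simp_all add: blinfun.add_left blinfun.scaleR_left blinfun.add_right blinfun.scaleR_right)
  qed
  have q0: "q 0 = p" using c pc by (simp add: q_def)
  have line: "line_at GA ((p, R p), section_velocity c b p v) t = (q t, W t)" if "t \<in> T" for t
  proof -
    have "line_at GA ((p, R p), section_velocity c b p v) t = chart_inv (gc c b) (?l t, L t)"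
      by (simp add: line_at_def Let_def ca gc_apply section_velocity_def L_def R_coord_def)
    also have "\<dots> = (q t, W t)" unfolding q_def W_def by (rule gc_inv(1)[OF c b _ H]) (use that in \<open>simp add: T_def\<close>)
    finally show ?thesis .
  qed
  have qd: "q t \<in> fst c" "snd c (q t) = ?l t" if "t \<in> T" for t
    using gc_inv(3,4)[OF c b _ H, of "?l t"] that by (auto simp: T_def q_def)
  have "isCont ?l 0" using cont by (simp add: continuous_on_eq_continuous_at)
  moreover have "isCont (chart_inv c) (?l 0)"
  proof -
    have "continuous_on ?U (chart_inv c)" using chart_homeo[OF c] by (simp add: homeomorphism_def)
    then show ?thesis using U pc by (simp add: continuous_on_eq_continuous_at)
  qed
  ultimately have "isCont (\<lambda>t. chart_inv c (?l t)) 0" by (rule isCont_o2)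
  then have qt: "(q \<longlongrightarrow> p) (at 0)" using q0 by (simp add: isCont_def q_def[abs_def])
  show ?thesis
  proof (intro exI[of _ T] exI[of _ q] exI[of _ W] conjI ballI impI T q0 qt line)
    fix t assume t: "t \<in> T"
    show "subspace (W t)" "dim (W t) = d" "coords b (tau c (q t) ` W t) (R_coord c b p + t *\<^sub>R R_coord_deriv c b p v)"
      using graph_plane_dim[OF b H[of t]] tau_inv_image_plane[OF c qd(1)[OF t]] tau_image_plane(4)[OF c qd(1)[OF t]]
      by (simp_all add: W_def L_def)
  next
    fix c' assume c': "c' \<in> A" "p \<in> fst c'"
    have "(?l has_vector_derivative tau c p v) (at 0)" by (auto intro!: derivative_eq_intros)
    then have "((\<lambda>t. snd c (q t)) has_vector_derivative tau c (q 0) v) (at 0)"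
      unfolding q0 by (rule has_vector_derivative_transform_within_open[OF _ T]) (simp add: qd)
    with chart_vector_derivative[OF C2_id c c'(1), of q 0 UNIV v]
    show "((\<lambda>t. snd c' (q t)) has_vector_derivative tau c' p v) (at 0)"
      using pc c'(2) qt by (simp add: q0)
  qed
qed

text \<open>The vectors \<open>section_velocity\<close> in different charts are coordinates of a single tangent vector of the Grassmann
  bundle, and this vector lies over \<open>v\<close>.\<close>

lemma tangent_coord_section_velocity:
  assumes c: "c \<in> A" "c' \<in> A" and b: "lin_iso b" "lin_iso b'" and p: "(p, R p) \<in> fst (gc c b)" "(p, R p) \<in> fst (gc c' b')"
    and ca: "chart_at GA (p, R p) = gc c b" and v: "v \<in> E p"
  shows "tangent_coord GA (gc c' b') ((p, R p), section_velocity c b p v) = section_velocity c' b' p v"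
    and "tangent_map GA A fst ((p, R p), section_velocity c b p v) = (p, v)"
proof -
  have pc: "p \<in> fst c" "p \<in> fst c'" using p by (auto simp: R_in_gc)
  obtain T q W where *: "open T \<and> (0::real) \<in> T \<and> q 0 = p \<and> (q \<longlongrightarrow> p) (at 0) \<and>
    (\<forall>t\<in>T. line_at GA ((p, R p), section_velocity c b p v) t = (q t, W t)) \<and>
    (\<forall>t\<in>T. subspace (W t) \<and> dim (W t) = d \<and> coords b (tau c (q t) ` W t) (R_coord c b p + t *\<^sub>R R_coord_deriv c b p v)) \<and>
    (\<forall>c'\<in>A. p \<in> fst c' \<longrightarrow> ((\<lambda>t. snd c' (q t)) has_vector_derivative tau c' p v) (at 0))"
    using grassmann_line[OF c(1) b(1) p(1) ca, of v] by (elim exE)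
  then have T: "open T" "(0::real) \<in> T" and q: "q 0 = p" "(q \<longlongrightarrow> p) (at 0)"
    and line: "\<And>t. t \<in> T \<Longrightarrow> line_at GA ((p, R p), section_velocity c b p v) t = (q t, W t)"
    and W: "\<And>t. t \<in> T \<Longrightarrow> subspace (W t) \<and> dim (W t) = d \<and> coords b (tau c (q t) ` W t) (R_coord c b p + t *\<^sub>R R_coord_deriv c b p v)"
    and der: "\<And>c'. c' \<in> A \<Longrightarrow> p \<in> fst c' \<Longrightarrow> ((\<lambda>t. snd c' (q t)) has_vector_derivative tau c' p v) (at 0)"
    by simp_all
  have evT: "\<forall>\<^sub>F t in at 0. t \<in> T" using T by (simp add: eventually_at_topological) blast
  have W0: "coords b (tau c p ` W 0) (R_coord c b p)" using W[OF T(2)] by (simp add: q(1))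
  have "tau c p ` W 0 = tau c p ` R p" using W0 coords_R_coord[OF b(1) p(1)] by (simp add: coords_def)
  then have WR: "W 0 = R p" using tau_image_plane(3)[OF c(1) pc(1)] by metis
  let ?L = "\<lambda>t::real. R_coord c b p + t *\<^sub>R R_coord_deriv c b p v"
  have "\<forall>\<^sub>F t in at 0. subspace (W t) \<and> dim (W t) = d \<and> coords b (tau c (q t) ` W t) (?L t)"
    using evT by eventually_elim (rule W)
  moreover have "(?L has_vector_derivative R_coord_deriv c b p v) (at 0)" by (auto intro!: derivative_eq_intros)
  moreover have L0: "?L 0 = R_coord c b p" by simp
  ultimately obtain hm :: "'e \<Rightarrow>\<^sub>L 'e" where hm: "\<And>x. x \<in> V\<^sub>0 \<Longrightarrow> hm (D1 (rep id c c') (snd c p) (emb b (R_coord c b p) x)) =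
      D2 (rep id c c') (snd c p) (tau c p v) (emb b (R_coord c b p) x) + D1 (rep id c c') (snd c p) (b (R_coord_deriv c b p v x))"
    "((\<lambda>t. plane_coord b' (tau c' (q t) ` W t)) has_vector_derivative (Lam b' (R_coord c' b' p) o\<^sub>L hm o\<^sub>L emb b' (R_coord c' b' p))) (at 0)"
    using coords_change(2)[OF c b, where q = q and s = 0 and I = UNIV and W = W and L = ?L and L' = "R_coord c' b' p" and u = "tau c p v" and Ld = "R_coord_deriv c b p v",
        unfolded q(1) L0 WR, OF q(2) pc UNIV_I _ coords_R_coord[OF b(1) p(1)] coords_R_coord[OF b(2) p(2)] der[OF c(1) pc(1)]] by blast
  note R_coord_deriv_change[OF c b p v hm(1)]
  then have "((\<lambda>t. plane_coord b' (tau c' (q t) ` W t)) has_vector_derivative R_coord_deriv c' b' p v) (at 0)" using hm(2) by simp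
  then have "((\<lambda>t. snd (gc c' b') (q t, W t)) has_vector_derivative section_velocity c' b' p v) (at 0)"
    unfolding gc_apply section_velocity_def by (intro has_vector_derivative_Pair der c pc)
  then have "((\<lambda>t. snd (gc c' b') (line_at GA ((p, R p), section_velocity c b p v) t)) has_vector_derivative section_velocity c' b' p v) (at 0)"
    by (rule has_vector_derivative_transform_within_open[OF _ T]) (simp add: line)
  then show "tangent_coord GA (gc c' b') ((p, R p), section_velocity c b p v) = section_velocity c' b' p v"
    unfolding tangent_coord_def by (rule vector_derivative_at)
  have "((\<lambda>t. snd (chart_at A p) (q t)) has_vector_derivative v) (at 0)"
    using der[OF chart_at[of p]] by simp
  then have "((\<lambda>t. snd (chart_at A p) (fst (line_at GA ((p, R p), section_velocity c b p v) t))) has_vector_derivative v) (at 0)"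
    by (rule has_vector_derivative_transform_within_open[OF _ T]) (simp add: line)
  then show "tangent_map GA A fst ((p, R p), section_velocity c b p v) = (p, v)"
    unfolding tangent_map_def by (simp add: vector_derivative_at)
qed

lemma section_velocity_linear:
  assumes c: "c \<in> A" "p \<in> fst c" and v: "v \<in> E p" "v' \<in> E p"
  shows "section_velocity c b p (r *\<^sub>R v + r' *\<^sub>R v') = r *\<^sub>R section_velocity c b p v + r' *\<^sub>R section_velocity c b p v'"
proof -
  have "r *\<^sub>R v + r' *\<^sub>R v' \<in> E p" using v E_sub by (simp add: subspace_add subspace_scale)
  then have "turning c p (r *\<^sub>R v + r' *\<^sub>R v') z = r *\<^sub>R turning c p v z + r' *\<^sub>R turning c p v' z" for z
    by (simp add: turning_apply[OF c] v hc_linear_v[OF v] tau_simps[OF c])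
  then have "R_coord_deriv c b p (r *\<^sub>R v + r' *\<^sub>R v') = r *\<^sub>R R_coord_deriv c b p v + r' *\<^sub>R R_coord_deriv c b p v'"
    by (intro blinfun_eqI) (simp add: R_coord_deriv_def blinfun.add_left blinfun.add_right blinfun.scaleR_left blinfun.scaleR_right)
  then show ?thesis by (simp add: section_velocity_def tau_simps[OF c])
qed

lemma C1_arc_E_arc:
  assumes arc: "C1_arc A a e \<gamma> \<gamma>'" and E: "\<And>t. t \<in> {a..e} \<Longrightarrow> \<gamma>' t \<in> total_space E"
  shows "E_arc {a..e} \<gamma> (\<lambda>t. snd (\<gamma>' t))"
  unfolding E_arc_def
proof (intro ballI conjI impI)
  let ?I = "{a..e}"
  fix t assume t: "t \<in> ?I"
  let ?F = "at t within ?I"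
  have vel: "has_velocity A \<gamma> ?I s (\<gamma>' s)" if "s \<in> ?I" for s using arc that by (simp add: C1_arc_def)
  have fst: "fst (\<gamma>' s) = \<gamma> s" if "s \<in> ?I" for s using vel[OF that] by (simp add: has_velocity_def)
  show "snd (\<gamma>' t) \<in> E (\<gamma> t)" using E[OF t] fst[OF t] by (auto simp: total_space_def)
  have evI: "\<forall>\<^sub>F s in ?F. fst (\<gamma>' s) = \<gamma> s" using fst by (auto simp: eventually_at_filter)
  have "atin_within euclidean t ?I = ?F"
    by (simp add: filter_eq_iff eventually_atin_within eventually_at_topological) blast
  then have "limitin (tangent_topology A UNIV) \<gamma>' (\<gamma>' t) ?F"
    using arc t unfolding C1_arc_def continuous_map_atin
    by (metis atin_subtopology_within[OF t] topspace_euclidean_subtopology)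
  then have "tends_TM ?F (\<lambda>s. fst (\<gamma>' s)) (\<lambda>s. snd (\<gamma>' s)) (fst (\<gamma>' t)) (snd (\<gamma>' t))"
    by (simp add: tends_TM_iff_limitin)
  then have tT: "tends_TM ?F (\<lambda>s. fst (\<gamma>' s)) (\<lambda>s. snd (\<gamma>' s)) (\<gamma> t) (snd (\<gamma>' t))" using fst[OF t] by simp
  have \<gamma>: "(\<gamma> \<longlongrightarrow> \<gamma> t) ?F" using Lim_transform_eventually[OF tends_TMD(1)[OF tT] evI] .
  show "tends_TM ?F \<gamma> (\<lambda>s. snd (\<gamma>' s)) (\<gamma> t) (snd (\<gamma>' t))"
  proof (rule tends_TMI[OF \<gamma> chart_at])
    show "((\<lambda>s. tau (chart_at A (\<gamma> t)) (\<gamma> s) (snd (\<gamma>' s))) \<longlongrightarrow> tau (chart_at A (\<gamma> t)) (\<gamma> t) (snd (\<gamma>' t))) ?F"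
      by (rule Lim_transform_eventually[OF tends_TMD(2)[OF tT chart_at]]) (use evI in eventually_elim, simp)
  qed
  fix c assume c: "c \<in> A" "\<gamma> t \<in> fst c"
  have "((\<lambda>s. snd (chart_at A (\<gamma> t)) (\<gamma> s)) has_vector_derivative tau (chart_at A (\<gamma> t)) (\<gamma> t) (snd (\<gamma>' t))) ?F"
    using vel[OF t] by (simp add: has_velocity_def)
  from chart_vector_derivative[OF C2_id chart_at(1) c(1) chart_at(2) _ t \<gamma> this]
  show "((\<lambda>s. snd c (\<gamma> s)) has_vector_derivative tau c (\<gamma> t) (snd (\<gamma>' t))) ?F" using c by simp
qed

lemma chart_at_GA:
  "\<exists>c b. c \<in> A \<and> lin_iso b \<and> chart_at GA (p, R p) = gc c b \<and> (p, R p) \<in> fst (gc c b)"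
proof -
  let ?c = "cc p"
  have c: "?c \<in> A" "p \<in> fst ?c" using cc_A cc_in by auto
  obtain b where b: "lin_iso b" "coords b (tau ?c p ` R p) 0"
    using adapted_frame[OF tau_image_plane(1)[OF c R_sub]] tau_image_plane(2)[OF c] dim_R by metis
  have "gc ?c b \<in> GA \<and> (p, R p) \<in> fst (gc ?c b)"
    using b c unfolding grassmann_atlas_def lin_iso_def R_in_gc by blast
  then have "chart_at GA (p, R p) \<in> GA \<and> (p, R p) \<in> fst (chart_at GA (p, R p))"
    unfolding chart_at_def by (rule someI)
  then obtain c b where "c \<in> A" "lin_iso b" "chart_at GA (p, R p) = gc c b" "(p, R p) \<in> fst (chart_at GA (p, R p))"
    unfolding grassmann_atlas_def lin_iso_def by blast
  then show ?thesis by metis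
qed

text \<open>In the preferred chart at \<open>R p\<close> the vector \<open>H (p, v)\<close> is given by \<open>section_velocity\<close>, and so it is in every chart; hence
  continuity can be checked in a fixed chart. Since \<open>section_velocity\<close> is linear only on \<open>E p\<close>, it is extended by a
  projection onto \<open>E p\<close>.\<close>

lemma R_C1: "C1_with_respect_to A d R E"
proof -
  have "\<forall>p. \<exists>c b. c \<in> A \<and> lin_iso b \<and> chart_at GA (p, R p) = gc c b \<and> (p, R p) \<in> fst (gc c b)"
    using chart_at_GA by blast
  then obtain C B where CB: "\<And>p. C p \<in> A" "\<And>p. lin_iso (B p)" "\<And>p. chart_at GA (p, R p) = gc (C p) (B p)"
    "\<And>p. (p, R p) \<in> fst (gc (C p) (B p))" by metis
  have pC: "p \<in> fst (C p)" for p using CB(4)[of p] by (simp add: R_in_gc)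
  define H where "H \<xi> = (section_of R (fst \<xi>), section_velocity (C (fst \<xi>)) (B (fst \<xi>)) (fst \<xi>) (snd \<xi>))" for \<xi> :: "'m \<times> 'e"
  have model: "section_velocity (C p) (B p) p v \<in> grassmann_model d" for p v
    using R_coord_deriv_hom[OF CB(2,4)] by (simp add: section_velocity_def grassmann_model_def)
  have coord: "tangent_coord GA (gc c' b') (H (p, v)) = section_velocity c' b' p v"
    if "c' \<in> A" "lin_iso b'" "(p, R p) \<in> fst (gc c' b')" "v \<in> E p" for c' b' p v
    unfolding H_def section_of_def fst_conv snd_conv
    by (rule tangent_coord_section_velocity(1)[OF CB(1) that(1) CB(2) that(2) CB(4) that(3) CB(3) that(4)])
  show ?thesis
    unfolding C1_with_respect_to_def
  proof (intro exI[of _ H] conjI allI ballI impI)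
    let ?X = "subtopology (tangent_topology A UNIV) (total_space E)" and ?Y = "tangent_topology GA (grassmann_model d)"
    show "continuous_map ?X ?Y H"
      unfolding continuous_map_atin
    proof
      fix \<xi> assume \<xi>: "\<xi> \<in> topspace ?X"
      obtain p v where pv: "\<xi> = (p, v)" "v \<in> E p" using \<xi> by (auto simp: total_space_def)
      let ?F = "atin ?X \<xi>"
      let ?w = "\<lambda>\<eta>. if snd \<eta> \<in> E (fst \<eta>) then snd \<eta> else 0"
      have inE: "\<forall>\<^sub>F \<eta> in ?F. snd \<eta> \<in> E (fst \<eta>)"
        unfolding eventually_atin
        by (rule disjI2, rule exI[of _ "topspace ?X"], intro conjI openin_topspace \<xi>) (auto simp: total_space_def)
      have "continuous_map ?X (tangent_topology A UNIV) (\<lambda>\<eta>. \<eta>)" by (rule continuous_map_from_subtopology) simp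
      then have "limitin (tangent_topology A UNIV) (\<lambda>\<eta>. (fst \<eta>, snd \<eta>)) (p, v) ?F"
        using \<xi> pv unfolding continuous_map_atin by auto
      then have t: "tends_TM ?F fst snd p v" by (simp add: tends_TM_iff_limitin)
      have w: "tends_TM ?F fst ?w p v"
        unfolding tends_TM_def
      proof (intro conjI ballI impI tends_TMD(1)[OF t])
        fix c assume c: "c \<in> A" "p \<in> fst c"
        show "((\<lambda>\<eta>. tau c (fst \<eta>) (?w \<eta>)) \<longlongrightarrow> tau c p v) ?F"
          by (rule Lim_transform_eventually[OF tends_TMD(2)[OF t c]]) (use inE in eventually_elim, simp)
      qed
      have Hpv: "H \<xi> = ((p, R p), section_velocity (C p) (B p) p v)" by (simp add: H_def pv section_of_def)
      have sub: "\<forall>\<^sub>F \<eta> in ?F. H \<eta> \<in> V" if V: "V \<in> {{\<xi>. fst \<xi> \<in> fst c \<and> snd \<xi> \<in> grassmann_model d \<and>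
          (snd c (fst \<xi>), tangent_coord GA c \<xi>) \<in> B} | c B. c \<in> GA \<and> open B}" and HV: "H \<xi> \<in> V" for V
      proof -
        obtain c' b' Z where c': "c' \<in> A" and b': "lin_iso b'" and Z: "open Z"
          and VZ: "V = {\<xi>. fst \<xi> \<in> fst (gc c' b') \<and> snd \<xi> \<in> grassmann_model d \<and> (snd (gc c' b') (fst \<xi>), tangent_coord GA (gc c' b') \<xi>) \<in> Z}"
          using V unfolding grassmann_atlas_def lin_iso_def by blast
        have p': "(p, R p) \<in> fst (gc c' b')" using HV by (simp add: VZ Hpv)
        have pc': "p \<in> fst c'" using p' by (simp add: R_in_gc)
        have "(snd (gc c' b') (p, R p), section_velocity c' b' p v) \<in> Z"
          using HV coord[OF c' b' p' pv(2), folded pv(1)] by (simp add: VZ Hpv)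
        then have 0: "((snd c' p, R_coord c' b' p), section_velocity c' b' p v) \<in> Z" by (simp add: gc_apply R_coord_def)
        have "((\<lambda>\<eta>. ((snd c' (fst \<eta>), R_coord c' b' (fst \<eta>)), section_velocity c' b' (fst \<eta>) (?w \<eta>))) \<longlongrightarrow>
            ((snd c' p, R_coord c' b' p), section_velocity c' b' p v)) ?F"
        proof (intro tendsto_Pair)
          show "((\<lambda>\<eta>. snd c' (fst \<eta>)) \<longlongrightarrow> snd c' p) ?F" by (rule chart_tendsto(1)[OF tends_TMD(1)[OF t] c' pc'])
          show "((\<lambda>\<eta>. R_coord c' b' (fst \<eta>)) \<longlongrightarrow> R_coord c' b' p) ?F"
            by (rule filterlim_compose[OF R_in_gc_open(2)[OF c' b' p'] tends_TMD(1)[OF t]])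
          show "((\<lambda>\<eta>. section_velocity c' b' (fst \<eta>) (?w \<eta>)) \<longlongrightarrow> section_velocity c' b' p v) ?F"
            by (rule section_velocity_tendsto[OF c' b' p' w _ pv(2)]) (simp add: subspace_0[OF E_sub])
        qed
        from topological_tendstoD[OF this Z 0] inE
          eventually_compose_filterlim[OF R_in_gc_open(1)[OF c' b' p'] tends_TMD(1)[OF t]]
        show ?thesis
        proof eventually_elim
          case (elim \<eta>)
          have "tangent_coord GA (gc c' b') (H \<eta>) = section_velocity c' b' (fst \<eta>) (snd \<eta>)"
            using coord[OF c' b' elim(3,2)] by simp
          then show ?case using elim model by (simp add: VZ H_def section_of_def gc_apply R_coord_def)
        qed
      qed
      show "limitin ?Y H (H \<xi>) ?F"
        unfolding limitin_def
      proof (intro conjI allI impI)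
        let ?G = "gc (C p) (B p)"
        have "?G \<in> GA" using CB unfolding grassmann_atlas_def lin_iso_def by blast
        then have "openin ?Y {\<xi>. fst \<xi> \<in> fst ?G \<and> snd \<xi> \<in> grassmann_model d \<and> (snd ?G (fst \<xi>), tangent_coord GA ?G \<xi>) \<in> UNIV}"
          unfolding tangent_topology_def by (intro topology_generated_by_Basis) blast
        from openin_subset[OF this] show "H \<xi> \<in> topspace ?Y" using CB(4) model by (auto simp: Hpv)
        fix U assume U: "openin ?Y U \<and> H \<xi> \<in> U"
        then have "openin ?Y U" "H \<xi> \<in> U" by auto
        from eventually_subbasis[OF this(1)[unfolded tangent_topology_def] this(2) sub]
        show "\<forall>\<^sub>F \<eta> in ?F. H \<eta> \<in> U" .
      qed
    qed
  next
    fix p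
    let ?\<pi> = "proj_along (E p) (orthogonal_comp (E p))"
    note cE = complementary_orthogonal[OF E_sub[of p]]
    have \<pi>: "linear ?\<pi>" "?\<pi> v \<in> E p" "v \<in> E p \<Longrightarrow> ?\<pi> v = v" for v
      using proj_along_linear[OF cE] proj_along_in[OF cE] proj_along_unique[OF cE, of v v]
        subspace_0[OF subspace_orthogonal_comp, of "E p"] by auto
    let ?h = "\<lambda>v. section_velocity (C p) (B p) p (?\<pi> v)"
    note lin = section_velocity_linear[OF CB(1) pC \<pi>(2,2)]
    have "linear ?h"
    proof (rule linearI)
      fix x y r
      show "?h (x + y) = ?h x + ?h y" using lin[where r = 1 and r' = 1 and b = "B p"] by (simp add: linear_add[OF \<pi>(1)])
      show "?h (r *\<^sub>R x) = r *\<^sub>R ?h x" using lin[where r = r and r' = 0 and b = "B p"] by (simp add: linear_scale[OF \<pi>(1)])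
    qed
    then show "\<exists>h. linear h \<and> (\<forall>v\<in>E p. h v \<in> grassmann_model d \<and> H (p, v) = (section_of R p, h v))"
      using model \<pi>(3) by (intro exI[of _ ?h]) (simp add: H_def)
  next
    fix \<xi> assume "\<xi> \<in> total_space E"
    then have "snd \<xi> \<in> E (fst \<xi>)" by (auto simp: total_space_def)
    from tangent_coord_section_velocity(2)[OF CB(1) CB(1) CB(2) CB(2) CB(4) CB(4) CB(3) this]
    show "tangent_map GA A fst (H \<xi>) = \<xi>" by (simp add: H_def section_of_def)
  next
    fix a e \<gamma> \<gamma>' t
    assume arc: "C1_arc A a e \<gamma> \<gamma>' \<and> (\<forall>t\<in>{a..e}. \<gamma>' t \<in> total_space E)" and t: "t \<in> {a..e}"
    then have E: "E_arc {a..e} \<gamma> (\<lambda>t. snd (\<gamma>' t))" by (intro C1_arc_E_arc) auto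
    have "fst (\<gamma>' t) = \<gamma> t" using arc t by (auto simp: C1_arc_def has_velocity_def)
    then show "has_velocity GA (section_of R \<circ> \<gamma>) {a..e} t (H (\<gamma>' t))"
      using section_arc[OF E t CB(1) CB(2) CB(4)] by (simp add: has_velocity_def H_def section_of_def CB(3) comp_def)
  qed
qed

end

section \<open>From the hypotheses to uniform constants\<close>

text \<open>Each point is the center of a closed ball in a chart; finitely many of the open balls cover \<open>M\<close>. The compact sets
  that belong to the same chart are united.\<close>

lemma (in smooth_manifold) finite_chart_cover:
  assumes M: "compact (UNIV :: 'm set)"
  shows "\<exists>cc K. (\<forall>x. cc x \<in> A) \<and> finite (range cc) \<and> (\<forall>x. compact (K (cc x)) \<and> K (cc x) \<subseteq> fst (cc x) \<and> x \<in> interior (K (cc x)))"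
proof -
  let ?c = "chart_at A"
  define good where "good p e \<longleftrightarrow> 0 < e \<and> cball (snd (?c p) p) e \<subseteq> snd (?c p) ` fst (?c p)" for p e
  have "\<exists>e. good p e" for p
  proof -
    have "open (snd (?c p) ` fst (?c p))" using open_chart_image[OF chart_at(1)[of p] open_UNIV] by simp
    then show ?thesis using chart_at(2)[of p] unfolding open_contains_cball good_def by blast
  qed
  then obtain e where "\<And>p. good p (e p)" by metis
  then have e: "\<And>p. e p > 0" "\<And>p. cball (snd (?c p) p) (e p) \<subseteq> snd (?c p) ` fst (?c p)"
    by (auto simp only: good_def)
  define B where "B p = chart_inv (?c p) ` cball (snd (?c p) p) (e p)" for p
  define V where "V p = fst (?c p) \<inter> snd (?c p) -` ball (snd (?c p) p) (e p)" for p
  note hom = chart_homeo[OF chart_at(1)]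
  have Bc: "compact (B p)" "B p \<subseteq> fst (?c p)" for p
  proof -
    have "continuous_on (cball (snd (?c p) p) (e p)) (chart_inv (?c p))"
      using hom[of p] e(2)[of p] unfolding homeomorphism_def by (meson continuous_on_subset)
    then show "compact (B p)" unfolding B_def by (intro compact_continuous_image) auto
    show "B p \<subseteq> fst (?c p)" using image_mono[OF e(2)[of p], of "chart_inv (?c p)"] unfolding B_def homeomorphism_image2[OF hom] .
  qed
  have Vo: "open (V p)" "p \<in> V p" "V p \<subseteq> B p" for p
  proof -
    have "open (fst (?c p))" using atlas chart_at(1) by (auto simp: smooth_atlas_def)
    then show "open (V p)" unfolding V_def
      using hom[of p] unfolding homeomorphism_def by (intro continuous_open_preimage) auto
    show "p \<in> V p" using e(1) chart_at by (simp add: V_def)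
    show "V p \<subseteq> B p"
    proof
      fix x assume x: "x \<in> V p"
      then have "x = chart_inv (?c p) (snd (?c p) x)" using chart_at(1) by (simp add: V_def)
      moreover have "snd (?c p) x \<in> cball (snd (?c p) p) (e p)" using x by (simp add: V_def)
      ultimately show "x \<in> B p" unfolding B_def by blast
    qed
  qed
  obtain D where D: "finite D" "UNIV \<subseteq> (\<Union>p\<in>D. V p)"
  proof (rule compactE_image[OF M, of UNIV V])
    show "UNIV \<subseteq> \<Union> (V ` UNIV)" using Vo(2) by blast
  qed (use Vo(1) in auto)
  then obtain pt where pt: "\<And>x. pt x \<in> D" "\<And>x. x \<in> V (pt x)" by (metis UNIV_I UN_E subsetD)
  define K where "K c = (\<Union>p\<in>{p \<in> D. ?c p = c}. B p)" for c
  show ?thesis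
  proof (intro exI[of _ "\<lambda>x. ?c (pt x)"] exI[of _ K] conjI allI)
    fix x
    show "?c (pt x) \<in> A" by (rule chart_at)
    show "finite (range (\<lambda>x. ?c (pt x)))"
      by (rule finite_subset[of _ "?c ` D"]) (use pt D in auto)
    show "compact (K (?c (pt x)))" unfolding K_def using D Bc by (intro compact_UN) auto
    show "K (?c (pt x)) \<subseteq> fst (?c (pt x))" using Bc(2) by (fastforce simp: K_def)
    have "V (pt x) \<subseteq> K (?c (pt x))" using Vo(3) pt(1) by (fastforce simp: K_def)
    then show "x \<in> interior (K (?c (pt x)))" using Vo(1) pt(2) by (meson interiorI)
  qed
qed

lemma ennreal_divide_mono: "a \<le> b \<Longrightarrow> c \<le> d \<Longrightarrow> a / d \<le> b / (c :: ennreal)"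
  unfolding divide_ennreal_def
proof (rule mult_mono)
  assume "c \<le> d"
  then show "inverse d \<le> inverse c" including ennreal.lifting by transfer (rule ereal_inverse_antimono)
qed auto

lemma operator_norm_ge: "x \<in> X \<Longrightarrow> x \<noteq> 0 \<Longrightarrow> ennreal (nY (T x) / nX x) \<le> operator_norm nX nY X T"
  unfolding operator_norm_def by (rule SUP_upper) auto

lemma conorm_le: "x \<in> X \<Longrightarrow> x \<noteq> 0 \<Longrightarrow> conorm nX nY X T \<le> ennreal (nY (T x) / nX x)"
  unfolding conorm_def by (rule INF_lower) auto

theorem theorem5p1:
  fixes A :: "('m::t2_space, 'e::euclidean_space) atlas"
    and N :: "'m \<Rightarrow> 'e \<Rightarrow> real"
    and f :: "'m \<Rightarrow> 'm"
    and R S E :: "'m \<Rightarrow> 'e set"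
    and d :: nat
  assumes "compact (UNIV :: 'm set)"
    and "smooth_atlas A"
    and "finsler_metric A N"
    and "Ck_diffeomorphism A 2 f"
    and "dominated_decomposition A N f R S"
    and "\<And>p. dim (R p) = d"
    and "continuous_subbundle A E"
    and "invariant_subbundle A f E"
    and "(SUP p. bundle_norm A N f S p / (bundle_conorm A N f R p * bundle_conorm A N f E p)) < 1"
  shows "C1_with_respect_to A d R E"
proof -
  interpret smooth_manifold A by unfold_locales (rule assms)
  have f: "bij f" "C2 f" "C2 (inv f)" using assms(4) by (auto simp: Ck_diffeomorphism_def)
  have "T (inv f) (f p) (T f p v) = v" for p v
  proof -
    have "inv f \<circ> f = id" using f(1) by (simp add: bij_is_inj)
    then show ?thesis using C2_compose_T[OF f(2,3)] C2_id T_id by metis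
  qed
  moreover have T0: "T g p 0 = 0" if "C2 g" for g p using linear_0[OF T_linear[OF that]] .
  ultimately have inj: "T f p v \<noteq> 0" if "v \<noteq> 0" for p v using that f(3) by metis
  have N: "0 < N p v" if "v \<noteq> 0" for p v
    using assms(3) that unfolding finsler_metric_def by (metis less_eq_real_def)
  have N0: "N p 0 = 0" for p using assms(3) by (simp add: finsler_metric_def)
  (* the minimum with 2 makes the number finite; the infimum is infinite if R or S is zero *)
  define \<mu> where "\<mu> = min 2 (INF p. bundle_conorm A N f R p / bundle_norm A N f S p)"
  have "1 < \<mu>" "\<mu> < \<infinity>" using assms(5) unfolding \<mu>_def dominated_decomposition_def by (auto simp: min_less_iff_disj)
  then obtain m where m: "\<mu> = ennreal m" "1 < m" by (cases \<mu>) auto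
  have dom: "N (f p) (T f p s) * N p r \<le> 1 / m * N p s * N (f p) (T f p r)" if rs: "r \<in> R p" "s \<in> S p" for p r s
  proof (cases "r = 0 \<or> s = 0")
    case False
    let ?a = "N (f p) (T f p r) / N p r" and ?s = "N (f p) (T f p s) / N p s"
    have pos: "0 < N p r" "0 < N p s" "0 < N (f p) (T f p r)" "0 < N (f p) (T f p s)" using False N inj by auto
    have "ennreal m \<le> bundle_conorm A N f R p / bundle_norm A N f S p"
      unfolding m(1)[symmetric] \<mu>_def by (rule min.coboundedI2) (rule INF_lower, simp)
    also have "\<dots> \<le> ennreal ?a / ennreal ?s"
      unfolding bundle_conorm_def bundle_norm_def using rs False
      by (intro ennreal_divide_mono conorm_le[where nY = "N (f p)"] operator_norm_ge[where nY = "N (f p)"]) auto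
    also have "\<dots> = ennreal (?a / ?s)" using pos by (intro divide_ennreal) auto
    finally have "m \<le> ?a / ?s" using pos by (subst (asm) ennreal_le_iff) auto
    then show ?thesis using pos m(2) by (simp add: field_simps)
  qed (use N0 T0[OF f(2)] in auto)
  define \<nu> where "\<nu> = (SUP p. bundle_norm A N f S p / (bundle_conorm A N f R p * bundle_conorm A N f E p))"
  have "\<nu> < 1" using assms(9) by (simp add: \<nu>_def)
  then obtain n where n: "\<nu> = ennreal n" "0 \<le> n" "n < 1" by (cases \<nu>) auto
  have bun: "N (f p) (T f p s) * N p r * N p v \<le> n * N p s * N (f p) (T f p r) * N (f p) (T f p v)"
    if rs: "r \<in> R p" "s \<in> S p" "v \<in> E p" for p r s v
  proof (cases "r = 0 \<or> s = 0 \<or> v = 0")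
    case False
    let ?a = "N (f p) (T f p r) / N p r" and ?s = "N (f p) (T f p s) / N p s" and ?e = "N (f p) (T f p v) / N p v"
    have pos: "0 < N p r" "0 < N p s" "0 < N p v" "0 < N (f p) (T f p r)" "0 < N (f p) (T f p s)" "0 < N (f p) (T f p v)"
      using False N inj by auto
    have ae: "ennreal (?a * ?e) = ennreal ?a * ennreal ?e" using pos by (intro ennreal_mult) auto
    have "ennreal (?s / (?a * ?e)) = ennreal ?s / ennreal (?a * ?e)" using pos by (intro divide_ennreal[symmetric]) auto
    also have "\<dots> = ennreal ?s / (ennreal ?a * ennreal ?e)" by (simp only: ae)
    also have "\<dots> \<le> bundle_norm A N f S p / (bundle_conorm A N f R p * bundle_conorm A N f E p)"
      unfolding bundle_conorm_def bundle_norm_def using rs False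
      by (intro ennreal_divide_mono mult_mono conorm_le[where nY = "N (f p)"] operator_norm_ge[where nY = "N (f p)"]) auto
    also have "\<dots> \<le> ennreal n" unfolding n(1)[symmetric] \<nu>_def by (rule SUP_upper) simp
    finally have "?s / (?a * ?e) \<le> n" using n(2) by (subst (asm) ennreal_le_iff) auto
    then show ?thesis using pos by (simp add: field_simps)
  qed (use N0 T0[OF f(2)] in auto)
  (* 1 / 2 only serves to make k positive *)
  define k where "k = Max {1 / 2, 1 / m, n}"
  have k: "0 < k" "k < 1" "1 / m \<le> k" "n \<le> k" using m(2) n by (auto simp: k_def less_max_iff_disj)
  obtain cc K where cc: "\<And>x. cc x \<in> A" "finite (range cc)" "\<And>x. compact (K (cc x))" "\<And>x. K (cc x) \<subseteq> fst (cc x)"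
    "\<And>x. x \<in> interior (K (cc x))"
    using finite_chart_cover[OF assms(1)] by metis
  have Nn: "0 \<le> N p v" for p v using assms(3) by (simp add: finsler_metric_def)
  interpret dominated_charts A N f R S E d k cc K
  proof unfold_locales
    fix p r s v assume rs: "r \<in> R p" "s \<in> S p"
    show "N (f p) (T f p s) * N p r \<le> k * N p s * N (f p) (T f p r)"
      using dom[OF rs] k(3) Nn by (meson mult_right_mono order_trans)
    assume "v \<in> E p"
    then show "N (f p) (T f p s) * N p r * N p v \<le> k * N p s * N (f p) (T f p r) * N (f p) (T f p v)"
      using bun[OF rs, of v] k(4) Nn by (meson mult_right_mono order_trans)
  qed (use assms f k cc in \<open>auto simp: dominated_decomposition_def invariant_subbundle_def\<close>)
  show ?thesis by (rule R_C1)
qed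

end
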